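(* Let $p,q\in(0,\infty]$, $r\in(0,p]$, $\sigma_1=r\,p'_r$, $\sigma_2=p$, $\alpha_3\ge 0$, let $\{\alpha^1_k\}_{k\ge 0}$, $\{\alpha^2_k\}_{k\ge 0}$ be sequences of positive real numbers, and let $\{t_k\}\in X^{\alpha_3}_{\alpha,\sigma,p}$. Let $\varphi_0\in D(\mathbb{R}^n)$ with $\int\varphi_0\,dx=1$, let $\zeta_0\in D(\mathbb{R}^n)$ and $\zeta:=\zeta_0-2^{-n}\zeta_0(\frac{\cdot}{2})$. Assume that for some numbers $A>0$ and $\mu\in(0,\min\{1,q,r\}]$, with $s=q_\mu=\frac{q}{\mu}$ and $s'$ the conjugate exponent of $s$: (i) for $\beta_k=(2^{kA}\alpha^1_k)^\mu$ one has $$\sup_{N\in\mathbb{N}}\Bigl(\sum_{k=0}^{N}\beta_k^{s}\Bigr)^{\frac1s}\Bigl(\sum_{k=N}^{\infty}\beta_k^{-s'}\Bigr)^{\frac1{s'}}<\infty;$$ (ii) for $\beta_k=(2^{-k(1+L_\zeta)}\alpha^2_k)^\mu$ one has $$\sup_{N\in\mathbb{N}}\Bigl(\sum_{k=N}^{\infty}\beta_k^{s}\Bigr)^{\frac1s}\Bigl(\sum_{k=0}^{N}\beta_k^{-s'}\Bigr)^{\frac1{s'}}<\infty.$$ Then there is a constant $C>0$ such that for all $f\in S'_e$ $$\|f|B^{\zeta_0}_{p,q}(\mathbb{R}^n,\{t_k\})\|\le C\,\|f|B^{\varphi_0}_{p,q}(\mathbb{R}^n,\{t_k\})\|.$$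
   Context: Exponents: for $r\in(0,p]$, $p_r:=p/r$ (with $p_r=1$ if $r=p$, including $r=p=\infty$, and $p_r=\infty$ if $p=\infty>r$), and $p'_r$ is the Hölder conjugate of $p_r$, with $r p'_r=\infty$ when $p'_r=\infty$; similarly $q_\mu:=q/\mu$. Whenever an exponent equals $\infty$, the sum (integral) $(\sum|\cdot|^s)^{1/s}$ is replaced by the supremum (essential supremum), and $1/\infty=0$. Distributions: $D(\mathbb{R}^n)$ is the space of compactly supported $C^\infty$ functions, $D'(\mathbb{R}^n)$ its dual. $S'_e\subset D'(\mathbb{R}^n)$ consists of those $f$ for which there are constants $C_f,N_f$ with $|\langle f,\psi\rangle|\le C_f\sup\{|D^\beta\psi(x)|\exp(N_f|x|): x\in\mathbb{R}^n,|\beta|\le N_f\}$ for all $\psi\in D(\mathbb{R}^n)$. For $g\in D(\mathbb{R}^n)$ and $j\in\mathbb{N}$, $g_j:=2^{jn}g(2^j\,\cdot)$. For a function $\psi\in D(\mathbb{R}^n)$, $L_\psi$ is the supremum of the integers $L$ such that $\int x^\beta\psi(x)\,dx=0$ for all multi-indices $|\beta|\le L$. Dyadic cubes: $Q^n_{k,m}=\prod_{i=1}^n(\frac{m_i}{2^k},\frac{m_i+1}{2^k})$ for $k\in\mathbb{N}_0$, $m\in\mathbb{Z}^n$. Weights: a weight is a measurable function on $\mathbb{R}^n$ that is positive almost everywhere. A sequence of weights $\{t_k\}_{k=0}^\infty$ is $p$-admissible if $t_k\in L_p^{\mathrm{loc}}(\mathbb{R}^n)$ for all $k\in\mathbb{N}_0$;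 then $t_{k,m}:=\|t_k|L_p(Q^n_{k,m})\|$. Class $X^{\alpha_3}_{\alpha,\sigma,p}$, where $\sigma=(\sigma_1,\sigma_2)$, $\sigma_1,\sigma_2\in(0,\infty]$, $\alpha=(\{\alpha^1_k\},\{\alpha^2_k\})$: the set of all $p$-admissible weight sequences $\{t_k\}$ such that for some $C_1,C_2>0$, for all $0\le k\le j$ and $m\in\mathbb{Z}^n$, 1) $\bigl(2^{kn}\int_{Q^n_{k,m}}t_k^p\,dx\bigr)^{1/p}\bigl(2^{kn}\int_{Q^n_{k,m}}t_j^{-\sigma_1}\,dx\bigr)^{1/\sigma_1}\le C_1\frac{\alpha^1_k}{\alpha^1_j}$; 2) $\bigl(2^{kn}\int_{Q^n_{k,m}}t_k^p\,dx\bigr)^{-1/p}\bigl(2^{kn}\int_{Q^n_{k,m}}t_j^{\sigma_2}\,dx\bigr)^{1/\sigma_2}\le C_2\frac{\alpha^2_j}{\alpha^2_k}$; and 3) for all $k\in\mathbb{N}_0$, $0<t_{k,m}\le 2^{\alpha_3}t_{k,\widetilde m}$ whenever $m,\widetilde m\in\mathbb{Z}^n$, $|m_i-\widetilde m_i|\le 1$, $i=1,\dots,n$. Space $B^{\varphi_0}_{p,q}(\mathbb{R}^n,\{t_k\})$: for $\varphi_0\in D(\mathbb{R}^n)$ put $\varphi:=\varphi_0-2^{-n}\varphi_0(\frac{\cdot}{2})$, and $\varphi_k:=2^{kn}\varphi(2^k\cdot)$ for $k\ge1$ (for $k=0$ the function $\varphi_0$ itself is used). The space consists of all $f\in S'_e$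 with finite quasi-norm $$\|f|B^{\varphi_0}_{p,q}(\mathbb{R}^n,\{t_k\})\|:=\Bigl(\sum_{k=0}^\infty\|t_k(\varphi_k*f)|L_p(\mathbb{R}^n)\|^q\Bigr)^{1/q}$$ (set equal to $+\infty$ for other $f\in S'_e$). The quasi-norm for $\zeta_0$ is defined in the same way. *)

theory Defs
  imports "HOL-Analysis.Analysis" "HOL-Probability.Essential_Supremum"
begin

text \<open>In \<^typ>\<open>ennreal\<close> one has \<open>\<infinity> / \<infinity> = 0\<close>, so the case \<open>r = p = \<infinity>\<close> needs a separate clause.\<close>
definition exp_ratio :: "ennreal \<Rightarrow> ennreal \<Rightarrow> ennreal" where
  "exp_ratio p r = (if r = p then 1 else p / r)"

text \<open>\<open>1/s + 1/s' = 1\<close>; since \<open>inverse 0 = \<infinity>\<close> and \<open>inverse \<infinity> = 0\<close> in \<^typ>\<open>ennreal\<close>,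
  this includes \<open>1' = \<infinity>\<close> and \<open>\<infinity>' = 1\<close>. Meant for \<open>s \<ge> 1\<close>.\<close>
definition conj_exp :: "ennreal \<Rightarrow> ennreal" where
  "conj_exp s = inverse (1 - inverse s)"

text \<open>Only used with \<open>a > 0\<close>; negative powers are written as powers of the inverse.\<close>
definition epowr :: "ennreal \<Rightarrow> real \<Rightarrow> ennreal" where
  "epowr x a = (if x = \<infinity> then \<infinity> else ennreal (enn2real x powr a))"

definition Lp_norm :: "'a measure \<Rightarrow> ennreal \<Rightarrow> ('a \<Rightarrow> 'b::real_normed_vector) \<Rightarrow> ennreal" where
  "Lp_norm M s g =
     (if s = \<infinity> then esssup M (\<lambda>x. ennreal (norm (g x)))
      else epowr (\<integral>\<^sup>+x. epowr (ennreal (norm (g x))) (enn2real s) \<partial>M) (1 / enn2real s))"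

definition lq_norm :: "nat set \<Rightarrow> ennreal \<Rightarrow> (nat \<Rightarrow> ennreal) \<Rightarrow> ennreal" where
  "lq_norm K s b =
     (if s = \<infinity> then (SUP k\<in>K. b k)
      else epowr (\<Sum>\<^sub>\<infinity>k\<in>K. epowr (b k) (enn2real s)) (1 / enn2real s))"

type_synonym 'n multiindex = "'n \<Rightarrow> nat"

abbreviation mdeg :: "('n::finite) multiindex \<Rightarrow> nat" where
  "mdeg \<beta> \<equiv> (\<Sum>i\<in>UNIV. \<beta> i)"

definition partial_deriv :: "'n::finite \<Rightarrow> (real^'n \<Rightarrow> complex) \<Rightarrow> real^'n \<Rightarrow> complex" where
  "partial_deriv i f x = frechet_derivative f (at x) (axis i 1)"

primrec Ck :: "nat \<Rightarrow> (real^'n::finite \<Rightarrow> complex) \<Rightarrow> bool" where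
  "Ck 0 f \<longleftrightarrow> continuous_on UNIV f"
| "Ck (Suc k) f \<longleftrightarrow> (\<forall>x. f differentiable (at x)) \<and> (\<forall>i. Ck k (partial_deriv i f))"

text \<open>The space \<open>D(\<real>\<^sup>n)\<close>, with complex scalars.\<close>
definition test_functions :: "(real^'n::finite \<Rightarrow> complex) set" where
  "test_functions = {\<psi>. (\<forall>k. Ck k \<psi>) \<and> compact (closure {x. \<psi> x \<noteq> 0})}"

text \<open>\<open>D\<^sup>\<beta>\<close>. The index type carries no order, so some enumeration of the coordinates is fixed;
  on smooth functions the result does not depend on it, since partial derivatives commute.\<close>
definition coord_list :: "'n::finite list" where
  "coord_list = (SOME xs. distinct xs \<and> set xs = UNIV)"

definition multi_deriv ::
  "('n::finite) multiindex \<Rightarrow> (real^'n \<Rightarrow> complex) \<Rightarrow> real^'n \<Rightarrow> complex" where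
  "multi_deriv \<beta> f = foldr (\<lambda>i. partial_deriv i ^^ \<beta> i) coord_list f"

text \<open>\<open>D'(\<real>\<^sup>n)\<close>: linear functionals on \<open>D(\<real>\<^sup>n)\<close>, continuous in the usual inductive limit
  topology, expressed by the seminorm estimates on each compact set. A functional is a HOL
  function of which only the values on \<^const>\<open>test_functions\<close> matter.\<close>
definition distributions :: "((real^'n::finite \<Rightarrow> complex) \<Rightarrow> complex) set" where
  "distributions = {f.
     (\<forall>\<phi>\<in>test_functions. \<forall>\<psi>\<in>test_functions. f (\<lambda>x. \<phi> x + \<psi> x) = f \<phi> + f \<psi>) \<and>
     (\<forall>c. \<forall>\<psi>\<in>test_functions. f (\<lambda>x. c * \<psi> x) = c * f \<psi>) \<and>
     (\<forall>K. compact K \<longrightarrow> (\<exists>(C::real) (N::nat). \<forall>\<psi>\<in>test_functions. {x. \<psi> x \<noteq> 0} \<subseteq> K \<longrightarrow>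
        ennreal (norm (f \<psi>)) \<le>
          ennreal C * (SUP \<beta>\<in>{\<beta>. mdeg \<beta> \<le> N}. SUP x. ennreal (norm (multi_deriv \<beta> \<psi> x)))))}"

definition S'_e :: "((real^'n::finite \<Rightarrow> complex) \<Rightarrow> complex) set" where
  "S'_e = {f \<in> distributions. \<exists>(C::real) (N::nat). \<forall>\<psi>\<in>test_functions.
     ennreal (norm (f \<psi>)) \<le> ennreal C *
       (SUP \<beta>\<in>{\<beta>. mdeg \<beta> \<le> N}. SUP x. ennreal (norm (multi_deriv \<beta> \<psi> x) * exp (real N * norm x)))}"

definition conv ::
  "(real^'n::finite \<Rightarrow> complex) \<Rightarrow> ((real^'n \<Rightarrow> complex) \<Rightarrow> complex) \<Rightarrow> real^'n \<Rightarrow> complex" where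
  "conv \<psi> f x = f (\<lambda>y. \<psi> (x - y))"

definition dilate :: "nat \<Rightarrow> (real^'n::finite \<Rightarrow> complex) \<Rightarrow> real^'n \<Rightarrow> complex" where
  "dilate j g x = (2::real) ^ (j * CARD('n)) *\<^sub>R g (2 ^ j *\<^sub>R x)"

definition dyadic_diff :: "(real^'n::finite \<Rightarrow> complex) \<Rightarrow> real^'n \<Rightarrow> complex" where
  "dyadic_diff \<phi>\<^sub>0 x = \<phi>\<^sub>0 x - (1 / (2::real) ^ CARD('n)) *\<^sub>R \<phi>\<^sub>0 ((1/2) *\<^sub>R x)"

definition dyadic_family :: "(real^'n::finite \<Rightarrow> complex) \<Rightarrow> nat \<Rightarrow> real^'n \<Rightarrow> complex" where
  "dyadic_family \<phi>\<^sub>0 k = (if k = 0 then \<phi>\<^sub>0 else dilate k (dyadic_diff \<phi>\<^sub>0))"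

text \<open>\<open>L\<^sub>\<psi>\<close>. Every negative integer belongs to the set vacuously, so the supremum is at
  least \<open>-1\<close>; for a test function \<open>\<psi>\<close> it is
  \<open>\<infinity>\<close> exactly when \<open>\<psi> = 0\<close>.\<close>
definition moment_order :: "(real^'n::finite \<Rightarrow> complex) \<Rightarrow> ereal" where
  "moment_order \<psi> =
     (SUP L \<in> {L::int. \<forall>\<beta>::'n multiindex. int (mdeg \<beta>) \<le> L \<longrightarrow>
                 (LINT x|lebesgue. (\<Prod>i\<in>UNIV. x $ i ^ \<beta> i) *\<^sub>R \<psi> x) = 0}.
      ereal (of_int L))"

text \<open>Extended exponents occur only through \<open>L\<^sub>\<psi> = \<infinity>\<close>, i.e. \<open>\<psi> = 0\<close>; the product \<open>0 * \<infinity>\<close>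
  in an exponent is \<open>0\<close>.\<close>
definition two_epowr :: "ereal \<Rightarrow> ennreal" where
  "two_epowr a = (if a = \<infinity> then \<infinity> else if a = -\<infinity> then 0 else ennreal (2 powr real_of_ereal a))"

definition weight :: "(real^'n::finite \<Rightarrow> real) \<Rightarrow> bool" where
  "weight t \<longleftrightarrow> t \<in> borel_measurable lebesgue \<and> (AE x in lebesgue. 0 < t x)"

definition Lp_loc :: "ennreal \<Rightarrow> (real^'n::finite \<Rightarrow> real) \<Rightarrow> bool" where
  "Lp_loc p t \<longleftrightarrow> t \<in> borel_measurable lebesgue \<and>
     (\<forall>K. compact K \<longrightarrow> Lp_norm (lebesgue_on K) p t < \<infinity>)"

definition admissible :: "ennreal \<Rightarrow> (nat \<Rightarrow> real^'n::finite \<Rightarrow> real) \<Rightarrow> bool" where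
  "admissible p t \<longleftrightarrow> (\<forall>k. weight (t k) \<and> Lp_loc p (t k))"

definition dyadic_cube :: "nat \<Rightarrow> int^'n \<Rightarrow> (real^'n::finite) set" where
  "dyadic_cube k m = box (\<chi> i. of_int (m $ i) / 2 ^ k) (\<chi> i. (of_int (m $ i) + 1) / 2 ^ k)"

definition cube_mean :: "ennreal \<Rightarrow> nat \<Rightarrow> int^'n \<Rightarrow> (real^'n::finite \<Rightarrow> real) \<Rightarrow> ennreal" where
  "cube_mean s k m g =
     (if s = \<infinity> then esssup (lebesgue_on (dyadic_cube k m)) (\<lambda>x. ennreal \<bar>g x\<bar>)
      else epowr (2 ^ (k * CARD('n)) *
               (\<integral>\<^sup>+x. epowr (ennreal \<bar>g x\<bar>) (enn2real s) \<partial>lebesgue_on (dyadic_cube k m)))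
             (1 / enn2real s))"

definition cube_norm :: "ennreal \<Rightarrow> nat \<Rightarrow> int^'n \<Rightarrow> (real^'n::finite \<Rightarrow> real) \<Rightarrow> ennreal" where
  "cube_norm p k m g = Lp_norm (lebesgue_on (dyadic_cube k m)) p g"

definition weight_class :: "real \<Rightarrow> (nat \<Rightarrow> real) \<Rightarrow> (nat \<Rightarrow> real) \<Rightarrow> ennreal \<Rightarrow> ennreal \<Rightarrow> ennreal \<Rightarrow>
    (nat \<Rightarrow> real^'n::finite \<Rightarrow> real) set" where
  "weight_class \<alpha>\<^sub>3 \<alpha>\<^sub>1 \<alpha>\<^sub>2 \<sigma>\<^sub>1 \<sigma>\<^sub>2 p = {t. admissible p t \<and>
     (\<exists>C\<^sub>1>0. \<exists>C\<^sub>2>0. \<forall>k j m. k \<le> j \<longrightarrow>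
        cube_mean p k m (t k) * cube_mean \<sigma>\<^sub>1 k m (\<lambda>x. inverse (t j x)) \<le> ennreal (C\<^sub>1 * (\<alpha>\<^sub>1 k / \<alpha>\<^sub>1 j)) \<and>
        inverse (cube_mean p k m (t k)) * cube_mean \<sigma>\<^sub>2 k m (t j) \<le> ennreal (C\<^sub>2 * (\<alpha>\<^sub>2 j / \<alpha>\<^sub>2 k))) \<and>
     (\<forall>k m m'. (\<forall>i. \<bar>m $ i - m' $ i\<bar> \<le> 1) \<longrightarrow>
        0 < cube_norm p k m (t k) \<and>
        cube_norm p k m (t k) \<le> ennreal (2 powr \<alpha>\<^sub>3) * cube_norm p k m' (t k))}"

definition besov_norm :: "ennreal \<Rightarrow> ennreal \<Rightarrow> (real^'n::finite \<Rightarrow> complex) \<Rightarrow>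
    (nat \<Rightarrow> real^'n \<Rightarrow> real) \<Rightarrow> ((real^'n \<Rightarrow> complex) \<Rightarrow> complex) \<Rightarrow> ennreal" where
  "besov_norm p q \<phi>\<^sub>0 t f =
     lq_norm UNIV q (\<lambda>k. Lp_norm lebesgue p (\<lambda>x. t k x *\<^sub>R conv (dyadic_family \<phi>\<^sub>0 k) f x))"

end

theory Submission
  imports Defs
begin

text \<open>The idea is Peetre's. In the convolution algebra write \<open>u\<^sub>l\<close> for the dilated \<open>\<phi>\<^sub>0\<close>. Since \<open>\<integral>\<phi>\<^sub>0 = 1\<close>,
  the factor \<open>1 - u\<^sub>l\<^sup>2\<close> gains a power \<open>2\<^bsup>-l\<^esup>\<close> at the cost of one derivative, so the telescoping sum of the
  differences of \<open>(1 - u\<^sub>l\<^sup>2)\<^bsup>i+1\<^esup>\<close> reproduces \<open>f\<close> from the convolutions \<open>\<phi>\<^sub>l * f\<close> with kernels that have as much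
  decay in \<open>l\<close> as desired, without any moment condition on \<open>\<phi>\<^sub>0\<close>; the moments of \<open>\<zeta>\<close> give the factor
  \<open>2\<^bsup>-d(1+L)\<^esup>\<close> at the coarser levels. Peetre's maximal function with exponential weights turns this
  into a pointwise bound of \<open>|\<zeta>\<^sub>k * f|\<^sup>\<mu>\<close> by averages of \<open>|\<phi>\<^sub>l * f|\<^sup>\<mu>\<close> over dyadic cubes. Hoelder's inequality
  and the two conditions on the weights bound the norm of such an average by the ratios of the \<open>\<alpha>\<^sub>1\<close> and the
  \<open>\<alpha>\<^sub>2\<close>, while shifted cubes cost powers of \<open>2 powr \<alpha>\<^sub>3\<close>, which the exponential weight absorbs. Finally (i) and
  (ii) force geometric decay of the remaining coefficients, and the sum over the levels is a convolution
  with a geometric sequence.\<close>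

section \<open>Test functions\<close>

text \<open>The square in \<open>1 - u\<^sup>2\<close> is essential. Differences of powers of
  \<open>1 - u\<close> also contain the factor \<open>u - v\<close>, but their cofactor contains the
  identity, so on a coarse level \<open>l\<close> the kernel would be no smoother than
  \<open>\<zeta>\<^sub>k\<close> and the moments would have nothing to act on. With squares the
  cofactor contains \<open>u + v\<close>, which is smooth on the scale \<open>2^-l\<close>. The
  conditions on the weights fix the shape of the rest. They compare weights of finer levels with the
  weight of level j on one cube of that level, or adjacent cubes. Therefore averages are taken over
  cubes of the coarser level j of the two levels k and l in play: condition 2 passes from
  \<open>t\<^sub>k\<close> to \<open>t\<^sub>j\<close>, condition 3 to a shifted cube, condition 1
  from \<open>t\<^sub>j\<close> to \<open>t\<^sub>l\<close>. The number \<mu> serves several ends: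
  \<mu> \<le> 1 makes the power subadditive, \<mu> \<le> p and \<mu> \<le> q give the exponents
  p/\<mu> and q/\<mu> a triangle inequality, and \<mu> \<le> r allows Hoelder's inequality on a
  cube. Passing to \<mu>-th powers turns the decay exponent i into i \<mu> - n, which has to reach A
  \<mu>.\<close>

text \<open>Derivatives and monomials are indexed by lists of coordinates instead of multi-indices, so that
  one can argue by induction on the list.\<close>

definition iter_deriv :: "'n list \<Rightarrow> (real^'n::finite \<Rightarrow> complex) \<Rightarrow> real^'n \<Rightarrow> complex" where
  "iter_deriv is f = foldr partial_deriv is f"

lemma iter_deriv_Nil [simp]: "iter_deriv [] f = f"
  by (simp add: iter_deriv_def)

lemma iter_deriv_Cons [simp]: "iter_deriv (i # is) f = partial_deriv i (iter_deriv is f)"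
  by (simp add: iter_deriv_def)

lemma iter_deriv_append: "iter_deriv (is @ js) f = iter_deriv is (iter_deriv js f)"
  by (simp add: iter_deriv_def)

lemma funpow_partial_deriv: "(partial_deriv i ^^ k) f = iter_deriv (replicate k i) f"
  by (induction k) auto

lemma multi_deriv_eq_iter_deriv:
  fixes \<beta> :: "('n::finite) multiindex"
  shows "\<exists>is. length is = mdeg \<beta> \<and> (\<forall>f. multi_deriv \<beta> f = iter_deriv is f)"
proof -
  have cl: "distinct (coord_list :: 'n list) \<and> set (coord_list :: 'n list) = UNIV"
    unfolding coord_list_def by (rule someI_ex) (metis finite_distinct_list finite)
  have *: "foldr (\<lambda>i. partial_deriv i ^^ \<beta> i) xs f = iter_deriv (concat (map (\<lambda>i. replicate (\<beta> i) i) xs)) f"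
    for xs and f :: "real^'n \<Rightarrow> complex"
    by (induction xs) (auto simp: funpow_partial_deriv iter_deriv_append)
  have len: "length (concat (map (\<lambda>i. replicate (\<beta> i) i) xs)) = (\<Sum>i\<leftarrow>xs. \<beta> i)" for xs
    by (induction xs) auto
  have "(\<Sum>i\<leftarrow>coord_list. \<beta> i) = mdeg \<beta>"
    using cl by (metis sum_list_distinct_conv_sum_set)
  then show ?thesis
    using * len unfolding multi_deriv_def by metis
qed

text \<open>The recursion on the order in \<open>Ck\<close> is done once here. Later constructions
  exhibit a family that is stable under partial derivatives instead of computing higher
  derivatives.\<close>

lemma Ck_coinduct:
  assumes "f \<in> A"
    and "\<And>g x. g \<in> A \<Longrightarrow> g differentiable (at x)"
    and "\<And>g i. g \<in> A \<Longrightarrow> partial_deriv i g \<in> A"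
  shows "Ck k f"
  using assms(1)
proof (induction k arbitrary: f)
  case 0
  then show ?case
    using assms(2) by (auto intro!: continuous_at_imp_continuous_on differentiable_imp_continuous_within)
next
  case (Suc k)
  then show ?case using assms(2,3) by auto
qed

text \<open>A radius about the origin replaces the compact closure, because radii add under
  convolution and scale under dilation.\<close>

definition supp_le :: "real \<Rightarrow> (real^'n::finite \<Rightarrow> complex) \<Rightarrow> bool" where
  "supp_le R f \<longleftrightarrow> (\<forall>x. f x \<noteq> 0 \<longrightarrow> norm x \<le> R)"

lemma supp_leD: "supp_le R f \<Longrightarrow> R < norm x \<Longrightarrow> f x = 0"
  by (force simp: supp_le_def)

lemma supp_le_mono: "supp_le R f \<Longrightarrow> R \<le> R' \<Longrightarrow> supp_le R' f"
  by (force simp: supp_le_def)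

lemma compact_closure_iff_supp_le:
  "compact (closure {x. f x \<noteq> 0}) \<longleftrightarrow> (\<exists>R. supp_le R f)"
  unfolding compact_closure bounded_iff supp_le_def by auto

lemma test_functions_iff: "\<psi> \<in> test_functions \<longleftrightarrow> (\<forall>k. Ck k \<psi>) \<and> (\<exists>R. supp_le R \<psi>)"
  by (simp add: test_functions_def compact_closure_iff_supp_le del: compact_closure)

lemma test_supp: assumes "\<psi> \<in> test_functions" obtains R where "0 < R" "supp_le R \<psi>"
proof -
  obtain R where "supp_le R \<psi>" using assms by (auto simp: test_functions_iff)
  then have "supp_le (max R 1) \<psi>" by (rule supp_le_mono) auto
  then show ?thesis by (rule that[rotated]) auto
qed

lemma test_differentiable: "\<psi> \<in> test_functions \<Longrightarrow> \<psi> differentiable (at x)"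
  by (metis Ck.simps(2) test_functions_iff)

lemma test_continuous: "\<psi> \<in> test_functions \<Longrightarrow> continuous_on S \<psi>"
  by (metis Ck.simps(1) test_functions_iff continuous_on_subset top_greatest)

lemma supp_le_partial_deriv:
  assumes "supp_le R f" shows "supp_le R (partial_deriv i f)"
  unfolding supp_le_def
proof (intro allI impI, rule ccontr)
  fix x assume x: "partial_deriv i f x \<noteq> 0" "\<not> norm x \<le> R"
  have op: "open {x::real^'n. R < norm x}"
    by (intro open_Collect_less continuous_intros)
  have "(f has_derivative (\<lambda>_. 0)) (at x)"
  proof (rule has_derivative_transform_within_open[where s="{x. R < norm x}" and f="\<lambda>_. 0"])
    show "open {x::real^'n. R < norm x}" by (rule op)
  qed (use x supp_leD[OF assms] in auto)
  then have "frechet_derivative f (at x) = (\<lambda>_. 0)"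
    by (metis frechet_derivative_at)
  then show False using x by (simp add: partial_deriv_def)
qed

lemma supp_le_iter_deriv: "supp_le R f \<Longrightarrow> supp_le R (iter_deriv is f)"
  by (induction "is") (auto intro: supp_le_partial_deriv)

lemma test_partial_deriv: "\<psi> \<in> test_functions \<Longrightarrow> partial_deriv i \<psi> \<in> test_functions"
  unfolding test_functions_iff by (metis Ck.simps(2) supp_le_partial_deriv)

lemma test_iter_deriv: "\<psi> \<in> test_functions \<Longrightarrow> iter_deriv is \<psi> \<in> test_functions"
  by (induction "is") (auto intro: test_partial_deriv)

lemma test_coinduct:
  assumes "f \<in> A" "supp_le R f"
    and "\<And>g x. g \<in> A \<Longrightarrow> g differentiable (at x)"
    and "\<And>g i. g \<in> A \<Longrightarrow> partial_deriv i g \<in> A"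
  shows "f \<in> test_functions"
  using Ck_coinduct[of f A] assms by (auto simp: test_functions_iff)

lemma has_derivative_frechet_test:
  "\<psi> \<in> test_functions \<Longrightarrow> (\<psi> has_derivative frechet_derivative \<psi> (at x)) (at x)"
  using test_differentiable frechet_derivative_works by blast

lemma partial_derivI: "(f has_derivative D) (at x) \<Longrightarrow> partial_deriv i f x = D (axis i 1)"
  by (metis partial_deriv_def frechet_derivative_at)

lemma linear_sum_axis:
  fixes D :: "real^'n::finite \<Rightarrow> complex"
  assumes "linear D" shows "D h = (\<Sum>i\<in>UNIV. h $ i *\<^sub>R D (axis i 1))"
proof -
  have "h = (\<Sum>i\<in>UNIV. h $ i *\<^sub>R axis i 1)"
    by (metis basis_expansion scalar_mult_eq_scaleR)
  then have "D h = D (\<Sum>i\<in>UNIV. h $ i *\<^sub>R axis i 1)" by simp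
  also have "\<dots> = (\<Sum>i\<in>UNIV. h $ i *\<^sub>R D (axis i 1))"
    by (simp add: linear_sum[OF assms] linear_scale[OF assms])
  finally show ?thesis .
qed

lemma frechet_test:
  assumes "\<psi> \<in> test_functions"
  shows "frechet_derivative \<psi> (at x) h = (\<Sum>i\<in>UNIV. h $ i *\<^sub>R partial_deriv i \<psi> x)"
  unfolding partial_deriv_def
  by (rule linear_sum_axis) (metis assms has_derivative_frechet_test has_derivative_linear)

lemma has_derivative_test:
  assumes "\<psi> \<in> test_functions"
  shows "(\<psi> has_derivative (\<lambda>h. \<Sum>i\<in>UNIV. h $ i *\<^sub>R partial_deriv i \<psi> x)) (at x)"
proof -
  have "frechet_derivative \<psi> (at x) = (\<lambda>h. \<Sum>i\<in>UNIV. h $ i *\<^sub>R partial_deriv i \<psi> x)"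
    using frechet_test[OF assms] by blast
  then show ?thesis using has_derivative_frechet_test[OF assms, of x] by simp
qed

section \<open>Affine images and linear combinations of test functions\<close>

lemma partial_deriv_affine:
  assumes "b \<in> test_functions"
  shows "((\<lambda>x. c * b (s *\<^sub>R x + v)) has_derivative
           (\<lambda>h. c * (\<Sum>i\<in>UNIV. (s * h $ i) *\<^sub>R partial_deriv i b (s *\<^sub>R x + v)))) (at x)"
    and "partial_deriv i (\<lambda>x. c * b (s *\<^sub>R x + v)) = (\<lambda>x. (c * of_real s) * partial_deriv i b (s *\<^sub>R x + v))"
proof -
  show *: "((\<lambda>x. c * b (s *\<^sub>R x + v)) has_derivative
           (\<lambda>h. c * (\<Sum>i\<in>UNIV. (s * h $ i) *\<^sub>R partial_deriv i b (s *\<^sub>R x + v)))) (at x)" for x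
  proof -
    have "((\<lambda>x. s *\<^sub>R x + v) has_derivative (\<lambda>h. s *\<^sub>R h)) (at x)"
      by (auto intro!: derivative_eq_intros)
    from has_derivative_compose[OF this has_derivative_test[OF assms]]
    have "((\<lambda>x. b (s *\<^sub>R x + v)) has_derivative
      (\<lambda>h. \<Sum>i\<in>UNIV. (s *\<^sub>R h) $ i *\<^sub>R partial_deriv i b (s *\<^sub>R x + v))) (at x)" .
    from has_derivative_mult_right[OF this, of c] show ?thesis by simp
  qed
  show "partial_deriv i (\<lambda>x. c * b (s *\<^sub>R x + v)) = (\<lambda>x. (c * of_real s) * partial_deriv i b (s *\<^sub>R x + v))"
  proof
    fix x
    have "(\<Sum>k\<in>UNIV. (s * axis i 1 $ k) *\<^sub>R partial_deriv k b (s *\<^sub>R x + v)) = s *\<^sub>R partial_deriv i b (s *\<^sub>R x + v)"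
      by (subst sum.remove[of _ i]) (auto simp: axis_def intro!: sum.neutral)
    then show "partial_deriv i (\<lambda>x. c * b (s *\<^sub>R x + v)) x = (c * of_real s) * partial_deriv i b (s *\<^sub>R x + v)"
      unfolding partial_derivI[OF *] by (simp add: scaleR_conv_of_real[where 'a=complex] mult.assoc)
  qed
qed

lemma iter_deriv_affine:
  assumes "b \<in> test_functions"
  shows "iter_deriv is (\<lambda>x. c * b (s *\<^sub>R x + v)) = (\<lambda>x. (c * of_real (s ^ length is)) * iter_deriv is b (s *\<^sub>R x + v))"
proof (induction "is")
  case (Cons i "is")
  show ?case
    by (simp only: iter_deriv_Cons Cons.IH partial_deriv_affine(2)[OF test_iter_deriv[OF assms]]) (simp add: mult_ac)
qed auto

lemma test_affine:
  assumes "b \<in> test_functions" "s \<noteq> 0"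
  shows "(\<lambda>x. c * b (s *\<^sub>R x + v)) \<in> test_functions"
proof -
  obtain R where R: "supp_le R b" using assms(1) test_functions_iff by blast
  show ?thesis
  proof (rule test_coinduct[where A="{(\<lambda>x. c * b (s *\<^sub>R x + v)) | c b. b \<in> test_functions}" and R="(R + norm v) / \<bar>s\<bar>"])
    show "supp_le ((R + norm v) / \<bar>s\<bar>) (\<lambda>x. c * b (s *\<^sub>R x + v))"
      unfolding supp_le_def
    proof (intro allI impI)
      fix x assume "c * b (s *\<^sub>R x + v) \<noteq> 0"
      then have "norm (s *\<^sub>R x + v) \<le> R" using R by (auto simp: supp_le_def)
      moreover have "norm (s *\<^sub>R x) \<le> norm (s *\<^sub>R x + v) + norm v" by (metis norm_triangle_ineq4 add_diff_cancel)
      ultimately show "norm x \<le> (R + norm v) / \<bar>s\<bar>" using assms(2) by (simp add: field_simps)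
    qed
    show "(\<lambda>x. c * b (s *\<^sub>R x + v)) \<in> {(\<lambda>x. c * b (s *\<^sub>R x + v)) | c b. b \<in> test_functions}" using assms by blast
  next
    fix g :: "real^'a \<Rightarrow> complex" and x assume "g \<in> {(\<lambda>x. c * b (s *\<^sub>R x + v)) | c b. b \<in> test_functions}"
    then show "g differentiable (at x)" using partial_deriv_affine(1) by (auto simp: differentiable_def) blast
  next
    fix g :: "real^'a \<Rightarrow> complex" and i assume "g \<in> {(\<lambda>x. c * b (s *\<^sub>R x + v)) | c b. b \<in> test_functions}"
    then obtain c b where g: "g = (\<lambda>x. c * b (s *\<^sub>R x + v))" "b \<in> test_functions" by blast
    show "partial_deriv i g \<in> {(\<lambda>x. c * b (s *\<^sub>R x + v)) | c b. b \<in> test_functions}"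
      unfolding g(1) partial_deriv_affine(2)[OF g(2)] using test_partial_deriv[OF g(2)] by blast
  qed
qed

lemma partial_deriv_lin:
  assumes "f \<in> test_functions" "g \<in> test_functions"
  shows "partial_deriv i (\<lambda>x. c * f x + d * g x) = (\<lambda>x. c * partial_deriv i f x + d * partial_deriv i g x)"
    "(\<lambda>x. c * f x + d * g x) differentiable (at x)"
proof -
  have *: "((\<lambda>x. c * f x + d * g x) has_derivative
     (\<lambda>h. c * frechet_derivative f (at x) h + d * frechet_derivative g (at x) h)) (at x)" for x
    using assms by (intro derivative_intros has_derivative_frechet_test has_derivative_mult_right)
  show "partial_deriv i (\<lambda>x. c * f x + d * g x) = (\<lambda>x. c * partial_deriv i f x + d * partial_deriv i g x)"
    unfolding partial_derivI[OF *, abs_def] by (simp add: partial_deriv_def)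
  show "(\<lambda>x. c * f x + d * g x) differentiable (at x)" using * differentiable_def by blast
qed

lemma iter_deriv_lin:
  assumes "f \<in> test_functions" "g \<in> test_functions"
  shows "iter_deriv is (\<lambda>x. c * f x + d * g x) = (\<lambda>x. c * iter_deriv is f x + d * iter_deriv is g x)"
  by (induction "is") (auto simp: partial_deriv_lin test_iter_deriv assms)

lemma test_lin:
  assumes "f \<in> test_functions" "g \<in> test_functions"
  shows "(\<lambda>x. c * f x + d * g x) \<in> test_functions"
proof -
  obtain R1 R2 where R: "supp_le R1 f" "supp_le R2 g" using assms test_functions_iff by blast
  let ?A = "{(\<lambda>x. c * f x + d * g x) | f g. f \<in> test_functions \<and> g \<in> test_functions}"
  show ?thesis
  proof (rule test_coinduct[where A="?A" and R="max R1 R2"])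
    show "supp_le (max R1 R2) (\<lambda>x. c * f x + d * g x)"
      using R unfolding supp_le_def by (metis add_0 max.coboundedI1 max.coboundedI2 mult_zero_right)
    show "(\<lambda>x. c * f x + d * g x) \<in> ?A" using assms by blast
  next
    fix h x assume "h \<in> ?A" then show "h differentiable (at x)" using partial_deriv_lin(2) by blast
  next
    fix h i assume "h \<in> ?A"
    then obtain f g where h: "h = (\<lambda>x. c * f x + d * g x)" and fg: "f \<in> test_functions" "g \<in> test_functions" by blast
    show "partial_deriv i h \<in> ?A" unfolding h partial_deriv_lin(1)[OF fg] using fg test_partial_deriv by blast
  qed
qed

lemma test_add: "f \<in> test_functions \<Longrightarrow> g \<in> test_functions \<Longrightarrow> (\<lambda>x. f x + g x) \<in> test_functions"
  using test_lin[of f g 1 1] by simp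

lemma test_diff: "f \<in> test_functions \<Longrightarrow> g \<in> test_functions \<Longrightarrow> (\<lambda>x. f x - g x) \<in> test_functions"
  using test_lin[of f g 1 "-1"] by simp

lemma test_cmult: "f \<in> test_functions \<Longrightarrow> (\<lambda>x. c * f x) \<in> test_functions"
  using test_lin[of f f c 0] by simp

lemma test_zero: "(\<lambda>x. 0) \<in> test_functions"
  by (rule test_coinduct[where A="{\<lambda>x. 0}" and R=0]) (auto simp: supp_le_def partial_deriv_def)

lemma iter_deriv_diff: "f \<in> test_functions \<Longrightarrow> g \<in> test_functions \<Longrightarrow> iter_deriv is (\<lambda>x. f x - g x) = (\<lambda>x. iter_deriv is f x - iter_deriv is g x)"
  using iter_deriv_lin[of f g "is" 1 "-1"] by simp

lemma iter_deriv_add: "f \<in> test_functions \<Longrightarrow> g \<in> test_functions \<Longrightarrow> iter_deriv is (\<lambda>x. f x + g x) = (\<lambda>x. iter_deriv is f x + iter_deriv is g x)"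
  using iter_deriv_lin[of f g "is" 1 1] by simp

section \<open>Uniform bounds on derivatives\<close>

lemma supp_le_continuous_bounded:
  assumes "supp_le R f" "continuous_on UNIV f"
  shows "\<exists>B\<ge>0. \<forall>x. norm (f x) \<le> B"
proof -
  have "compact (f ` cball 0 R)" using assms(2) by (intro compact_continuous_image) (auto intro: continuous_on_subset)
  then obtain B where B: "\<And>x. x \<in> cball 0 R \<Longrightarrow> norm (f x) \<le> B"
    using compact_imp_bounded bounded_iff by (metis (no_types, lifting) imageI)
  have "norm (f x) \<le> max B 0" for x
    using B[of x] max.coboundedI1[of "norm (f x)" B 0] supp_leD[OF assms(1), of x] by (cases "norm x \<le> R") auto
  then show ?thesis by (intro exI[of _ "max B 0"]) auto
qed

text \<open>Order exactly \<open>m\<close>, not up to \<open>m\<close>: on the dyadic level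
  \<open>l\<close> every order has its own size \<open>2 ^ (l * (n + m))\<close>, and the gains
  below trade a single order for a small factor.\<close>

definition deriv_bound :: "nat \<Rightarrow> real \<Rightarrow> (real^'n::finite \<Rightarrow> complex) \<Rightarrow> bool" where
  "deriv_bound m B f \<longleftrightarrow> (\<forall>is x. length is = m \<longrightarrow> norm (iter_deriv is f x) \<le> B)"

lemma deriv_bound_ge0: "deriv_bound m B f \<Longrightarrow> 0 \<le> B"
  unfolding deriv_bound_def by (metis norm_ge_zero order_trans length_replicate)

lemma deriv_bound_mono: "deriv_bound m B f \<Longrightarrow> B \<le> B' \<Longrightarrow> deriv_bound m B' f"
  unfolding deriv_bound_def using order_trans[of _ B B'] by blast

lemma deriv_bound_iter_deriv: "deriv_bound (m + k) B f \<Longrightarrow> length is = k \<Longrightarrow> deriv_bound m B (iter_deriv is f)"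
  unfolding deriv_bound_def by (metis iter_deriv_append length_append)

lemma deriv_bound_0: "deriv_bound 0 B f \<longleftrightarrow> (\<forall>x. norm (f x) \<le> B)"
  by (simp add: deriv_bound_def)

lemma finite_lists_length: "finite {is :: 'n::finite list. length is = m}"
  using finite_lists_length_eq[of "UNIV :: 'n set" m] by simp

lemma test_deriv_bound: assumes "f \<in> test_functions" shows "\<exists>B\<ge>0. deriv_bound m B f"
proof -
  have "\<exists>B\<ge>0. \<forall>x. norm (iter_deriv is f x) \<le> B" for "is"
  proof -
    obtain R where "supp_le R (iter_deriv is f)" using test_supp[OF test_iter_deriv[OF assms]] by metis
    then show ?thesis by (rule supp_le_continuous_bounded) (rule test_continuous[OF test_iter_deriv[OF assms]])
  qed
  then obtain B where B: "\<And>is. 0 \<le> B is" "\<And>is x. norm (iter_deriv is f x) \<le> B is" by metis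
  have "norm (iter_deriv is f x) \<le> sum B {is. length is = m}" if "length is = m" for "is" x
    using B that by (intro order_trans[OF B(2)] member_le_sum) (auto simp: finite_lists_length)
  then show ?thesis unfolding deriv_bound_def using sum_nonneg[of _ B] B by metis
qed

lemma test_lipschitz:
  fixes f :: "real^'n::finite \<Rightarrow> complex"
  assumes "f \<in> test_functions" "deriv_bound 1 B f"
  shows "norm (f x - f y) \<le> real CARD('n) * B * norm (x - y)"
proof (rule differentiable_bound[OF convex_UNIV, where f'="\<lambda>x h. \<Sum>i\<in>UNIV. h $ i *\<^sub>R partial_deriv i f x"])
  show "(f has_derivative (\<lambda>h. \<Sum>i\<in>UNIV. h $ i *\<^sub>R partial_deriv i f x)) (at x within UNIV)" for x
    using has_derivative_test[OF assms(1)] by simp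
  show "onorm (\<lambda>h. \<Sum>i\<in>UNIV. h $ i *\<^sub>R partial_deriv i f x) \<le> real CARD('n) * B" for x
  proof (rule onorm_bound)
    show "0 \<le> real CARD('n) * B" using deriv_bound_ge0[OF assms(2)] by simp
    fix h :: "real^'n"
    have "norm (\<Sum>i\<in>UNIV. h $ i *\<^sub>R partial_deriv i f x) \<le> (\<Sum>i::'n\<in>UNIV. norm h * B)"
    proof (rule sum_norm_le)
      fix i :: 'n assume "i \<in> UNIV"
      have "norm (partial_deriv i f x) \<le> B"
        using assms(2)[unfolded deriv_bound_def, rule_format, of "[i]"] by simp
      then show "norm (h $ i *\<^sub>R partial_deriv i f x) \<le> norm h * B"
        by (simp add: component_le_norm_cart mult_mono)
    qed
    then show "norm (\<Sum>i\<in>UNIV. h $ i *\<^sub>R partial_deriv i f x) \<le> real CARD('n) * B * norm h"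
      by (simp add: mult_ac)
  qed
qed auto

section \<open>Convolution\<close>

text \<open>Integrable, but not continuous: \<open>conv_convolve\<close> cuts a kernel by indicators
  of balls, and the pieces have to be kernels again.\<close>

definition kernel :: "real \<Rightarrow> (real^'n::finite \<Rightarrow> complex) \<Rightarrow> bool" where
  "kernel R a \<longleftrightarrow> integrable lborel a \<and> supp_le R a"

definition convolve :: "(real^'n::finite \<Rightarrow> complex) \<Rightarrow> (real^'n \<Rightarrow> complex) \<Rightarrow> real^'n \<Rightarrow> complex" where
  "convolve a b x = (LINT z|lborel. a z * b (x - z))"

definition l1_norm :: "(real^'n::finite \<Rightarrow> complex) \<Rightarrow> real" where
  "l1_norm a = (LINT z|lborel. norm (a z))"

lemma l1_norm_nonneg: "0 \<le> l1_norm a"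
  unfolding l1_norm_def by (rule integral_nonneg_AE) auto

lemma kernel_continuous:
  assumes "supp_le R a" "continuous_on UNIV a" shows "kernel R a"
proof -
  have "integrable lborel (\<lambda>x. indicator (cball 0 R) x *\<^sub>R a x)"
    by (rule borel_integrable_compact) (auto intro: continuous_on_subset[OF assms(2)])
  moreover have "(\<lambda>x. indicator (cball 0 R) x *\<^sub>R a x) = a"
    using supp_leD[OF assms(1)] by (auto simp: indicator_def)
  ultimately show ?thesis using assms by (simp add: kernel_def)
qed

lemma kernel_test: "a \<in> test_functions \<Longrightarrow> supp_le R a \<Longrightarrow> kernel R a"
  by (simp add: kernel_continuous test_continuous)

lemma cont_refl: "continuous_on UNIV b \<Longrightarrow> continuous_on UNIV (\<lambda>z::real^'n::finite. b (x - z))"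
  by (rule continuous_on_compose2[of UNIV b]) (auto intro!: continuous_intros)

lemma convolve_integrable:
  fixes b :: "real^'n::finite \<Rightarrow> complex"
  assumes "kernel R a" "continuous_on UNIV b"
  shows "integrable lborel (\<lambda>z. a z * b (x - z))"
proof -
  have "compact ((\<lambda>z. b (x - z)) ` cball 0 R)"
    by (intro compact_continuous_image continuous_on_subset[OF cont_refl[OF assms(2)]]) auto
  then obtain B where "\<forall>y\<in>(\<lambda>z. b (x - z)) ` cball 0 R. norm y \<le> B"
    using compact_imp_bounded bounded_iff by metis
  then have B: "\<And>z. norm z \<le> R \<Longrightarrow> norm (b (x - z)) \<le> B" by simp
  have [measurable]: "a \<in> borel_measurable borel" using assms(1) unfolding kernel_def
    using borel_measurable_integrable by fastforce
  have [measurable]: "(\<lambda>z. b (x - z)) \<in> borel_measurable borel"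
    by (intro borel_measurable_continuous_onI cont_refl assms)
  show ?thesis
  proof (rule Bochner_Integration.integrable_bound[where f="\<lambda>z. \<bar>B\<bar> * norm (a z)"])
    show "integrable lborel (\<lambda>z. \<bar>B\<bar> * norm (a z))" using assms(1) by (auto simp: kernel_def)
    have "norm (a z * b (x - z)) \<le> norm (\<bar>B\<bar> * norm (a z))" for z
      using B[of z] supp_leD[of R a z] assms(1)
      by (cases "norm z \<le> R") (auto simp: kernel_def norm_mult mult.commute[of "\<bar>B\<bar>"] intro!: mult_left_mono)
    then show "AE z in lborel. norm (a z * b (x - z)) \<le> norm (\<bar>B\<bar> * norm (a z))" by simp
  qed simp
qed

lemma convolve_bound:
  assumes "kernel R a" "\<And>z. a z \<noteq> 0 \<Longrightarrow> norm (b (x - z)) \<le> B" "0 \<le> B"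
  shows "norm (convolve a b x) \<le> l1_norm a * B"
proof -
  have "norm (convolve a b x) \<le> (LINT z|lborel. norm (a z * b (x - z)))"
    unfolding convolve_def by (rule integral_norm_bound)
  also have "\<dots> \<le> (LINT z|lborel. norm (a z) * B)"
  proof (rule integral_mono')
    show "integrable lborel (\<lambda>z. norm (a z) * B)" using assms(1) by (auto simp: kernel_def)
    show "norm (a z * b (x - z)) \<le> norm (a z) * B" for z
      using assms(2)[of z] by (cases "a z = 0") (auto simp: norm_mult)
    show "0 \<le> norm (a z) * B" for z using assms by simp
  qed
  finally show ?thesis by (simp add: l1_norm_def)
qed

lemma supp_le_convolve:
  assumes "supp_le R a" "supp_le R' b" shows "supp_le (R + R') (convolve a b)"
  unfolding supp_le_def
proof (intro allI impI, rule ccontr)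
  fix x assume x: "convolve a b x \<noteq> 0" "\<not> norm x \<le> R + R'"
  have "a z * b (x - z) = 0" for z
  proof (rule ccontr)
    assume "a z * b (x - z) \<noteq> 0"
    then have "norm z \<le> R" "norm (x - z) \<le> R'" using assms by (auto simp: supp_le_def)
    then show False using x(2) norm_triangle_ineq[of z "x - z"] by simp
  qed
  then have "(\<lambda>z. a z * b (x - z)) = (\<lambda>z. 0)" by blast
  then have "convolve a b x = 0" unfolding convolve_def by (simp only: Bochner_Integration.integral_zero)
  then show False using x(1) by simp
qed

lemma convolve_lin_right:
  assumes "kernel R a" "continuous_on UNIV f" "continuous_on UNIV g"
  shows "convolve a (\<lambda>x. c * f x + d * g x) = (\<lambda>x. c * convolve a f x + d * convolve a g x)"
proof
  fix x
  have "(LINT z|lborel. c * (a z * f (x - z)) + d * (a z * g (x - z)))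
      = c * convolve a f x + d * convolve a g x"
    unfolding convolve_def using convolve_integrable[OF assms(1)] assms by simp
  then show "convolve a (\<lambda>x. c * f x + d * g x) x = c * convolve a f x + d * convolve a g x"
    unfolding convolve_def by (simp add: algebra_simps)
qed

lemma convolve_add_right:
  "kernel R a \<Longrightarrow> continuous_on UNIV f \<Longrightarrow> continuous_on UNIV g \<Longrightarrow> convolve a (\<lambda>x. f x + g x) = (\<lambda>x. convolve a f x + convolve a g x)"
  using convolve_lin_right[of R a f g 1 1] by simp

lemma convolve_diff_right:
  "kernel R a \<Longrightarrow> continuous_on UNIV f \<Longrightarrow> continuous_on UNIV g \<Longrightarrow> convolve a (\<lambda>x. f x - g x) = (\<lambda>x. convolve a f x - convolve a g x)"
  using convolve_lin_right[of R a f g 1 "-1"] by simp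

lemma convolve_add_left:
  assumes "kernel R a" "kernel R' a'" "continuous_on UNIV f"
  shows "convolve (\<lambda>z. a z + a' z) f = (\<lambda>x. convolve a f x + convolve a' f x)"
  unfolding convolve_def using convolve_integrable[OF assms(1)] convolve_integrable[OF assms(2)] assms(3)
  by (simp add: distrib_right)

lemma convolve_diff_left:
  assumes "kernel R a" "kernel R' a'" "continuous_on UNIV f"
  shows "convolve (\<lambda>z. a z - a' z) f = (\<lambda>x. convolve a f x - convolve a' f x)"
  unfolding convolve_def using convolve_integrable[OF assms(1)] convolve_integrable[OF assms(2)] assms(3)
  by (simp add: left_diff_distrib)

lemma convolve_zero_left: "convolve (\<lambda>z. 0) f = (\<lambda>x. 0)"
  by (rule ext) (simp add: convolve_def)

text \<open>Linearization at \<open>y\<close> leaves the variation of the first derivatives over a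
  ball of radius \<open>norm h\<close>. The bound does not depend on \<open>y\<close>, so it can be
  integrated against a kernel.\<close>

lemma test_second_order:
  fixes b :: "real^'n::finite \<Rightarrow> complex"
  assumes "b \<in> test_functions" "deriv_bound 2 B b"
  shows "norm (b (y + h) - b y - (\<Sum>i\<in>UNIV. h $ i *\<^sub>R partial_deriv i b y)) \<le> (real CARD('n))\<^sup>2 * B * (norm h)\<^sup>2"
proof -
  let ?D = "\<lambda>x h. \<Sum>i\<in>UNIV. h $ i *\<^sub>R partial_deriv i b x"
  have B0: "0 \<le> B" using deriv_bound_ge0[OF assms(2)] .
  have "norm (b (y + h) - b y - ?D y (y + h - y)) \<le> norm (y + h - y) * ((real CARD('n))\<^sup>2 * B * norm h)"
  proof (rule differentiable_bound_linearization[where S="cball y (norm h)" and f'="?D"])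
    show "(b has_derivative ?D x) (at x within cball y (norm h))" for x
      using has_derivative_test[OF assms(1)] has_derivative_at_withinI by blast
    show "y + t *\<^sub>R (y + h - y) \<in> cball y (norm h)" if "t \<in> {0..1}" for t
      using that by (auto simp: dist_norm mult_left_le_one_le)
    fix x assume x: "x \<in> cball y (norm h)"
    show "onorm (?D x - ?D y) \<le> (real CARD('n))\<^sup>2 * B * norm h"
    proof (rule onorm_bound)
      show "0 \<le> (real CARD('n))\<^sup>2 * B * norm h" using B0 by simp
      fix k :: "real^'n"
      have "norm ((?D x - ?D y) k) = norm (\<Sum>i\<in>UNIV. k $ i *\<^sub>R (partial_deriv i b x - partial_deriv i b y))"
        by (simp add: sum_subtractf scaleR_diff_right)
      also have "\<dots> \<le> (\<Sum>i::'n\<in>UNIV. norm k * (real CARD('n) * B * norm h))"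
      proof (rule sum_norm_le)
        fix i :: 'n assume "i \<in> UNIV"
        have "deriv_bound (Suc 0) B (partial_deriv i b)"
          using deriv_bound_iter_deriv[of "Suc 0" 1 B b "[i]"] assms(2) by (simp add: numeral_2_eq_2)
        then have "norm (partial_deriv i b x - partial_deriv i b y) \<le> real CARD('n) * B * norm (x - y)"
          by (intro test_lipschitz test_partial_deriv assms) simp
        also have "\<dots> \<le> real CARD('n) * B * norm h"
          using x B0 by (intro mult_left_mono) (auto simp: dist_norm norm_minus_commute)
        finally show "norm (k $ i *\<^sub>R (partial_deriv i b x - partial_deriv i b y)) \<le> norm k * (real CARD('n) * B * norm h)"
          by (simp add: component_le_norm_cart mult_mono)
      qed
      also have "\<dots> = (real CARD('n))\<^sup>2 * B * norm h * norm k" by (simp add: power2_eq_square)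
      finally show "norm ((?D x - ?D y) k) \<le> (real CARD('n))\<^sup>2 * B * norm h * norm k" .
    qed
  qed simp
  then show ?thesis by (simp add: power2_eq_square algebra_simps)
qed

text \<open>As \<open>a\<close> is only integrable, the derivative falls on \<open>b\<close>. The
  remainder under the integral is quadratic in the increment, uniformly in \<open>z\<close>, so
  differentiating under the integral needs no limit theorem.\<close>

lemma convolve_has_derivative:
  fixes b :: "real^'n::finite \<Rightarrow> complex"
  assumes a: "kernel R a" and b: "b \<in> test_functions"
  shows "(convolve a b has_derivative (\<lambda>h. \<Sum>i\<in>UNIV. h $ i *\<^sub>R convolve a (partial_deriv i b) x)) (at x)"
proof -
  obtain B where B: "0 \<le> B" "deriv_bound 2 B b" using test_deriv_bound[OF b] by metis
  define K where "K = l1_norm a * ((real CARD('n))\<^sup>2 * B)"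
  show ?thesis
  proof (rule has_derivativeI_sandwich[where e=1 and H="\<lambda>y. K * norm (y - x)"])
    have "linear (\<lambda>h. \<Sum>i\<in>UNIV. h $ i *\<^sub>R convolve a (partial_deriv i b) x)"
      by (rule linearI) (auto simp: scaleR_add_left sum.distrib scaleR_sum_right)
    then show "bounded_linear (\<lambda>h. \<Sum>i\<in>UNIV. h $ i *\<^sub>R convolve a (partial_deriv i b) x)"
      using linear_conv_bounded_linear by blast
    have "((\<lambda>y. K * norm (y - x)) \<longlongrightarrow> K * norm (x - x)) (at x)" by (intro tendsto_intros)
    then show "((\<lambda>y. K * norm (y - x)) \<longlongrightarrow> 0) (at x)" by simp
    fix y assume "y \<noteq> x"
    define h where "h = y - x"
    have int: "integrable lborel (\<lambda>z. a z * partial_deriv i b (x - z))" for i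
      by (intro convolve_integrable[OF a] test_continuous test_partial_deriv b)
    have intb: "integrable lborel (\<lambda>z. a z * b (x' - z))" for x'
      by (intro convolve_integrable[OF a] test_continuous b)
    have intK: "integrable lborel (\<lambda>z. a z * (\<Sum>i\<in>UNIV. h $ i *\<^sub>R partial_deriv i b (x - z)))"
    proof -
      have "integrable lborel (\<lambda>z. \<Sum>i\<in>UNIV. h $ i *\<^sub>R (a z * partial_deriv i b (x - z)))"
        by (intro Bochner_Integration.integrable_sum integrable_scaleR_right int)
      then show ?thesis by (simp add: sum_distrib_left)
    qed
    have "convolve a b y - convolve a b x - (\<Sum>i\<in>UNIV. h $ i *\<^sub>R convolve a (partial_deriv i b) x)
      = (LINT z|lborel. a z * (b (y - z) - b (x - z) - (\<Sum>i\<in>UNIV. h $ i *\<^sub>R partial_deriv i b (x - z))))"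
    proof -
      have "(\<Sum>i\<in>UNIV. h $ i *\<^sub>R convolve a (partial_deriv i b) x) = (LINT z|lborel. (\<Sum>i\<in>UNIV. h $ i *\<^sub>R (a z * partial_deriv i b (x - z))))"
        unfolding convolve_def by (subst Bochner_Integration.integral_sum) (auto intro: int)
      also have "\<dots> = (LINT z|lborel. a z * (\<Sum>i\<in>UNIV. h $ i *\<^sub>R partial_deriv i b (x - z)))"
        by (simp add: sum_distrib_left)
      finally show ?thesis unfolding convolve_def using intb intK by (simp add: right_diff_distrib)
    qed
    also have "norm \<dots> \<le> (LINT z|lborel. norm (a z * (b (y - z) - b (x - z) - (\<Sum>i\<in>UNIV. h $ i *\<^sub>R partial_deriv i b (x - z)))))"
      by (rule integral_norm_bound)
    also have "\<dots> \<le> (LINT z|lborel. norm (a z) * ((real CARD('n))\<^sup>2 * B * (norm h)\<^sup>2))"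
    proof (rule integral_mono')
      show "integrable lborel (\<lambda>z. norm (a z) * ((real CARD('n))\<^sup>2 * B * (norm h)\<^sup>2))" using a by (auto simp: kernel_def)
      show "norm (a z * (b (y - z) - b (x - z) - (\<Sum>i\<in>UNIV. h $ i *\<^sub>R partial_deriv i b (x - z))))
        \<le> norm (a z) * ((real CARD('n))\<^sup>2 * B * (norm h)\<^sup>2)" for z
        using test_second_order[OF b B(2), of "x - z" h] unfolding norm_mult
        by (intro mult_left_mono) (auto simp: h_def algebra_simps)
      show "0 \<le> norm (a z) * ((real CARD('n))\<^sup>2 * B * (norm h)\<^sup>2)" for z using B by simp
    qed
    also have "\<dots> = K * (norm h)\<^sup>2" by (simp add: K_def l1_norm_def)
    finally have "norm (convolve a b y - convolve a b x - (\<Sum>i\<in>UNIV. h $ i *\<^sub>R convolve a (partial_deriv i b) x)) / norm h \<le> K * (norm h)\<^sup>2 / norm h"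
      by (rule divide_right_mono) simp
    then show "norm (convolve a b y - convolve a b x - (\<Sum>i\<in>UNIV. (y - x) $ i *\<^sub>R convolve a (partial_deriv i b) x)) / norm (y - x) \<le> K * norm (y - x)"
      using \<open>y \<noteq> x\<close> unfolding h_def by (simp add: power2_eq_square)
  qed simp
qed

lemma partial_deriv_convolve:
  assumes "kernel R a" "b \<in> test_functions"
  shows "partial_deriv i (convolve a b) = convolve a (partial_deriv i b)"
proof
  fix x
  have "(\<Sum>k\<in>UNIV. axis i 1 $ k *\<^sub>R convolve a (partial_deriv k b) x) = convolve a (partial_deriv i b) x"
    by (subst sum.remove[of _ i]) (auto simp: axis_def intro!: sum.neutral)
  then show "partial_deriv i (convolve a b) x = convolve a (partial_deriv i b) x"
    using partial_derivI[OF convolve_has_derivative[OF assms]] by simp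
qed

lemma iter_deriv_convolve:
  assumes "kernel R a" "b \<in> test_functions"
  shows "iter_deriv is (convolve a b) = convolve a (iter_deriv is b)"
  by (induction "is") (auto simp: partial_deriv_convolve[OF assms(1) test_iter_deriv[OF assms(2)]])

lemma test_convolve:
  assumes "kernel R a" "b \<in> test_functions" shows "convolve a b \<in> test_functions"
proof -
  obtain R' where R': "supp_le R' b" using test_supp[OF assms(2)] by metis
  show ?thesis
  proof (rule test_coinduct[where A="convolve a ` test_functions"])
    show "supp_le (R + R') (convolve a b)" using supp_le_convolve R' assms(1) by (auto simp: kernel_def)
  next
    fix g x assume "g \<in> convolve a ` test_functions"
    then show "g differentiable (at x)" using convolve_has_derivative[OF assms(1)] differentiable_def by blast
  next
    fix g i assume "g \<in> convolve a ` test_functions"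
    then show "partial_deriv i g \<in> convolve a ` test_functions"
      using partial_deriv_convolve[OF assms(1)] test_partial_deriv by blast
  qed (use assms in auto)
qed

lemma deriv_bound_convolve:
  assumes "kernel R a" "b \<in> test_functions" "deriv_bound m B b" "l1_norm a \<le> A"
  shows "deriv_bound m (A * B) (convolve a b)"
  unfolding deriv_bound_def
proof (intro allI impI)
  fix "is" :: "'a list" and x assume len: "length is = m"
  have B: "0 \<le> B" using assms(3) deriv_bound_ge0 by blast
  have "norm (convolve a (iter_deriv is b) x) \<le> l1_norm a * B"
    using assms(3) len B by (intro convolve_bound[OF assms(1)]) (auto simp: deriv_bound_def)
  also have "\<dots> \<le> A * B" using B assms by (intro mult_right_mono)
  finally show "norm (iter_deriv is (convolve a b) x) \<le> A * B" by (simp add: iter_deriv_convolve[OF assms(1,2)])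
qed

section \<open>Changes of variables, commutativity and reflections\<close>

lemma lborel_integral_affine:
  fixes f :: "real^'n::finite \<Rightarrow> 'b::{banach, second_countable_topology}"
  assumes "c \<noteq> 0" and [measurable]: "f \<in> borel_measurable borel"
  shows "(LINT x|lborel. f x) = \<bar>c\<bar> ^ CARD('n) *\<^sub>R (LINT x|lborel. f (v + c *\<^sub>R x))"
proof -
  have "(LINT x|lborel. f x) = (LINT x|density (distr lborel borel (\<lambda>x. v + c *\<^sub>R x)) (\<lambda>_. \<bar>c\<bar>^DIM(real^'n)). f x)"
    using lborel_affine[OF assms(1), of v] by simp
  also have "\<dots> = \<bar>c\<bar> ^ CARD('n) *\<^sub>R (LINT x|lborel. f (v + c *\<^sub>R x))"
    by (subst integral_density) (auto simp: integral_distr)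
  finally show ?thesis .
qed

lemma nn_integral_affine:
  fixes f :: "real^'n::finite \<Rightarrow> ennreal"
  assumes "c \<noteq> 0" and [measurable]: "f \<in> borel_measurable borel"
  shows "(\<integral>\<^sup>+x. f x \<partial>lborel) = ennreal (\<bar>c\<bar> ^ CARD('n)) * (\<integral>\<^sup>+x. f (v + c *\<^sub>R x) \<partial>lborel)"
proof -
  have "(\<integral>\<^sup>+x. f x \<partial>lborel) = (\<integral>\<^sup>+x. f x \<partial>density (distr lborel borel (\<lambda>x. v + c *\<^sub>R x)) (\<lambda>_. \<bar>c\<bar>^DIM(real^'n)))"
    using lborel_affine[OF assms(1), of v] by simp
  also have "\<dots> = ennreal (\<bar>c\<bar> ^ CARD('n)) * (\<integral>\<^sup>+x. f (v + c *\<^sub>R x) \<partial>lborel)"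
    by (subst nn_integral_density) (auto simp: nn_integral_distr nn_integral_cmult)
  finally show ?thesis .
qed

lemma convolve_commute:
  fixes a b :: "real^'n::finite \<Rightarrow> complex"
  assumes "continuous_on UNIV a" "continuous_on UNIV b"
  shows "convolve a b = convolve b a"
proof
  fix x
  have [measurable]: "a \<in> borel_measurable borel" "b \<in> borel_measurable borel"
    using assms borel_measurable_continuous_onI by auto
  have "convolve a b x = \<bar>-1\<bar> ^ CARD('n) *\<^sub>R (LINT z|lborel. a (x + (-1) *\<^sub>R z) * b (x - (x + (-1) *\<^sub>R z)))"
    unfolding convolve_def by (rule lborel_integral_affine) auto
  then show "convolve a b x = convolve b a x" by (simp add: convolve_def mult.commute)
qed

text \<open>Fubini, with the boundedness of \<open>g\<close> providing the majorant. Together with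
  commutativity this amounts to associativity, in the form that two convolution operators
  commute.\<close>

lemma convolve_left_commute:
  fixes a b g :: "real^'n::finite \<Rightarrow> complex"
  assumes a: "kernel R a" and b: "kernel R' b" and g: "continuous_on UNIV g" "supp_le R'' g"
  shows "convolve a (convolve b g) = convolve b (convolve a g)"
proof
  fix x
  obtain B where B: "0 \<le> B" "\<And>x. norm (g x) \<le> B" using supp_le_continuous_bounded[OF g(2,1)] by metis
  have [measurable]: "g \<in> borel_measurable borel" by (rule borel_measurable_continuous_onI[OF g(1)])
  have [measurable]: "a \<in> borel_measurable borel" "b \<in> borel_measurable borel"
    using a b borel_measurable_integrable unfolding kernel_def by fastforce+
  let ?f = "\<lambda>z w. a z * (b w * g (x - z - w))"
  have ig: "integrable lborel (\<lambda>w. b w * g (y - w))" for y by (rule convolve_integrable[OF b g(1)])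
  have "integrable (lborel \<Otimes>\<^sub>M lborel) (case_prod ?f)"
  proof (rule lborel_pair.Fubini_integrable)
    show "AE z in lborel. integrable lborel (\<lambda>w. case (z, w) of (z, w) \<Rightarrow> ?f z w)"
      using ig by simp
    show "integrable lborel (\<lambda>z. LINT w|lborel. norm (case (z, w) of (z, w) \<Rightarrow> ?f z w))"
    proof (rule Bochner_Integration.integrable_bound[where f="\<lambda>z. norm (a z) * (l1_norm b * B)"])
      show "integrable lborel (\<lambda>z. norm (a z) * (l1_norm b * B))" using a by (simp add: kernel_def)
      have "norm (LINT w|lborel. norm (?f z w)) \<le> norm (norm (a z) * (l1_norm b * B))" for z
      proof -
        have "(LINT w|lborel. norm (?f z w)) \<le> (LINT w|lborel. norm (a z) * (norm (b w) * B))"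
          using b B by (intro integral_mono') (auto simp: kernel_def norm_mult intro!: mult_left_mono)
        also have "\<dots> = norm (a z) * (l1_norm b * B)" by (simp add: l1_norm_def)
        finally have "(LINT w|lborel. norm (?f z w)) \<le> norm (a z) * (l1_norm b * B)" .
        moreover have "0 \<le> (LINT w|lborel. norm (?f z w))" by (rule integral_nonneg_AE) simp
        ultimately show ?thesis by simp
      qed
      then show "AE z in lborel. norm (LINT w|lborel. norm (case (z, w) of (z, w) \<Rightarrow> ?f z w)) \<le> norm (norm (a z) * (l1_norm b * B))"
        by simp
    qed measurable
  qed measurable
  then have "(LINT w|lborel. LINT z|lborel. ?f z w) = (LINT z|lborel. LINT w|lborel. ?f z w)"
    by (rule lborel_pair.Fubini_integral)
  moreover have "(LINT w|lborel. LINT z|lborel. ?f z w) = convolve b (convolve a g) x"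
  proof -
    have "(LINT z|lborel. ?f z w) = b w * (LINT z|lborel. a z * g (x - w - z))" for w
      by (subst integral_mult_right_zero[symmetric]) (simp add: algebra_simps)
    then show ?thesis by (simp add: convolve_def)
  qed
  ultimately show "convolve a (convolve b g) x = convolve b (convolve a g) x" by (simp add: convolve_def)
qed

lemma refl_eq:
  fixes g :: "real^'n::finite \<Rightarrow> complex"
  shows "(\<lambda>y. g (x - y)) = (\<lambda>y::real^'n::finite. 1 * g ((-1) *\<^sub>R y + x))"
  by (rule ext) simp

lemma test_refl: "g \<in> test_functions \<Longrightarrow> (\<lambda>y. g (x - y)) \<in> test_functions"
  by (subst refl_eq) (rule test_affine, auto)

lemma iter_deriv_refl: "g \<in> test_functions \<Longrightarrow> iter_deriv is (\<lambda>y. g (x - y)) = (\<lambda>y. (-1) ^ length is * iter_deriv is g (x - y))"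
  by (subst refl_eq, subst iter_deriv_affine, assumption) auto

lemma deriv_bound_refl: "g \<in> test_functions \<Longrightarrow> deriv_bound m B g \<Longrightarrow> deriv_bound m B (\<lambda>y. g (x - y))"
  by (auto simp: deriv_bound_def iter_deriv_refl norm_mult norm_power)

lemma supp_le_refl: "supp_le R g \<Longrightarrow> supp_le (R + norm x) (\<lambda>y. g (x - y))"
  unfolding supp_le_def
proof (intro allI impI)
  fix y assume "\<forall>x. g x \<noteq> 0 \<longrightarrow> norm x \<le> R" "g (x - y) \<noteq> 0"
  then have "norm (x - y) \<le> R" by blast
  then show "norm y \<le> R + norm x" using norm_triangle_sub[of y x] by (simp add: norm_minus_commute)
qed

section \<open>Functionals of exponential order and their convolutions\<close>

lemma test_deriv_bound_upto:
  assumes "b \<in> test_functions" shows "\<exists>B\<ge>0. \<forall>m\<le>N. deriv_bound m B b"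
proof -
  obtain B where B: "\<And>m. 0 \<le> B m" "\<And>m. deriv_bound m (B m) b" using test_deriv_bound[OF assms] by metis
  have "deriv_bound m (sum B {..N}) b" if "m \<le> N" for m
    using that B by (intro deriv_bound_mono[OF B(2)] member_le_sum) auto
  then show ?thesis using B(1) by (intro exI[of _ "sum B {..N}"]) (auto simp: sum_nonneg)
qed

text \<open>On the support the exponential weight is at most \<open>exp (N * \<rho>)\<close>, and
  the supremum over multi-indices reduces to finitely many bounds \<open>deriv_bound\<close>.
  \<open>C\<close> and \<open>N\<close> depend on \<open>f\<close>; below they enter only into
  continuity, convergence and finiteness, never into a final constant.\<close>

lemma S'_e_bound:
  fixes f :: "(real^'n::finite \<Rightarrow> complex) \<Rightarrow> complex"
  assumes "f \<in> S'_e"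
  shows "\<exists>C\<ge>0. \<exists>N::nat. \<forall>\<psi>\<in>test_functions. \<forall>\<rho> B. supp_le \<rho> \<psi> \<longrightarrow> 0 \<le> B \<longrightarrow> (\<forall>m\<le>N. deriv_bound m B \<psi>) \<longrightarrow>
    norm (f \<psi>) \<le> C * exp (real N * \<rho>) * B"
proof -
  obtain C :: real and N :: nat where CN: "\<And>\<psi>. \<psi> \<in> test_functions \<Longrightarrow>
     ennreal (norm (f \<psi>)) \<le> ennreal C *
       (SUP \<beta>\<in>{\<beta>. mdeg \<beta> \<le> N}. SUP x. ennreal (norm (multi_deriv \<beta> \<psi> x) * exp (real N * norm x)))"
    using assms unfolding S'_e_def by blast
  have "norm (f \<psi>) \<le> max C 0 * exp (real N * \<rho>) * B"
    if \<psi>: "\<psi> \<in> test_functions" and s: "supp_le \<rho> \<psi>" and B: "0 \<le> B" "\<forall>m\<le>N. deriv_bound m B \<psi>" for \<psi> \<rho> B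
  proof -
    have "(SUP \<beta>\<in>{\<beta>. mdeg \<beta> \<le> N}. SUP x. ennreal (norm (multi_deriv \<beta> \<psi> x) * exp (real N * norm x)))
      \<le> ennreal (exp (real N * \<rho>) * B)"
    proof (intro SUP_least ennreal_leI)
      fix \<beta> :: "'n multiindex" and x assume "\<beta> \<in> {\<beta>. mdeg \<beta> \<le> N}"
      moreover obtain "is" where "is": "length is = mdeg \<beta>" "multi_deriv \<beta> \<psi> = iter_deriv is \<psi>"
        using multi_deriv_eq_iter_deriv by blast
      ultimately have b: "norm (iter_deriv is \<psi> x) \<le> B" using B by (auto simp: deriv_bound_def)
      show "norm (multi_deriv \<beta> \<psi> x) * exp (real N * norm x) \<le> exp (real N * \<rho>) * B"
      proof (cases "norm x \<le> \<rho>")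
        case True
        then have "exp (real N * norm x) \<le> exp (real N * \<rho>)" by (simp add: mult_left_mono)
        then show ?thesis unfolding "is"(2) using b by (simp add: mult.commute[of _ B] mult_mono B)
      next
        case False
        then have "iter_deriv is \<psi> x = 0" using supp_leD[OF supp_le_iter_deriv[OF s]] by simp
        then show ?thesis using "is" B by simp
      qed
    qed
    then have "ennreal (norm (f \<psi>)) \<le> ennreal C * ennreal (exp (real N * \<rho>) * B)"
      using CN[OF \<psi>] by (meson mult_left_mono order_trans zero_le)
    also have "\<dots> = ennreal (max C 0) * ennreal (exp (real N * \<rho>) * B)"
      by (cases "0 \<le> C") (auto simp: ennreal_neg)
    also have "\<dots> = ennreal (max C 0 * (exp (real N * \<rho>) * B))" by (rule ennreal_mult[symmetric]) (auto simp: B)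
    finally show ?thesis using B by (simp add: mult.assoc)
  qed
  then show ?thesis by (intro exI[of _ "max C 0"] conjI exI[of _ N]) auto
qed

lemma S'_e_add: "f \<in> S'_e \<Longrightarrow> \<phi> \<in> test_functions \<Longrightarrow> \<psi> \<in> test_functions \<Longrightarrow> f (\<lambda>x. \<phi> x + \<psi> x) = f \<phi> + f \<psi>"
  unfolding S'_e_def distributions_def by blast

lemma S'_e_cmult: "f \<in> S'_e \<Longrightarrow> \<psi> \<in> test_functions \<Longrightarrow> f (\<lambda>x. c * \<psi> x) = c * f \<psi>"
  unfolding S'_e_def distributions_def by blast

lemma S'_e_zero: "f \<in> S'_e \<Longrightarrow> f (\<lambda>x. 0) = 0"
  using S'_e_cmult[OF _ test_zero, of f 0] by simp

lemma S'_e_diff: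
  assumes "f \<in> S'_e" "\<phi> \<in> test_functions" "\<psi> \<in> test_functions"
  shows "f (\<lambda>x. \<phi> x - \<psi> x) = f \<phi> - f \<psi>"
  using S'_e_add[OF assms(1,2) test_cmult[OF assms(3), of "-1"]] S'_e_cmult[OF assms(1,3), of "-1"] by simp

lemma conv_add: "f \<in> S'_e \<Longrightarrow> g \<in> test_functions \<Longrightarrow> h \<in> test_functions \<Longrightarrow> conv (\<lambda>x. g x + h x) f x = conv g f x + conv h f x"
  unfolding conv_def by (rule S'_e_add) (auto intro: test_refl)

lemma conv_diff: "f \<in> S'_e \<Longrightarrow> g \<in> test_functions \<Longrightarrow> h \<in> test_functions \<Longrightarrow> conv (\<lambda>x. g x - h x) f x = conv g f x - conv h f x"
  unfolding conv_def by (rule S'_e_diff) (auto intro: test_refl)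

lemma conv_zero: "f \<in> S'_e \<Longrightarrow> conv (\<lambda>x. 0) f x = 0"
  unfolding conv_def by (rule S'_e_zero)

lemma deriv_bound_lipschitz_iter_deriv:
  fixes g :: "real^'n::finite \<Rightarrow> complex"
  assumes "g \<in> test_functions" "deriv_bound (Suc m) B g" "length is = m"
  shows "norm (iter_deriv is g x - iter_deriv is g y) \<le> real CARD('n) * B * norm (x - y)"
  by (rule test_lipschitz[OF test_iter_deriv[OF assms(1)] deriv_bound_iter_deriv[where k=m]]) (use assms in auto)

text \<open>The derivatives of the difference of two translates of \<open>b\<close> are bounded by
  the shift times the derivatives of one order more, hence \<open>Suc N\<close>. The exponential
  weight makes the constant depend on \<open>r\<close>.\<close>

lemma conv_lipschitz:
  fixes b :: "real^'n::finite \<Rightarrow> complex"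
  assumes f: "f \<in> S'_e" and b: "b \<in> test_functions"
  shows "\<exists>K\<ge>0. \<forall>x y. norm x \<le> r \<longrightarrow> norm y \<le> r \<longrightarrow> norm (conv b f x - conv b f y) \<le> K * norm (x - y)"
proof -
  obtain C N where CN: "0 \<le> C" "\<And>\<psi> \<rho> B. \<psi> \<in> test_functions \<Longrightarrow> supp_le \<rho> \<psi> \<Longrightarrow> 0 \<le> B \<Longrightarrow> (\<forall>m\<le>N. deriv_bound m B \<psi>) \<Longrightarrow>
    norm (f \<psi>) \<le> C * exp (real N * \<rho>) * B" using S'_e_bound[OF f] by metis
  obtain B where B: "0 \<le> B" "\<And>m. m \<le> Suc N \<Longrightarrow> deriv_bound m B b" using test_deriv_bound_upto[OF b, of "Suc N"] by metis
  obtain R where R: "supp_le R b" using test_supp[OF b] by metis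
  define K where "K = C * exp (real N * (R + r)) * (real CARD('n) * B)"
  have "norm (conv b f x - conv b f y) \<le> K * norm (x - y)" if xy: "norm x \<le> r" "norm y \<le> r" for x y
  proof -
    have t: "(\<lambda>w. b (x - w)) \<in> test_functions" "(\<lambda>w. b (y - w)) \<in> test_functions" using test_refl[OF b] by auto
    have "norm (f (\<lambda>w. b (x - w) - b (y - w))) \<le> C * exp (real N * (R + r)) * (real CARD('n) * B * norm (x - y))"
    proof (rule CN(2))
      show "(\<lambda>w. b (x - w) - b (y - w)) \<in> test_functions" by (intro test_diff t)
      have "supp_le (R + r) (\<lambda>w. b (x - w))" "supp_le (R + r) (\<lambda>w. b (y - w))"
        by (auto intro!: supp_le_mono[OF supp_le_refl[OF R]] simp: xy)
      then show "supp_le (R + r) (\<lambda>w. b (x - w) - b (y - w))" unfolding supp_le_def by (metis diff_self)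
      show "0 \<le> real CARD('n) * B * norm (x - y)" using B by simp
      show "\<forall>m\<le>N. deriv_bound m (real CARD('n) * B * norm (x - y)) (\<lambda>w. b (x - w) - b (y - w))"
        unfolding deriv_bound_def
      proof (intro allI impI)
        fix m "is" w assume m: "m \<le> N" "length (is :: 'n list) = m"
        have "iter_deriv is (\<lambda>w. b (x - w) - b (y - w)) w = (-1) ^ m * (iter_deriv is b (x - w) - iter_deriv is b (y - w))"
          by (simp add: iter_deriv_diff[OF t] iter_deriv_refl[OF b] m right_diff_distrib)
        moreover have "norm (iter_deriv is b (x - w) - iter_deriv is b (y - w)) \<le> real CARD('n) * B * norm (x - y)"
          using deriv_bound_lipschitz_iter_deriv[OF b _ m(2), of B "x - w" "y - w"] B(2) m by simp
        ultimately show "norm (iter_deriv is (\<lambda>w. b (x - w) - b (y - w)) w) \<le> real CARD('n) * B * norm (x - y)"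
          by (simp add: norm_mult norm_power)
      qed
    qed
    then show ?thesis unfolding conv_def K_def S'_e_diff[OF f t] by (simp add: mult.assoc)
  qed
  moreover have "0 \<le> K" unfolding K_def using CN(1) B(1) by simp
  ultimately show ?thesis by blast
qed

lemma conv_continuous:
  fixes b :: "real^'n::finite \<Rightarrow> complex"
  assumes f: "f \<in> S'_e" and b: "b \<in> test_functions"
  shows "continuous_on UNIV (conv b f)"
proof (rule continuous_at_imp_continuous_on, intro ballI)
  fix x :: "real^'n"
  obtain K where K: "K \<ge> 0" "\<And>y z. norm y \<le> norm x + 1 \<Longrightarrow> norm z \<le> norm x + 1 \<Longrightarrow> norm (conv b f y - conv b f z) \<le> K * norm (y - z)"
    using conv_lipschitz[OF f b] by metis
  have ev: "\<forall>\<^sub>F y in at x. dist (conv b f y) (conv b f x) \<le> K * dist y x"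
  proof -
    have "\<forall>\<^sub>F y in at x. dist y x < 1" by (auto simp: eventually_at intro: exI[of _ 1])
    then show ?thesis
    proof eventually_elim
      case (elim y)
      then have "norm y \<le> norm x + 1" using norm_triangle_sub[of y x] by (simp add: dist_norm)
      then show ?case using K(2)[of y x] by (simp add: dist_norm)
    qed
  qed
  have lim: "((\<lambda>y. K * dist y x) \<longlongrightarrow> 0) (at x)"
  proof -
    have "((\<lambda>y. K * dist y x) \<longlongrightarrow> K * dist x x) (at x)" by (intro tendsto_intros)
    then show ?thesis by simp
  qed
  have "((\<lambda>y. dist (conv b f y) (conv b f x)) \<longlongrightarrow> 0) (at x)"
    by (rule tendsto_sandwich[OF always_eventually ev tendsto_const lim]) simp
  then show "isCont (conv b f) x" unfolding isCont_def using tendsto_dist_iff by blast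
qed

text \<open>After subtracting the value at \<open>w - z0\<close>, the remaining function is at most
  \<open>e\<close> wherever \<open>a\<close> is nonzero. This serves twice: for small pieces of a
  kernel, and with \<open>z0 = 0\<close> for kernels of integral 1 and small support.\<close>

lemma convolve_local:
  assumes a: "kernel R a" and g: "continuous_on UNIV g"
    and e: "\<And>z. a z \<noteq> 0 \<Longrightarrow> norm (g (w - z) - g (w - z0)) \<le> e" "0 \<le> e"
  shows "norm (convolve a g w - (LINT z|lborel. a z) * g (w - z0)) \<le> l1_norm a * e"
proof -
  have "convolve a g w - (LINT z|lborel. a z) * g (w - z0) = convolve a (\<lambda>u. g u - g (w - z0)) w"
  proof -
    have "convolve a (\<lambda>u. g (w - z0)) w = (LINT z|lborel. a z) * g (w - z0)"
      using a by (simp add: convolve_def)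
    then show ?thesis using convolve_diff_right[OF a g, of "\<lambda>_. g (w - z0)"] by simp
  qed
  also have "norm \<dots> \<le> l1_norm a * e" by (rule convolve_bound[OF a]) (use e in auto)
  finally show ?thesis .
qed

text \<open>As \<open>f\<close> acts on test functions only, it is taken under the integral by hand: \<open>a\<close> is cut into
  pieces supported in balls of radius \<open>\<delta>\<close>, on which both sides agree up to \<open>O(\<delta>)\<close> times the
  \<open>L\<^sub>1\<close> norm of the piece, and \<open>\<delta> \<rightarrow> 0\<close>.\<close>

theorem conv_convolve:
  fixes b :: "real^'n::finite \<Rightarrow> complex"
  assumes f: "f \<in> S'_e" and a: "kernel R a" and b: "b \<in> test_functions"
  shows "conv (convolve a b) f x = convolve a (conv b f) x"
proof -
  define \<Delta> where "\<Delta> a = conv (convolve a b) f x - convolve a (conv b f) x" for a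
  obtain C N where CN: "0 \<le> C" "\<And>\<psi> \<rho> B. \<psi> \<in> test_functions \<Longrightarrow> supp_le \<rho> \<psi> \<Longrightarrow> 0 \<le> B \<Longrightarrow> (\<forall>m\<le>N. deriv_bound m B \<psi>) \<Longrightarrow>
    norm (f \<psi>) \<le> C * exp (real N * \<rho>) * B" using S'_e_bound[OF f] by metis
  obtain B where B: "0 \<le> B" "\<And>m. m \<le> Suc N \<Longrightarrow> deriv_bound m B b" using test_deriv_bound_upto[OF b, of "Suc N"] by metis
  obtain Rb where Rb: "0 < Rb" "supp_le Rb b" using test_supp[OF b] by metis
  obtain K where K: "K \<ge> 0" "\<And>y z. norm y \<le> norm x + \<bar>R\<bar> \<Longrightarrow> norm z \<le> norm x + \<bar>R\<bar> \<Longrightarrow> norm (conv b f y - conv b f z) \<le> K * norm (y - z)"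
    using conv_lipschitz[OF f b] by metis
  define \<rho> where "\<rho> = \<bar>R\<bar> + Rb + norm x"
  define K' where "K' = C * exp (real N * \<rho>) * (real CARD('n) * B) + K"
  \<comment> \<open>For a piece of \<open>a\<close> near \<open>z0\<close> both sides are compared
    with its integral times \<open>conv b f (x - z0)\<close>. The two errors are the two summands of
    \<open>K'\<close>: one from the estimate for the functional, one from the Lipschitz bound of
    \<open>conv b f\<close>.\<close>
  have local: "norm (\<Delta> a) \<le> K' * \<delta> * l1_norm a"
    if a: "kernel R a" and z0: "norm z0 \<le> R" and \<delta>: "0 < \<delta>" and near: "\<And>z. a z \<noteq> 0 \<Longrightarrow> dist z0 z < \<delta>" for a z0 \<delta>
  proof -
    let ?A = "LINT z|lborel. a z"
    let ?h = "\<lambda>w. convolve a b w - ?A * b (w - z0)"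
    have tb: "(\<lambda>w. b (w - z0)) \<in> test_functions" using test_affine[OF b, of 1 1 "- z0"] by simp
    have tab: "convolve a b \<in> test_functions" by (rule test_cmult[of _ 1, simplified, OF test_convolve[OF a b]])
    have th: "?h \<in> test_functions" by (intro test_diff tab test_cmult tb)
    have ipdh: "iter_deriv is ?h = (\<lambda>w. convolve a (iter_deriv is b) w - ?A * iter_deriv is b (w - z0))" for "is"
    proof -
      have "iter_deriv is (\<lambda>w. ?A * b (w - z0)) = (\<lambda>w. ?A * iter_deriv is b (w - z0))"
        using iter_deriv_affine[OF b, of "is" ?A 1 "- z0"] by simp
      then show ?thesis by (simp add: iter_deriv_diff[OF tab test_cmult[OF tb]] iter_deriv_convolve[OF a b])
    qed
    have dz: "norm (g (w - z) - g (w - z0)) \<le> L * \<delta>"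
      if "a z \<noteq> 0" "\<And>y u. norm (g y - g u) \<le> L * norm (y - u)" "0 \<le> L" for g :: "real^'n \<Rightarrow> complex" and w z L
    proof -
      have "norm (g (w - z) - g (w - z0)) \<le> L * norm ((w - z) - (w - z0))" by (rule that)
      also have "\<dots> \<le> L * \<delta>" using near[OF that(1)] that(3) by (intro mult_left_mono) (auto simp: dist_norm)
      finally show ?thesis .
    qed
    have dh: "\<forall>m\<le>N. deriv_bound m (l1_norm a * (real CARD('n) * B * \<delta>)) ?h"
      unfolding deriv_bound_def ipdh
    proof (intro allI impI)
      fix m "is" w assume m: "m \<le> N" "length (is :: 'n list) = m"
      show "norm (convolve a (iter_deriv is b) w - ?A * iter_deriv is b (w - z0)) \<le> l1_norm a * (real CARD('n) * B * \<delta>)"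
      proof (rule convolve_local[OF a test_continuous[OF test_iter_deriv[OF b]]])
        fix z assume "a z \<noteq> 0"
        then show "norm (iter_deriv is b (w - z) - iter_deriv is b (w - z0)) \<le> real CARD('n) * B * \<delta>"
          by (rule dz) (use m B in \<open>auto intro!: deriv_bound_lipschitz_iter_deriv[OF b _ m(2)]\<close>)
      qed (use B \<delta> in auto)
    qed
    have "supp_le (\<bar>R\<bar> + Rb) ?h"
    proof -
      have 1: "supp_le (\<bar>R\<bar> + Rb) (convolve a b)"
        using supp_le_convolve[of R a Rb b] a Rb by (auto simp: kernel_def intro: supp_le_mono)
      have 2: "supp_le (\<bar>R\<bar> + Rb) (\<lambda>w. b (w - z0))"
        unfolding supp_le_def
      proof (intro allI impI)
        fix w assume "b (w - z0) \<noteq> 0"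
        then have "norm (w - z0) \<le> Rb" using Rb by (auto simp: supp_le_def)
        then show "norm w \<le> \<bar>R\<bar> + Rb" using norm_triangle_sub[of w z0] z0 by simp
      qed
      show ?thesis using 1 2 unfolding supp_le_def by (metis diff_self mult_zero_right)
    qed
    then have "supp_le \<rho> (\<lambda>y. ?h (x - y))" unfolding \<rho>_def by (rule supp_le_refl)
    then have "norm (f (\<lambda>y. ?h (x - y))) \<le> C * exp (real N * \<rho>) * (l1_norm a * (real CARD('n) * B * \<delta>))"
      by (rule CN(2)[OF test_refl[OF th]]) (use B \<delta> l1_norm_nonneg[of a] dh deriv_bound_refl[OF th] in auto)
    moreover have "f (\<lambda>y. ?h (x - y)) = conv (convolve a b) f x - ?A * conv b f (x - z0)"
    proof -
      have "conv ?h f x = conv (convolve a b) f x - conv (\<lambda>w. ?A * b (w - z0)) f x"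
        by (rule conv_diff[OF f tab test_cmult[OF tb]])
      also have "conv (\<lambda>w. ?A * b (w - z0)) f x = ?A * conv b f (x - z0)"
      proof -
        have "(\<lambda>y. b (x - z0 - y)) = (\<lambda>y. b (x - y - z0))" by (simp add: algebra_simps)
        then show ?thesis unfolding conv_def using S'_e_cmult[OF f test_refl[OF tb, of x], of ?A] by simp
      qed
      finally show ?thesis by (simp add: conv_def)
    qed
    ultimately have 1: "norm (conv (convolve a b) f x - ?A * conv b f (x - z0)) \<le> C * exp (real N * \<rho>) * (l1_norm a * (real CARD('n) * B * \<delta>))" by simp
    have 2: "norm (convolve a (conv b f) x - ?A * conv b f (x - z0)) \<le> l1_norm a * (K * \<delta>)"
    proof (rule convolve_local[OF a conv_continuous[OF f b]])
      fix z assume z: "a z \<noteq> 0"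
      then have "norm z \<le> R" using a by (auto simp: kernel_def supp_le_def)
      then have "norm (x - z) \<le> norm x + \<bar>R\<bar>" "norm (x - z0) \<le> norm x + \<bar>R\<bar>"
        using z0 norm_triangle_ineq4[of x z] norm_triangle_ineq4[of x z0] by auto
      then have "norm (conv b f (x - z) - conv b f (x - z0)) \<le> K * norm ((x - z) - (x - z0))" by (rule K(2))
      also have "\<dots> \<le> K * \<delta>" using near[OF z] K(1) by (intro mult_left_mono) (auto simp: dist_norm)
      finally show "norm (conv b f (x - z) - conv b f (x - z0)) \<le> K * \<delta>" .
    qed (use K \<delta> in auto)
    have "norm (\<Delta> a) \<le> norm (conv (convolve a b) f x - ?A * conv b f (x - z0)) + norm (convolve a (conv b f) x - ?A * conv b f (x - z0))"
      unfolding \<Delta>_def dist_norm[symmetric] by (rule dist_triangle2)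
    also have "\<dots> \<le> C * exp (real N * \<rho>) * (l1_norm a * (real CARD('n) * B * \<delta>)) + l1_norm a * (K * \<delta>)"
      using 1 2 by (rule add_mono)
    also have "\<dots> = K' * \<delta> * l1_norm a" by (simp add: K'_def algebra_simps)
    finally show ?thesis .
  qed
  \<comment> \<open>Induction over the centres, splitting off the part of \<open>a\<close> in one
    ball. The two pieces are nonzero on disjoint sets, so their \<open>L_1\<close> norms add up and
    the number of balls does not enter the bound.\<close>
  have cover: "\<forall>a. kernel R a \<longrightarrow> (\<forall>z. a z \<noteq> 0 \<longrightarrow> (\<exists>c\<in>k. dist c z < \<delta>)) \<longrightarrow> norm (\<Delta> a) \<le> K' * \<delta> * l1_norm a"
    if "finite k" "k \<subseteq> cball 0 R" "0 < \<delta>" for k \<delta>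
    using that(1,2)
  proof (induction k rule: finite_induct)
    case empty
    show ?case
    proof (intro allI impI)
      fix a :: "real^'n \<Rightarrow> complex" assume "\<forall>z. a z \<noteq> 0 \<longrightarrow> (\<exists>c\<in>{}. dist c z < \<delta>)"
      then have "a = (\<lambda>z. 0)" by auto
      then show "norm (\<Delta> a) \<le> K' * \<delta> * l1_norm a" by (simp add: \<Delta>_def convolve_zero_left conv_zero[OF f] l1_norm_def)
    qed
  next
    case (insert c k)
    show ?case
    proof (intro allI impI)
      fix a :: "real^'n \<Rightarrow> complex" assume a: "kernel R a" and near: "\<forall>z. a z \<noteq> 0 \<longrightarrow> (\<exists>c\<in>insert c k. dist c z < \<delta>)"
      define a1 where "a1 = (\<lambda>z. indicator (ball c \<delta>) z *\<^sub>R a z)"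
      define a2 where "a2 = (\<lambda>z. indicator (- ball c \<delta>) z *\<^sub>R a z)"
      have k1: "kernel R a1" "kernel R a2"
        using a unfolding kernel_def a1_def a2_def
        by (auto intro!: integrable_mult_indicator simp: supp_le_def)
      have a12: "a = (\<lambda>z. a1 z + a2 z)" by (auto simp: a1_def a2_def indicator_def)
      have l12: "l1_norm a = l1_norm a1 + l1_norm a2"
      proof -
        have "norm (a z) = norm (a1 z) + norm (a2 z)" for z by (auto simp: a1_def a2_def indicator_def)
        then show ?thesis using k1 by (simp add: l1_norm_def kernel_def)
      qed
      have "\<Delta> a = \<Delta> a1 + \<Delta> a2"
        unfolding \<Delta>_def
        using convolve_add_left[OF k1(1) k1(2) test_continuous[OF b]]
          convolve_add_left[OF k1(1) k1(2) conv_continuous[OF f b]]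
          conv_add[OF f test_convolve[OF k1(1) b] test_convolve[OF k1(2) b], of x]
        by (simp add: a12)
      then have "norm (\<Delta> a) \<le> norm (\<Delta> a1) + norm (\<Delta> a2)" by (simp add: norm_triangle_ineq)
      also have "norm (\<Delta> a1) \<le> K' * \<delta> * l1_norm a1"
        by (rule local[OF k1(1), of c]) (use insert.prems that(3) in \<open>auto simp: a1_def indicator_def split: if_splits\<close>)
      also have "norm (\<Delta> a2) \<le> K' * \<delta> * l1_norm a2"
      proof -
        have "\<forall>z. a2 z \<noteq> 0 \<longrightarrow> (\<exists>c\<in>k. dist c z < \<delta>)" using near by (auto simp: a2_def indicator_def split: if_splits)
        then show ?thesis using insert.IH insert.prems k1 by auto
      qed
      finally show "norm (\<Delta> a) \<le> K' * \<delta> * l1_norm a" by (simp add: l12 algebra_simps)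
    qed
  qed
  have small: "norm (\<Delta> a) \<le> K' * \<delta> * l1_norm a" if \<delta>: "0 < \<delta>" for \<delta>
  proof -
    have "seq_compact (cball (0::real^'n) R)" by (simp add: compact_eq_seq_compact_metric[symmetric])
    from seq_compact_imp_totally_bounded[OF this, rule_format, OF \<delta>]
    obtain k where k: "finite k" "k \<subseteq> cball (0::real^'n) R" "cball (0::real^'n) R \<subseteq> (\<Union>x\<in>k. ball x \<delta>)"
      by metis
    have "\<forall>z. a z \<noteq> 0 \<longrightarrow> (\<exists>c\<in>k. dist c z < \<delta>)"
    proof (intro allI impI)
      fix z assume "a z \<noteq> 0"
      then have "z \<in> cball 0 R" using a by (auto simp: kernel_def supp_le_def)
      then obtain c where "c \<in> k" "z \<in> ball c \<delta>" using k(3) by (meson UN_E subsetD)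
      then show "\<exists>c\<in>k. dist c z < \<delta>" by (metis mem_ball)
    qed
    then show ?thesis using cover[OF k(1,2) \<delta>, rule_format, OF a] by metis
  qed
  have lim: "((\<lambda>\<delta>. K' * \<delta> * l1_norm a) \<longlongrightarrow> K' * 0 * l1_norm a) (at_right 0)" by (intro tendsto_intros)
  have "\<forall>\<^sub>F \<delta> in at_right 0. norm (\<Delta> a) \<le> K' * \<delta> * l1_norm a"
    using small by (auto simp: eventually_at_filter)
  from tendsto_lowerbound[OF lim this] have "norm (\<Delta> a) \<le> 0" by simp
  then show ?thesis by (simp add: \<Delta>_def)
qed

section \<open>The reproducing formula\<close>

text \<open>In the convolution algebra, \<open>residual u\<close> is multiplication by \<open>1 - u\<^sup>2\<close>, and \<open>residual_quotient u v m\<close> is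
  multiplication by \<open>((1 - v\<^sup>2)\<^sup>m - (1 - u\<^sup>2)\<^sup>m) / (u\<^sup>2 - v\<^sup>2)\<close>.\<close>

definition residual :: "(real^'n::finite \<Rightarrow> complex) \<Rightarrow> (real^'n \<Rightarrow> complex) \<Rightarrow> real^'n \<Rightarrow> complex" where
  "residual u g = (\<lambda>x. g x - convolve u (convolve u g) x)"

primrec residual_quotient :: "(real^'n::finite \<Rightarrow> complex) \<Rightarrow> (real^'n \<Rightarrow> complex) \<Rightarrow> nat \<Rightarrow> (real^'n \<Rightarrow> complex) \<Rightarrow> real^'n \<Rightarrow> complex" where
  "residual_quotient u v 0 g = (\<lambda>x. 0)"
| "residual_quotient u v (Suc m) g = (\<lambda>x. residual u (residual_quotient u v m g) x + (residual v ^^ m) g x)"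

section \<open>Residuals as multiplication operators of a commutative algebra\<close>

lemma test_kernel: assumes "u \<in> test_functions" obtains R where "kernel R u"
  using assms kernel_test test_supp by metis

lemma test_convolve': "u \<in> test_functions \<Longrightarrow> g \<in> test_functions \<Longrightarrow> convolve u g \<in> test_functions"
  using test_kernel test_convolve by metis

lemma test_residual: "u \<in> test_functions \<Longrightarrow> g \<in> test_functions \<Longrightarrow> residual u g \<in> test_functions"
  unfolding residual_def by (intro test_diff test_convolve')

lemma test_residual_pow: "u \<in> test_functions \<Longrightarrow> g \<in> test_functions \<Longrightarrow> (residual u ^^ m) g \<in> test_functions"
  by (induction m) (auto intro: test_residual)

lemma test_residual_quotient:
  "u \<in> test_functions \<Longrightarrow> v \<in> test_functions \<Longrightarrow> g \<in> test_functions \<Longrightarrow> residual_quotient u v m g \<in> test_functions"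
  by (induction m) (auto intro: test_zero test_add test_residual test_residual_pow)

lemma convolve_diff:
  assumes "u \<in> test_functions" "g \<in> test_functions" "h \<in> test_functions"
  shows "convolve u (\<lambda>x. g x - h x) = (\<lambda>x. convolve u g x - convolve u h x)"
proof -
  obtain R where "kernel R u" using test_kernel[OF assms(1)] .
  then show ?thesis by (rule convolve_diff_right) (intro test_continuous assms)+
qed

lemma convolve_add:
  assumes "u \<in> test_functions" "g \<in> test_functions" "h \<in> test_functions"
  shows "convolve u (\<lambda>x. g x + h x) = (\<lambda>x. convolve u g x + convolve u h x)"
proof -
  obtain R where "kernel R u" using test_kernel[OF assms(1)] .
  then show ?thesis by (rule convolve_add_right) (intro test_continuous assms)+
qed

lemma convolve_diff':
  assumes "u \<in> test_functions" "v \<in> test_functions" "g \<in> test_functions"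
  shows "convolve (\<lambda>x. u x - v x) g = (\<lambda>x. convolve u g x - convolve v g x)"
proof -
  obtain R R' where "kernel R u" "kernel R' v" using test_kernel assms(1,2) by metis
  then show ?thesis by (rule convolve_diff_left) (intro test_continuous assms)
qed

lemma convolve_add':
  assumes "u \<in> test_functions" "v \<in> test_functions" "g \<in> test_functions"
  shows "convolve (\<lambda>x. u x + v x) g = (\<lambda>x. convolve u g x + convolve v g x)"
proof -
  obtain R R' where "kernel R u" "kernel R' v" using test_kernel assms(1,2) by metis
  then show ?thesis by (rule convolve_add_left) (intro test_continuous assms)
qed

lemma convolve_lcomm:
  assumes "u \<in> test_functions" "v \<in> test_functions" "g \<in> test_functions"
  shows "convolve u (convolve v g) = convolve v (convolve u g)"
proof -
  obtain R R' R'' where "kernel R u" "kernel R' v" "supp_le R'' g" using test_kernel test_supp assms by metis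
  then show ?thesis by (intro convolve_left_commute[of R _ R' _ _ R''] test_continuous assms)
qed

lemma convolve_comm: "u \<in> test_functions \<Longrightarrow> v \<in> test_functions \<Longrightarrow> convolve u v = convolve v u"
  by (intro convolve_commute test_continuous)

lemma convolve_residual:
  assumes "a \<in> test_functions" "u \<in> test_functions" "g \<in> test_functions"
  shows "convolve a (residual u g) = residual u (convolve a g)"
  unfolding residual_def using assms by (simp add: convolve_diff test_convolve' convolve_lcomm[of a u])

lemma convolve_residual_pow:
  assumes "a \<in> test_functions" "u \<in> test_functions" "g \<in> test_functions"
  shows "convolve a ((residual u ^^ m) g) = (residual u ^^ m) (convolve a g)"
  by (induction m) (simp_all add: convolve_residual test_residual_pow assms)

lemma convolve_residual_quotient:
  assumes "a \<in> test_functions" "u \<in> test_functions" "v \<in> test_functions" "g \<in> test_functions"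
  shows "convolve a (residual_quotient u v m g) = residual_quotient u v m (convolve a g)"
proof (induction m)
  case 0
  show ?case by (auto simp: convolve_def)
next
  case (Suc m)
  show ?case
    by (simp add: convolve_add test_residual test_residual_pow test_residual_quotient assms convolve_residual convolve_residual_pow Suc.IH)
qed

lemma residual_diff: "u \<in> test_functions \<Longrightarrow> g \<in> test_functions \<Longrightarrow> h \<in> test_functions \<Longrightarrow>
    residual u (\<lambda>x. g x - h x) = (\<lambda>x. residual u g x - residual u h x)"
  unfolding residual_def by (simp add: convolve_diff test_convolve' algebra_simps)

lemma residual_quotient_telescope:
  assumes u: "u \<in> test_functions" and v: "v \<in> test_functions" and g: "g \<in> test_functions"
  shows "(\<lambda>x. convolve u (convolve u (residual_quotient u v m g)) x - convolve v (convolve v (residual_quotient u v m g)) x) = (\<lambda>x. (residual v ^^ m) g x - (residual u ^^ m) g x)"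
proof (induction m)
  case 0
  show ?case by (simp add: convolve_def)
next
  case (Suc m)
  let ?W = "residual_quotient u v m g" and ?h = "(residual v ^^ m) g" and ?k = "(residual u ^^ m) g"
  have tW: "?W \<in> test_functions" and th: "?h \<in> test_functions" and tk: "?k \<in> test_functions"
    using assms by (auto intro: test_residual_quotient test_residual_pow)
  have 1: "(\<lambda>x. convolve u (convolve u (residual u ?W)) x - convolve v (convolve v (residual u ?W)) x) = (\<lambda>x. residual u ?h x - residual u ?k x)"
  proof -
    have "(\<lambda>x. convolve u (convolve u (residual u ?W)) x - convolve v (convolve v (residual u ?W)) x)
      = residual u (\<lambda>x. convolve u (convolve u ?W) x - convolve v (convolve v ?W) x)"
      by (simp add: convolve_residual residual_diff u v tW test_convolve')
    also have "\<dots> = (\<lambda>x. residual u ?h x - residual u ?k x)"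
      unfolding Suc.IH by (rule residual_diff[OF u th tk])
    finally show ?thesis .
  qed
  have "convolve u (convolve u (residual_quotient u v (Suc m) g)) x - convolve v (convolve v (residual_quotient u v (Suc m) g)) x = (residual v ^^ Suc m) g x - (residual u ^^ Suc m) g x" for x
  proof -
    have "convolve u (convolve u (residual_quotient u v (Suc m) g)) x - convolve v (convolve v (residual_quotient u v (Suc m) g)) x
      = (convolve u (convolve u (residual u ?W)) x - convolve v (convolve v (residual u ?W)) x) + (convolve u (convolve u ?h) x - convolve v (convolve v ?h) x)"
      by (simp add: convolve_add u v tW th test_residual test_convolve')
    also have "\<dots> = (residual u ?h x - residual u ?k x) + (residual v ?h x - residual u ?h x)"
      using fun_cong[OF 1, of x] by (simp add: residual_def)
    finally show ?thesis by simp
  qed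
  then show ?case by blast
qed

text \<open>Moving the factor \<open>u + v\<close> through the quotient onto \<open>g\<close> leaves
  the single factor \<open>u - v\<close> outside; the mixed products cancel because the convolutions
  commute.\<close>

lemma reproducing_step:
  assumes u: "u \<in> test_functions" and v: "v \<in> test_functions" and g: "g \<in> test_functions"
  shows "convolve (\<lambda>x. u x - v x) (residual_quotient u v m (convolve (\<lambda>x. u x + v x) g)) = (\<lambda>x. (residual v ^^ m) g x - (residual u ^^ m) g x)"
proof -
  let ?W = "residual_quotient u v m g"
  have tW: "?W \<in> test_functions" using assms by (auto intro: test_residual_quotient)
  have w: "(\<lambda>x. u x + v x) \<in> test_functions" using u v by (rule test_add)
  have "residual_quotient u v m (convolve (\<lambda>x. u x + v x) g) = (\<lambda>x. convolve u ?W x + convolve v ?W x)"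
    by (simp add: convolve_residual_quotient[OF w u v g, symmetric] convolve_add' u v tW)
  then have "convolve (\<lambda>x. u x - v x) (residual_quotient u v m (convolve (\<lambda>x. u x + v x) g))
     = (\<lambda>x. convolve u (convolve u ?W) x + convolve u (convolve v ?W) x - (convolve v (convolve u ?W) x + convolve v (convolve v ?W) x))"
    by (simp add: convolve_diff' u v tW test_add test_convolve' convolve_add)
  also have "\<dots> = (\<lambda>x. convolve u (convolve u ?W) x - convolve v (convolve v ?W) x)"
    by (simp add: convolve_lcomm[OF u v tW])
  also have "\<dots> = (\<lambda>x. (residual v ^^ m) g x - (residual u ^^ m) g x)" by (rule residual_quotient_telescope[OF assms])
  finally show ?thesis .
qed

lemma residual_zero: "residual (\<lambda>x. 0) g = g"
  by (simp add: residual_def convolve_def)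

lemma residual_pow_zero: "(residual (\<lambda>x. 0) ^^ m) g = g"
  by (induction m) (auto simp: residual_zero)

text \<open>\<open>d\<close> derivatives are spent for the factor \<open>c\<close>. The trivial
  bound has \<open>d = 0\<close>; with \<open>d = 1\<close> the factor is proportional to the
  support radius of \<open>u\<close>. With one notion for both regimes, the inductions over powers
  and quotients are done once.\<close>

definition residual_gain :: "real \<Rightarrow> nat \<Rightarrow> (real^'n::finite \<Rightarrow> complex) \<Rightarrow> bool" where
  "residual_gain c d u \<longleftrightarrow> (\<forall>m B g. g \<in> test_functions \<longrightarrow> deriv_bound (m + d) B g \<longrightarrow> deriv_bound m (c * B) (residual u g))"

lemma deriv_bound_add:
  assumes "f \<in> test_functions" "g \<in> test_functions" "deriv_bound m B f" "deriv_bound m B' g"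
  shows "deriv_bound m (B + B') (\<lambda>x. f x + g x)"
  using assms(3,4) unfolding deriv_bound_def iter_deriv_add[OF assms(1,2)]
  by (auto intro!: order_trans[OF norm_triangle_ineq] add_mono)

lemma deriv_bound_diff:
  assumes "f \<in> test_functions" "g \<in> test_functions" "deriv_bound m B f" "deriv_bound m B' g"
  shows "deriv_bound m (B + B') (\<lambda>x. f x - g x)"
  using assms(3,4) unfolding deriv_bound_def iter_deriv_diff[OF assms(1,2)]
  by (auto intro!: order_trans[OF norm_triangle_ineq4] add_mono)

lemma residual_gain_nogain:
  assumes u: "u \<in> test_functions" and A: "l1_norm u \<le> A"
  shows "residual_gain (1 + A * A) 0 u"
  unfolding residual_gain_def
proof (intro allI impI)
  fix m B and g :: "real^'a \<Rightarrow> complex" assume g: "g \<in> test_functions" and d: "deriv_bound (m + 0) B g"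
  obtain R where k: "kernel R u" using test_kernel[OF u] .
  have "deriv_bound m (A * (A * B)) (convolve u (convolve u g))"
    using d by (intro deriv_bound_convolve[OF k _ _ A] test_convolve' u g) simp
  then have "deriv_bound m (B + A * (A * B)) (residual u g)" unfolding residual_def
    using d by (intro deriv_bound_diff g test_convolve' u) simp_all
  then show "deriv_bound m ((1 + A * A) * B) (residual u g)" by (simp add: algebra_simps)
qed

text \<open>Factor \<open>1 - u\<^sup>2 = (1 + u) (1 - u)\<close>. As \<open>u\<close> has integral
  1, \<open>1 - u\<close> averages increments of \<open>g\<close> over distances at most
  \<open>\<rho>\<close>, at the cost of one derivative; \<open>1 + u\<close> contributes the factor
  \<open>1 + A\<close>.\<close>

lemma residual_gain_gain:
  fixes u :: "real^'n::finite \<Rightarrow> complex"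
  assumes u: "u \<in> test_functions" and A: "l1_norm u \<le> A" and s: "supp_le \<rho> u" and \<rho>: "0 \<le> \<rho>" and i: "(LINT x|lborel. u x) = 1"
  shows "residual_gain ((1 + A) * (A * (real CARD('n) * \<rho>))) 1 u"
  unfolding residual_gain_def
proof (intro allI impI)
  fix m B and g :: "real^'n \<Rightarrow> complex" assume g: "g \<in> test_functions" and d: "deriv_bound (m + 1) B g"
  have k: "kernel \<rho> u" by (rule kernel_test[OF u s])
  have B: "0 \<le> B" using d deriv_bound_ge0 by blast
  let ?D = "\<lambda>x. g x - convolve u g x"
  let ?E = "A * (real CARD('n) * B * \<rho>)"
  have tD: "?D \<in> test_functions" by (intro test_diff test_convolve' u g)
  have D: "deriv_bound m ?E ?D"
    unfolding deriv_bound_def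
  proof (intro allI impI)
    fix "is" :: "'n list" and x assume len: "length is = m"
    let ?h = "iter_deriv is g"
    have "norm (convolve u ?h x - (LINT z|lborel. u z) * ?h (x - 0)) \<le> l1_norm u * (real CARD('n) * B * \<rho>)"
    proof (rule convolve_local[OF k test_continuous[OF test_iter_deriv[OF g]]])
      fix z assume "u z \<noteq> 0"
      then have z: "norm z \<le> \<rho>" using s by (auto simp: supp_le_def)
      have "norm (?h (x - z) - ?h (x - 0)) \<le> real CARD('n) * B * norm (x - z - (x - 0))"
        by (rule deriv_bound_lipschitz_iter_deriv[OF g _ len]) (use d in simp)
      also have "\<dots> \<le> real CARD('n) * B * \<rho>" using z B by (intro mult_left_mono) auto
      finally show "norm (?h (x - z) - ?h (x - 0)) \<le> real CARD('n) * B * \<rho>" .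
    qed (use B \<rho> in auto)
    also have "\<dots> \<le> ?E" using A B \<rho> by (intro mult_right_mono) auto
    finally show "norm (iter_deriv is ?D x) \<le> ?E"
      by (simp add: iter_deriv_diff[OF g test_convolve'[OF u g]] iter_deriv_convolve[OF k g] i norm_minus_commute)
  qed
  have "deriv_bound m (?E + A * ?E) (\<lambda>x. ?D x + convolve u ?D x)"
    by (intro deriv_bound_add tD test_convolve' u D deriv_bound_convolve[OF k tD D A])
  moreover have "(\<lambda>x. ?D x + convolve u ?D x) = residual u g"
    by (simp add: residual_def convolve_diff[OF u g test_convolve'[OF u g]])
  ultimately have "deriv_bound m (?E + A * ?E) (residual u g)" by simp
  moreover have "?E + A * ?E = (1 + A) * (A * (real CARD('n) * \<rho>)) * B" by (simp add: algebra_simps)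
  ultimately show "deriv_bound m ((1 + A) * (A * (real CARD('n) * \<rho>)) * B) (residual u g)" by simp
qed

lemma deriv_bound_residual_pow:
  assumes "residual_gain c d u" "u \<in> test_functions" "g \<in> test_functions" "deriv_bound (m + d * i) B g"
  shows "deriv_bound m (c ^ i * B) ((residual u ^^ i) g)"
  using assms(4)
proof (induction i arbitrary: m)
  case (Suc i)
  have "deriv_bound (m + d) (c ^ i * B) ((residual u ^^ i) g)"
    by (rule Suc.IH) (use Suc.prems in \<open>simp add: algebra_simps\<close>)
  then have "deriv_bound m (c * (c ^ i * B)) (residual u ((residual u ^^ i) g))"
    using assms(1) test_residual_pow[OF assms(2,3)] unfolding residual_gain_def by blast
  then show ?case by (simp add: mult.assoc)
qed simp

text \<open>The quotient with index \<open>Suc i\<close> is a sum of \<open>Suc i\<close> products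
  of \<open>i\<close> residual operators each, which explains the factor \<open>Suc i\<close> as
  well as the powers \<open>c ^ i\<close> and \<open>d * i\<close>.\<close>

lemma deriv_bound_residual_quotient:
  assumes su: "residual_gain c d u" and sv: "residual_gain c d v" and u: "u \<in> test_functions" and v: "v \<in> test_functions"
    and g: "g \<in> test_functions" and "deriv_bound (m + d * i) B g"
  shows "deriv_bound m (real (Suc i) * c ^ i * B) (residual_quotient u v (Suc i) g)"
  using assms(6)
proof (induction i arbitrary: m)
  case 0
  have "residual_quotient u v (Suc 0) g = g" by (auto simp: residual_def convolve_def)
  then show ?case using 0 by simp
next
  case (Suc i)
  have "deriv_bound (m + d) (real (Suc i) * c ^ i * B) (residual_quotient u v (Suc i) g)"
    by (rule Suc.IH) (use Suc.prems in \<open>simp add: algebra_simps\<close>)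
  then have 1: "deriv_bound m (c * (real (Suc i) * c ^ i * B)) (residual u (residual_quotient u v (Suc i) g))"
    using su test_residual_quotient[OF u v g] unfolding residual_gain_def by blast
  have 2: "deriv_bound m (c ^ Suc i * B) ((residual v ^^ Suc i) g)"
    by (rule deriv_bound_residual_pow[OF sv v g Suc.prems])
  have "deriv_bound m (c * (real (Suc i) * c ^ i * B) + c ^ Suc i * B) (residual_quotient u v (Suc (Suc i)) g)"
    unfolding residual_quotient.simps(2)[of u v "Suc i"]
    by (rule deriv_bound_add[OF test_residual[OF u test_residual_quotient[OF u v g]] test_residual_pow[OF v g] 1 2])
  moreover have "c * (real (Suc i) * c ^ i * B) + c ^ Suc i * B = real (Suc (Suc i)) * c ^ Suc i * B"
    by (simp add: algebra_simps)
  ultimately show ?case by metis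
qed

section \<open>Supports of residuals\<close>

lemma supp_le_add: "supp_le R f \<Longrightarrow> supp_le R g \<Longrightarrow> supp_le R (\<lambda>x. f x + g x)"
  unfolding supp_le_def by (metis add_0)

lemma supp_le_diff: "supp_le R f \<Longrightarrow> supp_le R g \<Longrightarrow> supp_le R (\<lambda>x. f x - g x)"
  unfolding supp_le_def by (metis diff_self)

lemma supp_le_residual:
  assumes "supp_le \<rho> u" "supp_le R g" "0 \<le> \<rho>" shows "supp_le (R + 2 * \<rho>) (residual u g)"
  unfolding residual_def
proof (rule supp_le_diff)
  show "supp_le (R + 2 * \<rho>) g" using assms by (auto intro: supp_le_mono)
  have "supp_le (\<rho> + (\<rho> + R)) (convolve u (convolve u g))" using assms by (intro supp_le_convolve)
  then show "supp_le (R + 2 * \<rho>) (convolve u (convolve u g))" by (rule supp_le_mono) simp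
qed

lemma supp_le_residual_pow:
  assumes "supp_le \<rho> u" "supp_le R g" "0 \<le> \<rho>" shows "supp_le (R + 2 * \<rho> * i) ((residual u ^^ i) g)"
proof (induction i)
  case (Suc i)
  have "supp_le (R + 2 * \<rho> * i + 2 * \<rho>) (residual u ((residual u ^^ i) g))" by (rule supp_le_residual[OF assms(1) Suc assms(3)])
  then show ?case by (simp add: algebra_simps)
qed (use assms in simp)

lemma supp_le_residual_quotient:
  assumes "supp_le \<rho> u" "supp_le \<rho> v" "supp_le R g" "0 \<le> \<rho>" "0 \<le> R"
  shows "supp_le (R + 2 * \<rho> * i) (residual_quotient u v i g)"
proof (induction i)
  case 0
  show ?case using assms by (simp add: supp_le_def)
next
  case (Suc i)
  have "supp_le (R + 2 * \<rho> * i + 2 * \<rho>) (residual u (residual_quotient u v i g))" by (rule supp_le_residual[OF assms(1) Suc assms(4)])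
  moreover have "supp_le (R + 2 * \<rho> * i + 2 * \<rho>) ((residual v ^^ i) g)"
    by (rule supp_le_mono[OF supp_le_residual_pow[OF assms(2,3,4)]]) (use assms in simp)
  ultimately show ?case by (simp add: algebra_simps supp_le_add)
qed

section \<open>Vanishing moments\<close>

primrec list_monomial :: "'n list \<Rightarrow> real^'n::finite \<Rightarrow> real" where
  "list_monomial [] z = 1"
| "list_monomial (i # is) z = z $ i * list_monomial is z"

lemma continuous_list_monomial: "continuous_on S (list_monomial is)"
  by (induction "is") (auto intro!: continuous_intros)

lemma list_monomial_scaleR: "list_monomial is (s *\<^sub>R z) = s ^ length is * list_monomial is z"
  by (induction "is") auto

lemma lists_Suc:
  "{is :: 'n::finite list. length is = Suc m} = (\<lambda>(i, is). i # is) ` (UNIV \<times> {is. length is = m})"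
  by (auto simp: length_Suc_conv image_iff)

text \<open>Taylor's formula without the explicit coefficients, which the vanishing moments make irrelevant.\<close>

lemma taylor_exists:
  fixes g :: "real^'n::finite \<Rightarrow> complex"
  assumes "g \<in> test_functions" "deriv_bound L B g"
  shows "\<exists>c. \<forall>z. norm (g (x - z) - (\<Sum>m<L. \<Sum>is | length is = m. c is * of_real (list_monomial is z))) \<le> (real CARD('n) * norm z) ^ L * B"
  using assms
proof (induction L arbitrary: g)
  case 0
  then show ?case by (auto simp: deriv_bound_0)
next
  case (Suc L)
  let ?Q = "\<lambda>i c. \<forall>z. norm (partial_deriv i g (x - z) - (\<Sum>m<L. \<Sum>is | length is = m. c is * of_real (list_monomial is z))) \<le> (real CARD('n) * norm z) ^ L * B"
  have "\<forall>i. \<exists>c. ?Q i c"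
  proof
    fix i
    have "deriv_bound L B (partial_deriv i g)"
      using deriv_bound_iter_deriv[of L 1 B g "[i]"] Suc.prems(2) by simp
    then show "\<exists>c. ?Q i c" by (rule Suc.IH[OF test_partial_deriv[OF Suc.prems(1)]])
  qed
  from choice[OF this] obtain c where "\<forall>i. ?Q i (c i)" ..
  note c = this[rule_format]
  have B: "0 \<le> B" using deriv_bound_ge0[OF Suc.prems(2)] .
  \<comment> \<open>Integrating the expansions of the partial derivatives along the segment from
    \<open>x\<close> to \<open>x - z\<close> divides the terms of degree \<open>m\<close> by
    \<open>m + 1\<close>; the minus sign is that of \<open>x - z\<close>.\<close>
  define c' where "c' is = (case is of [] \<Rightarrow> g x | i # js \<Rightarrow> - c i js / of_nat (Suc (length js)))" for "is"
  have "norm (g (x - z) - (\<Sum>m<Suc L. \<Sum>is | length is = m. c' is * of_real (list_monomial is z))) \<le> (real CARD('n) * norm z) ^ Suc L * B" for z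
  proof -
    define T where "T i s = (\<Sum>m<L. \<Sum>is | length is = m. c i is * of_real (list_monomial is (s *\<^sub>R z)))" for i s
    \<comment> \<open>This is minus the nonconstant part of the new polynomial at
      \<open>s *\<^sub>R z\<close>. Hence the derivative of \<open>H\<close> contains only the
      remainders of the partial derivatives, and the mean value bound on \<open>[0, 1]\<close> gives
      the claim.\<close>
    define P where "P s = (\<Sum>i\<in>UNIV. \<Sum>m<L. \<Sum>is | length is = m. (of_real (z $ i) * c i is * of_real (list_monomial is z) / of_nat (Suc m)) * of_real (s ^ Suc m))" for s :: real
    define H where "H s = g (x - s *\<^sub>R z) + P s" for s
    have dP: "(P has_vector_derivative (\<Sum>i\<in>UNIV. z $ i *\<^sub>R T i s)) (at s)" for s
    proof -
      have "((\<lambda>s. (of_real (z $ i) * c i is * of_real (list_monomial is z) / of_nat (Suc m)) * of_real (s ^ Suc m)) has_vector_derivative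
           of_real (z $ i) * c i is * of_real (list_monomial is z) * of_real (s ^ m)) (at s)" for i "is" m
      proof -
        have "((\<lambda>s. complex_of_real (s ^ Suc m)) has_vector_derivative of_real (real (Suc m) * s ^ m)) (at s)"
          using DERIV_pow[of "Suc m" s] by (intro has_vector_derivative_of_real) (simp add: has_real_derivative_iff_has_vector_derivative[symmetric] del: power_Suc of_nat_Suc)
        then have "((\<lambda>s. (of_real (z $ i) * c i is * of_real (list_monomial is z) / of_nat (Suc m)) * of_real (s ^ Suc m)) has_vector_derivative
           (of_real (z $ i) * c i is * of_real (list_monomial is z) / of_nat (Suc m)) * of_real (real (Suc m) * s ^ m)) (at s)"
          by (rule has_vector_derivative_mult_right)
        then show ?thesis by (simp add: field_simps del: of_nat_Suc power_Suc)
      qed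
      then have "(P has_vector_derivative (\<Sum>i\<in>UNIV. \<Sum>m<L. \<Sum>is | length is = m. of_real (z $ i) * c i is * of_real (list_monomial is z) * of_real (s ^ m))) (at s)"
        unfolding P_def[abs_def] by (intro has_vector_derivative_sum)
      moreover have "(\<Sum>m<L. \<Sum>is | length is = m. of_real (z $ i) * c i is * of_real (list_monomial is z) * of_real (s ^ m)) = z $ i *\<^sub>R T i s" for i
        unfolding T_def by (auto simp: scaleR_conv_of_real[where 'a=complex] sum_distrib_left list_monomial_scaleR mult_ac intro!: sum.cong)
      ultimately show ?thesis by simp
    qed
    have dg: "((\<lambda>s. g (x - s *\<^sub>R z)) has_vector_derivative (\<Sum>i\<in>UNIV. - (z $ i) *\<^sub>R partial_deriv i g (x - s *\<^sub>R z))) (at s)" for s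
    proof -
      have "((\<lambda>s. x - s *\<^sub>R z) has_derivative (\<lambda>h. - (h *\<^sub>R z))) (at s)"
        by (auto intro!: derivative_eq_intros)
      from has_derivative_compose[OF this has_derivative_test[OF Suc.prems(1)]]
      show ?thesis unfolding has_vector_derivative_def
        by (simp add: scaleR_sum_right)
    qed
    have dH: "(H has_vector_derivative (\<Sum>i\<in>UNIV. z $ i *\<^sub>R (T i s - partial_deriv i g (x - s *\<^sub>R z)))) (at s)" for s
      using has_vector_derivative_add[OF dg[of s] dP[of s]] unfolding H_def[abs_def]
      by (simp add: sum.distrib[symmetric] scaleR_diff_right)
    have "norm (H 1 - H 0) \<le> (real CARD('n) * norm z) ^ Suc L * B * norm (1 - 0 :: real)"
    proof (rule differentiable_bound[where S="{0..1::real}" and f'="\<lambda>s h. h *\<^sub>R (\<Sum>i\<in>UNIV. z $ i *\<^sub>R (T i s - partial_deriv i g (x - s *\<^sub>R z)))"])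
      show "(H has_derivative (\<lambda>h. h *\<^sub>R (\<Sum>i\<in>UNIV. z $ i *\<^sub>R (T i s - partial_deriv i g (x - s *\<^sub>R z))))) (at s within {0..1})" for s
        using dH[of s] unfolding has_vector_derivative_def by (rule has_derivative_at_withinI)
      fix s :: real assume s: "s \<in> {0..1}"
      show "onorm (\<lambda>h. h *\<^sub>R (\<Sum>i\<in>UNIV. z $ i *\<^sub>R (T i s - partial_deriv i g (x - s *\<^sub>R z)))) \<le> (real CARD('n) * norm z) ^ Suc L * B"
      proof (rule onorm_bound)
        fix h :: real
        have "norm (\<Sum>i\<in>UNIV. z $ i *\<^sub>R (T i s - partial_deriv i g (x - s *\<^sub>R z))) \<le> (\<Sum>i::'n\<in>UNIV. norm z * ((real CARD('n) * norm z) ^ L * B))"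
        proof (rule sum_norm_le)
          fix i :: 'n assume "i \<in> UNIV"
          have "norm (T i s - partial_deriv i g (x - s *\<^sub>R z)) \<le> (real CARD('n) * norm (s *\<^sub>R z)) ^ L * B"
            using c[where i=i and z="s *\<^sub>R z"] unfolding T_def by (simp add: norm_minus_commute)
          also have "\<dots> \<le> (real CARD('n) * norm z) ^ L * B"
            using s B by (intro mult_right_mono power_mono mult_left_mono) (auto simp: mult_left_le_one_le)
          finally show "norm (z $ i *\<^sub>R (T i s - partial_deriv i g (x - s *\<^sub>R z))) \<le> norm z * ((real CARD('n) * norm z) ^ L * B)"
            by (simp add: component_le_norm_cart mult_mono)
        qed
        from mult_left_mono[OF this, of "\<bar>h\<bar>"] show "norm (h *\<^sub>R (\<Sum>i\<in>UNIV. z $ i *\<^sub>R (T i s - partial_deriv i g (x - s *\<^sub>R z)))) \<le> (real CARD('n) * norm z) ^ Suc L * B * norm h"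
          by (simp add: mult_ac)
      qed (use B in simp)
    qed auto
    moreover have "H 1 - H 0 = g (x - z) - (\<Sum>m<Suc L. \<Sum>is | length is = m. c' is * of_real (list_monomial is z))"
    proof -
      have "(\<Sum>m<Suc L. \<Sum>is | length is = m. c' is * of_real (list_monomial is z))
         = g x + (\<Sum>m<L. \<Sum>is | length is = Suc m. c' is * of_real (list_monomial is z))"
        by (subst sum.lessThan_Suc_shift) (simp add: c'_def)
      also have "(\<Sum>m<L. \<Sum>is | length is = Suc m. c' is * of_real (list_monomial is z)) = - P 1"
      proof -
        have "(\<Sum>is | length is = Suc m. c' is * of_real (list_monomial is z))
          = (\<Sum>i\<in>UNIV. \<Sum>is | length is = m. - (of_real (z $ i) * c i is * of_real (list_monomial is z) / of_nat (Suc m)))" for m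
        proof -
          have "(\<Sum>is | length is = Suc m. c' is * of_real (list_monomial is z))
             = (\<Sum>p\<in>UNIV \<times> {is. length is = m}. c' (fst p # snd p) * of_real (list_monomial (fst p # snd p) z))"
            unfolding lists_Suc by (subst sum.reindex) (auto simp: inj_on_def case_prod_beta)
          also have "\<dots> = (\<Sum>i\<in>UNIV. \<Sum>is | length is = m. c' (i # is) * of_real (list_monomial (i # is) z))"
            by (simp add: sum.cartesian_product case_prod_beta)
          also have "\<dots> = (\<Sum>i\<in>UNIV. \<Sum>is | length is = m. - (of_real (z $ i) * c i is * of_real (list_monomial is z) / of_nat (Suc m)))"
            by (intro sum.cong refl) (auto simp: c'_def mult_ac)
          finally show ?thesis .
        qed
        then show ?thesis unfolding P_def by (subst sum.swap) (simp add: sum_negf)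
      qed
      moreover have "P 0 = 0" by (simp add: P_def)
      ultimately show ?thesis by (simp add: H_def)
    qed
    ultimately show ?thesis by simp
  qed
  then show ?case by blast
qed

text \<open>Subtracting from \<open>g (x - z)\<close> its Taylor polynomial in \<open>z\<close> of
  degree below \<open>L\<close> does not change the integral; on the support of \<open>a\<close> the
  remainder is of order \<open>\<rho> ^ L\<close>.\<close>

lemma convolve_moments:
  fixes g :: "real^'n::finite \<Rightarrow> complex"
  assumes a: "a \<in> test_functions" "supp_le \<rho> a" "0 \<le> \<rho>" and g: "g \<in> test_functions" "deriv_bound L B g"
    and mom: "\<And>is. length is < L \<Longrightarrow> (LINT z|lborel. of_real (list_monomial is z) * a z) = 0"
  shows "norm (convolve a g x) \<le> l1_norm a * ((real CARD('n) * \<rho>) ^ L * B)"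
proof -
  from taylor_exists[OF g, of x] obtain c where "\<forall>z. norm (g (x - z) - (\<Sum>m<L. \<Sum>is | length is = m. c is * of_real (list_monomial is z))) \<le> (real CARD('n) * norm z) ^ L * B" ..
  note c = this[rule_format]
  let ?p = "\<lambda>z. \<Sum>m<L. \<Sum>is | length is = m. c is * of_real (list_monomial is z)"
  have k: "kernel \<rho> a" by (rule kernel_test[OF a(1,2)])
  have B: "0 \<le> B" using deriv_bound_ge0[OF g(2)] .
  have i1: "integrable lborel (\<lambda>z. of_real (list_monomial is z) * a z)" for "is"
  proof -
    have "continuous_on UNIV (\<lambda>z. complex_of_real (list_monomial is z) * a z)"
      by (intro continuous_intros continuous_list_monomial test_continuous[OF a(1)])
    moreover have "supp_le \<rho> (\<lambda>z. of_real (list_monomial is z) * a z)" using a(2) by (auto simp: supp_le_def)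
    ultimately show ?thesis using kernel_continuous kernel_def by blast
  qed
  have "(LINT z|lborel. a z * ?p z) = (LINT z|lborel. (\<Sum>m<L. \<Sum>is | length is = m. c is * (of_real (list_monomial is z) * a z)))"
    by (simp add: sum_distrib_left mult_ac)
  also have "\<dots> = (\<Sum>m<L. \<Sum>is | length is = m. c is * (LINT z|lborel. of_real (list_monomial is z) * a z))"
    using i1 by (subst Bochner_Integration.integral_sum; (subst Bochner_Integration.integral_sum)?) auto
  also have "\<dots> = 0" using mom by (intro sum.neutral ballI) auto
  finally have z: "(LINT z|lborel. a z * ?p z) = 0" .
  have i2: "integrable lborel (\<lambda>z. a z * ?p z)"
  proof -
    have "integrable lborel (\<lambda>z. (\<Sum>m<L. \<Sum>is | length is = m. c is * (of_real (list_monomial is z) * a z)))"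
      using i1 by (intro Bochner_Integration.integrable_sum integrable_mult_right)
    then show ?thesis by (simp add: sum_distrib_left mult_ac)
  qed
  have "convolve a g x = (LINT z|lborel. a z * (g (x - z) - ?p z))"
    using convolve_integrable[OF k test_continuous[OF g(1)], of x] i2 z by (simp add: convolve_def right_diff_distrib)
  also have "norm \<dots> \<le> (LINT z|lborel. norm (a z * (g (x - z) - ?p z)))" by (rule integral_norm_bound)
  also have "\<dots> \<le> (LINT z|lborel. norm (a z) * ((real CARD('n) * \<rho>) ^ L * B))"
  proof (rule integral_mono')
    show "integrable lborel (\<lambda>z. norm (a z) * ((real CARD('n) * \<rho>) ^ L * B))" using k by (auto simp: kernel_def)
    show "0 \<le> norm (a z) * ((real CARD('n) * \<rho>) ^ L * B)" for z using a(3) B by simp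
    show "norm (a z * (g (x - z) - ?p z)) \<le> norm (a z) * ((real CARD('n) * \<rho>) ^ L * B)" for z
    proof (cases "a z = 0")
      case False
      then have "norm z \<le> \<rho>" using a(2) by (auto simp: supp_le_def)
      then have "(real CARD('n) * norm z) ^ L * B \<le> (real CARD('n) * \<rho>) ^ L * B"
        using B by (intro mult_right_mono power_mono mult_left_mono) auto
      then show ?thesis unfolding norm_mult using c[of z] by (intro mult_left_mono) auto
    qed simp
  qed
  finally show ?thesis by (simp add: l1_norm_def)
qed

section \<open>Local estimates\<close>

text \<open>The shift by one and the value 0 on level 0 make \<open>dyadic_family g l\<close> equal
  to \<open>dilate l g - lowpass g l\<close> on every level, level 0 included.\<close>

definition lowpass :: "(real^'n::finite \<Rightarrow> complex) \<Rightarrow> nat \<Rightarrow> real^'n \<Rightarrow> complex" where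
  "lowpass g l = (if l = 0 then (\<lambda>x. 0) else dilate (l - 1) g)"

lemma dilate_affine: "dilate l g = (\<lambda>x::real^'n::finite. of_real (2 ^ (l * CARD('n))) * g (2 ^ l *\<^sub>R x + 0))"
  by (auto simp: dilate_def scaleR_conv_of_real[where 'a=complex])

lemma dilate_0 [simp]: "dilate 0 g = g"
  by (auto simp: dilate_def)

lemma test_dilate: "g \<in> test_functions \<Longrightarrow> dilate l g \<in> test_functions"
  unfolding dilate_affine by (rule test_affine) auto

lemma dyadic_diff_affine:
  "dyadic_diff g = (\<lambda>x::real^'n::finite. g x - of_real (1 / 2 ^ CARD('n)) * g ((1/2) *\<^sub>R x + 0))"
  by (auto simp: dyadic_diff_def scaleR_conv_of_real[where 'a=complex])

lemma test_dyadic_diff: "g \<in> test_functions \<Longrightarrow> dyadic_diff g \<in> test_functions"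
  unfolding dyadic_diff_affine by (intro test_diff test_affine) auto

lemma test_dyadic_family: "g \<in> test_functions \<Longrightarrow> dyadic_family g l \<in> test_functions"
  by (auto simp: dyadic_family_def intro: test_dilate test_dyadic_diff)

lemma test_lowpass: "g \<in> test_functions \<Longrightarrow> lowpass g l \<in> test_functions"
  by (auto simp: lowpass_def intro: test_dilate test_zero)

lemma dyadic_family_eq:
  fixes g :: "real^'n::finite \<Rightarrow> complex"
  shows "dyadic_family g l = (\<lambda>x. dilate l g x - lowpass g l x)"
proof (cases l)
  case (Suc m)
  have "dilate (Suc m) (dyadic_diff g) x = dilate (Suc m) g x - dilate m g x" for x :: "real^'n"
    by (simp add: dilate_def dyadic_diff_def scaleR_diff_right power_add)
  then show ?thesis using Suc by (auto simp: dyadic_family_def lowpass_def)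
qed (auto simp: dyadic_family_def lowpass_def)

lemma borel_test: "g \<in> test_functions \<Longrightarrow> g \<in> borel_measurable borel"
  by (rule borel_measurable_continuous_onI) (rule test_continuous)

lemma integral_dilate:
  fixes g :: "real^'n::finite \<Rightarrow> complex"
  assumes "g \<in> test_functions"
  shows "(LINT x|lborel. dilate l g x) = (LINT x|lborel. g x)"
proof -
  have "(LINT x|lborel. g x) = \<bar>2 ^ l\<bar> ^ CARD('n) *\<^sub>R (LINT x|lborel. g (0 + 2 ^ l *\<^sub>R x))"
    by (rule lborel_integral_affine) (auto intro: borel_test assms)
  then show ?thesis by (simp add: dilate_def power_mult)
qed

lemma l1_norm_dilate:
  fixes g :: "real^'n::finite \<Rightarrow> complex"
  assumes "g \<in> test_functions"
  shows "l1_norm (dilate l g) = l1_norm g"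
proof -
  have "(LINT x|lborel. norm (g x)) = \<bar>2 ^ l\<bar> ^ CARD('n) *\<^sub>R (LINT x|lborel. norm (g (0 + 2 ^ l *\<^sub>R x)))"
    using borel_test[OF assms] by (intro lborel_integral_affine) auto
  then show ?thesis by (simp add: l1_norm_def dilate_def power_mult)
qed

text \<open>What is retained of the dilation structure: \<open>dilate\<close>,
  \<open>lowpass\<close> and \<open>dyadic_family\<close> satisfy these bounds with constants
  independent of the level, although only the first consists of dilates of one function.\<close>

definition level_bounds :: "real \<Rightarrow> real \<Rightarrow> (nat \<Rightarrow> real) \<Rightarrow> nat \<Rightarrow> (real^'n::finite \<Rightarrow> complex) \<Rightarrow> bool" where
  "level_bounds R A Bs l g \<longleftrightarrow> g \<in> test_functions \<and> supp_le (R / 2 ^ l) g \<and> l1_norm g \<le> A \<and>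
     (\<forall>m. deriv_bound m (2 ^ (l * (CARD('n) + m)) * Bs m) g)"

lemma level_bounds_mono:
  fixes g :: "real^'n::finite \<Rightarrow> complex"
  assumes "level_bounds R A Bs l g" "R \<le> R'" "A \<le> A'" "\<And>m. Bs m \<le> Bs' m"
  shows "level_bounds R' A' Bs' l g"
  unfolding level_bounds_def
proof (intro conjI allI)
  show "supp_le (R' / 2 ^ l) g" using assms(1,2) unfolding level_bounds_def by (meson supp_le_mono divide_right_mono zero_le_numeral zero_le_power)
  show "deriv_bound m (2 ^ (l * (CARD('n) + m)) * Bs' m) g" for m
    using assms(1) assms(4)[of m] unfolding level_bounds_def by (meson deriv_bound_mono mult_left_mono zero_le_numeral zero_le_power)
qed (use assms in \<open>auto simp: level_bounds_def\<close>)

lemma level_bounds_dilate: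
  fixes g :: "real^'n::finite \<Rightarrow> complex"
  assumes "g \<in> test_functions"
  shows "\<exists>R A Bs. 0 < R \<and> 0 \<le> A \<and> (\<forall>m. 0 \<le> Bs m) \<and> (\<forall>l. level_bounds R A Bs l (dilate l g))"
proof -
  obtain R where R: "0 < R" "supp_le R g" using test_supp[OF assms] .
  obtain Bs where Bs: "\<And>m. 0 \<le> Bs m" "\<And>m. deriv_bound m (Bs m) g" using test_deriv_bound[OF assms] by metis
  have "level_bounds R (l1_norm g) Bs l (dilate l g)" for l
    unfolding level_bounds_def
  proof (intro conjI allI)
    show "supp_le (R / 2 ^ l) (dilate l g)"
      unfolding supp_le_def
    proof (intro allI impI)
      fix x assume "dilate l g x \<noteq> 0"
      then have "norm ((2 ^ l :: real) *\<^sub>R x) \<le> R" using R(2) by (auto simp: dilate_def supp_le_def)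
      then show "norm x \<le> R / 2 ^ l" by (simp add: field_simps)
    qed
    show "deriv_bound m (2 ^ (l * (CARD('n) + m)) * Bs m) (dilate l g)" for m
      unfolding deriv_bound_def dilate_affine iter_deriv_affine[OF assms]
    proof (intro allI impI)
      fix "is" :: "'n list" and x assume "length is = m"
      then have "norm (iter_deriv is g (2 ^ l *\<^sub>R x + 0)) \<le> Bs m" using Bs(2)[of m] unfolding deriv_bound_def by blast
      then show "norm (of_real (2 ^ (l * CARD('n))) * of_real ((2 ^ l) ^ length is) * iter_deriv is g (2 ^ l *\<^sub>R x + 0)) \<le> 2 ^ (l * (CARD('n) + m)) * Bs m"
        using \<open>length is = m\<close>
        by (simp add: norm_mult norm_power power_mult power_add distrib_left mult_left_mono)
    qed
  qed (auto simp: test_dilate assms l1_norm_dilate)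
  then show ?thesis using R(1) Bs(1) l1_norm_nonneg by blast
qed

text \<open>Level 0 carries \<open>g\<close> and the other levels carry dilates of
  \<open>dyadic_diff g\<close>; adding the two sets of constants covers both.\<close>

lemma level_bounds_dyadic_family:
  fixes g :: "real^'n::finite \<Rightarrow> complex"
  assumes "g \<in> test_functions"
  shows "\<exists>R A Bs. 0 < R \<and> 0 \<le> A \<and> (\<forall>m. 0 \<le> Bs m) \<and> (\<forall>l. level_bounds R A Bs l (dyadic_family g l))"
proof -
  obtain R A Bs where 1: "0 < R" "0 \<le> A" "\<And>m. 0 \<le> Bs m" "\<And>l. level_bounds R A Bs l (dilate l g)"
    using level_bounds_dilate[OF assms] by metis
  obtain R' A' Bs' where 2: "0 < R'" "0 \<le> A'" "\<And>m. 0 \<le> Bs' m" "\<And>l. level_bounds R' A' Bs' l (dilate l (dyadic_diff g))"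
    using level_bounds_dilate[OF test_dyadic_diff[OF assms]] by metis
  have "level_bounds (R + R') (A + A') (\<lambda>m. Bs m + Bs' m) l (dyadic_family g l)" for l
  proof (cases "l = 0")
    case True
    then have "dyadic_family g l = dilate l g" by (simp add: dyadic_family_def)
    then show ?thesis using level_bounds_mono[OF 1(4)] 1 2 by (simp add: add_increasing2)
  next
    case False
    then have "dyadic_family g l = dilate l (dyadic_diff g)" by (simp add: dyadic_family_def)
    then show ?thesis using level_bounds_mono[OF 2(4)] 1 2 by (simp add: add_increasing)
  qed
  then show ?thesis using 1 2
    by (intro exI[of _ "R + R'"] exI[of _ "A + A'"] exI[of _ "\<lambda>m. Bs m + Bs' m"]) auto
qed

lemma l1_norm_zero: "l1_norm (\<lambda>x. 0) = 0"
  by (simp add: l1_norm_def)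

text \<open>A function of level \<open>l - 1\<close> is read as one of level \<open>l\<close>: its
  relative support radius doubles, while its derivatives obey the weaker bounds of level
  \<open>l\<close>.\<close>

lemma level_bounds_lowpass:
  fixes g :: "real^'n::finite \<Rightarrow> complex"
  assumes "0 < R" "0 \<le> A" "\<And>m. 0 \<le> Bs m" "\<And>l. level_bounds R A Bs l (dilate l g)"
  shows "level_bounds (2 * R) A Bs l (lowpass g l)"
proof (cases l)
  case 0
  have z: "iter_deriv is (\<lambda>x::real^'n. 0 :: complex) = (\<lambda>x. 0)" for "is"
    by (induction "is") (auto simp: partial_deriv_def)
  show ?thesis using 0 assms by (simp add: level_bounds_def lowpass_def l1_norm_zero test_zero supp_le_def deriv_bound_def z)
next
  case (Suc k)
  have *: "level_bounds R A Bs k (dilate k g)" by (rule assms)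
  have "deriv_bound m (2 ^ (Suc k * (CARD('n) + m)) * Bs m) (dilate k g)" for m
  proof -
    have "deriv_bound m (2 ^ (k * (CARD('n) + m)) * Bs m) (dilate k g)" using * by (auto simp: level_bounds_def)
    then show ?thesis by (rule deriv_bound_mono) (intro mult_right_mono power_increasing assms; simp)
  qed
  then show ?thesis using * Suc by (simp add: level_bounds_def lowpass_def)
qed

text \<open>For \<open>u = dilate l g\<close> and \<open>v = lowpass g l\<close> one has \<open>u - v = dyadic_family g l\<close>, so by
  \<open>u\<^sup>2 - v\<^sup>2 = (u - v)(u + v)\<close> convolving this kernel with \<open>dyadic_family g l\<close> gives the difference of
  the residuals of \<open>h\<close> at two consecutive levels.\<close>

definition rep_kernel :: "(real^'n::finite \<Rightarrow> complex) \<Rightarrow> nat \<Rightarrow> nat \<Rightarrow> (real^'n \<Rightarrow> complex) \<Rightarrow> real^'n \<Rightarrow> complex" where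
  "rep_kernel g i l h = residual_quotient (dilate l g) (lowpass g l) (Suc i) (convolve (\<lambda>x. dilate l g x + lowpass g l x) h)"

lemma test_rep_kernel: "g \<in> test_functions \<Longrightarrow> h \<in> test_functions \<Longrightarrow> rep_kernel g i l h \<in> test_functions"
  unfolding rep_kernel_def by (intro test_residual_quotient test_convolve' test_add test_dilate test_lowpass)

lemma l1_norm_add:
  assumes "u \<in> test_functions" "v \<in> test_functions"
  shows "l1_norm (\<lambda>x. u x + v x) \<le> l1_norm u + l1_norm v"
proof -
  obtain R R' where k: "kernel R u" "kernel R' v" using test_kernel assms by metis
  have "l1_norm (\<lambda>x. u x + v x) \<le> (LINT x|lborel. norm (u x) + norm (v x))"
    unfolding l1_norm_def using k by (intro integral_mono') (auto simp: kernel_def norm_triangle_ineq)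
  also have "\<dots> = l1_norm u + l1_norm v" using k by (simp add: l1_norm_def kernel_def)
  finally show ?thesis .
qed

lemma divide_pow_mono: "(0::real) \<le> c \<Longrightarrow> k \<le> l \<Longrightarrow> c / 2 ^ l \<le> c / 2 ^ k"
  by (intro divide_left_mono) (auto intro: power_increasing)

text \<open>Every residual adds twice the radius of its function. All radii are expressed on a level
  \<open>m\<close> coarser than both, because the averages will be taken on the coarser of the two
  scales.\<close>

lemma rep_kernel_supp:
  fixes g h :: "real^'n::finite \<Rightarrow> complex"
  assumes g: "level_bounds R A Bs l (dilate l g)" "level_bounds R A Bs l (lowpass g l)" and h: "level_bounds R' A' Bs' k h"
    and "0 \<le> R" "0 \<le> R'" "m \<le> l" "m \<le> k"
  shows "supp_le ((R + R' + 2 * R * Suc i) / 2 ^ m) (rep_kernel g i l h)"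
proof -
  have "supp_le (R / 2 ^ l) (\<lambda>x. dilate l g x + lowpass g l x)"
    using g by (intro supp_le_add) (auto simp: level_bounds_def)
  then have "supp_le (R / 2 ^ l + R' / 2 ^ k) (convolve (\<lambda>x. dilate l g x + lowpass g l x) h)"
    using h by (intro supp_le_convolve) (auto simp: level_bounds_def)
  then have "supp_le ((R / 2 ^ l + R' / 2 ^ k) + 2 * (R / 2 ^ l) * Suc i) (rep_kernel g i l h)"
    unfolding rep_kernel_def using g assms by (intro supp_le_residual_quotient) (auto simp: level_bounds_def)
  then show ?thesis
  proof (rule supp_le_mono)
    have "R / 2 ^ l \<le> R / 2 ^ m" "R' / 2 ^ k \<le> R' / 2 ^ m" using assms by (auto intro: divide_pow_mono)
    then have "R / 2 ^ l + R' / 2 ^ k + 2 * (R / 2 ^ l) * Suc i \<le> R / 2 ^ m + R' / 2 ^ m + 2 * (R / 2 ^ m) * Suc i"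
      by (intro add_mono mult_right_mono mult_left_mono) auto
    then show "R / 2 ^ l + R' / 2 ^ k + 2 * (R / 2 ^ l) * Suc i \<le> (R + R' + 2 * R * Suc i) / 2 ^ m"
      by (simp add: add_divide_distrib)
  qed
qed

text \<open>Each of the \<open>i\<close> residual factors gains \<open>2 ^ -l\<close> from its
  support radius and spends a derivative of \<open>h\<close>, worth \<open>2 ^ k\<close>. Strictness
  in \<open>k < l\<close> makes \<open>l\<close> positive, so that \<open>lowpass g l\<close> has
  integral 1 and its residual gains as well.\<close>

lemma rep_kernel_fine:
  fixes g h :: "real^'n::finite \<Rightarrow> complex"
  assumes g: "level_bounds R A Bs l (dilate l g)" "level_bounds R A Bs l (lowpass g l)" and h: "level_bounds R' A' Bs' k h"
    and int: "(LINT x|lborel. g x) = 1" "g \<in> test_functions" and "0 \<le> R" "0 \<le> A" "k < l"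
  shows "norm (rep_kernel g i l h x) \<le> (real (Suc i) * ((1 + A) * (A * (real CARD('n) * R))) ^ i * (2 * A * Bs' i)) * ((1 / 2) ^ ((l - k) * i) * 2 ^ (k * CARD('n)))"
proof -
  let ?w = "\<lambda>x. dilate l g x + lowpass g l x"
  have tw: "?w \<in> test_functions" using g by (intro test_add) (auto simp: level_bounds_def)
  have th: "h \<in> test_functions" using h by (simp add: level_bounds_def)
  have i2: "(LINT x|lborel. dilate l g x) = 1" "(LINT x|lborel. lowpass g l x) = 1"
    using int assms(8) by (auto simp: lowpass_def integral_dilate)
  let ?c = "(1 + A) * (A * (real CARD('n) * (R / 2 ^ l)))"
  have s1: "residual_gain ?c 1 (dilate l g)" by (rule residual_gain_gain) (use g i2 assms in \<open>auto simp: level_bounds_def\<close>)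
  have s2: "residual_gain ?c 1 (lowpass g l)" by (rule residual_gain_gain) (use g i2 assms in \<open>auto simp: level_bounds_def\<close>)
  have l1w: "l1_norm ?w \<le> 2 * A" using l1_norm_add[of "dilate l g" "lowpass g l"] g by (auto simp: level_bounds_def)
  obtain Rw where kw: "kernel Rw ?w" using test_kernel[OF tw] .
  have "deriv_bound (0 + 1 * i) (2 * A * (2 ^ (k * (CARD('n) + i)) * Bs' i)) (convolve ?w h)"
    using h by (intro deriv_bound_convolve[OF kw th _ l1w]) (auto simp: level_bounds_def)
  then have "deriv_bound 0 (real (Suc i) * ?c ^ i * (2 * A * (2 ^ (k * (CARD('n) + i)) * Bs' i))) (rep_kernel g i l h)"
    unfolding rep_kernel_def using g by (intro deriv_bound_residual_quotient[OF s1 s2] test_convolve' tw th) (auto simp: level_bounds_def)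
  moreover have "?c ^ i = ((1 + A) * (A * (real CARD('n) * R))) ^ i / 2 ^ (l * i)"
    by (simp add: power_divide power_mult)
  moreover have "(1 / 2 :: real) ^ ((l - k) * i) = 2 ^ (k * i) / 2 ^ (l * i)"
  proof -
    have "(2::real) ^ (l * i) = 2 ^ ((l - k) * i) * 2 ^ (k * i)"
      using assms(8) by (simp add: power_add[symmetric] distrib_right[symmetric])
    then show ?thesis by (simp add: power_divide)
  qed
  ultimately show ?thesis by (simp add: deriv_bound_0 power_add distrib_left mult_ac)
qed

text \<open>The roles are exchanged: by commutativity \<open>h\<close> is convolved with a function
  that is smooth on the scale \<open>2 ^ -l\<close>. Its \<open>L\<close> moments gain
  \<open>2 ^ (- k L)\<close> against \<open>L\<close> derivatives of size \<open>2 ^ (l L)\<close>,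
  and the residual factors are merely bounded.\<close>

lemma rep_kernel_coarse:
  fixes g h :: "real^'n::finite \<Rightarrow> complex"
  assumes g: "level_bounds R A Bs l (dilate l g)" "level_bounds R A Bs l (lowpass g l)" and h: "level_bounds R' A' Bs' k h"
    and mom: "\<And>is. length is < L \<Longrightarrow> (LINT z|lborel. of_real (list_monomial is z) * h z) = 0"
    and "0 \<le> R" "0 \<le> A" "0 \<le> R'" "0 \<le> Bs L" "l \<le> k"
  shows "norm (rep_kernel g i l h x) \<le> (A' * ((real CARD('n) * R') ^ L * (real (Suc i) * (1 + A * A) ^ i * (2 * Bs L)))) * ((1 / 2) ^ ((k - l) * L) * 2 ^ (l * CARD('n)))"
proof -
  let ?w = "\<lambda>x. dilate l g x + lowpass g l x"
  let ?u = "dilate l g" and ?v = "lowpass g l"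
  have tw: "?w \<in> test_functions" and tu: "?u \<in> test_functions" and tv: "?v \<in> test_functions"
    using g by (auto intro!: test_add simp: level_bounds_def)
  have th: "h \<in> test_functions" using h by (simp add: level_bounds_def)
  have s: "residual_gain (1 + A * A) 0 ?u" "residual_gain (1 + A * A) 0 ?v"
    using g by (auto intro!: residual_gain_nogain simp: level_bounds_def)
  have "deriv_bound L (2 ^ (l * (CARD('n) + L)) * Bs L + 2 ^ (l * (CARD('n) + L)) * Bs L) ?w"
    using g by (intro deriv_bound_add) (auto simp: level_bounds_def)
  then have "deriv_bound (L + 0 * i) (2 ^ (l * (CARD('n) + L)) * (2 * Bs L)) ?w" by (simp add: algebra_simps)
  then have d: "deriv_bound L (real (Suc i) * (1 + A * A) ^ i * (2 ^ (l * (CARD('n) + L)) * (2 * Bs L))) (residual_quotient ?u ?v (Suc i) ?w)"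
    by (intro deriv_bound_residual_quotient[OF s] tu tv tw)
  have eq: "rep_kernel g i l h = convolve h (residual_quotient ?u ?v (Suc i) ?w)"
    unfolding rep_kernel_def convolve_residual_quotient[OF th tu tv tw] convolve_comm[OF tw th] ..
  have "norm (rep_kernel g i l h x) \<le> l1_norm h * ((real CARD('n) * (R' / 2 ^ k)) ^ L * (real (Suc i) * (1 + A * A) ^ i * (2 ^ (l * (CARD('n) + L)) * (2 * Bs L))))"
    unfolding eq by (rule convolve_moments[OF th _ _ test_residual_quotient[OF tu tv tw] d mom]) (use h assms in \<open>auto simp: level_bounds_def\<close>)
  also have "\<dots> \<le> A' * ((real CARD('n) * (R' / 2 ^ k)) ^ L * (real (Suc i) * (1 + A * A) ^ i * (2 ^ (l * (CARD('n) + L)) * (2 * Bs L))))"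
    using h assms by (intro mult_right_mono) (auto simp: level_bounds_def)
  also have "\<dots> = (A' * ((real CARD('n) * R') ^ L * (real (Suc i) * (1 + A * A) ^ i * (2 * Bs L)))) * ((1 / 2) ^ ((k - l) * L) * 2 ^ (l * CARD('n)))"
  proof -
    have "(2::real) ^ (k * L) = 2 ^ ((k - l) * L) * 2 ^ (l * L)"
      using assms(9) by (simp add: power_add[symmetric] distrib_right[symmetric])
    then have "(1 / 2 :: real) ^ ((k - l) * L) = 2 ^ (l * L) / 2 ^ (k * L)"
      by (simp add: power_divide)
    moreover have "(real CARD('n) * (R' / 2 ^ k)) ^ L = (real CARD('n) * R') ^ L / 2 ^ (k * L)"
      by (simp add: power_divide power_mult)
    ultimately show ?thesis by (simp add: power_add distrib_left mult_ac)
  qed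
  finally show ?thesis .
qed

lemma start_bound:
  fixes g :: "real^'n::finite \<Rightarrow> complex" and i :: nat
  assumes g: "level_bounds R A Bs l (dilate l g)" and "0 \<le> R" "0 \<le> A"
  defines "st \<equiv> convolve (dilate l g) (residual_quotient (dilate l g) (\<lambda>x. 0) (Suc i) (dilate l g))"
  shows "norm (st x) \<le> A * (real (Suc i) * (1 + A * A) ^ i * Bs 0) * 2 ^ (l * CARD('n))"
    and "supp_le ((R + R + 2 * R * Suc i) / 2 ^ l) st"
proof -
  let ?u = "dilate l g"
  have tu: "?u \<in> test_functions" using g by (auto simp: level_bounds_def)
  obtain Ru where ku: "kernel Ru ?u" using test_kernel[OF tu] .
  have s: "residual_gain (1 + A * A) 0 ?u" "residual_gain (1 + A * A) 0 (\<lambda>x::real^'n. 0)"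
    using g assms by (auto intro!: residual_gain_nogain simp: level_bounds_def l1_norm_zero test_zero)
  have "deriv_bound 0 (2 ^ (l * (CARD('n) + 0)) * Bs 0) ?u" using g unfolding level_bounds_def by blast
  then have "deriv_bound (0 + 0 * i) (2 ^ (l * CARD('n)) * Bs 0) ?u" by simp
  then have d: "deriv_bound 0 (real (Suc i) * (1 + A * A) ^ i * (2 ^ (l * CARD('n)) * Bs 0)) (residual_quotient ?u (\<lambda>x. 0) (Suc i) ?u)"
    by (intro deriv_bound_residual_quotient[OF s] tu test_zero)
  have "deriv_bound 0 (A * (real (Suc i) * (1 + A * A) ^ i * (2 ^ (l * CARD('n)) * Bs 0))) st"
    unfolding st_def using g by (intro deriv_bound_convolve[OF ku _ d] test_residual_quotient tu test_zero) (auto simp: level_bounds_def)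
  then show "norm (st x) \<le> A * (real (Suc i) * (1 + A * A) ^ i * Bs 0) * 2 ^ (l * CARD('n))"
    by (simp add: deriv_bound_0 mult_ac)
  have su: "supp_le (R / 2 ^ l) ?u" using g by (auto simp: level_bounds_def)
  have "supp_le (R / 2 ^ l + (R / 2 ^ l + 2 * (R / 2 ^ l) * Suc i)) st"
    unfolding st_def by (intro supp_le_convolve supp_le_residual_quotient su) (use assms in \<open>auto simp: supp_le_def\<close>)
  then show "supp_le ((R + R + 2 * R * Suc i) / 2 ^ l) st" by (simp add: add_divide_distrib add.assoc)
qed

text \<open>The passage to nonnegative integrals over balls about \<open>x\<close>; from here on
  sums over levels are formed in \<open>ennreal\<close>, without questions of convergence.\<close>

lemma convolve_nn_bound:
  fixes a h :: "real^'n::finite \<Rightarrow> complex"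
  assumes a: "kernel \<rho> a" and D: "\<And>z. norm (a z) \<le> D" and h: "continuous_on UNIV h"
  shows "ennreal (norm (convolve a h x)) \<le> ennreal D * (\<integral>\<^sup>+w. ennreal (norm (h w)) * indicator (cball x \<rho>) w \<partial>lborel)"
proof -
  have [measurable]: "h \<in> borel_measurable borel" by (rule borel_measurable_continuous_onI[OF h])
  have [measurable]: "cball c \<rho> \<in> sets borel" for c :: "real^'n" by auto
  have meas: "(\<lambda>w. ennreal (norm (h w)) * indicator (cball x \<rho>) w) \<in> borel_measurable borel" by measurable
  have D0: "0 \<le> D" using D[of 0] norm_ge_zero order_trans by blast
  have "ennreal (norm (convolve a h x)) \<le> (\<integral>\<^sup>+z. ennreal (norm (a z * h (x - z))) \<partial>lborel)"
    unfolding convolve_def by (rule integral_norm_bound_ennreal[OF convolve_integrable[OF a h]])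
  also have "\<dots> \<le> (\<integral>\<^sup>+z. ennreal D * (ennreal (norm (h (x - z))) * indicator (cball x \<rho>) (x - z)) \<partial>lborel)"
  proof (rule nn_integral_mono)
    fix z
    show "ennreal (norm (a z * h (x - z))) \<le> ennreal D * (ennreal (norm (h (x - z))) * indicator (cball x \<rho>) (x - z))"
    proof (cases "a z = 0")
      case False
      then have "x - z \<in> cball x \<rho>" using a by (auto simp: kernel_def supp_le_def dist_norm)
      then show ?thesis using D[of z] D0 by (simp add: norm_mult ennreal_mult[symmetric] mult_right_mono)
    qed simp
  qed
  also have "\<dots> = ennreal D * (\<integral>\<^sup>+z. ennreal (norm (h (x - z))) * indicator (cball x \<rho>) (x - z) \<partial>lborel)"
  proof -
    have ind: "indicator (cball x \<rho>) (x - z) = (indicator (cball 0 \<rho>) z :: ennreal)" for z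
      by (simp add: indicator_def dist_norm)
    have "(\<lambda>z. ennreal (norm (h (x - z))) * indicator (cball 0 \<rho>) z) \<in> borel_measurable lborel"
      by measurable
    then show ?thesis by (simp only: nn_integral_cmult ind)
  qed
  also have "(\<integral>\<^sup>+z. ennreal (norm (h (x - z))) * indicator (cball x \<rho>) (x - z) \<partial>lborel)
     = (\<integral>\<^sup>+w. ennreal (norm (h w)) * indicator (cball x \<rho>) w \<partial>lborel)"
    using nn_integral_affine[OF _ meas, of "-1" x] by simp
  finally show ?thesis .
qed

text \<open>Now \<open>h\<close> is fixed while the support of \<open>u\<close> shrinks, so every
  residual factor contributes \<open>2 ^ -J\<close>. The functional sees \<open>N\<close>
  derivatives of the result, that is, \<open>N + Suc i\<close> derivatives of
  \<open>h\<close>.\<close>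

lemma remainder_tendsto:
  fixes g :: "real^'n::finite \<Rightarrow> complex"
  assumes f: "f \<in> S'_e" and g: "g \<in> test_functions" "(LINT x|lborel. g x) = 1" and h: "h \<in> test_functions"
  shows "(\<lambda>J. conv ((residual (dilate J g) ^^ Suc i) h) f x) \<longlonglongrightarrow> 0"
proof -
  obtain C N where CN: "0 \<le> C" "\<And>\<psi> \<rho> B. \<psi> \<in> test_functions \<Longrightarrow> supp_le \<rho> \<psi> \<Longrightarrow> 0 \<le> B \<Longrightarrow> (\<forall>m\<le>N. deriv_bound m B \<psi>) \<Longrightarrow>
    norm (f \<psi>) \<le> C * exp (real N * \<rho>) * B" using S'_e_bound[OF f] by metis
  obtain R A Bs where lv: "0 < R" "0 \<le> A" "\<And>m. 0 \<le> Bs m" "\<And>l. level_bounds R A Bs l (dilate l g)"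
    using level_bounds_dilate[OF g(1)] by metis
  obtain B where B: "0 \<le> B" "\<And>m. m \<le> N + Suc i \<Longrightarrow> deriv_bound m B h" using test_deriv_bound_upto[OF h] by metis
  obtain Rh where Rh: "0 < Rh" "supp_le Rh h" using test_supp[OF h] .
  define K where "K = (1 + A) * (A * (real CARD('n) * R))"
  define \<rho> where "\<rho> = Rh + 2 * R * Suc i + norm x"
  have bound: "norm (conv ((residual (dilate J g) ^^ Suc i) h) f x) \<le> C * exp (real N * \<rho>) * ((K / 2 ^ J) ^ Suc i * B)" for J
  proof -
    let ?u = "dilate J g" and ?h = "(residual (dilate J g) ^^ Suc i) h"
    have tu: "?u \<in> test_functions" by (rule test_dilate[OF g(1)])
    have "residual_gain ((1 + A) * (A * (real CARD('n) * (R / 2 ^ J)))) 1 ?u"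
      by (rule residual_gain_gain) (use lv(1,2) lv(4)[of J] g in \<open>auto simp: level_bounds_def integral_dilate\<close>)
    then have "residual_gain (K / 2 ^ J) 1 ?u" by (simp add: K_def)
    then have d: "deriv_bound m ((K / 2 ^ J) ^ Suc i * B) ?h" if "m \<le> N" for m
      by (rule deriv_bound_residual_pow) (use tu h B that in auto)
    have th: "?h \<in> test_functions" by (rule test_residual_pow[OF tu h])
    have "supp_le (Rh + 2 * (R / 2 ^ J) * Suc i) ?h"
      by (rule supp_le_residual_pow) (use lv(1,2) lv(4)[of J] Rh in \<open>auto simp: level_bounds_def\<close>)
    then have "supp_le (Rh + 2 * R * Suc i) ?h"
    proof (rule supp_le_mono)
      have "R / 2 ^ J \<le> R" using divide_pow_mono[of R 0 J] lv(1) by simp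
      then show "Rh + 2 * (R / 2 ^ J) * Suc i \<le> Rh + 2 * R * Suc i"
        by (intro add_left_mono mult_right_mono mult_left_mono) auto
    qed
    then have s: "supp_le \<rho> (\<lambda>y. ?h (x - y))" unfolding \<rho>_def by (rule supp_le_refl)
    have K0: "0 \<le> K" using lv by (simp add: K_def)
    show ?thesis unfolding conv_def
      by (rule CN(2)[OF test_refl[OF th] s]) (use K0 B deriv_bound_refl[OF th] d in auto)
  qed
  have "(\<lambda>J. K / 2 ^ J) \<longlonglongrightarrow> 0"
    using tendsto_mult[OF tendsto_const[of K] LIMSEQ_realpow_zero[of "1/2"]] by (simp add: power_divide)
  then have "(\<lambda>J. C * exp (real N * \<rho>) * ((K / 2 ^ J) ^ Suc i * B)) \<longlonglongrightarrow> C * exp (real N * \<rho>) * (0 ^ Suc i * B)"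
    by (intro tendsto_intros)
  then have "(\<lambda>J. C * exp (real N * \<rho>) * ((K / 2 ^ J) ^ Suc i * B)) \<longlonglongrightarrow> 0" by simp
  then show ?thesis by (rule Lim_null_comparison[rotated]) (use bound in auto)
qed

section \<open>The reproducing series\<close>

lemma rep_kernel_step:
  assumes "g \<in> test_functions" "h \<in> test_functions" "f \<in> S'_e"
  shows "conv ((residual (lowpass g l) ^^ Suc i) h) f x - conv ((residual (dilate l g) ^^ Suc i) h) f x
    = convolve (rep_kernel g i l h) (conv (dyadic_family g l) f) x"
proof -
  let ?u = "dilate l g" and ?v = "lowpass g l"
  have t: "?u \<in> test_functions" "?v \<in> test_functions" using assms by (auto intro: test_dilate test_lowpass)
  obtain R where k: "kernel R (rep_kernel g i l h)" using test_kernel[OF test_rep_kernel[OF assms(1,2)]] .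
  have "convolve (rep_kernel g i l h) (conv (dyadic_family g l) f) x = conv (convolve (rep_kernel g i l h) (dyadic_family g l)) f x"
    by (rule conv_convolve[OF assms(3) k test_dyadic_family[OF assms(1)], symmetric])
  also have "convolve (rep_kernel g i l h) (dyadic_family g l) = convolve (dyadic_family g l) (rep_kernel g i l h)"
    by (rule convolve_comm[OF test_rep_kernel[OF assms(1,2)] test_dyadic_family[OF assms(1)]])
  also have "\<dots> = (\<lambda>x. (residual ?v ^^ Suc i) h x - (residual ?u ^^ Suc i) h x)"
    unfolding dyadic_family_eq rep_kernel_def by (rule reproducing_step[OF t assms(2)])
  also have "conv \<dots> f x = conv ((residual ?v ^^ Suc i) h) f x - conv ((residual ?u ^^ Suc i) h) f x"
    by (rule conv_diff[OF assms(3)]) (intro test_residual_pow t assms)+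
  finally show ?thesis by simp
qed

lemma reproducing_sum:
  assumes "g \<in> test_functions" "h \<in> test_functions" "f \<in> S'_e"
  shows "conv ((residual (lowpass g j) ^^ Suc i) h) f x - conv ((residual (dilate (j + J) g) ^^ Suc i) h) f x
    = (\<Sum>l\<le>J. convolve (rep_kernel g i (j + l) h) (conv (dyadic_family g (j + l)) f) x)"
proof (induction J)
  case 0
  show ?case using rep_kernel_step[OF assms, where l=j and i=i and x=x] by simp
next
  case (Suc J)
  have "lowpass g (j + Suc J) = dilate (j + J) g" by (simp add: lowpass_def)
  then show ?case using Suc rep_kernel_step[OF assms, where l="j + Suc J" and i=i and x=x] by (simp add: diff_eq_eq add_ac del: funpow.simps)
qed

text \<open>Bounding partial sums and letting the remainder tend to 0 covers the case that the
  series of norms diverges: the right-hand side is then infinite.\<close>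

lemma limit_bound:
  fixes a :: complex and e :: "nat \<Rightarrow> complex" and b :: "nat \<Rightarrow> complex"
  assumes "\<And>J. a - e J = (\<Sum>l\<le>J. b l)" "e \<longlonglongrightarrow> 0"
  shows "ennreal (norm a) \<le> (\<Sum>l. ennreal (norm (b l)))"
proof (rule LIMSEQ_le_const)
  have "(\<lambda>J. ennreal (norm (e J))) \<longlonglongrightarrow> ennreal 0"
    by (intro tendsto_ennrealI) (use tendsto_norm_zero[OF assms(2)] in simp)
  then have "(\<lambda>J. (\<Sum>l. ennreal (norm (b l))) + ennreal (norm (e J))) \<longlonglongrightarrow> (\<Sum>l. ennreal (norm (b l))) + ennreal 0"
    by (intro tendsto_add tendsto_const)
  then show "(\<lambda>J. (\<Sum>l. ennreal (norm (b l))) + ennreal (norm (e J))) \<longlonglongrightarrow> (\<Sum>l. ennreal (norm (b l)))" by simp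
  have "ennreal (norm a) \<le> (\<Sum>l. ennreal (norm (b l))) + ennreal (norm (e J))" for J
  proof -
    have "a = (\<Sum>l\<le>J. b l) + e J" using assms(1)[of J] by (simp add: algebra_simps)
    then have "norm a \<le> norm (\<Sum>l\<le>J. b l) + norm (e J)" by (simp add: norm_triangle_ineq)
    also have "norm (\<Sum>l\<le>J. b l) \<le> (\<Sum>l\<le>J. norm (b l))" by (rule norm_sum)
    finally have "ennreal (norm a) \<le> ennreal ((\<Sum>l\<le>J. norm (b l)) + norm (e J))" by (simp add: ennreal_leI)
    also have "\<dots> = (\<Sum>l\<le>J. ennreal (norm (b l))) + ennreal (norm (e J))" by (simp add: sum_nonneg)
    also have "\<dots> \<le> (\<Sum>l. ennreal (norm (b l))) + ennreal (norm (e J))"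
      by (intro add_right_mono sum_le_suminf summableI) auto
    finally show ?thesis .
  qed
  then show "\<exists>N. \<forall>n\<ge>N. ennreal (norm a) \<le> (\<Sum>l. ennreal (norm (b l))) + ennreal (norm (e n))" by blast
qed

lemma level_bounds_common:
  fixes g :: "real^'n::finite \<Rightarrow> complex"
  assumes "g \<in> test_functions"
  shows "\<exists>R A Bs. 0 < R \<and> 0 \<le> A \<and> (\<forall>m. 0 \<le> Bs m) \<and> (\<forall>l. level_bounds R A Bs l (dilate l g) \<and> level_bounds R A Bs l (lowpass g l) \<and> level_bounds R A Bs l (dyadic_family g l))"
proof -
  obtain R A Bs where 1: "0 < R" "0 \<le> A" "\<And>m. 0 \<le> Bs m" "\<And>l. level_bounds R A Bs l (dilate l g)"
    using level_bounds_dilate[OF assms] by metis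
  obtain R' A' Bs' where 2: "0 < R'" "0 \<le> A'" "\<And>m. 0 \<le> Bs' m" "\<And>l. level_bounds R' A' Bs' l (dyadic_family g l)"
    using level_bounds_dyadic_family[OF assms] by metis
  note 3 = level_bounds_lowpass[OF 1]
  let ?R = "2 * R + R'" and ?A = "A + A'" and ?B = "\<lambda>m. Bs m + Bs' m"
  have L1: "level_bounds ?R ?A ?B l (dilate l g)" for l by (rule level_bounds_mono[OF 1(4)]) (use 1 2 in auto)
  have L2: "level_bounds ?R ?A ?B l (lowpass g l)" for l by (rule level_bounds_mono[OF 3]) (use 1 2 in auto)
  have L3: "level_bounds ?R ?A ?B l (dyadic_family g l)" for l by (rule level_bounds_mono[OF 2(4)]) (use 1 2 in auto)
  have P: "0 < ?R" "0 \<le> ?A" "0 \<le> ?B m" for m using 1 2 by (auto simp: add_pos_pos)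
  show ?thesis by (intro exI[of _ ?R] exI[of _ ?A] exI[of _ ?B] conjI allI P L1 L2 L3)
qed

text \<open>The step with \<open>v = 0\<close>, rearranged so that the kernel acts on
  \<open>conv h f\<close> itself. With \<open>h\<close> on level \<open>l\<close> the expansion can
  thus start at level \<open>l\<close>, and no coarser level enters.\<close>

lemma start_step:
  assumes g: "g \<in> test_functions" and h: "h \<in> test_functions" and f: "f \<in> S'_e"
  shows "conv h f x - conv ((residual (dilate l g) ^^ m) h) f x
    = convolve (convolve (dilate l g) (residual_quotient (dilate l g) (\<lambda>x. 0) m (dilate l g))) (conv h f) x"
proof -
  let ?u = "dilate l g"
  let ?W = "residual_quotient ?u (\<lambda>x. 0) m ?u"
  have tu: "?u \<in> test_functions" by (rule test_dilate[OF g])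
  have tW: "?W \<in> test_functions" by (rule test_residual_quotient[OF tu test_zero tu])
  obtain R where k: "kernel R (convolve ?u ?W)" using test_kernel[OF test_convolve'[OF tu tW]] .
  have "convolve ?u (residual_quotient ?u (\<lambda>x. 0) m (convolve ?u h)) = (\<lambda>x. h x - (residual ?u ^^ m) h x)"
    using reproducing_step[OF tu test_zero h, of m] by (simp add: residual_pow_zero)
  moreover have "residual_quotient ?u (\<lambda>x. 0) m (convolve ?u h) = convolve h ?W"
    unfolding convolve_residual_quotient[OF h tu test_zero tu] convolve_comm[OF tu h] ..
  moreover have "convolve ?u (convolve h ?W) = convolve (convolve ?u ?W) h"
    unfolding convolve_lcomm[OF tu h tW] by (rule convolve_comm[OF h test_convolve'[OF tu tW]])
  ultimately have "convolve (convolve ?u ?W) h = (\<lambda>x. h x - (residual ?u ^^ m) h x)" by simp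
  then have "conv (convolve (convolve ?u ?W) h) f x = conv h f x - conv ((residual ?u ^^ m) h) f x"
    using conv_diff[OF f h test_residual_pow[OF tu h]] by simp
  then show ?thesis using conv_convolve[OF f k h] by simp
qed

text \<open>Only the levels \<open>j + l\<close> occur, with an arbitrary exponent \<open>i\<close>
  of decay. Coarser levels would lie outside the maximal function based at level \<open>j\<close>
  that is to absorb the right-hand side.\<close>

theorem local_estimate_self:
  fixes \<phi> :: "real^'n::finite \<Rightarrow> complex"
  assumes \<phi>: "\<phi> \<in> test_functions" "(LINT x|lborel. \<phi> x) = 1"
  shows "\<exists>C\<ge>0. \<exists>R>0. \<forall>f\<in>S'_e. \<forall>j x. ennreal (norm (conv (dyadic_family \<phi> j) f x))
    \<le> (\<Sum>l. ennreal (C * ((1/2) ^ (l * i) * 2 ^ (j * CARD('n)))) *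
         (\<integral>\<^sup>+w. ennreal (norm (conv (dyadic_family \<phi> (j + l)) f w)) * indicator (cball x (R / 2 ^ j)) w \<partial>lborel))"
proof -
  obtain R A Bs where lv: "0 < R" "0 \<le> A" "\<And>m. 0 \<le> Bs m" "\<And>l. level_bounds R A Bs l (dilate l \<phi>)"
     "\<And>l. level_bounds R A Bs l (lowpass \<phi> l)" "\<And>l. level_bounds R A Bs l (dyadic_family \<phi> l)"
    using level_bounds_common[OF \<phi>(1)] by metis
  define C1 where "C1 = A * (real (Suc i) * (1 + A * A) ^ i * Bs 0)"
  define C2 where "C2 = real (Suc i) * ((1 + A) * (A * (real CARD('n) * R))) ^ i * (2 * A * Bs i)"
  define R' where "R' = R + R + 2 * R * Suc i"
  have C: "0 \<le> C1" "0 \<le> C2" using lv by (auto simp: C1_def C2_def)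
  have R': "0 < R'" unfolding R'_def using lv(1) by (intro add_pos_pos) auto
  have "ennreal (norm (conv (dyadic_family \<phi> j) f x))
    \<le> (\<Sum>l. ennreal ((C1 + C2) * ((1/2) ^ (l * i) * 2 ^ (j * CARD('n)))) *
         (\<integral>\<^sup>+w. ennreal (norm (conv (dyadic_family \<phi> (j + l)) f w)) * indicator (cball x (R' / 2 ^ j)) w \<partial>lborel))"
    if f: "f \<in> S'_e" for f j x
  proof -
    let ?F = "\<lambda>l. conv (dyadic_family \<phi> l) f"
    let ?h = "dyadic_family \<phi> j"
    let ?st = "convolve (dilate j \<phi>) (residual_quotient (dilate j \<phi>) (\<lambda>x. 0) (Suc i) (dilate j \<phi>))"
    have th: "?h \<in> test_functions" by (rule test_dyadic_family[OF \<phi>(1)])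
    have cF: "continuous_on UNIV (?F l)" for l by (rule conv_continuous[OF f test_dyadic_family[OF \<phi>(1)]])
    \<comment> \<open>Term 0 is the start kernel on level \<open>j\<close>. The others are
      telescoping differences from level \<open>Suc j\<close> on, where
      \<open>lowpass \<phi> (Suc j)\<close> is the same function \<open>dilate j \<phi>\<close> that
      the start kernel leaves behind.\<close>
    define b where "b l = (case l of 0 \<Rightarrow> convolve ?st (?F j) x | Suc l \<Rightarrow> convolve (rep_kernel \<phi> i (Suc j + l) ?h) (?F (Suc j + l)) x)" for l
    define e where "e J = conv ((residual (dilate (j + J) \<phi>) ^^ Suc i) ?h) f x" for J
    have ser: "?F j x - e J = (\<Sum>l\<le>J. b l)" for J
    proof -
      have 0: "?F j x - e 0 = b 0" using start_step[OF \<phi>(1) th f, where l=j and x=x and m="Suc i"] by (simp add: b_def e_def del: funpow.simps residual_quotient.simps)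
      show ?thesis
      proof (cases J)
        case (Suc K)
        have "lowpass \<phi> (Suc j) = dilate j \<phi>" by (simp add: lowpass_def)
        then have "e 0 - e J = (\<Sum>l\<le>K. b (Suc l))"
          using reproducing_sum[OF \<phi>(1) th f, where j="Suc j" and i=i and x=x and J=K] by (simp add: b_def e_def Suc del: funpow.simps)
        then show ?thesis using 0 by (simp add: Suc sum.atMost_Suc_shift diff_eq_eq add_ac del: sum.atMost_Suc)
      qed (use 0 in simp)
    qed
    have lim: "e \<longlonglongrightarrow> 0"
      unfolding e_def[abs_def] using LIMSEQ_ignore_initial_segment[OF remainder_tendsto[OF f \<phi> th, where i=i and x=x], of j]
      by (simp add: add.commute)
    have "ennreal (norm (?F j x)) \<le> (\<Sum>l. ennreal (norm (b l)))" by (rule limit_bound[OF ser lim])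
    also have "\<dots> \<le> (\<Sum>l. ennreal ((C1 + C2) * ((1/2) ^ (l * i) * 2 ^ (j * CARD('n)))) *
         (\<integral>\<^sup>+w. ennreal (norm (?F (j + l) w)) * indicator (cball x (R' / 2 ^ j)) w \<partial>lborel))"
    proof (rule suminf_le)
      fix l
      show "ennreal (norm (b l)) \<le> ennreal ((C1 + C2) * ((1/2) ^ (l * i) * 2 ^ (j * CARD('n)))) *
         (\<integral>\<^sup>+w. ennreal (norm (?F (j + l) w)) * indicator (cball x (R' / 2 ^ j)) w \<partial>lborel)"
      proof (cases l)
        case 0
        have "ennreal (norm (convolve ?st (?F j) x)) \<le> ennreal ((C1 + C2) * ((1/2) ^ (0 * i) * 2 ^ (j * CARD('n)))) *
          (\<integral>\<^sup>+w. ennreal (norm (?F j w)) * indicator (cball x (R' / 2 ^ j)) w \<partial>lborel)"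
        proof (rule convolve_nn_bound[OF kernel_test _ cF])
          show "?st \<in> test_functions" by (intro test_convolve' test_residual_quotient test_dilate test_zero \<phi>(1))
          show "supp_le (R' / 2 ^ j) ?st" unfolding R'_def by (rule start_bound(2)[OF lv(4)]) (use lv in auto)
          fix z
          have "norm (?st z) \<le> C1 * 2 ^ (j * CARD('n))" unfolding C1_def by (rule start_bound(1)[OF lv(4)]) (use lv in auto)
          also have "\<dots> \<le> (C1 + C2) * ((1/2) ^ (0 * i) * 2 ^ (j * CARD('n)))" using C by simp
          finally show "norm (?st z) \<le> (C1 + C2) * ((1/2) ^ (0 * i) * 2 ^ (j * CARD('n)))" .
        qed
        then show ?thesis using 0 by (simp add: b_def)
      next
        case (Suc m)
        have "ennreal (norm (convolve (rep_kernel \<phi> i (j + l) ?h) (?F (j + l)) x)) \<le> ennreal ((C1 + C2) * ((1/2) ^ (l * i) * 2 ^ (j * CARD('n)))) *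
          (\<integral>\<^sup>+w. ennreal (norm (?F (j + l) w)) * indicator (cball x (R' / 2 ^ j)) w \<partial>lborel)"
        proof (rule convolve_nn_bound[OF kernel_test _ cF])
          show "rep_kernel \<phi> i (j + l) ?h \<in> test_functions" by (rule test_rep_kernel[OF \<phi>(1) th])
          show "supp_le (R' / 2 ^ j) (rep_kernel \<phi> i (j + l) ?h)" unfolding R'_def
            by (rule rep_kernel_supp[OF lv(4) lv(5) lv(6)]) (use lv in auto)
          fix z
          have "norm (rep_kernel \<phi> i (j + l) ?h z) \<le> C2 * ((1/2) ^ (((j + l) - j) * i) * 2 ^ (j * CARD('n)))" unfolding C2_def
            by (rule rep_kernel_fine[OF lv(4) lv(5) lv(6) \<phi>(2,1)]) (use lv Suc in auto)
          also have "\<dots> \<le> (C1 + C2) * ((1/2) ^ (l * i) * 2 ^ (j * CARD('n)))" using C by (simp add: mult_right_mono)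
          finally show "norm (rep_kernel \<phi> i (j + l) ?h z) \<le> (C1 + C2) * ((1/2) ^ (l * i) * 2 ^ (j * CARD('n)))" .
        qed
        then show ?thesis using Suc by (simp add: b_def)
      qed
    qed auto
    finally show ?thesis .
  qed
  then show ?thesis using C R' by (intro exI[of _ "C1 + C2"] conjI exI[of _ R']) auto
qed

text \<open>The telescoping sum starts at level 0, where \<open>lowpass\<close> vanishes and the
  residual is the identity. The decay comes from the \<open>L\<close> moments for
  \<open>l <= k\<close> and from the residuals for \<open>l > k\<close>.\<close>

theorem local_estimate_other:
  fixes \<phi> \<zeta> :: "real^'n::finite \<Rightarrow> complex"
  assumes \<phi>: "\<phi> \<in> test_functions" "(LINT x|lborel. \<phi> x) = 1" and \<zeta>: "\<zeta> \<in> test_functions"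
    and mom: "\<And>is. length is < L \<Longrightarrow> (LINT z|lborel. of_real (list_monomial is z) * dyadic_diff \<zeta> z) = 0"
  shows "\<exists>C\<ge>0. \<exists>R>0. \<forall>f\<in>S'_e. \<forall>k x. ennreal (norm (conv (dyadic_family \<zeta> k) f x))
    \<le> (\<Sum>l. ennreal (C * ((1/2) ^ (if l \<le> k then (k - l) * L else (l - k) * i) * 2 ^ (min k l * CARD('n)))) *
         (\<integral>\<^sup>+w. ennreal (norm (conv (dyadic_family \<phi> l) f w)) * indicator (cball x (R / 2 ^ min k l)) w \<partial>lborel))"
proof -
  obtain R A Bs where lv: "0 < R" "0 \<le> A" "\<And>m. 0 \<le> Bs m" "\<And>l. level_bounds R A Bs l (dilate l \<phi>)"
     "\<And>l. level_bounds R A Bs l (lowpass \<phi> l)" "\<And>l. level_bounds R A Bs l (dyadic_family \<phi> l)"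
    using level_bounds_common[OF \<phi>(1)] by metis
  obtain R1 A1 Bs1 where lz: "0 < R1" "0 \<le> A1" "\<And>m. 0 \<le> Bs1 m" "\<And>l. level_bounds R1 A1 Bs1 l (dyadic_family \<zeta> l)"
    using level_bounds_dyadic_family[OF \<zeta>] by metis
  define C1 where "C1 L = A1 * ((real CARD('n) * R1) ^ L * (real (Suc i) * (1 + A * A) ^ i * (2 * Bs L)))" for L
  define C2 where "C2 = real (Suc i) * ((1 + A) * (A * (real CARD('n) * R))) ^ i * (2 * A * Bs1 i)"
  define R' where "R' = R + R1 + 2 * R * Suc i"
  have C: "0 \<le> C1 L" "0 \<le> C2" for L using lv lz by (auto simp: C1_def C2_def)
  have R': "0 < R'" unfolding R'_def using lv(1) lz(1) by (intro add_pos_pos) auto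
  define D where "D = C1 0 + C1 L + C2"
  have D: "0 \<le> D" "C1 0 \<le> D" "C1 L \<le> D" "C2 \<le> D" using C(1)[of 0] C(1)[of L] C(2) by (auto simp: D_def)
  have momk: "(LINT z|lborel. of_real (list_monomial is z) * dyadic_family \<zeta> k z) = 0" if "length is < L" "k \<noteq> 0" for "is" k
  proof -
    let ?h = "\<lambda>z. of_real (list_monomial is z) * dyadic_diff \<zeta> z"
    have hm: "?h \<in> borel_measurable borel"
      by (intro borel_measurable_continuous_onI continuous_intros continuous_list_monomial test_continuous test_dyadic_diff \<zeta>)
    have "0 = \<bar>2 ^ k\<bar> ^ CARD('n) *\<^sub>R (LINT z|lborel. ?h (0 + 2 ^ k *\<^sub>R z))"
      using lborel_integral_affine[of "2 ^ k" ?h 0] hm mom[OF that(1)] by simp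
    also have "(LINT z|lborel. ?h (0 + 2 ^ k *\<^sub>R z)) = (LINT z|lborel. of_real ((2 ^ k) ^ length is / 2 ^ (k * CARD('n))) * (of_real (list_monomial is z) * dyadic_family \<zeta> k z))"
      using that(2) by (intro Bochner_Integration.integral_cong)
         (auto simp: list_monomial_scaleR dyadic_family_def dilate_def scaleR_conv_of_real[where 'a=complex])
    also have "\<dots> = of_real ((2 ^ k) ^ length is / 2 ^ (k * CARD('n))) * (LINT z|lborel. of_real (list_monomial is z) * dyadic_family \<zeta> k z)"
      by (rule integral_mult_right_zero)
    finally show ?thesis by simp
  qed
  have "ennreal (norm (conv (dyadic_family \<zeta> k) f x))
    \<le> (\<Sum>l. ennreal (D * ((1/2) ^ (if l \<le> k then (k - l) * L else (l - k) * i) * 2 ^ (min k l * CARD('n)))) *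
         (\<integral>\<^sup>+w. ennreal (norm (conv (dyadic_family \<phi> l) f w)) * indicator (cball x (R' / 2 ^ min k l)) w \<partial>lborel))"
    if f: "f \<in> S'_e" for f k x
  proof -
    let ?F = "\<lambda>l. conv (dyadic_family \<phi> l) f"
    let ?h = "dyadic_family \<zeta> k"
    have th: "?h \<in> test_functions" by (rule test_dyadic_family[OF \<zeta>(1)])
    have cF: "continuous_on UNIV (?F l)" for l by (rule conv_continuous[OF f test_dyadic_family[OF \<phi>(1)]])
    define b where "b l = convolve (rep_kernel \<phi> i l ?h) (?F l) x" for l
    define e where "e J = conv ((residual (dilate J \<phi>) ^^ Suc i) ?h) f x" for J
    have ser: "conv ?h f x - e J = (\<Sum>l\<le>J. b l)" for J
    proof -
      have "lowpass \<phi> 0 = (\<lambda>x. 0)" by (simp add: lowpass_def)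
      then show ?thesis
        using reproducing_sum[OF \<phi>(1) th f, where j=0 and i=i and x=x and J=J] by (simp add: b_def e_def residual_zero residual_pow_zero del: funpow.simps)
    qed
    have lim: "e \<longlonglongrightarrow> 0"
      unfolding e_def[abs_def] by (rule remainder_tendsto[OF f \<phi> th])
    have "ennreal (norm (conv ?h f x)) \<le> (\<Sum>l. ennreal (norm (b l)))" by (rule limit_bound[OF ser lim])
    also have "\<dots> \<le> (\<Sum>l. ennreal (D * ((1/2) ^ (if l \<le> k then (k - l) * L else (l - k) * i) * 2 ^ (min k l * CARD('n)))) *
         (\<integral>\<^sup>+w. ennreal (norm (conv (dyadic_family \<phi> l) f w)) * indicator (cball x (R' / 2 ^ min k l)) w \<partial>lborel))"
    proof (rule suminf_le)
      fix l
      show "ennreal (norm (b l)) \<le> ennreal (D * ((1/2) ^ (if l \<le> k then (k - l) * L else (l - k) * i) * 2 ^ (min k l * CARD('n)))) *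
         (\<integral>\<^sup>+w. ennreal (norm (conv (dyadic_family \<phi> l) f w)) * indicator (cball x (R' / 2 ^ min k l)) w \<partial>lborel)"
        unfolding b_def
      proof (rule convolve_nn_bound[OF kernel_test _ cF])
        show "rep_kernel \<phi> i l ?h \<in> test_functions" by (rule test_rep_kernel[OF \<phi>(1) th])
        show "supp_le (R' / 2 ^ min k l) (rep_kernel \<phi> i l ?h)" unfolding R'_def
          by (rule rep_kernel_supp[OF lv(4) lv(5) lz(4)]) (use lv lz in auto)
        fix z
        show "norm (rep_kernel \<phi> i l ?h z) \<le> D * ((1/2) ^ (if l \<le> k then (k - l) * L else (l - k) * i) * 2 ^ (min k l * CARD('n)))"
        proof (cases "l \<le> k")
          case False
          have "norm (rep_kernel \<phi> i l ?h z) \<le> C2 * ((1/2) ^ ((l - k) * i) * 2 ^ (k * CARD('n)))" unfolding C2_def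
            by (rule rep_kernel_fine[OF lv(4) lv(5) lz(4) \<phi>(2,1)]) (use lv False in auto)
          also have "\<dots> \<le> D * ((1/2) ^ ((l - k) * i) * 2 ^ (k * CARD('n)))" using D by (simp add: mult_right_mono)
          finally show ?thesis using False by (simp add: min_absorb1)
        next
          case True
          show ?thesis
          proof (cases "k = 0")
            \<comment> \<open>Level 0 of the family is \<open>\<zeta>\<close> itself, whose moments
              need not vanish. But then \<open>l = 0\<close> as well, no decay is claimed, and the
              coarse bound with zero moments suffices.\<close>
            case k: True
            have "norm (rep_kernel \<phi> i l ?h z) \<le> C1 0 * ((1/2) ^ ((k - l) * 0) * 2 ^ (l * CARD('n)))" unfolding C1_def
              by (rule rep_kernel_coarse[OF lv(4) lv(5) lz(4)]) (use lv lz True in auto)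
            also have "\<dots> \<le> D * 2 ^ (l * CARD('n))" using D by simp
            finally show ?thesis using True k by simp
          next
            case k: False
            have "norm (rep_kernel \<phi> i l ?h z) \<le> C1 L * ((1/2) ^ ((k - l) * L) * 2 ^ (l * CARD('n)))" unfolding C1_def
              by (rule rep_kernel_coarse[OF lv(4) lv(5) lz(4) momk[OF _ k]]) (use lv lz True in auto)
            also have "\<dots> \<le> D * ((1/2) ^ ((k - l) * L) * 2 ^ (l * CARD('n)))" using D by (simp add: mult_right_mono)
            finally show ?thesis using True by (simp add: min_absorb2)
          qed
        qed
      qed
    qed auto
    finally show ?thesis .
  qed
  then show ?thesis using D R' by (intro exI[of _ D] conjI exI[of _ R']) auto
qed

text \<open>\<open>C\<close> and \<open>N\<close> depend on \<open>f\<close>. The bound only serves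
  to show that a maximal function with sufficiently large parameters is finite.\<close>

theorem conv_growth:
  fixes \<phi> :: "real^'n::finite \<Rightarrow> complex"
  assumes \<phi>: "\<phi> \<in> test_functions" and f: "f \<in> S'_e"
  shows "\<exists>C N::nat. 0 \<le> (C::real) \<and> (\<forall>l x. norm (conv (dyadic_family \<phi> l) f x) \<le> C * (2 ^ (l * N) * exp (real N * norm x)))"
proof -
  obtain C N where CN: "0 \<le> C" "\<And>\<psi> \<rho> B. \<psi> \<in> test_functions \<Longrightarrow> supp_le \<rho> \<psi> \<Longrightarrow> 0 \<le> B \<Longrightarrow> (\<forall>m\<le>N. deriv_bound m B \<psi>) \<Longrightarrow>
    norm (f \<psi>) \<le> C * exp (real N * \<rho>) * B" using S'_e_bound[OF f] by metis
  obtain R A Bs where lv: "0 < R" "0 \<le> A" "\<And>m. 0 \<le> Bs m" "\<And>l. level_bounds R A Bs l (dyadic_family \<phi> l)"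
    using level_bounds_dyadic_family[OF \<phi>] by metis
  let ?N = "CARD('n) + N" and ?B = "sum Bs {..N}"
  have "norm (conv (dyadic_family \<phi> l) f x) \<le> (C * exp (real N * R) * ?B) * (2 ^ (l * ?N) * exp (real ?N * norm x))" for l x
  proof -
    let ?h = "dyadic_family \<phi> l"
    have th: "?h \<in> test_functions" by (rule test_dyadic_family[OF \<phi>])
    have "R / 2 ^ l \<le> R" using divide_pow_mono[of R 0 l] lv(1) by simp
    then have "supp_le R ?h" using lv(4)[of l] by (auto simp: level_bounds_def intro: supp_le_mono)
    then have s: "supp_le (R + norm x) (\<lambda>y. ?h (x - y))" by (rule supp_le_refl)
    have "deriv_bound m (2 ^ (l * ?N) * ?B) ?h" if "m \<le> N" for m
    proof (rule deriv_bound_mono)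
      show "deriv_bound m (2 ^ (l * (CARD('n) + m)) * Bs m) ?h" using lv(4)[of l] by (auto simp: level_bounds_def)
      show "2 ^ (l * (CARD('n) + m)) * Bs m \<le> 2 ^ (l * ?N) * ?B"
        using that lv(3) by (intro mult_mono power_increasing member_le_sum) auto
    qed
    then have "norm (conv ?h f x) \<le> C * exp (real N * (R + norm x)) * (2 ^ (l * ?N) * ?B)"
      unfolding conv_def using lv(3) by (intro CN(2)[OF test_refl[OF th] s]) (auto intro!: deriv_bound_refl[OF th] sum_nonneg mult_nonneg_nonneg)
    also have "exp (real N * (R + norm x)) = exp (real N * R) * exp (real N * norm x)"
      by (simp add: distrib_left exp_add)
    also have "C * (exp (real N * R) * exp (real N * norm x)) * (2 ^ (l * ?N) * ?B)
       \<le> C * (exp (real N * R) * exp (real ?N * norm x)) * (2 ^ (l * ?N) * ?B)"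
      using CN(1) lv(3) by (intro mult_right_mono mult_left_mono) (auto intro!: sum_nonneg mult_nonneg_nonneg simp: mult_right_mono)
    finally show ?thesis by (simp add: mult_ac)
  qed
  moreover have "0 \<le> C * exp (real N * R) * ?B" using CN(1) lv(3) by (simp add: sum_nonneg)
  ultimately show ?thesis by blast
qed

section \<open>Peetre's maximal function\<close>

lemma suminf_shift_le: "(\<Sum>m. k (l + m)) \<le> (\<Sum>p. k p :: ennreal)"
proof (rule suminf_le_const[OF summableI])
  fix M
  have "(\<Sum>m<M. k (l + m)) = sum k {l..<l + M}"
    using sum.shift_bounds_nat_ivl[of k 0 l M] by (simp add: atLeast0LessThan add.commute)
  also have "\<dots> \<le> sum k {..<l + M}" by (rule sum_mono2) auto
  also have "\<dots> \<le> (\<Sum>p. k p)" by (rule sum_le_suminf[OF summableI]) auto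
  finally show "(\<Sum>m<M. k (l + m)) \<le> (\<Sum>p. k p)" .
qed

text \<open>The exponent combines the decay \<open>2 ^ (- l i)\<close> with the volume factor
  \<open>2 ^ (l n)\<close>; dividing out the power \<open>1 - \<mu>\<close> of the maximal function
  turns \<open>i\<close> into \<open>i * \<mu>\<close>. The weight decays on the coarse scale
  \<open>2 ^ -j\<close>, on which the conditions on the weights apply.\<close>

definition peetre_sum :: "(nat \<Rightarrow> real^'n::finite \<Rightarrow> real) \<Rightarrow> real \<Rightarrow> nat \<Rightarrow> real \<Rightarrow> nat \<Rightarrow> real^'n \<Rightarrow> ennreal" where
  "peetre_sum u \<mu> i B j x = (\<Sum>l. ennreal (2 powr (- (real l * (real i * \<mu> - real CARD('n)))) * 2 ^ (j * CARD('n))) *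
     (\<integral>\<^sup>+w. ennreal (exp (- (\<mu> * (B * (2 ^ j * norm (x - w))))) * u (j + l) w powr \<mu>) \<partial>lborel))"

text \<open>With \<open>p = l + m\<close> the exponents of 2 are \<open>- p i\<close> from the
  decay, \<open>p n\<close> from the volume factor after \<open>l <= p\<close>, and
  \<open>p i (1 - \<mu>)\<close> from the bound of the power of \<open>v\<close>; their sum is
  \<open>- p (i \<mu> - n)\<close>. Moving the exponential weight from \<open>y\<close> to
  \<open>w\<close> costs \<open>exp (B * R)\<close>, whatever the level.\<close>

lemma peetre_pointwise:
  fixes x y w :: "real^'n::finite"
  assumes \<mu>: "0 < \<mu>" "\<mu> \<le> 1" and B: "0 \<le> B" and C: "0 \<le> C" and v: "0 \<le> v" and X: "0 \<le> X"
    and vX: "v \<le> X * 2 ^ ((l + m) * i) * exp (B * (2 ^ j * norm (x - w)))"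
    and w: "norm (y - w) \<le> R / 2 ^ (j + l)"
  shows "((1/2) ^ (l * i) * exp (- (B * (2 ^ j * norm (x - y))))) * (C * ((1/2) ^ (m * i) * 2 ^ ((j + l) * n)) * v)
     \<le> (C * exp (B * R) * X powr (1 - \<mu>)) * ((2 powr (- (real (l + m) * (real i * \<mu> - real n))) * 2 ^ (j * n)) *
        (exp (- (\<mu> * (B * (2 ^ j * norm (x - w))))) * v powr \<mu>))"
proof (cases "v = 0")
  case False
  define E where "E = B * (2 ^ j * norm (x - w))"
  define p where "p = l + m"
  have v0: "0 < v" using False v by simp
  have X0: "0 < X"
  proof (rule ccontr)
    assume "\<not> 0 < X"
    then have "X = 0" using X by simp
    then show False using vX v0 by simp
  qed
  have e1: "exp (- (B * (2 ^ j * norm (x - y)))) \<le> exp (B * R) * exp (- E)"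
  proof -
    have "R / 2 ^ (j + l) * 2 ^ j \<le> R"
    proof -
      have "R / 2 ^ (j + l) * 2 ^ j = R / 2 ^ l" by (simp add: power_add)
      moreover have "0 \<le> R" using w norm_ge_zero[of "y - w"] by (smt (verit, ccfv_SIG) divide_neg_pos zero_less_power)
      ultimately show ?thesis using divide_pow_mono[of R 0 l] by simp
    qed
    moreover have "norm (x - w) \<le> norm (x - y) + norm (y - w)" using norm_triangle_ineq[of "x - y" "y - w"] by simp
    then have "2 ^ j * norm (x - w) \<le> 2 ^ j * (norm (x - y) + R / 2 ^ (j + l))" using w by (intro mult_left_mono) auto
    ultimately have "2 ^ j * norm (x - w) \<le> 2 ^ j * norm (x - y) + R" by (simp add: distrib_left mult.commute)
    then have "E \<le> B * (2 ^ j * norm (x - y) + R)" unfolding E_def using B by (intro mult_left_mono)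
    then show ?thesis by (simp add: exp_add[symmetric] algebra_simps)
  qed
  have "v = v powr \<mu> * v powr (1 - \<mu>)" using v0 by (simp add: powr_add[symmetric])
  also have "v powr (1 - \<mu>) \<le> (X * 2 ^ (p * i) * exp E) powr (1 - \<mu>)"
    using vX v0 \<mu> by (intro powr_mono2) (auto simp: p_def E_def)
  also have "(X * 2 ^ (p * i) * exp E) powr (1 - \<mu>) = X powr (1 - \<mu>) * 2 powr (real (p * i) * (1 - \<mu>)) * exp ((1 - \<mu>) * E)"
    using X0 by (simp add: powr_mult powr_realpow[symmetric] powr_powr exp_powr_real mult.commute)
  finally have e2: "v \<le> v powr \<mu> * (X powr (1 - \<mu>) * 2 powr (real (p * i) * (1 - \<mu>)) * exp ((1 - \<mu>) * E))"
    by (simp add: mult_left_mono)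
  have e3: "(1/2::real) ^ (l * i) * (1/2) ^ (m * i) = 2 powr (- real (p * i))"
    unfolding p_def by (simp add: power_add[symmetric] distrib_right[symmetric] powr_minus powr_realpow power_one_over inverse_eq_divide del: of_nat_mult of_nat_add)
  have e4: "(2::real) ^ ((j + l) * n) \<le> 2 ^ (j * n) * 2 powr (real (p * n))"
  proof -
    have "(2::real) ^ ((j + l) * n) = 2 ^ (j * n) * 2 ^ (l * n)" by (simp add: distrib_right power_add)
    also have "(2::real) ^ (l * n) \<le> 2 ^ (p * n)" by (intro power_increasing) (auto simp: p_def)
    finally show ?thesis by (simp add: powr_realpow[symmetric] del: of_nat_mult)
  qed
  have "((1/2) ^ (l * i) * exp (- (B * (2 ^ j * norm (x - y))))) * (C * ((1/2) ^ (m * i) * 2 ^ ((j + l) * n)) * v)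
     = C * ((1/2::real) ^ (l * i) * (1/2) ^ (m * i)) * exp (- (B * (2 ^ j * norm (x - y)))) * 2 ^ ((j + l) * n) * v"
    by (simp add: mult_ac)
  also have "\<dots> \<le> C * 2 powr (- real (p * i)) * (exp (B * R) * exp (- E)) * (2 ^ (j * n) * 2 powr (real (p * n))) *
      (v powr \<mu> * (X powr (1 - \<mu>) * 2 powr (real (p * i) * (1 - \<mu>)) * exp ((1 - \<mu>) * E)))"
    unfolding e3 using C v by (intro mult_mono e1 e2 e4 order_refl) auto
  also have "\<dots> = (C * exp (B * R) * X powr (1 - \<mu>)) * (((2 powr (- real (p * i)) * 2 powr (real (p * n)) * 2 powr (real (p * i) * (1 - \<mu>))) * 2 ^ (j * n)) *
        ((exp (- E) * exp ((1 - \<mu>) * E)) * v powr \<mu>))"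
    by (simp add: mult_ac)
  also have "2 powr (- real (p * i)) * 2 powr (real (p * n)) * 2 powr (real (p * i) * (1 - \<mu>)) = 2 powr (- (real p * (real i * \<mu> - real n)))"
    by (simp add: powr_add[symmetric] algebra_simps)
  also have "exp (- E) * exp ((1 - \<mu>) * E) = exp (- (\<mu> * E))"
    by (simp add: exp_add[symmetric] algebra_simps)
  finally show ?thesis unfolding E_def p_def .
qed simp

text \<open>The local estimate detached from distributions: Peetre's argument uses nonnegative
  functions only.\<close>

definition self_est :: "(nat \<Rightarrow> real^'n::finite \<Rightarrow> real) \<Rightarrow> nat \<Rightarrow> real \<Rightarrow> real \<Rightarrow> bool" where
  "self_est u i C R \<longleftrightarrow> (\<forall>j x. ennreal (u j x) \<le> (\<Sum>l. ennreal (C * ((1/2) ^ (l * i) * 2 ^ (j * CARD('n)))) *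
       (\<integral>\<^sup>+w. ennreal (u (j + l) w) * indicator (cball x (R / 2 ^ j)) w \<partial>lborel)))"

text \<open>The supremum also runs over finer levels, with the same exponent \<open>i\<close> as in
  the local estimate; this is what allows the estimate at \<open>(j + l, y)\<close> to be absorbed
  at \<open>(j, x)\<close>.\<close>

definition peetre_max :: "(nat \<Rightarrow> real^'n::finite \<Rightarrow> real) \<Rightarrow> nat \<Rightarrow> real \<Rightarrow> nat \<Rightarrow> real^'n \<Rightarrow> ennreal" where
  "peetre_max u i B j x = (SUP (l, y). ennreal ((1/2) ^ (l * i) * exp (- (B * (2 ^ j * norm (x - y)))) * u (j + l) y))"

context
  fixes u :: "nat \<Rightarrow> real^'n::finite \<Rightarrow> real" and \<mu> :: real
  assumes \<mu>: "0 < \<mu>" "\<mu> \<le> 1" and u0: "\<And>l y. 0 \<le> u l y" and um: "\<And>l. u l \<in> borel_measurable borel"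
begin

lemma peetre_max_upper: "ennreal ((1/2) ^ (l * i) * exp (- (B * (2 ^ j * norm (x - y)))) * u (j + l) y) \<le> peetre_max u i B j x"
  unfolding peetre_max_def by (rule SUP_upper2[of "(l, y)"]) auto

text \<open>In the estimate for \<open>u\<close> write \<open>u = u\<^sup>\<mu> u\<^bsup>1-\<mu>\<^esup>\<close> and bound the second factor by the maximal function; if the
  latter is finite, its power \<open>1 - \<mu>\<close> can be divided out.\<close>

lemma peetre_max_finite_bound:
  assumes S: "self_est u i C R" and C: "0 \<le> C" and B: "0 \<le> B" and fin: "peetre_max u i B j x < \<infinity>"
  shows "ennreal (((1/2) ^ (l * i) * exp (- (B * (2 ^ j * norm (x - y)))) * u (j + l) y) powr \<mu>)
    \<le> ennreal ((C + 1) * exp (B * R)) * peetre_sum u \<mu> i B j x"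
proof -
  define X where "X = enn2real (peetre_max u i B j x)"
  have X: "peetre_max u i B j x = ennreal X" "0 \<le> X" using fin by (auto simp: X_def)
  define k where "k l = ennreal (2 powr (- (real l * (real i * \<mu> - real CARD('n)))) * 2 ^ (j * CARD('n))) *
     (\<integral>\<^sup>+w. ennreal (exp (- (\<mu> * (B * (2 ^ j * norm (x - w))))) * u (j + l) w powr \<mu>) \<partial>lborel)" for l
  have K: "peetre_sum u \<mu> i B j x = (\<Sum>l. k l)" by (simp add: peetre_sum_def k_def)
  note um [measurable]
  have [measurable]: "cball c r \<in> sets borel" for c :: "real^'n" and r by auto
  have ub: "u (j + p) w \<le> X * 2 ^ (p * i) * exp (B * (2 ^ j * norm (x - w)))" for p w
  proof -
    have "ennreal ((1/2) ^ (p * i) * exp (- (B * (2 ^ j * norm (x - w)))) * u (j + p) w) \<le> ennreal X"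
      using peetre_max_upper[of p i B j x w] X by simp
    then have "(1/2) ^ (p * i) * exp (- (B * (2 ^ j * norm (x - w)))) * u (j + p) w \<le> X"
      using X(2) by (simp add: ennreal_le_iff)
    then show ?thesis by (simp add: exp_minus power_one_over field_simps)
  qed
  have bound: "ennreal ((1/2) ^ (l * i) * exp (- (B * (2 ^ j * norm (x - y)))) * u (j + l) y)
      \<le> ennreal (C * exp (B * R) * X powr (1 - \<mu>)) * (\<Sum>p. k p)" for l y
  proof -
    let ?a = "(1/2) ^ (l * i) * exp (- (B * (2 ^ j * norm (x - y))))"
    have "ennreal (?a * u (j + l) y) = ennreal ?a * ennreal (u (j + l) y)"
      by (rule ennreal_mult) (auto simp: u0)
    also have "\<dots> \<le> ennreal ?a * (\<Sum>m. ennreal (C * ((1/2) ^ (m * i) * 2 ^ ((j + l) * CARD('n)))) *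
       (\<integral>\<^sup>+w. ennreal (u (j + l + m) w) * indicator (cball y (R / 2 ^ (j + l))) w \<partial>lborel))"
      using S unfolding self_est_def by (intro mult_left_mono) auto
    also have "\<dots> = (\<Sum>m. ennreal ?a * (ennreal (C * ((1/2) ^ (m * i) * 2 ^ ((j + l) * CARD('n)))) *
       (\<integral>\<^sup>+w. ennreal (u (j + l + m) w) * indicator (cball y (R / 2 ^ (j + l))) w \<partial>lborel)))"
      by (rule ennreal_suminf_cmult[symmetric])
    also have "\<dots> \<le> (\<Sum>m. ennreal (C * exp (B * R) * X powr (1 - \<mu>)) * k (l + m))"
    proof (rule suminf_le)
      fix m
      let ?c = "C * ((1/2) ^ (m * i) * 2 ^ ((j + l) * CARD('n)))"
      let ?d = "2 powr (- (real (l + m) * (real i * \<mu> - real CARD('n)))) * 2 ^ (j * CARD('n))"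
      have "ennreal ?a * (ennreal ?c * (\<integral>\<^sup>+w. ennreal (u (j + l + m) w) * indicator (cball y (R / 2 ^ (j + l))) w \<partial>lborel))
        = (\<integral>\<^sup>+w. ennreal ?a * (ennreal ?c * (ennreal (u (j + l + m) w) * indicator (cball y (R / 2 ^ (j + l))) w)) \<partial>lborel)"
        by (simp add: nn_integral_cmult)
      also have "\<dots> \<le> (\<integral>\<^sup>+w. ennreal (C * exp (B * R) * X powr (1 - \<mu>)) * (ennreal ?d * ennreal (exp (- (\<mu> * (B * (2 ^ j * norm (x - w))))) * u (j + (l + m)) w powr \<mu>)) \<partial>lborel)"
      proof (rule nn_integral_mono)
        fix w
        show "ennreal ?a * (ennreal ?c * (ennreal (u (j + l + m) w) * indicator (cball y (R / 2 ^ (j + l))) w))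
          \<le> ennreal (C * exp (B * R) * X powr (1 - \<mu>)) * (ennreal ?d * ennreal (exp (- (\<mu> * (B * (2 ^ j * norm (x - w))))) * u (j + (l + m)) w powr \<mu>))"
        proof (cases "w \<in> cball y (R / 2 ^ (j + l))")
          case True
          have "?a * (?c * u (j + (l + m)) w) \<le> (C * exp (B * R) * X powr (1 - \<mu>)) * (?d * (exp (- (\<mu> * (B * (2 ^ j * norm (x - w))))) * u (j + (l + m)) w powr \<mu>))"
            by (rule peetre_pointwise[OF \<mu> B C u0 X(2) ub]) (use True in \<open>simp add: dist_norm\<close>)
          then have "ennreal (?a * (?c * u (j + (l + m)) w)) \<le> ennreal ((C * exp (B * R) * X powr (1 - \<mu>)) * (?d * (exp (- (\<mu> * (B * (2 ^ j * norm (x - w))))) * u (j + (l + m)) w powr \<mu>)))"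
            by (rule ennreal_leI)
          then show ?thesis using True C u0 by (simp add: ennreal_mult add.assoc)
        qed simp
      qed
      also have "\<dots> = ennreal (C * exp (B * R) * X powr (1 - \<mu>)) * k (l + m)"
        unfolding k_def by (simp add: nn_integral_cmult)
      finally show "ennreal ?a * (ennreal ?c * (\<integral>\<^sup>+w. ennreal (u (j + l + m) w) * indicator (cball y (R / 2 ^ (j + l))) w \<partial>lborel))
         \<le> ennreal (C * exp (B * R) * X powr (1 - \<mu>)) * k (l + m)" .
    qed auto
    also have "\<dots> = ennreal (C * exp (B * R) * X powr (1 - \<mu>)) * (\<Sum>m. k (l + m))"
      by (rule ennreal_suminf_cmult)
    also have "\<dots> \<le> ennreal (C * exp (B * R) * X powr (1 - \<mu>)) * (\<Sum>p. k p)"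
      by (intro mult_left_mono suminf_shift_le) auto
    finally show ?thesis by (simp add: mult_ac)
  qed
  have XK: "ennreal X \<le> ennreal (C * exp (B * R) * X powr (1 - \<mu>)) * (\<Sum>p. k p)"
    unfolding X(1)[symmetric] peetre_max_def by (rule SUP_least) (auto intro: bound)
  \<comment> \<open>Using \<open>C + 1\<close> instead of \<open>C\<close> keeps the constant
    nonzero, so that an infinite sum makes the bound trivial.\<close>
  have powX: "ennreal (X powr \<mu>) \<le> ennreal ((C + 1) * exp (B * R)) * (\<Sum>p. k p)"
  proof (cases "X = 0")
    case False
    then have X0: "0 < X" using X(2) by simp
    show ?thesis
    proof (cases "(\<Sum>p. k p) = \<infinity>")
      case True
      have "ennreal ((C + 1) * exp (B * R)) \<noteq> 0" using C by (simp add: ennreal_eq_0_iff add_nonneg_pos not_le)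
      then show ?thesis using True by (simp add: ennreal_mult_eq_top_iff)
    next
      case False
      then obtain S where S: "(\<Sum>p. k p) = ennreal S" "0 \<le> S" by (cases "\<Sum>p. k p") auto
      have "X \<le> C * exp (B * R) * X powr (1 - \<mu>) * S"
        using XK S C by (simp add: ennreal_mult[symmetric])
      then have "X powr (\<mu> - 1) * X \<le> X powr (\<mu> - 1) * (C * exp (B * R) * X powr (1 - \<mu>) * S)"
        by (intro mult_left_mono) auto
      also have "\<dots> = (X powr (\<mu> - 1) * X powr (1 - \<mu>)) * (C * exp (B * R) * S)" by (simp add: mult_ac)
      also have "X powr (\<mu> - 1) * X powr (1 - \<mu>) = 1" using X0 by (simp add: powr_add[symmetric])
      finally have "X powr (\<mu> - 1) * X \<le> C * exp (B * R) * S" by simp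
      also have "X powr (\<mu> - 1) * X = X powr \<mu>" using X0 powr_add[of X "\<mu> - 1" 1] by simp
      also have "C * exp (B * R) * S \<le> (C + 1) * exp (B * R) * S" using S(2) by (intro mult_right_mono) auto
      finally show ?thesis using S C by (simp add: ennreal_mult[symmetric] ennreal_leI)
    qed
  qed simp
  have "(1/2) ^ (l * i) * exp (- (B * (2 ^ j * norm (x - y)))) * u (j + l) y \<le> X"
    using peetre_max_upper[of l i B j x y] X by (simp add: ennreal_le_iff)
  then have "((1/2) ^ (l * i) * exp (- (B * (2 ^ j * norm (x - y)))) * u (j + l) y) powr \<mu> \<le> X powr \<mu>"
    using u0 \<mu> by (intro powr_mono2) auto
  then show ?thesis unfolding K using powX by (meson ennreal_leI order_trans)
qed

text \<open>\<open>2 ^ (- l i)\<close> absorbs the growth \<open>2 ^ (l N)\<close> in the level, and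
  by the triangle inequality the weight absorbs \<open>exp (N * norm y)\<close> up to a factor
  depending on \<open>x\<close>.\<close>

lemma peetre_max_growth:
  fixes N :: nat
  assumes g: "\<And>l y. u l y \<le> D * (2 ^ (l * N) * exp (real N * norm y))" and D: "0 \<le> D"
    and i: "N \<le> i" and B: "real N \<le> B"
  shows "peetre_max u i B j x < \<infinity>"
proof -
  have "peetre_max u i B j x \<le> ennreal (D * (2 ^ (j * N) * exp (real N * norm x)))"
    unfolding peetre_max_def
  proof (intro SUP_least, clarify)
    fix l y
    have 1: "(1/2::real) ^ (l * i) * 2 ^ ((j + l) * N) \<le> 2 ^ (j * N)"
    proof -
      have "(1/2::real) ^ (l * i) \<le> (1/2) ^ (l * N)" using i by (intro power_decreasing) auto
      then have "(1/2::real) ^ (l * i) * 2 ^ ((j + l) * N) \<le> (1/2) ^ (l * N) * 2 ^ ((j + l) * N)" by (rule mult_right_mono) simp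
      also have "\<dots> = 2 ^ (j * N)" by (simp add: distrib_right power_add power_one_over)
      finally show ?thesis .
    qed
    have 2: "exp (- (B * (2 ^ j * norm (x - y)))) * exp (real N * norm y) \<le> exp (real N * norm x)"
    proof -
      have "real N * norm y \<le> real N * (norm x + norm (x - y))"
        using norm_triangle_sub[of y x] by (intro mult_left_mono) (auto simp: norm_minus_commute)
      moreover have "real N * norm (x - y) \<le> B * (2 ^ j * norm (x - y))"
      proof (rule mult_mono[OF B])
        show "norm (x - y) \<le> 2 ^ j * norm (x - y)" using mult_right_mono[of 1 "2 ^ j :: real" "norm (x - y)"] by simp
      qed (use B in auto)
      ultimately have "- (B * (2 ^ j * norm (x - y))) + real N * norm y \<le> real N * norm x" by (simp add: distrib_left)
      then show ?thesis by (simp add: exp_add[symmetric])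
    qed
    have "(1/2) ^ (l * i) * exp (- (B * (2 ^ j * norm (x - y)))) * u (j + l) y
      \<le> (1/2) ^ (l * i) * exp (- (B * (2 ^ j * norm (x - y)))) * (D * (2 ^ ((j + l) * N) * exp (real N * norm y)))"
      by (intro mult_left_mono g) auto
    also have "\<dots> = D * (((1/2) ^ (l * i) * 2 ^ ((j + l) * N)) * (exp (- (B * (2 ^ j * norm (x - y)))) * exp (real N * norm y)))"
      by (simp only: mult_ac)
    also have "\<dots> \<le> D * (2 ^ (j * N) * exp (real N * norm x))"
      using D 1 2 by (intro mult_left_mono mult_mono) auto
    finally show "ennreal ((1/2) ^ (l * i) * exp (- (B * (2 ^ j * norm (x - y)))) * u (j + l) y) \<le> ennreal (D * (2 ^ (j * N) * exp (real N * norm x)))"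
      by (rule ennreal_leI)
  qed
  then show ?thesis by (rule le_less_trans) simp
qed

lemma peetre_sum_antimono:
  assumes "i \<le> i'" "B \<le> B'"
  shows "peetre_sum u \<mu> i' B' j x \<le> peetre_sum u \<mu> i B j x"
  unfolding peetre_sum_def
proof (rule suminf_le)
  fix l
  have 1: "2 powr - (real l * (real i' * \<mu> - real CARD('n))) * 2 ^ (j * CARD('n)) \<le> 2 powr - (real l * (real i * \<mu> - real CARD('n))) * 2 ^ (j * CARD('n))"
    using assms(1) \<mu> by (intro mult_right_mono powr_mono) (auto intro!: mult_left_mono mult_right_mono)
  have 2: "exp (- (\<mu> * (B' * (2 ^ j * norm (x - w))))) * u (j + l) w powr \<mu> \<le> exp (- (\<mu> * (B * (2 ^ j * norm (x - w))))) * u (j + l) w powr \<mu>" for w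
  proof -
    have "\<mu> * (B * (2 ^ j * norm (x - w))) \<le> \<mu> * (B' * (2 ^ j * norm (x - w)))"
      using assms(2) \<mu> by (intro mult_left_mono mult_right_mono) auto
    then show ?thesis by (intro mult_right_mono) auto
  qed
  show "ennreal (2 powr - (real l * (real i' * \<mu> - real CARD('n))) * 2 ^ (j * CARD('n))) *
      (\<integral>\<^sup>+w. ennreal (exp (- (\<mu> * (B' * (2 ^ j * norm (x - w))))) * u (j + l) w powr \<mu>) \<partial>lborel)
    \<le> ennreal (2 powr - (real l * (real i * \<mu> - real CARD('n))) * 2 ^ (j * CARD('n))) *
      (\<integral>\<^sup>+w. ennreal (exp (- (\<mu> * (B * (2 ^ j * norm (x - w))))) * u (j + l) w powr \<mu>) \<partial>lborel)"
    by (intro mult_mono nn_integral_mono ennreal_leI 1 2) auto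
qed auto

text \<open>A triangle inequality for the weights: the factor with which \<open>(j + l, y)\<close>
  enters the maximal function, to the power \<open>\<mu>\<close>, is paid for by the decay inside
  the sum. Hence a pointwise bound at all \<open>(j + l, y)\<close> becomes a bound of the supremum
  by the sum at \<open>(j, x)\<close>.\<close>

lemma peetre_sum_shift:
  assumes B: "0 \<le> B"
  shows "ennreal (((1/2) ^ (l * i) * exp (- (B * (2 ^ j * norm (x - y))))) powr \<mu>) * peetre_sum u \<mu> i B (j + l) y \<le> peetre_sum u \<mu> i B j x"
proof -
  define k where "k l = ennreal (2 powr (- (real l * (real i * \<mu> - real CARD('n)))) * 2 ^ (j * CARD('n))) *
     (\<integral>\<^sup>+w. ennreal (exp (- (\<mu> * (B * (2 ^ j * norm (x - w))))) * u (j + l) w powr \<mu>) \<partial>lborel)" for l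
  note um [measurable]
  let ?a = "((1/2) ^ (l * i) * exp (- (B * (2 ^ j * norm (x - y))))) powr \<mu>"
  have a: "?a = 2 powr (- (real l * (real i * \<mu>))) * exp (- (\<mu> * (B * (2 ^ j * norm (x - y)))))"
  proof -
    have "(1/2::real) ^ (l * i) = 2 powr (- real (l * i))"
      by (simp add: powr_minus powr_realpow power_one_over inverse_eq_divide del: of_nat_mult)
    then have "?a = (2 powr (- real (l * i))) powr \<mu> * exp (- (B * (2 ^ j * norm (x - y)))) powr \<mu>"
      by (simp add: powr_mult)
    then show ?thesis by (simp add: powr_powr exp_powr_real mult_ac)
  qed
  have "ennreal ?a * peetre_sum u \<mu> i B (j + l) y = (\<Sum>m. ennreal ?a * (ennreal (2 powr (- (real m * (real i * \<mu> - real CARD('n)))) * 2 ^ ((j + l) * CARD('n))) *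
     (\<integral>\<^sup>+w. ennreal (exp (- (\<mu> * (B * (2 ^ (j + l) * norm (y - w))))) * u (j + l + m) w powr \<mu>) \<partial>lborel)))"
    unfolding peetre_sum_def by (rule ennreal_suminf_cmult[symmetric])
  also have "\<dots> \<le> (\<Sum>m. k (l + m))"
  proof (rule suminf_le)
    fix m
    let ?c = "2 powr (- (real m * (real i * \<mu> - real CARD('n)))) * 2 ^ ((j + l) * CARD('n))"
    let ?d = "2 powr (- (real (l + m) * (real i * \<mu> - real CARD('n)))) * 2 ^ (j * CARD('n))"
    have cd: "2 powr (- (real l * (real i * \<mu>))) * ?c = ?d"
    proof -
      have "(2::real) ^ ((j + l) * CARD('n)) = 2 ^ (j * CARD('n)) * 2 powr (real l * real CARD('n))"
        by (simp add: distrib_right power_add powr_realpow[symmetric])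
      then have "2 powr (- (real l * (real i * \<mu>))) * ?c = (2 powr (- (real l * (real i * \<mu>))) * 2 powr (- (real m * (real i * \<mu> - real CARD('n)))) * 2 powr (real l * real CARD('n))) * 2 ^ (j * CARD('n))"
        by (simp only: mult_ac)
      also have "2 powr (- (real l * (real i * \<mu>))) * 2 powr (- (real m * (real i * \<mu> - real CARD('n)))) * 2 powr (real l * real CARD('n)) = 2 powr (- (real (l + m) * (real i * \<mu> - real CARD('n))))"
        by (simp add: powr_add[symmetric] algebra_simps)
      finally show ?thesis .
    qed
    have "ennreal ?a * (ennreal ?c * (\<integral>\<^sup>+w. ennreal (exp (- (\<mu> * (B * (2 ^ (j + l) * norm (y - w))))) * u (j + l + m) w powr \<mu>) \<partial>lborel))
      = (\<integral>\<^sup>+w. ennreal ?a * (ennreal ?c * ennreal (exp (- (\<mu> * (B * (2 ^ (j + l) * norm (y - w))))) * u (j + l + m) w powr \<mu>)) \<partial>lborel)"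
      by (simp add: nn_integral_cmult)
    also have "\<dots> \<le> (\<integral>\<^sup>+w. ennreal ?d * ennreal (exp (- (\<mu> * (B * (2 ^ j * norm (x - w))))) * u (j + (l + m)) w powr \<mu>) \<partial>lborel)"
    proof (rule nn_integral_mono)
      fix w
      have "exp (- (\<mu> * (B * (2 ^ j * norm (x - y))))) * exp (- (\<mu> * (B * (2 ^ (j + l) * norm (y - w))))) \<le> exp (- (\<mu> * (B * (2 ^ j * norm (x - w)))))"
      proof -
        have "2 ^ j * norm (x - w) \<le> 2 ^ j * norm (x - y) + 2 ^ (j + l) * norm (y - w)"
        proof -
          have "2 ^ j * norm (x - w) \<le> 2 ^ j * (norm (x - y) + norm (y - w))"
            using norm_triangle_ineq[of "x - y" "y - w"] by (intro mult_left_mono) auto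
          moreover have "2 ^ j * norm (y - w) \<le> 2 ^ (j + l) * norm (y - w)" by (intro mult_right_mono power_increasing) auto
          ultimately show ?thesis by (simp add: distrib_left)
        qed
        then have "\<mu> * (B * (2 ^ j * norm (x - w))) \<le> \<mu> * (B * (2 ^ j * norm (x - y) + 2 ^ (j + l) * norm (y - w)))"
          using \<mu> B by (intro mult_left_mono) auto
        then show ?thesis by (simp add: exp_add[symmetric] distrib_left)
      qed
      then have "?d * ((exp (- (\<mu> * (B * (2 ^ j * norm (x - y))))) * exp (- (\<mu> * (B * (2 ^ (j + l) * norm (y - w)))))) * u (j + l + m) w powr \<mu>)
         \<le> ?d * (exp (- (\<mu> * (B * (2 ^ j * norm (x - w))))) * u (j + (l + m)) w powr \<mu>)"
        by (intro mult_left_mono) (auto simp: add.assoc mult_right_mono)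
      moreover have "?a * (?c * (exp (- (\<mu> * (B * (2 ^ (j + l) * norm (y - w))))) * u (j + l + m) w powr \<mu>))
        = ?d * ((exp (- (\<mu> * (B * (2 ^ j * norm (x - y))))) * exp (- (\<mu> * (B * (2 ^ (j + l) * norm (y - w)))))) * u (j + l + m) w powr \<mu>)"
        unfolding a cd[symmetric] by (simp only: mult_ac)
      ultimately have "ennreal (?a * (?c * (exp (- (\<mu> * (B * (2 ^ (j + l) * norm (y - w))))) * u (j + l + m) w powr \<mu>)))
         \<le> ennreal (?d * (exp (- (\<mu> * (B * (2 ^ j * norm (x - w))))) * u (j + (l + m)) w powr \<mu>))"
        by (simp only: ennreal_leI)
      then show "ennreal ?a * (ennreal ?c * ennreal (exp (- (\<mu> * (B * (2 ^ (j + l) * norm (y - w))))) * u (j + l + m) w powr \<mu>))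
         \<le> ennreal ?d * ennreal (exp (- (\<mu> * (B * (2 ^ j * norm (x - w))))) * u (j + (l + m)) w powr \<mu>)"
        by (simp add: ennreal_mult[symmetric])
    qed
    also have "\<dots> = k (l + m)" unfolding k_def by (simp add: nn_integral_cmult)
    finally show "ennreal ?a * (ennreal ?c * (\<integral>\<^sup>+w. ennreal (exp (- (\<mu> * (B * (2 ^ (j + l) * norm (y - w))))) * u (j + l + m) w powr \<mu>) \<partial>lborel)) \<le> k (l + m)" .
  qed auto
  also have "\<dots> \<le> (\<Sum>p. k p)" by (rule suminf_shift_le)
  also have "\<dots> = peetre_sum u \<mu> i B j x" by (simp add: peetre_sum_def k_def)
  finally show ?thesis .
qed

text \<open>For \<open>i\<close> and \<open>B\<close> large the maximal function is finite by the growth of \<open>u\<close>, but how large depends on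
  \<open>u\<close>, and so does the constant obtained. This rough bound shows that the maximal function for the given
  \<open>i\<close> and \<open>B\<close> is finite as well, which gives a constant independent of \<open>u\<close>.\<close>

theorem peetre_estimate:
  fixes N :: nat
  assumes S: "self_est u i C R" and C: "0 \<le> C" and B: "0 \<le> B"
    and S': "\<And>i. \<exists>C\<ge>0. \<exists>R. self_est u i C R"
    and g: "\<And>l y. u l y \<le> D * (2 ^ (l * N) * exp (real N * norm y))" and D: "0 \<le> D"
  shows "ennreal (((1/2) ^ (l * i) * exp (- (B * (2 ^ j * norm (x - y)))) * u (j + l) y) powr \<mu>)
    \<le> ennreal ((C + 1) * exp (B * R)) * peetre_sum u \<mu> i B j x"
proof (cases "peetre_sum u \<mu> i B j x = \<infinity>")
  case True
  have "ennreal ((C + 1) * exp (B * R)) \<noteq> 0" using C by (simp add: ennreal_eq_0_iff add_nonneg_pos not_le)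
  then show ?thesis using True by (simp add: ennreal_mult_eq_top_iff)
next
  case False
  define i' where "i' = max i N"
  define B' where "B' = max B (real N)"
  obtain C' R' where CR: "0 \<le> C'" "self_est u i' C' R'" using S' by metis
  let ?c = "(C' + 1) * exp (B' * R')"
  have c0: "0 \<le> ?c" using CR by simp
  \<comment> \<open>The diagonal instance \<open>l = 0\<close>, \<open>y = x\<close> for the
    enlarged parameters; since the sum decreases in both parameters, the given ones may be restored
    on the right.\<close>
  have rough: "ennreal (u j x powr \<mu>) \<le> ennreal ?c * peetre_sum u \<mu> i B j x" for j x
  proof -
    have "ennreal (((1/2) ^ (0 * i') * exp (- (B' * (2 ^ j * norm (x - x)))) * u (j + 0) x) powr \<mu>)
      \<le> ennreal ?c * peetre_sum u \<mu> i' B' j x"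
      by (rule peetre_max_finite_bound[OF CR(2,1) _ peetre_max_growth[OF g D]]) (use B in \<open>auto simp: i'_def B'_def\<close>)
    then have "ennreal (u j x powr \<mu>) \<le> ennreal ?c * peetre_sum u \<mu> i' B' j x" by simp
    also have "\<dots> \<le> ennreal ?c * peetre_sum u \<mu> i B j x"
      by (intro mult_left_mono peetre_sum_antimono) (auto simp: i'_def B'_def)
    finally show ?thesis .
  qed
  obtain P where P: "peetre_sum u \<mu> i B j x = ennreal P" "0 \<le> P" using False by (cases "peetre_sum u \<mu> i B j x") auto
  have "peetre_max u i B j x \<le> ennreal ((?c * P) powr (1 / \<mu>))"
    unfolding peetre_max_def
  proof (intro SUP_least, clarify)
    fix l y
    let ?a = "(1/2) ^ (l * i) * exp (- (B * (2 ^ j * norm (x - y))))"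
    have "ennreal ((?a * u (j + l) y) powr \<mu>) = ennreal (?a powr \<mu>) * ennreal (u (j + l) y powr \<mu>)"
      using u0 by (simp add: powr_mult ennreal_mult[symmetric])
    also have "\<dots> \<le> ennreal (?a powr \<mu>) * (ennreal ?c * peetre_sum u \<mu> i B (j + l) y)"
      by (intro mult_left_mono rough) auto
    also have "\<dots> = ennreal ?c * (ennreal (?a powr \<mu>) * peetre_sum u \<mu> i B (j + l) y)" by (simp only: mult_ac)
    also have "\<dots> \<le> ennreal ?c * peetre_sum u \<mu> i B j x"
      by (intro mult_left_mono peetre_sum_shift B) auto
    also have "\<dots> = ennreal (?c * P)" using P c0 by (simp add: ennreal_mult)
    finally have "(?a * u (j + l) y) powr \<mu> \<le> ?c * P" using P(2) c0 by (simp add: ennreal_le_iff)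
    then have "((?a * u (j + l) y) powr \<mu>) powr (1 / \<mu>) \<le> (?c * P) powr (1 / \<mu>)"
      using \<mu> by (intro powr_mono2) auto
    moreover have "((?a * u (j + l) y) powr \<mu>) powr (1 / \<mu>) = ?a * u (j + l) y"
      using \<mu> u0[of "j + l" y] by (simp add: powr_powr)
    ultimately show "ennreal (?a * u (j + l) y) \<le> ennreal ((?c * P) powr (1 / \<mu>))"
      by (intro ennreal_leI) simp
  qed
  then have "peetre_max u i B j x < \<infinity>" by (rule le_less_trans) simp
  then show ?thesis by (rule peetre_max_finite_bound[OF S C B])
qed

end

section \<open>Quasi-norms and discrete Hardy operators\<close>

lemma epowr_top [simp]: "epowr \<infinity> a = \<infinity>" "epowr top a = top"
  by (simp_all add: epowr_def)

lemma epowr_ennreal: "0 \<le> x \<Longrightarrow> epowr (ennreal x) a = ennreal (x powr a)"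
  by (simp add: epowr_def)

lemma epowr_0 [simp]: "epowr 0 a = 0"
  by (simp add: epowr_def)

lemma epowr_1 [simp]: "epowr 1 a = 1"
  by (simp add: epowr_def)

lemma epowr_one [simp]: "epowr x 1 = x"
  by (cases x) (auto simp: epowr_ennreal)

lemma epowr_mono: "0 \<le> a \<Longrightarrow> x \<le> y \<Longrightarrow> epowr x a \<le> epowr y a"
  by (cases x; cases y) (auto simp: epowr_ennreal top_unique intro!: ennreal_leI powr_mono2)

lemma epowr_epowr: "epowr (epowr x a) b = epowr x (a * b)"
  by (cases x) (auto simp: epowr_ennreal powr_powr)

lemma epowr_mult: "0 < a \<Longrightarrow> epowr (x * y) a = epowr x a * epowr y a"
proof (cases x; cases y)
  fix r s assume "0 < a" "0 \<le> r" "x = ennreal r" "0 \<le> s" "y = ennreal s"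
  then show ?thesis by (simp add: epowr_ennreal ennreal_mult[symmetric] powr_mult)
next
  fix r assume a: "0 < a" "0 \<le> r" "x = ennreal r" "y = top"
  then show ?thesis by (cases "r = 0") (auto simp: epowr_ennreal ennreal_mult_top)
next
  fix r assume a: "0 < a" "0 \<le> r" "y = ennreal r" "x = top"
  then show ?thesis by (cases "r = 0") (auto simp: epowr_ennreal ennreal_top_mult)
next
  assume "x = top" "y = top" then show ?thesis by simp
qed

lemma epowr_eq_0_iff [simp]: "epowr x a = 0 \<longleftrightarrow> x = 0"
  by (cases x) (auto simp: epowr_ennreal)

lemma epowr_le_iff: "0 < a \<Longrightarrow> epowr x a \<le> y \<longleftrightarrow> x \<le> epowr y (1 / a)"
proof
  assume a: "0 < a" and "epowr x a \<le> y"
  then have "epowr (epowr x a) (1 / a) \<le> epowr y (1 / a)" by (intro epowr_mono) auto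
  then show "x \<le> epowr y (1 / a)" using a by (simp add: epowr_epowr)
next
  assume a: "0 < a" and "x \<le> epowr y (1 / a)"
  then have "epowr x a \<le> epowr (epowr y (1 / a)) a" by (intro epowr_mono) auto
  then show "epowr x a \<le> y" using a by (simp add: epowr_epowr)
qed

lemma epowr_measurable [measurable]: "(\<lambda>x. epowr x a) \<in> borel_measurable borel"
  unfolding epowr_def by measurable

text \<open>Split \<open>(r + s) powr a\<close> into the multiples of
  \<open>(r + s) powr (a - 1)\<close> by \<open>r\<close> and by \<open>s\<close>, and use that the
  exponent \<open>a - 1\<close> is not positive.\<close>

lemma epowr_add_le:
  assumes "0 < a" "a \<le> 1" shows "epowr (x + y) a \<le> epowr x a + epowr y a"
proof (cases x; cases y)
  fix r s assume rs: "0 \<le> r" "x = ennreal r" "0 \<le> s" "y = ennreal s"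
  have "(r + s) powr a \<le> r powr a + s powr a"
  proof (cases "r = 0 \<or> s = 0")
    case False
    then have p: "0 < r" "0 < s" using rs by auto
    have *: "c * (r + s) powr (a - 1) \<le> c powr a" if "0 < c" "c \<le> r + s" for c
    proof -
      have "c * (r + s) powr (a - 1) \<le> c * c powr (a - 1)"
        using that assms powr_mono2'[of "1 - a" c "r + s"] p by (intro mult_left_mono) (auto simp: powr_mono2')
      also have "\<dots> = c powr a" using that powr_add[of c 1 "a - 1"] by simp
      finally show ?thesis .
    qed
    have "(r + s) powr a = r * (r + s) powr (a - 1) + s * (r + s) powr (a - 1)"
      using p powr_add[of "r + s" 1 "a - 1"] by (simp add: distrib_right)
    also have "\<dots> \<le> r powr a + s powr a" using p by (intro add_mono *) auto
    finally show ?thesis .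
  qed auto
  then show ?thesis using rs by (simp add: epowr_ennreal ennreal_plus[symmetric] del: ennreal_plus)
qed auto

lemma epowr_sum_le:
  fixes n :: nat
  assumes "0 < a" "a \<le> 1" shows "epowr (\<Sum>i<n. f i) a \<le> (\<Sum>i<n. epowr (f i) a)"
proof (induction n)
  case (Suc n)
  have "epowr (\<Sum>i<Suc n. f i) a \<le> epowr (\<Sum>i<n. f i) a + epowr (f n) a"
    using epowr_add_le[OF assms] by simp
  also have "\<dots> \<le> (\<Sum>i<n. epowr (f i) a) + epowr (f n) a" by (intro add_right_mono Suc)
  finally show ?case by simp
qed simp

text \<open>The power is moved to the right-hand side, so that it suffices to bound partial
  sums.\<close>

lemma epowr_suminf_le:
  assumes "0 < a" "a \<le> 1" shows "epowr (\<Sum>i. f i) a \<le> (\<Sum>i. epowr (f i) a)"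
  unfolding epowr_le_iff[OF assms(1)]
proof (rule suminf_le_const[OF summableI])
  fix n
  have "epowr (\<Sum>i<n. f i) a \<le> (\<Sum>i<n. epowr (f i) a)" by (rule epowr_sum_le[OF assms])
  also have "\<dots> \<le> (\<Sum>i. epowr (f i) a)" by (rule sum_le_suminf[OF summableI]) auto
  finally show "(\<Sum>i<n. f i) \<le> epowr (\<Sum>i. epowr (f i) a) (1 / a)" by (simp add: epowr_le_iff[OF assms(1)])
qed

text \<open>The tangent of the convex function \<open>x ^ p\<close> at \<open>y\<close>, arranged
  such that no subtraction occurs in \<open>ennreal\<close>.\<close>

lemma epowr_young:
  assumes "1 \<le> p" "0 < y"
  shows "ennreal (p * y powr (p - 1)) * x \<le> epowr x p + ennreal ((p - 1) * y powr p)"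
proof (cases x)
  case (real r)
  have "p * y powr (p - 1) * r \<le> r powr p + (p - 1) * y powr p"
  proof (cases "r = 0")
    case False
    then have r: "0 < r" using real by simp
    have "(r powr p) powr (1 / p) * (y powr p) powr (1 - 1 / p) \<le> 1 / p * r powr p + (1 - 1 / p) * y powr p"
      using assms r by (intro Youngs_inequality_0) auto
    moreover have "(r powr p) powr (1 / p) = r" using assms r by (simp add: powr_powr)
    moreover have "p * (1 - 1 / p) = p - 1" using assms by (simp add: right_diff_distrib)
    then have "(y powr p) powr (1 - 1 / p) = y powr (p - 1)" by (simp only: powr_powr)
    ultimately have "r * y powr (p - 1) \<le> 1 / p * r powr p + (1 - 1 / p) * y powr p" by simp
    then have "p * (r * y powr (p - 1)) \<le> p * (1 / p * r powr p + (1 - 1 / p) * y powr p)"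
      using assms by (intro mult_left_mono) auto
    then show ?thesis using assms by (simp add: distrib_left algebra_simps)
  qed (use assms in auto)
  then show ?thesis using real assms
    by (simp add: epowr_ennreal ennreal_mult[symmetric] ennreal_plus[symmetric] ennreal_leI del: ennreal_plus)
qed auto

text \<open>Sum the tangent inequality at the mean \<open>y\<close>. The mean is first shown to be
  finite, by \<open>x <= 1 + x ^ p\<close>, so that the multiple of \<open>y ^ p\<close> can be
  cancelled among the reals.\<close>

lemma jensen_suminf:
  assumes p: "1 \<le> p" and w: "(\<Sum>i. w i) = (1::ennreal)"
  shows "epowr (\<Sum>i. w i * x i) p \<le> (\<Sum>i. w i * epowr (x i) p)"
proof (cases "(\<Sum>i. w i * epowr (x i) p) = \<infinity>")
  case False
  let ?R = "\<Sum>i. w i * epowr (x i) p"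
  have "x i \<le> 1 + epowr (x i) p" for i
  proof (cases "x i")
    case (real r)
    have "r \<le> 1 + r powr p"
    proof (cases "r \<le> 1")
      case False
      then have "r powr 1 \<le> r powr p" using p by (intro powr_mono) auto
      then show ?thesis using False by simp
    qed (simp add: add_increasing2)
    then show ?thesis using real by (simp add: epowr_ennreal ennreal_plus[symmetric] ennreal_1[symmetric] ennreal_leI del: ennreal_plus ennreal_1)
  qed simp
  then have "(\<Sum>i. w i * x i) \<le> (\<Sum>i. w i * (1 + epowr (x i) p))" by (intro suminf_le mult_left_mono) auto
  also have "\<dots> = 1 + ?R" using w by (simp add: distrib_left suminf_add[OF summableI summableI, symmetric])
  also have "\<dots> < \<infinity>" using False by (simp add: less_top)
  finally obtain y where y: "(\<Sum>i. w i * x i) = ennreal y" "0 \<le> y" by (cases "\<Sum>i. w i * x i") auto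
  obtain r where r: "?R = ennreal r" "0 \<le> r" using False by (cases ?R) auto
  show ?thesis
  proof (cases "y = 0")
    case True
    then show ?thesis using y by simp
  next
    case False
    then have y0: "0 < y" using y by simp
    have "ennreal (p * y powr (p - 1)) * (\<Sum>i. w i * x i) = (\<Sum>i. w i * (ennreal (p * y powr (p - 1)) * x i))"
      by (subst ennreal_suminf_cmult[symmetric]) (simp add: mult_ac)
    also have "\<dots> \<le> (\<Sum>i. w i * (epowr (x i) p + ennreal ((p - 1) * y powr p)))"
      by (intro suminf_le mult_left_mono epowr_young p y0) auto
    also have "\<dots> = ?R + (\<Sum>i. ennreal ((p - 1) * y powr p) * w i)"
      by (simp add: distrib_left suminf_add[OF summableI summableI, symmetric] mult.commute)
    also have "(\<Sum>i. ennreal ((p - 1) * y powr p) * w i) = ennreal ((p - 1) * y powr p)"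
      using w by (simp add: ennreal_suminf_cmult)
    finally have "ennreal (p * y powr (p - 1) * y) \<le> ennreal (r + (p - 1) * y powr p)"
      using y r p by (simp add: ennreal_mult[symmetric] ennreal_plus[symmetric] del: ennreal_plus)
    then have "p * y powr (p - 1) * y \<le> r + (p - 1) * y powr p" using r p y by (subst (asm) ennreal_le_iff) auto
    moreover have "y powr (p - 1) * y = y powr p" using y0 powr_add[of y "p - 1" 1] by simp
    ultimately have "y powr p \<le> r" by (simp add: algebra_simps mult.assoc)
    then show ?thesis using y r by (simp add: epowr_ennreal ennreal_leI)
  qed
qed simp

text \<open>With values in \<open>ennreal\<close>, infinite sums of functions may be inserted, and
  sequences are covered by the counting measure.\<close>

definition nn_Lp :: "'a measure \<Rightarrow> ennreal \<Rightarrow> ('a \<Rightarrow> ennreal) \<Rightarrow> ennreal" where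
  "nn_Lp M P h = (if P = \<infinity> then esssup M h else epowr (\<integral>\<^sup>+x. epowr (h x) (enn2real P) \<partial>M) (1 / enn2real P))"

lemma Lp_norm_nn_Lp: "Lp_norm M p g = nn_Lp M p (\<lambda>x. ennreal (norm (g x)))"
  by (simp add: Lp_norm_def nn_Lp_def)

lemma esssup_le_iff: "h \<in> borel_measurable M \<Longrightarrow> esssup M (h :: _ \<Rightarrow> ennreal) \<le> c \<longleftrightarrow> (AE x in M. h x \<le> c)"
proof
  assume "esssup M h \<le> c"
  then show "AE x in M. h x \<le> c" using esssup_AE[of h M] by (auto elim: eventually_mono)
qed (auto intro: esssup_I)

lemma enn2real_pos: "0 < P \<Longrightarrow> P \<noteq> \<infinity> \<Longrightarrow> 0 < enn2real P"
  by (simp add: enn2real_positive_iff less_top)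

lemma nn_Lp_le_iff:
  assumes "0 < P" "P \<noteq> \<infinity>"
  shows "nn_Lp M P h \<le> c \<longleftrightarrow> (\<integral>\<^sup>+x. epowr (h x) (enn2real P) \<partial>M) \<le> epowr c (enn2real P)"
  using enn2real_pos[OF assms] assms by (simp add: nn_Lp_def epowr_le_iff)

lemma nn_Lp_AE_mono:
  assumes "0 < P" "h \<in> borel_measurable M" "AE x in M. h x \<le> g x"
  shows "nn_Lp M P h \<le> nn_Lp M P g"
proof (cases "P = \<infinity>")
  case True
  then show ?thesis using assms by (simp add: nn_Lp_def esssup_AE_mono)
next
  case False
  have "(\<integral>\<^sup>+x. epowr (h x) (enn2real P) \<partial>M) \<le> (\<integral>\<^sup>+x. epowr (g x) (enn2real P) \<partial>M)"
    using assms(3) by (intro nn_integral_mono_AE) (auto elim!: eventually_mono intro: epowr_mono)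
  then show ?thesis using False by (auto simp: nn_Lp_def intro: epowr_mono)
qed

lemma nn_Lp_cmult:
  assumes P: "0 < P" and h[measurable]: "h \<in> borel_measurable M"
  shows "nn_Lp M P (\<lambda>x. c * h x) \<le> c * nn_Lp M P h"
proof (cases "P = \<infinity>")
  case True
  have "AE x in M. c * h x \<le> c * esssup M h" using esssup_AE[of h M] by eventually_elim (rule mult_left_mono, auto)
  then show ?thesis using True by (simp add: nn_Lp_def esssup_I)
next
  case False
  note p = enn2real_pos[OF P False]
  have "(\<integral>\<^sup>+x. epowr (c * h x) (enn2real P) \<partial>M) = epowr c (enn2real P) * (\<integral>\<^sup>+x. epowr (h x) (enn2real P) \<partial>M)"
    using p by (simp add: epowr_mult nn_integral_cmult)
  then show ?thesis using False p by (simp add: nn_Lp_def epowr_mult epowr_epowr)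
qed

text \<open>This replaces a quasi-norm by a norm: for \<open>\<mu> <= P\<close> the exponent on the
  right is at least 1. An infinite exponent stays infinite.\<close>

lemma nn_Lp_power:
  assumes P: "0 < P" and \<mu>: "0 < \<mu>" and h[measurable]: "h \<in> borel_measurable M"
  shows "epowr (nn_Lp M P h) \<mu> = nn_Lp M (P / ennreal \<mu>) (\<lambda>x. epowr (h x) \<mu>)"
proof (cases "P = \<infinity>")
  case True
  have "P / ennreal \<mu> = \<infinity>" using True \<mu> by (simp add: ennreal_top_divide)
  moreover have "epowr (esssup M h) \<mu> = esssup M (\<lambda>x. epowr (h x) \<mu>)"
  proof (rule antisym)
    show "epowr (esssup M h) \<mu> \<le> esssup M (\<lambda>x. epowr (h x) \<mu>)"
      unfolding epowr_le_iff[OF \<mu>] esssup_le_iff[OF h]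
      unfolding epowr_le_iff[OF \<mu>, symmetric]
      by (rule esssup_AE)
    show "esssup M (\<lambda>x. epowr (h x) \<mu>) \<le> epowr (esssup M h) \<mu>"
    proof (rule esssup_I)
      show "AE x in M. epowr (h x) \<mu> \<le> epowr (esssup M h) \<mu>"
        using esssup_AE[of h M] by eventually_elim (use \<mu> in \<open>auto intro: epowr_mono\<close>)
    qed measurable
  qed
  ultimately show ?thesis using True by (simp add: nn_Lp_def)
next
  case False
  note p = enn2real_pos[OF P False]
  have fin: "P / ennreal \<mu> \<noteq> \<infinity>" using False \<mu> by (simp add: ennreal_divide_eq_top_iff)
  have e: "enn2real (P / ennreal \<mu>) = enn2real P / \<mu>"
    using False \<mu> by (cases P) (auto simp: divide_ennreal)
  show ?thesis using False fin \<mu> by (simp add: nn_Lp_def e epowr_epowr)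
qed

text \<open>Countable Minkowski from Jensen: with the norms \<open>n i\<close> and their sum
  \<open>S\<close>, the function is \<open>S\<close> times the convex combination of the normalized
  \<open>g i / n i\<close> with weights \<open>n i / S\<close>.\<close>

theorem nn_Lp_suminf:
  assumes P: "1 \<le> P" and g[measurable]: "\<And>i. g i \<in> borel_measurable M"
  shows "nn_Lp M P (\<lambda>x. \<Sum>i. g i x) \<le> (\<Sum>i. nn_Lp M P (g i))"
proof (cases "P = \<infinity>")
  case True
  have "AE x in M. \<forall>i. g i x \<le> esssup M (g i)"
    unfolding AE_all_countable using esssup_AE by blast
  then have "AE x in M. (\<Sum>i. g i x) \<le> (\<Sum>i. esssup M (g i))"
    by eventually_elim (auto intro: suminf_le)
  then show ?thesis using True by (simp add: nn_Lp_def esssup_I)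
next
  case False
  define p where "p = enn2real P"
  have p: "1 \<le> p" using P False unfolding p_def by (cases P) (auto simp: ennreal_1[symmetric] simp del: ennreal_1)
  have P0: "0 < P" using P by (metis less_le_trans zero_less_one)
  define n where "n i = nn_Lp M P (g i)" for i
  define S where "S = (\<Sum>i. n i)"
  have ni: "(\<integral>\<^sup>+x. epowr (g i x) p \<partial>M) = epowr (n i) p" for i
    using p False by (simp add: n_def nn_Lp_def epowr_epowr p_def[symmetric])
  show ?thesis
  proof (cases "S = \<infinity>")
    case True
    then show ?thesis by (simp add: S_def n_def)
  next
    case Sfin: False
    have nS: "n i \<le> S" for i
      unfolding S_def using sum_le_suminf[OF summableI, of "{i}" n] by simp
    have nfin: "n i \<noteq> top" for i using nS[of i] Sfin by (auto simp: top_unique)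
    \<comment> \<open>A summand with \<open>n i = 0\<close> gets weight 0 and would be lost in the
      convex combination; it vanishes almost everywhere.\<close>
    have AE0: "AE x in M. \<forall>i. n i = 0 \<longrightarrow> g i x = 0"
      unfolding AE_all_countable
    proof
      fix i
      show "AE x in M. n i = 0 \<longrightarrow> g i x = 0"
      proof (cases "n i = 0")
        case True
        then have "(\<integral>\<^sup>+x. epowr (g i x) p \<partial>M) = 0" using ni[of i] by simp
        then have "AE x in M. epowr (g i x) p = 0" by (subst (asm) nn_integral_0_iff_AE) auto
        then show ?thesis by simp
      qed simp
    qed
    have "(\<integral>\<^sup>+x. epowr (\<Sum>i. g i x) p \<partial>M) \<le> epowr S p"
    proof (cases "S = 0")
      case True
      then have n0: "n i = 0" for i using nS[of i] by simp
      have "AE x in M. epowr (\<Sum>i. g i x) p = 0" using AE0 by eventually_elim (simp add: n0)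
      then have "(\<integral>\<^sup>+x. epowr (\<Sum>i. g i x) p \<partial>M) = (\<integral>\<^sup>+x. 0 \<partial>M)" by (rule nn_integral_cong_AE)
      then show ?thesis by simp
    next
      case S0: False
      have "inverse S * S = 1"
        using ennreal_divide_self[of S] S0 Sfin by (simp add: divide_ennreal_def mult.commute less_top)
      then have w1: "(\<Sum>i. n i / S) = 1"
        unfolding divide_ennreal_def by (simp add: mult.commute[of _ "inverse S"] S_def[symmetric])
      have dd: "c * (d / c) = d" if "c \<noteq> 0" "c \<noteq> top" for c d :: ennreal
        using that by (simp add: ennreal_times_divide ennreal_mult_divide_eq mult.commute[of c])
      have "AE x in M. epowr (\<Sum>i. g i x) p \<le> epowr S p * (\<Sum>i. n i / S * epowr (g i x / n i) p)"
        using AE0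
      proof eventually_elim
        case (elim x)
        from jensen_suminf[OF p w1, of "\<lambda>i. g i x / n i"]
        have "epowr S p * epowr (\<Sum>i. n i / S * (g i x / n i)) p \<le> epowr S p * (\<Sum>i. n i / S * epowr (g i x / n i) p)"
          by (rule mult_left_mono) simp
        also have "epowr S p * epowr (\<Sum>i. n i / S * (g i x / n i)) p = epowr (S * (\<Sum>i. n i / S * (g i x / n i))) p"
          using p by (simp add: epowr_mult)
        also have "S * (\<Sum>i. n i / S * (g i x / n i)) = (\<Sum>i. g i x)"
        proof -
          have "S * (n i / S * (g i x / n i)) = g i x" for i
          proof (cases "n i = 0")
            case False
            have "S * (n i / S * (g i x / n i)) = (S * (n i / S)) * (g i x / n i)" by (simp only: mult_ac)
            then show ?thesis using dd S0 Sfin nfin False by simp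
          qed (use elim in simp)
          then show ?thesis by (subst ennreal_suminf_cmult[symmetric]) simp
        qed
        finally show ?case .
      qed
      then have "(\<integral>\<^sup>+x. epowr (\<Sum>i. g i x) p \<partial>M) \<le> (\<integral>\<^sup>+x. epowr S p * (\<Sum>i. n i / S * epowr (g i x / n i) p) \<partial>M)"
        by (rule nn_integral_mono_AE)
      also have "\<dots> = epowr S p * (\<Sum>i. n i / S * (\<integral>\<^sup>+x. epowr (g i x / n i) p \<partial>M))"
        by (simp add: nn_integral_cmult nn_integral_suminf)
      also have "\<dots> \<le> epowr S p * (\<Sum>i. n i / S)"
      proof (intro mult_left_mono suminf_le)
        fix i
        show "n i / S * (\<integral>\<^sup>+x. epowr (g i x / n i) p \<partial>M) \<le> n i / S"
        proof (cases "n i = 0")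
          case False
          have "(\<integral>\<^sup>+x. epowr (g i x / n i) p \<partial>M) = (\<integral>\<^sup>+x. epowr (inverse (n i)) p * epowr (g i x) p \<partial>M)"
            using p by (simp add: divide_ennreal_def epowr_mult mult.commute)
          also have "\<dots> = epowr (inverse (n i)) p * epowr (n i) p" by (simp add: nn_integral_cmult ni)
          also have "\<dots> = epowr (n i / n i) p" using p by (simp add: epowr_mult divide_ennreal_def mult.commute)
          also have "n i / n i = 1" using False nfin by (simp add: less_top)
          finally show ?thesis by simp
        qed simp
      qed auto
      finally show ?thesis unfolding w1 by simp
    qed
    then have "nn_Lp M P (\<lambda>x. \<Sum>i. g i x) \<le> S"
      unfolding nn_Lp_le_iff[OF P0 False] p_def .
    then show ?thesis by (simp add: S_def n_def)
  qed
qed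

section \<open>Muckenhoupt's condition and geometric sequences\<close>

lemma infsum_nat_ennreal: "infsum f (UNIV :: nat set) = (\<Sum>n. f n :: ennreal)"
  using has_sum_imp_sums[OF has_sum_infsum[OF nonneg_summable_on_complete]] sums_unique by (metis zero_le)

lemma infsum_ge_elem: "k \<in> K \<Longrightarrow> (f k :: ennreal) \<le> infsum f K"
  using infsum_mono_neutral[of f "{k}" f K] by (simp add: nonneg_summable_on_complete)

lemma lq_norm_ge: "k \<in> K \<Longrightarrow> 0 < s \<Longrightarrow> b k \<le> lq_norm K s b"
proof (cases "s = \<infinity>")
  case True
  assume "k \<in> K" then show ?thesis using True by (auto simp: lq_norm_def intro: SUP_upper)
next
  case False
  assume k: "k \<in> K" and s: "0 < s"
  note p = enn2real_pos[OF s False]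
  have "b k = epowr (epowr (b k) (enn2real s)) (1 / enn2real s)" using p by (simp add: epowr_epowr)
  also have "\<dots> \<le> epowr (\<Sum>\<^sub>\<infinity>k\<in>K. epowr (b k) (enn2real s)) (1 / enn2real s)"
    using p infsum_ge_elem[OF k, of "\<lambda>k. epowr (b k) (enn2real s)"] by (intro epowr_mono) auto
  finally show ?thesis using False by (simp add: lq_norm_def)
qed

text \<open>The threshold \<open>m\<close> is 1 in the application, because the supremum in the
  condition starts at \<open>N = 1\<close>.\<close>

lemma geometric_decay:
  fixes S :: "nat \<Rightarrow> real"
  assumes "\<And>N. N \<ge> m \<Longrightarrow> S (Suc N) \<le> \<kappa> * S N" "0 \<le> \<kappa>" "m \<le> j"
  shows "S (j + d) \<le> \<kappa> ^ d * S j"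
proof (induction d)
  case (Suc d)
  have "S (j + Suc d) \<le> \<kappa> * S (j + d)" using assms(1)[of "j + d"] assms(3) by simp
  also have "\<dots> \<le> \<kappa> * (\<kappa> ^ d * S j)" by (intro mult_left_mono Suc assms)
  finally show ?case by (simp add: mult.assoc)
qed simp

lemma geometric_growth:
  fixes S :: "nat \<Rightarrow> real"
  assumes "\<And>N. S N \<le> \<kappa> * S (Suc N)" "0 \<le> \<kappa>"
  shows "S j \<le> \<kappa> ^ d * S (j + d)"
proof (induction d)
  case (Suc d)
  have "\<kappa> ^ d * S (j + d) \<le> \<kappa> ^ d * (\<kappa> * S (j + Suc d))" using assms(1)[of "j + d"] assms(2) by (intro mult_left_mono) auto
  then show ?case using Suc by (simp add: mult_ac)
qed simp

text \<open>With the same weight on both sides, Muckenhoupt's condition for the discrete Hardy inequality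
  forces geometric growth of the weight, so that the Hardy operator is a convolution with a
  geometric sequence.\<close>

lemma muckenhoupt_geometric:
  fixes \<beta> :: "nat \<Rightarrow> real"
  assumes \<beta>: "\<And>k. 0 < \<beta> k" and s: "0 < s" "0 < s'" "s = \<infinity> \<longrightarrow> s' = 1"
    and fin: "(SUP N\<in>{1..}. lq_norm {0..N} s (\<lambda>k. ennreal (\<beta> k)) * lq_norm {N..} s' (\<lambda>k. inverse (ennreal (\<beta> k)))) < \<infinity>"
  shows "\<exists>C \<theta>. 0 \<le> C \<and> 0 < \<theta> \<and> \<theta> < 1 \<and> (\<forall>j d. \<beta> j \<le> C * \<theta> ^ d * \<beta> (j + d))"
proof -
  define K where "K = enn2real (SUP N\<in>{1..}. lq_norm {0..N} s (\<lambda>k. ennreal (\<beta> k)) * lq_norm {N..} s' (\<lambda>k. inverse (ennreal (\<beta> k))))"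
  have Kub: "lq_norm {0..N} s (\<lambda>k. ennreal (\<beta> k)) * lq_norm {N..} s' (\<lambda>k. inverse (ennreal (\<beta> k))) \<le> ennreal K" if "1 \<le> N" for N
  proof -
    have "lq_norm {0..N} s (\<lambda>k. ennreal (\<beta> k)) * lq_norm {N..} s' (\<lambda>k. inverse (ennreal (\<beta> k)))
      \<le> (SUP N\<in>{1..}. lq_norm {0..N} s (\<lambda>k. ennreal (\<beta> k)) * lq_norm {N..} s' (\<lambda>k. inverse (ennreal (\<beta> k))))"
      using that by (intro SUP_upper) auto
    then show ?thesis using fin by (simp add: K_def)
  qed
  have K0: "0 \<le> K" by (simp add: K_def)
  have inv: "inverse (ennreal (\<beta> k)) = ennreal (1 / \<beta> k)" for k
    using \<beta>[of k] by (simp add: inverse_ennreal inverse_eq_divide)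
  \<comment> \<open>The terms with index 1 of both factors at \<open>N = 1\<close> multiply to 1.
    Below, \<open>1 <= K\<close> ensures that \<open>1 - 1 / K\<close> and \<open>1 - 1 / c\<close>
    are nonnegative.\<close>
  have K1: "1 \<le> K"
  proof -
    have "ennreal (\<beta> 1) * ennreal (1 / \<beta> 1) \<le> lq_norm {0..1} s (\<lambda>k. ennreal (\<beta> k)) * lq_norm {1..} s' (\<lambda>k. inverse (ennreal (\<beta> k)))"
      using lq_norm_ge[of 1 "{0..1}" s "\<lambda>k. ennreal (\<beta> k)"] lq_norm_ge[of 1 "{1..}" s' "\<lambda>k. inverse (ennreal (\<beta> k))"] s
      by (intro mult_mono) (auto simp: inv)
    also have "\<dots> \<le> ennreal K" by (rule Kub) simp
    finally have "\<beta> 1 * (1 / \<beta> 1) \<le> K" using K0 \<beta>[of 1] by (simp add: ennreal_mult[symmetric])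
    then show ?thesis using \<beta>[of 1] by simp
  qed
  show ?thesis
  proof (cases "s = \<infinity>")
    case False
    define p where "p = enn2real s"
    have p: "0 < p" using enn2real_pos[OF s(1) False] by (simp add: p_def)
    define S where "S N = (\<Sum>k\<le>N. \<beta> k powr p)" for N
    define c where "c = K powr p"
    have c1: "1 \<le> c" using K1 p by (simp add: c_def ge_one_powr_ge_zero)
    \<comment> \<open>From the second factor only the term \<open>N\<close> is kept. This bounds the
      partial sum of the \<open>\<beta> powr p\<close> by its last term, and such partial sums grow
      geometrically. The index 0, absent from the supremum, is trivial here.\<close>
    have Sc: "S N \<le> c * \<beta> N powr p" for N
    proof (cases "N = 0")
      case True
      then show ?thesis using c1 mult_right_mono[of 1 c "\<beta> 0 powr p"] by (simp add: S_def)
    next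
      case N: False
      have e1: "lq_norm {0..N} s (\<lambda>k. ennreal (\<beta> k)) = ennreal (S N powr (1 / p))"
      proof -
        have "(\<Sum>\<^sub>\<infinity>k\<in>{0..N}. epowr (ennreal (\<beta> k)) p) = ennreal (S N)"
          using \<beta> by (simp add: S_def epowr_ennreal less_imp_le atLeast0AtMost)
        then show ?thesis using False by (simp add: lq_norm_def p_def[symmetric] epowr_ennreal S_def sum_nonneg)
      qed
      have e2: "ennreal (1 / \<beta> N) \<le> lq_norm {N..} s' (\<lambda>k. inverse (ennreal (\<beta> k)))"
        using lq_norm_ge[of N "{N..}" s' "\<lambda>k. inverse (ennreal (\<beta> k))"] s by (simp add: inv)
      have "ennreal (S N powr (1 / p)) * ennreal (1 / \<beta> N) \<le> lq_norm {0..N} s (\<lambda>k. ennreal (\<beta> k)) * lq_norm {N..} s' (\<lambda>k. inverse (ennreal (\<beta> k)))"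
        unfolding e1 by (intro mult_left_mono e2) simp
      also have "\<dots> \<le> ennreal K" by (rule Kub) (use N in simp)
      finally have "ennreal (S N powr (1 / p)) * ennreal (1 / \<beta> N) \<le> ennreal K" .
      then have "S N powr (1 / p) * (1 / \<beta> N) \<le> K" using K0 \<beta>[of N] by (simp add: ennreal_mult[symmetric])
      then have "S N powr (1 / p) \<le> K * \<beta> N" using \<beta>[of N] by (simp add: field_simps)
      then have "(S N powr (1 / p)) powr p \<le> (K * \<beta> N) powr p" using p by (intro powr_mono2) auto
      moreover have "(S N powr (1 / p)) powr p = S N" using p by (simp add: powr_powr S_def sum_nonneg)
      moreover have "(K * \<beta> N) powr p = c * \<beta> N powr p" using K0 \<beta>[of N] by (simp add: powr_mult c_def)
      ultimately show ?thesis by simp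
    qed
    \<comment> \<open>The increment \<open>S (Suc N) - S N\<close> is at least
      \<open>S (Suc N) / c\<close>, which gives the ratio \<open>1 - 1 / c\<close>. This is 0 for
      \<open>c = 1\<close>; the maximum keeps \<open>\<theta>\<close> positive.\<close>
    define \<kappa> where "\<kappa> = max (1 - 1 / c) (1/2)"
    have \<kappa>: "0 < \<kappa>" "\<kappa> < 1" using c1 by (auto simp: \<kappa>_def)
    have Spos: "0 \<le> S N" for N by (simp add: S_def sum_nonneg)
    have "S N \<le> \<kappa> * S (Suc N)" for N
    proof -
      have "S (Suc N) \<le> c * (S (Suc N) - S N)" using Sc[of "Suc N"] by (simp add: S_def)
      then have "S (Suc N) / c \<le> S (Suc N) - S N" using c1 by (simp add: divide_le_eq mult.commute)
      then have "S N \<le> (1 - 1 / c) * S (Suc N)" by (simp add: left_diff_distrib)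
      also have "\<dots> \<le> \<kappa> * S (Suc N)" using Spos by (intro mult_right_mono) (auto simp: \<kappa>_def)
      finally show ?thesis .
    qed
    from geometric_growth[of S \<kappa>, OF this] \<kappa> have growth: "S j \<le> \<kappa> ^ d * S (j + d)" for j d by simp
    have "\<beta> j \<le> K * (\<kappa> powr (1 / p)) ^ d * \<beta> (j + d)" for j d
    proof -
      have "\<beta> j powr p \<le> S j" unfolding S_def by (rule member_le_sum) auto
      also have "\<dots> \<le> \<kappa> ^ d * S (j + d)" by (rule growth)
      also have "\<dots> \<le> \<kappa> ^ d * (c * \<beta> (j + d) powr p)" using \<kappa> by (intro mult_left_mono Sc) auto
      finally have "(\<beta> j powr p) powr (1 / p) \<le> (\<kappa> ^ d * (c * \<beta> (j + d) powr p)) powr (1 / p)"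
        using p by (intro powr_mono2) auto
      moreover have "(\<beta> j powr p) powr (1 / p) = \<beta> j" using p \<beta>[of j] by (simp add: powr_powr)
      moreover have "(\<kappa> ^ d * (c * \<beta> (j + d) powr p)) powr (1 / p) = (\<kappa> powr (1 / p)) ^ d * (K * \<beta> (j + d))"
      proof -
        have "(\<kappa> ^ d) powr (1 / p) = (\<kappa> powr (1 / p)) ^ d"
          using \<kappa> by (simp add: powr_realpow[symmetric] powr_powr mult.commute)
        then show ?thesis using p \<beta>[of "j + d"] K1 by (simp add: powr_mult c_def powr_powr)
      qed
      ultimately show ?thesis by (simp add: mult_ac)
    qed
    moreover have "0 < \<kappa> powr (1 / p)" "\<kappa> powr (1 / p) < 1" using \<kappa> p powr_less_mono2[of "1 / p" \<kappa> 1] by auto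
    ultimately show ?thesis using K0 by blast
  next
    case True
    then have s1: "s' = 1" using s by simp
    \<comment> \<open>For \<open>s = \<infinity>\<close> the first factor is a supremum and the
      roles change: its term \<open>N\<close> is kept, and the tails of the series of
      \<open>1 / \<beta>\<close> decay geometrically.\<close>
    define T where "T N = infsum (\<lambda>k. ennreal (1 / \<beta> k)) {N..}" for N
    have TK: "ennreal (\<beta> N) * T N \<le> ennreal K" if "1 \<le> N" for N
    proof -
      have e1: "lq_norm {N..} s' (\<lambda>k. inverse (ennreal (\<beta> k))) = T N"
        using s1 by (simp add: lq_norm_def T_def inv)
      have e2: "ennreal (\<beta> N) \<le> lq_norm {0..N} s (\<lambda>k. ennreal (\<beta> k))"
        by (rule lq_norm_ge) (use s in auto)
      have "ennreal (\<beta> N) * T N \<le> lq_norm {0..N} s (\<lambda>k. ennreal (\<beta> k)) * lq_norm {N..} s' (\<lambda>k. inverse (ennreal (\<beta> k)))"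
        unfolding e1 by (intro mult_right_mono e2) simp
      also have "\<dots> \<le> ennreal K" by (rule Kub[OF that])
      finally show ?thesis .
    qed
    define t where "t N = enn2real (T N)" for N
    have Tt: "T N = ennreal (t N)" "0 \<le> t N" if "1 \<le> N" for N
    proof -
      have "T N \<noteq> top"
      proof
        assume "T N = top"
        then have "ennreal (\<beta> N) * T N = top" using \<beta>[of N] by (simp add: ennreal_mult_top)
        then show False using TK[OF that] by (simp add: top_unique)
      qed
      then show "T N = ennreal (t N)" "0 \<le> t N" by (auto simp: t_def less_top)
    qed
    have Tsplit: "T N = ennreal (1 / \<beta> N) + T (Suc N)" for N
    proof -
      have "{N..} = {N} \<union> {Suc N..}" by auto
      then show ?thesis unfolding T_def
        using infsum_Un_disjoint[of "\<lambda>k. ennreal (1 / \<beta> k)" "{N}" "{Suc N..}"] by (simp add: nonneg_summable_on_complete)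
    qed
    have tsplit: "t N = 1 / \<beta> N + t (Suc N)" if "1 \<le> N" for N
      using Tsplit[of N] Tt[OF that] Tt[of "Suc N"] \<beta>[of N] by (simp add: ennreal_plus[symmetric] del: ennreal_plus)
    have tK: "t N \<le> K / \<beta> N" if "1 \<le> N" for N
      using TK[OF that] Tt[OF that] \<beta>[of N] K0 by (simp add: ennreal_mult[symmetric] field_simps less_imp_le)
    define \<kappa> where "\<kappa> = max (1 - 1 / K) (1/2)"
    have \<kappa>: "0 < \<kappa>" "\<kappa> < 1" using K1 by (auto simp: \<kappa>_def)
    have "t (Suc N) \<le> \<kappa> * t N" if "1 \<le> N" for N
    proof -
      have "t N / K \<le> 1 / \<beta> N" using tK[OF that] K1 by (simp add: field_simps)
      then have "t (Suc N) \<le> (1 - 1 / K) * t N" using tsplit[OF that] by (simp add: left_diff_distrib)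
      also have "\<dots> \<le> \<kappa> * t N" using Tt[OF that] by (intro mult_right_mono) (auto simp: \<kappa>_def)
      finally show ?thesis .
    qed
    from geometric_decay[of 1 t \<kappa>, OF this] \<kappa> have decay: "t (j + d) \<le> \<kappa> ^ d * t j" if "1 \<le> j" for j d using that by simp
    have main: "\<beta> j \<le> K * \<kappa> ^ d * \<beta> (j + d)" if "1 \<le> j" for j d
    proof -
      have "1 / \<beta> (j + d) \<le> t (j + d)" using tsplit[of "j + d"] Tt[of "Suc (j + d)"] that by simp
      also have "\<dots> \<le> \<kappa> ^ d * t j" by (rule decay[OF that])
      also have "\<dots> \<le> \<kappa> ^ d * (K / \<beta> j)" using \<kappa> by (intro mult_left_mono tK that) auto
      finally show ?thesis using \<beta>[of j] \<beta>[of "j + d"] by (simp add: field_simps)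
    qed
    \<comment> \<open>The index 0 is outside the supremum, so \<open>\<beta> 0\<close> is compared
      with \<open>\<beta> 1\<close>, which loses one factor \<open>\<kappa>\<close>; the summand 1
      covers \<open>d = 0\<close>.\<close>
    define C where "C = K + 1 + (\<beta> 0 / \<beta> 1) * K / \<kappa>"
    have C: "K \<le> C" "1 \<le> C" "(\<beta> 0 / \<beta> 1) * K / \<kappa> \<le> C" using K0 \<beta>[of 0] \<beta>[of 1] \<kappa> by (auto simp: C_def)
    have "\<beta> j \<le> C * \<kappa> ^ d * \<beta> (j + d)" for j d
    proof (cases "j = 0")
      case False
      then have "\<beta> j \<le> K * \<kappa> ^ d * \<beta> (j + d)" by (intro main) simp
      also have "\<dots> \<le> C * \<kappa> ^ d * \<beta> (j + d)" using C \<kappa> \<beta>[of "j + d"] by (intro mult_right_mono) auto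
      finally show ?thesis .
    next
      case j: True
      show ?thesis
      proof (cases d)
        case 0
        then show ?thesis using j C \<beta>[of 0] by simp
      next
        case (Suc e)
        have "\<beta> 0 = (\<beta> 0 / \<beta> 1) * \<beta> 1" using \<beta>[of 1] by simp
        also have "\<dots> \<le> (\<beta> 0 / \<beta> 1) * (K * \<kappa> ^ e * \<beta> (1 + e))"
          using \<beta>[of 0] \<beta>[of 1] by (intro mult_left_mono main) auto
        also have "\<dots> = ((\<beta> 0 / \<beta> 1) * K / \<kappa>) * \<kappa> ^ d * \<beta> (0 + d)" using \<kappa> Suc by simp
        also have "\<dots> \<le> C * \<kappa> ^ d * \<beta> (0 + d)" using C \<kappa> \<beta>[of "0 + d"] by (intro mult_right_mono) auto
        finally show ?thesis using j by simp
      qed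
    qed
    then show ?thesis using C \<kappa> by (intro exI[of _ C] exI[of _ \<kappa>]) auto
  qed
qed

lemma lq_norm_nn_Lp: "lq_norm UNIV q b = nn_Lp (count_space UNIV) q b"
proof (cases "q = \<infinity>")
  case True
  have "(SUP k. b k) = esssup (count_space UNIV) b"
  proof (rule antisym)
    show "(SUP k. b k) \<le> esssup (count_space UNIV) b"
      using esssup_AE[of b "count_space UNIV"] by (intro SUP_least) (auto simp: AE_count_space)
    show "esssup (count_space UNIV) b \<le> (SUP k. b k)"
      by (rule esssup_I) (auto simp: AE_count_space intro: SUP_upper)
  qed
  then show ?thesis using True by (simp add: lq_norm_def nn_Lp_def)
next
  case False
  then show ?thesis by (simp add: lq_norm_def nn_Lp_def infsum_nat_ennreal nn_integral_count_space_nat)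
qed

lemma nn_Lp_shift_left:
  assumes P: "1 \<le> P"
  shows "nn_Lp (count_space UNIV) P (\<lambda>k. a (k + l)) \<le> nn_Lp (count_space UNIV) P (a :: nat \<Rightarrow> ennreal)"
proof (cases "P = \<infinity>")
  case True
  have "AE k in count_space UNIV. a k \<le> esssup (count_space UNIV) a" by (rule esssup_AE)
  then have "esssup (count_space UNIV) (\<lambda>k. a (k + l)) \<le> esssup (count_space UNIV) a"
    by (intro esssup_I) (auto simp: AE_count_space)
  then show ?thesis using True by (simp add: nn_Lp_def)
next
  case False
  have "(\<Sum>k. epowr (a (k + l)) (enn2real P)) \<le> (\<Sum>k. epowr (a k) (enn2real P))"
    using suminf_shift_le[of "\<lambda>k. epowr (a k) (enn2real P)" l] by (simp add: add.commute)
  then show ?thesis using False by (simp add: nn_Lp_def nn_integral_count_space_nat epowr_mono)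
qed

lemma nn_Lp_shift_right:
  assumes P: "1 \<le> P"
  shows "nn_Lp (count_space UNIV) P (\<lambda>k. if d \<le> k then a (k - d) else 0) \<le> nn_Lp (count_space UNIV) P (a :: nat \<Rightarrow> ennreal)"
proof (cases "P = \<infinity>")
  case True
  have "AE k in count_space UNIV. a k \<le> esssup (count_space UNIV) a" by (rule esssup_AE)
  then have "esssup (count_space UNIV) (\<lambda>k. if d \<le> k then a (k - d) else 0) \<le> esssup (count_space UNIV) a"
    by (intro esssup_I) (auto simp: AE_count_space)
  then show ?thesis using True by (simp add: nn_Lp_def)
next
  case False
  let ?f = "\<lambda>k. epowr (if d \<le> k then a (k - d) else 0) (enn2real P)"
  have "(\<Sum>k. ?f k) = (\<Sum>k. ?f (k + d)) + (\<Sum>k<d. ?f k)"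
    by (rule suminf_offset[OF summableI])
  also have "\<dots> = (\<Sum>k. epowr (a k) (enn2real P))" by simp
  finally show ?thesis using False by (simp add: nn_Lp_def nn_integral_count_space_nat)
qed

text \<open>Shifts in either direction do not increase the norm, so Minkowski leaves the product of
  two geometric series.\<close>

lemma geometric_convolution:
  assumes P: "1 \<le> P" and \<theta>: "0 < \<theta>" "\<theta> < (1::real)"
    and c: "\<And>k. c k \<le> (\<Sum>d. \<Sum>l. ennreal (\<theta> ^ d * \<theta> ^ l) * (if d \<le> k then a (k - d + l) else 0))"
  shows "nn_Lp (count_space UNIV) P c \<le> ennreal ((1 / (1 - \<theta>)) ^ 2) * nn_Lp (count_space UNIV) P (a :: nat \<Rightarrow> ennreal)"
proof -
  have P0: "0 < P" using P by (metis less_le_trans zero_less_one)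
  let ?n = "nn_Lp (count_space UNIV) P"
  have geo: "(\<Sum>d. ennreal (\<theta> ^ d)) = ennreal (1 / (1 - \<theta>))"
    using \<theta> by (subst suminf_ennreal_eq[of _ "1 / (1 - \<theta>)"]) (auto intro: geometric_sums)
  have "?n c \<le> ?n (\<lambda>k. \<Sum>d. \<Sum>l. ennreal (\<theta> ^ d * \<theta> ^ l) * (if d \<le> k then a (k - d + l) else 0))"
    using c by (intro nn_Lp_AE_mono P0) auto
  also have "\<dots> \<le> (\<Sum>d. ?n (\<lambda>k. \<Sum>l. ennreal (\<theta> ^ d * \<theta> ^ l) * (if d \<le> k then a (k - d + l) else 0)))"
    by (rule nn_Lp_suminf[OF P]) auto
  also have "\<dots> \<le> (\<Sum>d. \<Sum>l. ?n (\<lambda>k. ennreal (\<theta> ^ d * \<theta> ^ l) * (if d \<le> k then a (k - d + l) else 0)))"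
    by (intro suminf_le nn_Lp_suminf P) auto
  also have "\<dots> \<le> (\<Sum>d. \<Sum>l. ennreal (\<theta> ^ d) * (ennreal (\<theta> ^ l) * ?n a))"
  proof (intro suminf_le)
    fix d l
    have "?n (\<lambda>k. ennreal (\<theta> ^ d * \<theta> ^ l) * (if d \<le> k then a (k - d + l) else 0))
       \<le> ennreal (\<theta> ^ d * \<theta> ^ l) * ?n (\<lambda>k. if d \<le> k then a (k - d + l) else 0)"
      by (rule nn_Lp_cmult[OF P0]) auto
    also have "?n (\<lambda>k. if d \<le> k then a (k - d + l) else 0) \<le> ?n (\<lambda>k. a (k + l))"
      using nn_Lp_shift_right[OF P, of d "\<lambda>k. a (k + l)"] by simp
    also have "\<dots> \<le> ?n a" by (rule nn_Lp_shift_left[OF P])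
    finally show "?n (\<lambda>k. ennreal (\<theta> ^ d * \<theta> ^ l) * (if d \<le> k then a (k - d + l) else 0)) \<le> ennreal (\<theta> ^ d) * (ennreal (\<theta> ^ l) * ?n a)"
      using \<theta> by (simp add: ennreal_mult mult_left_mono mult.assoc)
  qed auto
  also have "\<dots> = ennreal (1 / (1 - \<theta>)) * (ennreal (1 / (1 - \<theta>)) * ?n a)"
    by (simp add: geo)
  also have "\<dots> = ennreal ((1 / (1 - \<theta>)) ^ 2) * ?n a"
    using \<theta> by (simp add: power2_eq_square ennreal_mult[symmetric] mult.assoc[symmetric])
  finally show ?thesis .
qed

section \<open>Weights on dyadic cubes\<close>

text \<open>The half-open cubes tile the space, so data attached to cubes become functions of the
  point that are measurable and defined everywhere.\<close>

definition cube_index :: "nat \<Rightarrow> real^'n::finite \<Rightarrow> int^'n" where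
  "cube_index j x = (\<chi> i. \<lfloor>2 ^ j * x $ i\<rfloor>)"

lemma mem_dyadic_cube:
  "x \<in> dyadic_cube j m \<longleftrightarrow> (\<forall>i. of_int (m $ i) < 2 ^ j * x $ i \<and> 2 ^ j * x $ i < of_int (m $ i) + 1)"
  unfolding dyadic_cube_def mem_box_cart by (simp add: field_simps)

lemma dyadic_cube_index:
  assumes "x \<in> dyadic_cube j m" shows "cube_index j x = m"
proof -
  have "\<lfloor>2 ^ j * x $ i\<rfloor> = m $ i" for i
    using assms[unfolded mem_dyadic_cube, rule_format, of i] by (intro floor_unique) linarith+
  then show ?thesis by (simp add: cube_index_def vec_eq_iff)
qed

text \<open>The open and the half-open cubes of level \<open>j\<close> disagree only on countably
  many coordinate hyperplanes.\<close>

lemma AE_cube_index: "AE x in lebesgue. \<forall>m. x \<in> dyadic_cube j m \<longleftrightarrow> cube_index j x = (m :: int^'n::finite)"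
proof -
  have "AE x in (lebesgue :: (real^'n) measure). x $ i \<noteq> of_int z / 2 ^ j" for i :: 'n and z :: int
  proof -
    have "{x::real^'n. x $ i = of_int z / 2 ^ j} \<in> null_sets lebesgue"
      unfolding negligible_iff_null_sets[symmetric]
      using negligible_standard_hyperplane[of "axis i 1 :: real^'n" "of_int z / 2 ^ j"] by (simp add: inner_axis axis_in_Basis_iff)
    from AE_not_in[OF this] show ?thesis by simp
  qed
  then have "AE x in (lebesgue :: (real^'n) measure). \<forall>i z. x $ (i::'n) \<noteq> of_int z / 2 ^ j"
    by (simp add: AE_all_countable)
  then show ?thesis
  proof eventually_elim
    case (elim x)
    show ?case
    proof (intro allI iffI)
      fix m assume "cube_index j x = m"
      then have m: "m $ i = \<lfloor>2 ^ j * x $ i\<rfloor>" for i by (auto simp: cube_index_def)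
      have neq: "of_int \<lfloor>2 ^ j * x $ i\<rfloor> \<noteq> 2 ^ j * x $ i" for i
      proof
        assume F: "of_int \<lfloor>2 ^ j * x $ i\<rfloor> = 2 ^ j * x $ i"
        have "x $ i = of_int \<lfloor>2 ^ j * x $ i\<rfloor> / 2 ^ j" unfolding F by simp
        then show False using elim by blast
      qed
      show "x \<in> dyadic_cube j m"
        unfolding mem_dyadic_cube m
      proof (intro allI conjI)
        fix i
        show "of_int \<lfloor>2 ^ j * x $ i\<rfloor> < 2 ^ j * x $ i"
          using neq[of i] of_int_floor_le[of "2 ^ j * x $ i"] by linarith
        show "2 ^ j * x $ i < of_int \<lfloor>2 ^ j * x $ i\<rfloor> + 1" by linarith
      qed
    qed (rule dyadic_cube_index)
  qed
qed

lemma dyadic_cube_sets [measurable]: "dyadic_cube j m \<in> sets lebesgue"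
  by (simp add: dyadic_cube_def)

lemma cube_index_measurable [measurable]:
  "cube_index j \<in> borel \<rightarrow>\<^sub>M count_space (UNIV :: (int^'n::finite) set)"
proof (subst measurable_count_space_eq2_countable, intro conjI ballI)
  fix m :: "int^'n"
  have "cube_index j -` {m} \<inter> space borel = {x. \<forall>i. of_int (m $ i) \<le> 2 ^ j * x $ i \<and> 2 ^ j * x $ i < of_int (m $ i) + 1}"
    by (auto simp: cube_index_def vec_eq_iff floor_eq_iff)
  also have "\<dots> \<in> sets borel" by measurable
  finally show "cube_index j -` {m} \<inter> space borel \<in> sets borel" .
qed auto

lemma cube_index_measurable_lebesgue [measurable]:
  "cube_index j \<in> lebesgue \<rightarrow>\<^sub>M count_space (UNIV :: (int^'n::finite) set)"
  by (rule measurable_completion) simp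

lemma step_measurable [measurable]:
  "(\<lambda>x::real^'n::finite. c (cube_index j x) :: ennreal) \<in> borel_measurable lebesgue"
  by (rule measurable_compose[OF cube_index_measurable_lebesgue]) simp

lemma nn_integral_cube:
  "(\<integral>\<^sup>+x. h x \<partial>lebesgue_on (dyadic_cube j m)) = (\<integral>\<^sup>+x. h x * indicator {m} (cube_index j x) \<partial>lebesgue)"
proof -
  have "(\<integral>\<^sup>+x. h x \<partial>lebesgue_on (dyadic_cube j m)) = (\<integral>\<^sup>+x. h x * indicator (dyadic_cube j m) x \<partial>lebesgue)"
    by (rule nn_integral_restrict_space) simp
  also have "\<dots> = (\<integral>\<^sup>+x. h x * indicator {m} (cube_index j x) \<partial>lebesgue)"
  proof (rule nn_integral_cong_AE)
    show "AE x in lebesgue. h x * indicator (dyadic_cube j m) x = h x * indicator {m} (cube_index j x)"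
      using AE_cube_index[of j] by eventually_elim (simp add: indicator_def)
  qed
  finally show ?thesis .
qed

lemma nn_integral_step:
  fixes h :: "real^'n::finite \<Rightarrow> ennreal"
  assumes h[measurable]: "h \<in> borel_measurable lebesgue"
  shows "(\<integral>\<^sup>+x. h x * c (cube_index j x) \<partial>lebesgue)
    = (\<integral>\<^sup>+m. c m * (\<integral>\<^sup>+x. h x \<partial>lebesgue_on (dyadic_cube j m)) \<partial>count_space UNIV)"
proof -
  have "h x * c (cube_index j x) = (\<integral>\<^sup>+m. c m * (h x * indicator {m} (cube_index j x)) \<partial>count_space UNIV)" for x
  proof -
    have "(\<integral>\<^sup>+m. c m * (h x * indicator {m} (cube_index j x)) \<partial>count_space UNIV)
      = (\<integral>\<^sup>+m. (c m * h x) * indicator {cube_index j x} m \<partial>count_space UNIV)"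
      by (intro nn_integral_cong) (auto simp: indicator_def)
    also have "\<dots> = c (cube_index j x) * h x"
      by (simp add: nn_integral_indicator_singleton')
    finally show ?thesis by (simp add: mult.commute)
  qed
  then have "(\<integral>\<^sup>+x. h x * c (cube_index j x) \<partial>lebesgue) = (\<integral>\<^sup>+x. \<integral>\<^sup>+m. c m * (h x * indicator {m} (cube_index j x)) \<partial>count_space UNIV \<partial>lebesgue)"
    by simp
  also have "\<dots> = (\<integral>\<^sup>+m. \<integral>\<^sup>+x. c m * (h x * indicator {m} (cube_index j x)) \<partial>lebesgue \<partial>count_space UNIV)"
    by (rule nn_integral_count_space_nn_integral) auto
  also have "\<dots> = (\<integral>\<^sup>+m. c m * (\<integral>\<^sup>+x. h x \<partial>lebesgue_on (dyadic_cube j m)) \<partial>count_space UNIV)"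
    unfolding nn_integral_cube by (intro nn_integral_cong nn_integral_cmult) measurable
  finally show ?thesis .
qed

lemma measurable_on_cube:
  "h \<in> borel_measurable lebesgue \<Longrightarrow> h \<in> borel_measurable (lebesgue_on (dyadic_cube j m))"
  by (rule measurable_restrict_space1)

lemma AE_on_cube: "(AE x in lebesgue_on (dyadic_cube j m). P x) \<longleftrightarrow> (AE x in lebesgue. x \<in> dyadic_cube j m \<longrightarrow> P x)"
  by (rule AE_restrict_space_iff) simp

text \<open>For a fixed shift \<open>d\<close> the map \<open>m + d\<close> permutes the lattice, so
  comparisons between single cubes add up to a global one. The sum over all shifts is later taken
  outside the norm.\<close>

lemma nn_Lp_step_le:
  fixes f g :: "real^'n::finite \<Rightarrow> ennreal"
  assumes P: "0 < P" and f[measurable]: "f \<in> borel_measurable lebesgue" and g[measurable]: "g \<in> borel_measurable lebesgue"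
    and le: "\<And>m. nn_Lp (lebesgue_on (dyadic_cube j m)) P f * A m \<le> G * nn_Lp (lebesgue_on (dyadic_cube j (m + d))) P g"
  shows "nn_Lp lebesgue P (\<lambda>x. f x * A (cube_index j x)) \<le> G * nn_Lp lebesgue P g"
proof (cases "P = \<infinity>")
  case True
  have sub: "esssup (lebesgue_on (dyadic_cube j m)) g \<le> esssup lebesgue g" for m
  proof (rule esssup_I)
    show "AE x in lebesgue_on (dyadic_cube j m). g x \<le> esssup lebesgue g"
      unfolding AE_on_cube using esssup_AE[of g lebesgue] by eventually_elim simp
  qed (rule measurable_on_cube[OF g])
  have "AE x in lebesgue. \<forall>m. x \<in> dyadic_cube j m \<longrightarrow> f x \<le> esssup (lebesgue_on (dyadic_cube j m)) f"
    unfolding AE_all_countable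
  proof
    show "AE x in lebesgue. x \<in> dyadic_cube j m \<longrightarrow> f x \<le> esssup (lebesgue_on (dyadic_cube j m)) f" for m
      unfolding AE_on_cube[symmetric] by (rule esssup_AE)
  qed
  then have "AE x in lebesgue. f x * A (cube_index j x) \<le> G * esssup lebesgue g"
    using AE_cube_index[of j]
  proof eventually_elim
    case (elim x)
    let ?m = "cube_index j x"
    have "f x * A ?m \<le> esssup (lebesgue_on (dyadic_cube j ?m)) f * A ?m"
      using elim by (intro mult_right_mono) auto
    also have "\<dots> \<le> G * esssup (lebesgue_on (dyadic_cube j (?m + d))) g"
      using le[of ?m] True by (simp add: nn_Lp_def)
    also have "\<dots> \<le> G * esssup lebesgue g" by (intro mult_left_mono sub) auto
    finally show ?case .
  qed
  then have "esssup lebesgue (\<lambda>x. f x * A (cube_index j x)) \<le> G * esssup lebesgue g"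
    by (intro esssup_I) measurable
  then show ?thesis using True by (simp add: nn_Lp_def)
next
  case False
  define p where "p = enn2real P"
  have p: "0 < p" using enn2real_pos[OF P False] by (simp add: p_def)
  have I: "(\<integral>\<^sup>+x. epowr (h x) p \<partial>lebesgue_on (dyadic_cube j m)) = epowr (nn_Lp (lebesgue_on (dyadic_cube j m)) P h) p" for h m
    using p False by (simp add: nn_Lp_def p_def[symmetric] epowr_epowr)
  have "(\<integral>\<^sup>+x. epowr (f x * A (cube_index j x)) p \<partial>lebesgue) = (\<integral>\<^sup>+x. epowr (f x) p * epowr (A (cube_index j x)) p \<partial>lebesgue)"
    using p by (simp add: epowr_mult)
  also have "\<dots> = (\<integral>\<^sup>+m. epowr (A m) p * (\<integral>\<^sup>+x. epowr (f x) p \<partial>lebesgue_on (dyadic_cube j m)) \<partial>count_space UNIV)"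
    by (rule nn_integral_step[where c="\<lambda>m. epowr (A m) p"]) measurable
  also have "\<dots> \<le> (\<integral>\<^sup>+m. epowr G p * (\<integral>\<^sup>+x. epowr (g x) p \<partial>lebesgue_on (dyadic_cube j (m + d))) \<partial>count_space UNIV)"
  proof (rule nn_integral_mono)
    fix m :: "int^'n"
    have "epowr (nn_Lp (lebesgue_on (dyadic_cube j m)) P f * A m) p \<le> epowr (G * nn_Lp (lebesgue_on (dyadic_cube j (m + d))) P g) p"
      using p le by (intro epowr_mono) auto
    then show "epowr (A m) p * (\<integral>\<^sup>+x. epowr (f x) p \<partial>lebesgue_on (dyadic_cube j m)) \<le> epowr G p * (\<integral>\<^sup>+x. epowr (g x) p \<partial>lebesgue_on (dyadic_cube j (m + d)))"
      unfolding I using p by (simp add: epowr_mult mult.commute)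
  qed
  also have "\<dots> = (\<integral>\<^sup>+m. epowr G p * (\<integral>\<^sup>+x. epowr (g x) p \<partial>lebesgue_on (dyadic_cube j m)) \<partial>count_space UNIV)"
  proof (rule nn_integral_bij_count_space[where g="\<lambda>m. m + d"])
    show "bij_betw (\<lambda>m. m + d) (UNIV :: (int^'n) set) UNIV"
      by (rule bij_betwI[where g="\<lambda>m. m - d"]) auto
  qed
  also have "\<dots> = (\<integral>\<^sup>+x. epowr (g x) p * epowr G p \<partial>lebesgue)"
    by (rule nn_integral_step[where c="\<lambda>m. epowr G p", symmetric]) measurable
  also have "\<dots> = epowr G p * epowr (nn_Lp lebesgue P g) p"
    using p False by (simp add: nn_Lp_def p_def[symmetric] epowr_epowr nn_integral_cmult mult.commute)
  also have "\<dots> = epowr (G * nn_Lp lebesgue P g) p" using p by (simp add: epowr_mult)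
  finally show ?thesis unfolding nn_Lp_le_iff[OF P False] p_def .
qed

section \<open>Averages over dyadic cubes and Hoelder's inequality\<close>

lemma emeasure_dyadic_cube:
  fixes m :: "int^'n::finite"
  shows "emeasure lebesgue (dyadic_cube j m) = ennreal (1 / 2 ^ (j * CARD('n)))"
proof -
  have "emeasure lborel (dyadic_cube j m) = (\<Prod>b\<in>Basis. ((\<chi> i. (of_int (m $ i) + 1) / 2 ^ j) - (\<chi> i. of_int (m $ i) / 2 ^ j) :: real^'n) \<bullet> b)"
    unfolding dyadic_cube_def
    by (rule emeasure_lborel_box) (auto simp: Basis_vec_def inner_axis divide_right_mono)
  also have "(\<Prod>b\<in>Basis. ((\<chi> i. (of_int (m $ i) + 1) / 2 ^ j) - (\<chi> i. of_int (m $ i) / 2 ^ j) :: real^'n) \<bullet> b)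
     = (\<Prod>b\<in>(Basis :: (real^'n) set). 1 / 2 ^ j)"
    by (intro prod.cong) (auto simp: Basis_vec_def inner_axis diff_divide_distrib[symmetric])
  also have "\<dots> = 1 / 2 ^ (j * CARD('n))" by (simp add: power_mult power_divide)
  finally show ?thesis by (simp add: dyadic_cube_def)
qed

lemma two_power_ennreal: "(2::ennreal) ^ n = ennreal (2 ^ n)"
  using ennreal_power[of 2 n] by simp

definition cube_avg :: "nat \<Rightarrow> int^'n::finite \<Rightarrow> (real^'n \<Rightarrow> ennreal) \<Rightarrow> ennreal" where
  "cube_avg j m h = 2 ^ (j * CARD('n)) * (\<integral>\<^sup>+x. h x \<partial>lebesgue_on (dyadic_cube j m))"

lemma cube_avg_const:
  fixes m :: "int^'n::finite"
  shows "cube_avg j m (\<lambda>_. c) = c"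
proof -
  have "emeasure (lebesgue_on (dyadic_cube j m)) (dyadic_cube j m) = ennreal (1 / 2 ^ (j * CARD('n)))" for m :: "int^'n"
    by (simp add: emeasure_restrict_space emeasure_dyadic_cube)
  moreover have "(2::ennreal) ^ (j * CARD('n)) * ennreal (1 / 2 ^ (j * CARD('n))) = 1"
    unfolding two_power_ennreal by (subst ennreal_mult[symmetric]) auto
  ultimately show ?thesis
    unfolding cube_avg_def by (simp add: mult.left_commute[of _ c])
qed

lemma cube_avg_mono_AE: "AE x in lebesgue_on (dyadic_cube j m). h x \<le> g x \<Longrightarrow> cube_avg j m h \<le> cube_avg j m g"
  unfolding cube_avg_def by (intro mult_left_mono nn_integral_mono_AE) auto

lemma cube_avg_cmult: "h \<in> borel_measurable lebesgue \<Longrightarrow> cube_avg j m (\<lambda>x. c * h x) = c * cube_avg j m h"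
  unfolding cube_avg_def by (simp add: nn_integral_cmult measurable_on_cube mult_ac)

lemma cube_avg_add: "h \<in> borel_measurable lebesgue \<Longrightarrow> g \<in> borel_measurable lebesgue \<Longrightarrow>
    cube_avg j m (\<lambda>x. h x + g x) = cube_avg j m h + cube_avg j m g"
  unfolding cube_avg_def by (simp add: nn_integral_add measurable_on_cube distrib_left)

lemma cube_mean_finite: "s \<noteq> \<infinity> \<Longrightarrow> cube_mean s j m g = epowr (cube_avg j m (\<lambda>x. epowr (ennreal \<bar>g x\<bar>) (enn2real s))) (1 / enn2real s)"
  by (simp add: cube_mean_def cube_avg_def)

text \<open>The ratio between a mean and a norm. It is the same for all cubes of a level and
  therefore cancels in the second condition on the weights; the type argument carries the
  dimension.\<close>

definition cube_factor :: "ennreal \<Rightarrow> nat \<Rightarrow> 'n::finite itself \<Rightarrow> ennreal" where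
  "cube_factor s j _ = (if s = \<infinity> then 1 else epowr (2 ^ (j * CARD('n))) (1 / enn2real s))"

lemma cube_factor_pos: "0 < cube_factor s j T" "cube_factor s j T < \<infinity>"
  by (auto simp: cube_factor_def epowr_ennreal two_power_ennreal)

lemma cube_mean_eq:
  fixes g :: "real^'n::finite \<Rightarrow> real"
  assumes "0 < s"
  shows "cube_mean s j m g = cube_factor s j TYPE('n) * nn_Lp (lebesgue_on (dyadic_cube j m)) s (\<lambda>x. ennreal \<bar>g x\<bar>)"
  using enn2real_pos[OF assms] by (auto simp: cube_mean_def cube_factor_def nn_Lp_def epowr_mult)

text \<open>A vanishing mean would force \<open>g = 0\<close> almost everywhere on a cube of
  positive measure. Since the product in the first condition on the weights is finite, positivity of
  both factors makes each of them finite.\<close>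

lemma cube_mean_pos:
  fixes g :: "real^'n::finite \<Rightarrow> real"
  assumes s: "0 < s" and g[measurable]: "g \<in> borel_measurable lebesgue" and pos: "AE x in lebesgue. 0 < g x"
  shows "0 < cube_mean s j m g"
proof (rule ccontr)
  assume "\<not> 0 < cube_mean s j m g"
  then have z: "cube_mean s j m g = 0" by (simp add: not_less)
  have "AE x in lebesgue_on (dyadic_cube j m). ennreal \<bar>g x\<bar> \<le> 0"
  proof (cases "s = \<infinity>")
    case True
    then show ?thesis using z esssup_AE[of "\<lambda>x. ennreal \<bar>g x\<bar>" "lebesgue_on (dyadic_cube j m)"] by (simp add: cube_mean_def)
  next
    case False
    then have "cube_avg j m (\<lambda>x. epowr (ennreal \<bar>g x\<bar>) (enn2real s)) = 0" using z by (simp add: cube_mean_finite)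
    then have "(\<integral>\<^sup>+x. epowr (ennreal \<bar>g x\<bar>) (enn2real s) \<partial>lebesgue_on (dyadic_cube j m)) = 0"
      by (simp add: cube_avg_def)
    then have "AE x in lebesgue_on (dyadic_cube j m). epowr (ennreal \<bar>g x\<bar>) (enn2real s) = 0"
      by (subst (asm) nn_integral_0_iff_AE) (auto intro!: measurable_on_cube)
    then show ?thesis by simp
  qed
  then have "AE x in lebesgue. x \<notin> dyadic_cube j m"
    unfolding AE_on_cube using pos by eventually_elim auto
  then have "dyadic_cube j m \<in> null_sets lebesgue"
    using AE_iff_null_sets[of "dyadic_cube j m" lebesgue] by simp
  then have "emeasure lebesgue (dyadic_cube j m) = 0" by auto
  then show False by (simp add: emeasure_dyadic_cube)
qed

text \<open>In all four cases \<open>1 / \<sigma> = 1 / r - 1 / p\<close>, the relation in Hoelder's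
  inequality; the list makes the infinite exponents explicit.\<close>

lemma conj_exp_cases:
  assumes r: "0 < r" "r \<le> p" and \<sigma>: "\<sigma> = r * conj_exp (exp_ratio p r)"
  obtains "p = \<infinity>" "r = \<infinity>" "\<sigma> = \<infinity>"
  | \<rho> where "0 < \<rho>" "r = ennreal \<rho>" "p = \<infinity>" "\<sigma> = ennreal \<rho>"
  | \<rho> where "0 < \<rho>" "r = ennreal \<rho>" "p = ennreal \<rho>" "\<sigma> = \<infinity>"
  | \<rho> \<pi> where "0 < \<rho>" "\<rho> < \<pi>" "r = ennreal \<rho>" "p = ennreal \<pi>" "\<sigma> = ennreal (\<rho> * \<pi> / (\<pi> - \<rho>))"
proof -
  have c1: "conj_exp 1 = \<infinity>" by (simp add: conj_exp_def)
  have ci: "conj_exp \<infinity> = 1" by (simp add: conj_exp_def)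
  show ?thesis
  proof (cases r)
    case top
    then have "p = \<infinity>" using r by (simp add: top_unique)
    then show ?thesis using that(1) \<sigma> top c1 by (simp add: exp_ratio_def ennreal_top_mult)
  next
    case (real \<rho>)
    then have \<rho>: "0 < \<rho>" using r by simp
    show ?thesis
    proof (cases p)
      case top
      then have "exp_ratio p r = \<infinity>" using real by (simp add: exp_ratio_def ennreal_top_divide)
      then show ?thesis using that(2)[OF \<rho>] \<sigma> real top ci by simp
    next
      case (real \<pi>)
      note p = this
      show ?thesis
      proof (cases "\<rho> = \<pi>")
        case True
        then show ?thesis using that(3)[OF \<rho>] \<sigma> \<open>r = ennreal \<rho>\<close> p c1 \<rho> by (simp add: exp_ratio_def ennreal_mult_top)
      next
        case False
        then have lt: "\<rho> < \<pi>" using r p \<open>r = ennreal \<rho>\<close> by (simp add: ennreal_le_iff)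
        have "exp_ratio p r = ennreal (\<pi> / \<rho>)" using p \<open>r = ennreal \<rho>\<close> lt \<rho> by (simp add: exp_ratio_def divide_ennreal)
        then have "conj_exp (exp_ratio p r) = inverse (1 - inverse (ennreal (\<pi> / \<rho>)))" by (simp add: conj_exp_def)
        also have "inverse (ennreal (\<pi> / \<rho>)) = ennreal (\<rho> / \<pi>)" using lt \<rho> by (simp add: inverse_ennreal)
        also have "1 - ennreal (\<rho> / \<pi>) = ennreal (1 - \<rho> / \<pi>)" using lt \<rho> by (simp add: ennreal_minus ennreal_1[symmetric] del: ennreal_1)
        also have "inverse (ennreal (1 - \<rho> / \<pi>)) = ennreal (\<pi> / (\<pi> - \<rho>))" using lt \<rho> by (simp add: inverse_ennreal field_simps)
        finally have "\<sigma> = ennreal (\<rho> * \<pi> / (\<pi> - \<rho>))"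
          using \<sigma> \<open>r = ennreal \<rho>\<close> lt \<rho> by (simp add: ennreal_mult[symmetric])
        then show ?thesis using that(4)[OF \<rho> lt] \<open>r = ennreal \<rho>\<close> p by simp
      qed
    qed
  qed
qed

lemma powr_le_one_add:
  fixes c :: real assumes "0 \<le> c" "0 < \<mu>" "\<mu> \<le> \<rho>" shows "c powr \<mu> \<le> 1 + c powr \<rho>"
proof (cases "c \<le> 1")
  case True
  then have "c powr \<mu> \<le> 1 powr \<mu>" using assms by (intro powr_mono2) auto
  then show ?thesis by (simp add: add_increasing2)
next
  case False
  then have "c powr \<mu> \<le> c powr \<rho>" using assms by (intro powr_mono) auto
  then show ?thesis by simp
qed

text \<open>A crude form of Young's inequality; constants do not matter below.\<close>

lemma holder_pointwise:
  fixes a b \<mu> :: real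
  assumes r: "0 < r" "r \<le> p" and \<sigma>: "\<sigma> = r * conj_exp (exp_ratio p r)"
    and \<mu>: "0 < \<mu>" "ennreal \<mu> \<le> r" and ab: "0 \<le> a" "0 \<le> b"
    and a1: "p = \<infinity> \<Longrightarrow> a \<le> 1" and b1: "\<sigma> = \<infinity> \<Longrightarrow> b \<le> 1"
  shows "(a * b) powr \<mu> \<le> 1 + (if p = \<infinity> then 0 else a powr enn2real p) + (if \<sigma> = \<infinity> then 0 else b powr enn2real \<sigma>)"
  using r \<sigma>
proof (cases rule: conj_exp_cases)
  case 1
  then have "a * b \<le> 1" using a1 b1 ab by (simp add: mult_le_one)
  then have "(a * b) powr \<mu> \<le> 1 powr \<mu>" using ab \<mu> by (intro powr_mono2) auto
  then show ?thesis using 1 by simp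
next
  case (2 \<rho>)
  then have "\<mu> \<le> \<rho>" using \<mu> by (simp add: ennreal_le_iff)
  then have "(a * b) powr \<mu> \<le> 1 + (a * b) powr \<rho>" using ab \<mu> by (intro powr_le_one_add) auto
  also have "(a * b) powr \<rho> \<le> b powr \<rho>" using 2 a1 ab by (intro powr_mono2) (auto simp: mult_left_le_one_le)
  finally show ?thesis using 2 by simp
next
  case (3 \<rho>)
  then have "\<mu> \<le> \<rho>" using \<mu> by (simp add: ennreal_le_iff)
  then have "(a * b) powr \<mu> \<le> 1 + (a * b) powr \<rho>" using ab \<mu> by (intro powr_le_one_add) auto
  also have "(a * b) powr \<rho> \<le> a powr \<rho>" using 3 b1 ab by (intro powr_mono2) (auto simp: mult_right_le_one_le)
  finally show ?thesis using 3 by simp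
next
  case (4 \<rho> \<pi>)
  let ?s = "\<rho> * \<pi> / (\<pi> - \<rho>)"
  have s: "0 \<le> ?s" using 4 by simp
  have "\<mu> \<le> \<rho>" using \<mu> 4 by (simp add: ennreal_le_iff)
  then have "(a * b) powr \<mu> \<le> 1 + (a * b) powr \<rho>" using ab \<mu> by (intro powr_le_one_add) auto
  also have "(a * b) powr \<rho> \<le> a powr \<pi> + b powr ?s"
  proof (cases "a = 0")
    case False
    then have a: "0 < a" using ab by simp
    \<comment> \<open>The two powers on the right balance at
      \<open>b = a powr ((\<pi> - \<rho>) / \<rho>)\<close>; on either side of this threshold the
      larger one alone bounds the product.\<close>
    show ?thesis
    proof (cases "b \<le> a powr ((\<pi> - \<rho>) / \<rho>)")
      case True
      then have "b powr \<rho> \<le> (a powr ((\<pi> - \<rho>) / \<rho>)) powr \<rho>" using ab 4 by (intro powr_mono2) auto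
      also have "\<dots> = a powr (\<pi> - \<rho>)" using 4 by (simp add: powr_powr)
      finally have "a powr \<rho> * b powr \<rho> \<le> a powr \<rho> * a powr (\<pi> - \<rho>)" by (intro mult_left_mono) auto
      also have "\<dots> = a powr \<pi>" by (simp add: powr_add[symmetric])
      finally show ?thesis using ab by (simp add: powr_mult add_increasing2)
    next
      case False
      then have le: "a powr ((\<pi> - \<rho>) / \<rho>) \<le> b" and b: "0 < b"
        using a by (auto intro: less_le_trans[OF powr_gt_zero[THEN iffD2], of a] simp: not_le) (metis a less_trans not_le powr_gt_zero less_irrefl)
      have "(a powr ((\<pi> - \<rho>) / \<rho>)) powr (\<rho> / (\<pi> - \<rho>)) \<le> b powr (\<rho> / (\<pi> - \<rho>))" using le 4 by (intro powr_mono2) auto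
      then have "a \<le> b powr (\<rho> / (\<pi> - \<rho>))" using a 4 by (simp add: powr_powr)
      then have "a powr \<rho> \<le> (b powr (\<rho> / (\<pi> - \<rho>))) powr \<rho>" using ab 4 by (intro powr_mono2) auto
      then have "a powr \<rho> * b powr \<rho> \<le> (b powr (\<rho> / (\<pi> - \<rho>))) powr \<rho> * b powr \<rho>" by (intro mult_right_mono) auto
      also have "\<dots> = b powr (\<rho> / (\<pi> - \<rho>) * \<rho> + \<rho>)" by (simp add: powr_powr powr_add)
      also have "\<rho> / (\<pi> - \<rho>) * \<rho> + \<rho> = ?s" using 4 by (simp add: field_simps)
      finally show ?thesis using ab by (simp add: powr_mult add_increasing)
    qed
  qed simp
  finally show ?thesis using 4 s by (simp add: add.assoc)
qed

lemma conj_exp_pos: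
  assumes "0 < r" "r \<le> p" "\<sigma> = r * conj_exp (exp_ratio p r)" shows "0 < \<sigma>"
  using assms by (cases rule: conj_exp_cases) (auto simp: divide_pos_pos)

text \<open>Write \<open>u = (t u) / t\<close> and normalize both factors by their means
  \<open>X\<close> and \<open>Y\<close>. Each of the three terms of the pointwise inequality then
  has average at most 1, whence the constant 3. \<open>Y\<close> is positive and finite, while
  \<open>X = 0\<close> and \<open>X = \<infinity>\<close> are treated apart.\<close>

lemma holder_cube:
  fixes t u :: "real^'n::finite \<Rightarrow> real"
  assumes r: "0 < r" "r \<le> p" and \<sigma>: "\<sigma> = r * conj_exp (exp_ratio p r)"
    and \<mu>: "0 < \<mu>" "ennreal \<mu> \<le> r"
    and t[measurable]: "t \<in> borel_measurable lebesgue" and tpos: "AE x in lebesgue. 0 < t x"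
    and u[measurable]: "u \<in> borel_measurable lebesgue" and u0: "\<And>x. 0 \<le> u x"
    and Yfin: "cube_mean \<sigma> j m (\<lambda>x. inverse (t x)) < \<infinity>"
  shows "cube_avg j m (\<lambda>x. ennreal (u x powr \<mu>))
    \<le> ennreal 3 * epowr (cube_mean p j m (\<lambda>x. t x * u x) * cube_mean \<sigma> j m (\<lambda>x. inverse (t x))) \<mu>"
proof -
  let ?Q = "lebesgue_on (dyadic_cube j m)"
  have p0: "0 < p" using r by (rule less_le_trans)
  have s0: "0 < \<sigma>" by (rule conj_exp_pos[OF r \<sigma>])
  define X where "X = cube_mean p j m (\<lambda>x. t x * u x)"
  define Y where "Y = cube_mean \<sigma> j m (\<lambda>x. inverse (t x))"
  have "AE x in lebesgue. 0 < inverse (t x)" using tpos by eventually_elim simp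
  then have Ypos: "0 < Y" unfolding Y_def by (intro cube_mean_pos s0) auto
  obtain Y' where Y': "Y = ennreal Y'" "0 < Y'" using Yfin Ypos unfolding Y_def[symmetric] by (cases Y) auto
  have tQ: "AE x in ?Q. 0 < t x" unfolding AE_on_cube using tpos by eventually_elim simp
  have mQ: "h \<in> borel_measurable ?Q" if "h \<in> borel_measurable lebesgue" for h :: "real^'n \<Rightarrow> ennreal"
    using that by (rule measurable_on_cube)
  have Xe: "cube_avg j m (\<lambda>x. epowr (ennreal \<bar>t x * u x\<bar>) (enn2real p)) = epowr X (enn2real p)" if "p \<noteq> \<infinity>"
    using enn2real_pos[OF p0 that] that by (simp add: X_def cube_mean_finite epowr_epowr)
  have Ye: "cube_avg j m (\<lambda>x. epowr (ennreal \<bar>inverse (t x)\<bar>) (enn2real \<sigma>)) = epowr Y (enn2real \<sigma>)" if "\<sigma> \<noteq> \<infinity>"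
    using enn2real_pos[OF s0 that] that by (simp add: Y_def cube_mean_finite epowr_epowr)
  have Xi: "AE x in ?Q. ennreal \<bar>t x * u x\<bar> \<le> X" if "p = \<infinity>"
    using that esssup_AE[of "\<lambda>x. ennreal \<bar>t x * u x\<bar>" ?Q] by (simp add: X_def cube_mean_def)
  have Yi: "AE x in ?Q. ennreal \<bar>inverse (t x)\<bar> \<le> Y" if "\<sigma> = \<infinity>"
    using that esssup_AE[of "\<lambda>x. ennreal \<bar>inverse (t x)\<bar>" ?Q] by (simp add: Y_def cube_mean_def)
  consider "X = \<infinity>" | "X = 0" | X' where "X = ennreal X'" "0 < X'"
    by (cases X) (auto simp: less_le)
  then have "cube_avg j m (\<lambda>x. ennreal (u x powr \<mu>)) \<le> ennreal 3 * epowr (X * Y) \<mu>"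
  proof cases
    case 1
    then show ?thesis using Y' by (simp add: ennreal_top_mult ennreal_mult_top)
  next
    case 2
    have "AE x in ?Q. ennreal \<bar>t x * u x\<bar> = 0"
    proof (cases "p = \<infinity>")
      case True
      then show ?thesis using Xi 2 by simp
    next
      case False
      have "(\<integral>\<^sup>+x. epowr (ennreal \<bar>t x * u x\<bar>) (enn2real p) \<partial>?Q) = 0"
        using Xe[OF False] 2 by (simp add: cube_avg_def)
      then have "AE x in ?Q. epowr (ennreal \<bar>t x * u x\<bar>) (enn2real p) = 0"
        by (subst (asm) nn_integral_0_iff_AE) (auto intro!: mQ)
      then show ?thesis by simp
    qed
    then have "AE x in ?Q. ennreal (u x powr \<mu>) \<le> 0" using tQ by eventually_elim auto
    then have "cube_avg j m (\<lambda>x. ennreal (u x powr \<mu>)) \<le> cube_avg j m (\<lambda>x::real^'n. 0)" by (rule cube_avg_mono_AE)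
    also have "\<dots> = 0" by (rule cube_avg_const)
    finally show ?thesis by simp
  next
    case (3 X')
    define A where "A x = (if p = \<infinity> then 0 else epowr (inverse X) (enn2real p) * epowr (ennreal \<bar>t x * u x\<bar>) (enn2real p))" for x
    define B where "B x = (if \<sigma> = \<infinity> then 0 else epowr (inverse Y) (enn2real \<sigma>) * epowr (ennreal \<bar>inverse (t x)\<bar>) (enn2real \<sigma>))" for x
    have [measurable]: "A \<in> borel_measurable lebesgue" "B \<in> borel_measurable lebesgue"
      unfolding A_def[abs_def] B_def[abs_def] by measurable
    have one: "epowr (inverse Z) q * epowr Z q = 1" if "Z = ennreal z" "0 < z" "0 < q" for Z z q
    proof -
      have "inverse Z * Z = 1" using that by (simp add: inverse_ennreal ennreal_mult[symmetric])
      then show ?thesis using epowr_mult[OF that(3), of "inverse Z" Z] by simp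
    qed
    have avgA: "cube_avg j m A \<le> 1"
    proof (cases "p = \<infinity>")
      case True
      then have "A = (\<lambda>x. 0)" by (auto simp: A_def)
      then show ?thesis by (simp add: cube_avg_const)
    next
      case False
      have "cube_avg j m A = epowr (inverse X) (enn2real p) * epowr X (enn2real p)"
        unfolding A_def[abs_def] using False by (simp add: cube_avg_cmult Xe)
      then show ?thesis using one[OF 3 enn2real_pos[OF p0 False]] by simp
    qed
    have avgB: "cube_avg j m B \<le> 1"
    proof (cases "\<sigma> = \<infinity>")
      case True
      then have "B = (\<lambda>x. 0)" by (auto simp: B_def)
      then show ?thesis by (simp add: cube_avg_const)
    next
      case False
      have "cube_avg j m B = epowr (inverse Y) (enn2real \<sigma>) * epowr Y (enn2real \<sigma>)"
        unfolding B_def[abs_def] using False by (simp add: cube_avg_cmult Ye del: abs_inverse)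
      then show ?thesis using one[OF Y' enn2real_pos[OF s0 False]] by simp
    qed
    have "AE x in ?Q. p = \<infinity> \<longrightarrow> ennreal \<bar>t x * u x\<bar> \<le> X" using Xi by (cases "p = \<infinity>") auto
    moreover have "AE x in ?Q. \<sigma> = \<infinity> \<longrightarrow> ennreal \<bar>inverse (t x)\<bar> \<le> Y" using Yi by (cases "\<sigma> = \<infinity>") auto
    ultimately have "AE x in ?Q. ennreal (u x powr \<mu>) \<le> epowr (X * Y) \<mu> * (1 + A x + B x)"
      using tQ
    proof eventually_elim
      case (elim x)
      define a where "a = t x * u x / X'"
      define b where "b = inverse (t x) / Y'"
      have ab: "0 \<le> a" "0 \<le> b" using elim u0[of x] 3 Y' by (auto simp: a_def b_def)
      have a1: "a \<le> 1" if "p = \<infinity>" using elim(1,3) that 3 u0[of x] by (simp add: a_def ennreal_le_iff abs_mult)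
      have b1: "b \<le> 1" if "\<sigma> = \<infinity>" using elim(2,3) that Y' by (simp add: b_def ennreal_le_iff)
      have Aa: "A x = ennreal (if p = \<infinity> then 0 else a powr enn2real p)"
      proof (cases "p = \<infinity>")
        case False
        have "A x = epowr (inverse X * ennreal \<bar>t x * u x\<bar>) (enn2real p)"
          using False enn2real_pos[OF p0 False] by (simp add: A_def epowr_mult)
        also have "inverse X * ennreal \<bar>t x * u x\<bar> = ennreal a"
          using 3 elim(3) u0[of x] by (simp add: a_def inverse_ennreal ennreal_mult[symmetric] divide_inverse mult.commute)
        finally show ?thesis using False ab by (simp add: epowr_ennreal)
      qed (simp add: A_def)
      have Bb: "B x = ennreal (if \<sigma> = \<infinity> then 0 else b powr enn2real \<sigma>)"
      proof (cases "\<sigma> = \<infinity>")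
        case False
        have "B x = epowr (inverse Y * ennreal \<bar>inverse (t x)\<bar>) (enn2real \<sigma>)"
          using False enn2real_pos[OF s0 False] by (simp add: B_def epowr_mult)
        also have "inverse Y * ennreal \<bar>inverse (t x)\<bar> = ennreal b"
          using Y' elim(3) by (simp add: b_def inverse_ennreal ennreal_mult[symmetric] divide_inverse mult.commute)
        finally show ?thesis using False ab by (simp add: epowr_ennreal)
      qed (simp add: B_def)
      have "u x = (X' * Y') * (a * b)" using elim 3 Y' by (simp add: a_def b_def)
      then have "u x powr \<mu> = (X' * Y') powr \<mu> * (a * b) powr \<mu>" using ab 3 Y' by (simp add: powr_mult)
      also have "\<dots> \<le> (X' * Y') powr \<mu> * (1 + (if p = \<infinity> then 0 else a powr enn2real p) + (if \<sigma> = \<infinity> then 0 else b powr enn2real \<sigma>))"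
        by (intro mult_left_mono holder_pointwise[OF r \<sigma> \<mu> ab a1 b1]) auto
      finally have "ennreal (u x powr \<mu>) \<le> ennreal ((X' * Y') powr \<mu> * (1 + (if p = \<infinity> then 0 else a powr enn2real p) + (if \<sigma> = \<infinity> then 0 else b powr enn2real \<sigma>)))"
        by (rule ennreal_leI)
      also have "\<dots> = ennreal ((X' * Y') powr \<mu>) * ennreal (1 + (if p = \<infinity> then 0 else a powr enn2real p) + (if \<sigma> = \<infinity> then 0 else b powr enn2real \<sigma>))"
        by (rule ennreal_mult) auto
      also have "ennreal (1 + (if p = \<infinity> then 0 else a powr enn2real p) + (if \<sigma> = \<infinity> then 0 else b powr enn2real \<sigma>)) = 1 + A x + B x"
        unfolding Aa Bb by (subst ennreal_plus; simp)+
      also have "ennreal ((X' * Y') powr \<mu>) = epowr (X * Y) \<mu>"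
        using 3 Y' by (simp add: ennreal_mult[symmetric] epowr_ennreal)
      finally show ?case .
    qed
    then have "cube_avg j m (\<lambda>x. ennreal (u x powr \<mu>)) \<le> cube_avg j m (\<lambda>x. epowr (X * Y) \<mu> * (1 + A x + B x))"
      by (rule cube_avg_mono_AE)
    also have "\<dots> = epowr (X * Y) \<mu> * (1 + cube_avg j m A + cube_avg j m B)"
      by (simp add: cube_avg_cmult cube_avg_add cube_avg_const)
    also have "\<dots> \<le> epowr (X * Y) \<mu> * (1 + 1 + 1)"
      using avgA avgB by (intro mult_left_mono add_mono) auto
    also have "(1 + 1 + 1 :: ennreal) = ennreal 3" by (simp add: ennreal_numeral[symmetric] ennreal_1[symmetric] ennreal_plus[symmetric] del: ennreal_numeral ennreal_1 ennreal_plus)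
    finally show ?thesis by (simp only: mult.commute)
  qed
  then show ?thesis by (simp only: X_def Y_def)
qed

text \<open>The number of unit steps along the axes, each costing a factor
  \<open>2 powr \<alpha>3\<close>. Diagonal steps would be fewer, but an additive count lets lattice
  sums factor over the coordinates.\<close>

definition int_l1 :: "int^'n::finite \<Rightarrow> nat" where
  "int_l1 d = (\<Sum>i\<in>UNIV. nat \<bar>d $ i\<bar>)"

lemma neighbour_chain:
  fixes T :: "int^'n::finite \<Rightarrow> ennreal"
  assumes nb: "\<And>m m'. (\<forall>i. \<bar>m $ i - m' $ i\<bar> \<le> 1) \<Longrightarrow> T m \<le> ennreal (2 powr \<alpha>) * T m'"
  shows "T m \<le> ennreal (2 powr (\<alpha> * real (int_l1 d))) * T (m + d)"
proof (induction "int_l1 d" arbitrary: m d)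
  case 0
  then have "d $ i = 0" for i by (auto simp: int_l1_def)
  then have "d = 0" by (simp add: vec_eq_iff)
  then show ?case by (simp add: int_l1_def)
next
  case (Suc N)
  then obtain i where i: "d $ i \<noteq> 0" by (auto simp: int_l1_def) (metis Suc.hyps(2) Zero_not_Suc abs_zero int_l1_def nat_0 sum.neutral)
  define a where "a = (axis i (sgn (d $ i)) :: int^'n)"
  have "int_l1 d = nat \<bar>d $ i\<bar> + (\<Sum>k\<in>UNIV - {i}. nat \<bar>d $ k\<bar>)" unfolding int_l1_def by (rule sum.remove) auto
  moreover have "int_l1 (d - a) = nat \<bar>(d - a) $ i\<bar> + (\<Sum>k\<in>UNIV - {i}. nat \<bar>(d - a) $ k\<bar>)" unfolding int_l1_def by (rule sum.remove) auto
  moreover have "(\<Sum>k\<in>UNIV - {i}. nat \<bar>(d - a) $ k\<bar>) = (\<Sum>k\<in>UNIV - {i}. nat \<bar>d $ k\<bar>)"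
    by (intro sum.cong) (auto simp: a_def axis_def)
  moreover have "nat \<bar>d $ i\<bar> = Suc (nat \<bar>(d - a) $ i\<bar>)" using i by (auto simp: a_def sgn_if)
  ultimately have N: "N = int_l1 (d - a)" using Suc.hyps(2) by simp
  have "T m \<le> ennreal (2 powr \<alpha>) * T (m + a)"
    by (rule nb) (auto simp: a_def axis_def sgn_if)
  also have "T (m + a) \<le> ennreal (2 powr (\<alpha> * real (int_l1 (d - a)))) * T (m + a + (d - a))"
    by (rule Suc.hyps(1)[OF N])
  finally have "T m \<le> ennreal (2 powr \<alpha>) * (ennreal (2 powr (\<alpha> * real (int_l1 (d - a)))) * T (m + d))"
    by (simp add: mult_left_mono)
  also have "\<dots> = ennreal (2 powr \<alpha> * 2 powr (\<alpha> * real N)) * T (m + d)"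
    by (simp add: ennreal_mult mult.assoc N)
  also have "2 powr \<alpha> * 2 powr (\<alpha> * real N) = 2 powr (\<alpha> * real (int_l1 d))"
    by (simp add: Suc.hyps(2)[symmetric] powr_add[symmetric] distrib_left)
  finally show ?case .
qed

text \<open>On a cube of level \<open>j\<close>, \<open>c2\<close> replaces \<open>t k\<close> by
  \<open>t j\<close>, the chain of neighbours moves to the cube shifted by \<open>d\<close>, and
  there \<open>c1\<close> with Hoelder's inequality brings in \<open>t l\<close>. The average is
  raised to \<open>1 / \<mu>\<close> so that cubes are compared in the exponent \<open>p\<close>;
  the power \<open>\<mu>\<close> is restored at the end and turns \<open>3 powr (1 / \<mu>)\<close>
  back into 3.\<close>

lemma weighted_step:
  fixes t :: "nat \<Rightarrow> real^'n::finite \<Rightarrow> real" and u :: "real^'n \<Rightarrow> real"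
  assumes r: "0 < r" "r \<le> p" and \<sigma>: "\<sigma> = r * conj_exp (exp_ratio p r)"
    and \<mu>: "0 < \<mu>" "ennreal \<mu> \<le> r"
    and wt: "\<And>k. weight (t k)"
    and C1: "0 < C1" and C2: "0 < C2" and \<alpha>1: "\<And>k. 0 < \<alpha>1 k" and \<alpha>2: "\<And>k. 0 < \<alpha>2 k"
    and c1: "\<And>k j m. k \<le> j \<Longrightarrow> cube_mean p k m (t k) * cube_mean \<sigma> k m (\<lambda>x. inverse (t j x)) \<le> ennreal (C1 * (\<alpha>1 k / \<alpha>1 j))"
    and c2: "\<And>k j m. k \<le> j \<Longrightarrow> inverse (cube_mean p k m (t k)) * cube_mean p k m (t j) \<le> ennreal (C2 * (\<alpha>2 j / \<alpha>2 k))"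
    and c3: "\<And>k m m'. (\<forall>i. \<bar>m $ i - m' $ i\<bar> \<le> 1) \<Longrightarrow> cube_norm p k m (t k) \<le> ennreal (2 powr \<alpha>3) * cube_norm p k m' (t k)"
    and u: "u \<in> borel_measurable lebesgue" and u0: "\<And>x. 0 \<le> u x" and jk: "j \<le> k" "j \<le> l"
  shows "nn_Lp lebesgue (p / ennreal \<mu>) (\<lambda>x. epowr (ennreal \<bar>t k x\<bar>) \<mu> * cube_avg j (cube_index j x + d) (\<lambda>x. ennreal (u x powr \<mu>)))
     \<le> ennreal (3 * (C1 * (\<alpha>1 j / \<alpha>1 l) * (C2 * (\<alpha>2 k / \<alpha>2 j)) * 2 powr (\<alpha>3 * real (int_l1 d))) powr \<mu>) * epowr (nn_Lp lebesgue p (\<lambda>x. ennreal (\<bar>t l x\<bar> * u x))) \<mu>"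
proof -
  have p0: "0 < p" using r by (rule less_le_trans)
  have s0: "0 < \<sigma>" by (rule conj_exp_pos[OF r \<sigma>])
  have tm[measurable]: "t k \<in> borel_measurable lebesgue" and tp: "AE x in lebesgue. 0 < t k x" for k
    using wt[of k] by (auto simp: weight_def)
  note u[measurable]
  let ?F = "cube_factor p j TYPE('n)"
  let ?v = "\<lambda>x. ennreal (u x powr \<mu>)"
  let ?N = "\<lambda>m h. nn_Lp (lebesgue_on (dyadic_cube j m)) p h"
  define T where "T m = cube_norm p j m (t j)" for m
  define g where "g x = ennreal (\<bar>t l x\<bar> * u x)" for x
  define f where "f x = ennreal \<bar>t k x\<bar>" for x
  define A where "A m = epowr (cube_avg j (m + d) ?v) (1 / \<mu>)" for m
  have [measurable]: "g \<in> borel_measurable lebesgue" "f \<in> borel_measurable lebesgue"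
    unfolding g_def[abs_def] f_def[abs_def] by measurable
  have TN: "T m = ?N m (\<lambda>x. ennreal \<bar>t j x\<bar>)" for m by (simp add: T_def cube_norm_def Lp_norm_nn_Lp)
  have FT: "cube_mean p j m (t j) = ?F * T m" for m unfolding TN by (rule cube_mean_eq[OF p0])
  have FTpos: "0 < ?F * T m" for m
    unfolding FT[symmetric] by (rule cube_mean_pos[OF p0 tm tp])
  define Y where "Y m = cube_mean \<sigma> j m (\<lambda>x. inverse (t l x))" for m
  have Ypos: "0 < Y m" for m
    unfolding Y_def using tp[of l] by (intro cube_mean_pos s0) (auto elim: eventually_mono)
  have c1': "?F * T m * Y m \<le> ennreal (C1 * (\<alpha>1 j / \<alpha>1 l))" for m
    using c1[OF jk(2), of m] by (simp add: FT Y_def)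
  have fin: "Y m < \<infinity>" "?F * T m < \<infinity>" for m
  proof -
    have lt: "?F * T m * Y m < \<infinity>" using c1'[of m] by (rule le_less_trans) simp
    show "Y m < \<infinity>"
    proof (rule ccontr)
      assume "\<not> Y m < \<infinity>"
      then have "Y m = top" by (metis less_top infinity_ennreal_def)
      then show False using lt FTpos[of m] by (auto simp: ennreal_mult_top split: if_splits)
    qed
    show "?F * T m < \<infinity>"
    proof (rule ccontr)
      assume "\<not> ?F * T m < \<infinity>"
      then have "?F * T m = top" by (metis less_top infinity_ennreal_def)
      then show False using lt Ypos[of m] by (auto simp: ennreal_top_mult split: if_splits)
    qed
  qed
  have c2': "?N m f \<le> ennreal (C2 * (\<alpha>2 k / \<alpha>2 j)) * T m" for m
  proof -
    have "?F * ?N m f = cube_mean p j m (t k)" unfolding f_def by (rule cube_mean_eq[OF p0, symmetric])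
    then have "inverse (?F * T m) * (?F * ?N m f) \<le> ennreal (C2 * (\<alpha>2 k / \<alpha>2 j))"
      using c2[OF jk(1), of m] by (simp add: FT)
    then have "(?F * T m) * (inverse (?F * T m) * (?F * ?N m f)) \<le> (?F * T m) * ennreal (C2 * (\<alpha>2 k / \<alpha>2 j))"
      by (rule mult_left_mono) simp
    moreover have "(?F * T m) * inverse (?F * T m) = 1"
      using ennreal_divide_self[OF FTpos[of m, THEN less_imp_neq, THEN not_sym]] fin(2)[of m]
      unfolding divide_ennreal_def infinity_ennreal_def .
    ultimately have "?F * ?N m f \<le> ?F * (T m * ennreal (C2 * (\<alpha>2 k / \<alpha>2 j)))"
      by (simp only: mult.assoc[symmetric]) (simp only: mult_1 mult.assoc)
    then have "?N m f \<le> T m * ennreal (C2 * (\<alpha>2 k / \<alpha>2 j))"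
      using cube_factor_pos[of p j "TYPE('n)"] ennreal_mult_le_mult_iff[of ?F "?N m f" "T m * ennreal (C2 * (\<alpha>2 k / \<alpha>2 j))"] by simp
    then show ?thesis by (simp only: mult.commute)
  qed
  have c3': "T m \<le> ennreal (2 powr (\<alpha>3 * real (int_l1 d))) * T (m + d)" for m
    by (rule neighbour_chain) (use c3 in \<open>auto simp: T_def\<close>)
  have hold: "A m \<le> ennreal (3 powr (1 / \<mu>)) * (?F * ?N (m + d) g * Y (m + d))" for m
  proof -
    have "cube_avg j (m + d) ?v \<le> ennreal 3 * epowr (cube_mean p j (m + d) (\<lambda>x. t l x * u x) * Y (m + d)) \<mu>"
      unfolding Y_def by (rule holder_cube[OF r \<sigma> \<mu> tm tp u u0]) (use fin Y_def in simp)
    moreover have "cube_mean p j (m + d) (\<lambda>x. t l x * u x) = ?F * ?N (m + d) g"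
      using cube_mean_eq[OF p0, of j "m + d" "\<lambda>x. t l x * u x"] u0 by (simp add: g_def[abs_def] abs_mult)
    ultimately have "A m \<le> epowr (ennreal 3 * epowr (?F * ?N (m + d) g * Y (m + d)) \<mu>) (1 / \<mu>)"
      unfolding A_def using \<mu> by (intro epowr_mono) auto
    also have "\<dots> = ennreal (3 powr (1 / \<mu>)) * (?F * ?N (m + d) g * Y (m + d))"
      using \<mu> by (simp add: epowr_mult epowr_epowr epowr_ennreal[symmetric])
    finally show ?thesis .
  qed
  define G where "G = ennreal (3 powr (1 / \<mu>) * (C1 * (\<alpha>1 j / \<alpha>1 l) * (C2 * (\<alpha>2 k / \<alpha>2 j)) * 2 powr (\<alpha>3 * real (int_l1 d))))"
  have pos: "0 \<le> C1 * (\<alpha>1 j / \<alpha>1 l)" "0 \<le> C2 * (\<alpha>2 k / \<alpha>2 j)"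
    using C1 C2 \<alpha>1[of j] \<alpha>1[of l] \<alpha>2[of j] \<alpha>2[of k] by auto
  have "nn_Lp lebesgue p (\<lambda>x. f x * A (cube_index j x)) \<le> G * nn_Lp lebesgue p g"
  proof (rule nn_Lp_step_le[OF p0])
    fix m
    let ?a = "ennreal (3 powr (1 / \<mu>))" and ?b = "ennreal (C1 * (\<alpha>1 j / \<alpha>1 l))" and ?c = "ennreal (C2 * (\<alpha>2 k / \<alpha>2 j))" and ?e = "ennreal (2 powr (\<alpha>3 * real (int_l1 d)))"
    have "?N m f * A m \<le> (?c * (?e * T (m + d))) * (?a * (?F * ?N (m + d) g * Y (m + d)))"
      by (intro mult_mono order_trans[OF c2' mult_left_mono[OF c3']] hold) auto
    also have "\<dots> = (?a * ?c * ?e * ?N (m + d) g) * (?F * T (m + d) * Y (m + d))" by (simp only: mult_ac)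
    also have "\<dots> \<le> (?a * ?c * ?e * ?N (m + d) g) * ?b" by (intro mult_left_mono c1') auto
    also have "\<dots> = (?a * (?b * ?c * ?e)) * ?N (m + d) g" by (simp only: mult_ac)
    also have "?a * (?b * ?c * ?e) = G" unfolding G_def by (simp only: ennreal_mult pos mult_nonneg_nonneg powr_ge_zero)
    finally show "?N m f * A m \<le> G * ?N (m + d) g" .
  qed measurable
  then have "epowr (nn_Lp lebesgue p (\<lambda>x. f x * A (cube_index j x))) \<mu> \<le> epowr (G * nn_Lp lebesgue p g) \<mu>"
    using \<mu> by (intro epowr_mono) auto
  moreover have "epowr (nn_Lp lebesgue p (\<lambda>x. f x * A (cube_index j x))) \<mu> = nn_Lp lebesgue (p / ennreal \<mu>) (\<lambda>x. epowr (f x * A (cube_index j x)) \<mu>)"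
    by (rule nn_Lp_power[OF p0 \<mu>(1)]) measurable
  moreover have "epowr (f x * A (cube_index j x)) \<mu> = epowr (ennreal \<bar>t k x\<bar>) \<mu> * cube_avg j (cube_index j x + d) ?v" for x
    using \<mu> by (simp add: epowr_mult A_def epowr_epowr f_def)
  moreover have "epowr (G * nn_Lp lebesgue p g) \<mu> = ennreal (3 * (C1 * (\<alpha>1 j / \<alpha>1 l) * (C2 * (\<alpha>2 k / \<alpha>2 j)) * 2 powr (\<alpha>3 * real (int_l1 d))) powr \<mu>) * epowr (nn_Lp lebesgue p g) \<mu>"
  proof -
    have "epowr G \<mu> = ennreal ((3 powr (1 / \<mu>)) powr \<mu> * (C1 * (\<alpha>1 j / \<alpha>1 l) * (C2 * (\<alpha>2 k / \<alpha>2 j)) * 2 powr (\<alpha>3 * real (int_l1 d))) powr \<mu>)"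
      unfolding G_def by (simp only: epowr_ennreal powr_mult mult_nonneg_nonneg powr_ge_zero pos)
    then show ?thesis using \<mu> by (simp add: epowr_mult powr_powr)
  qed
  ultimately show ?thesis by (simp add: g_def[abs_def])
qed

text \<open>An enumeration turns sums over the lattice into series, the form in which Minkowski's
  inequality is available.\<close>

definition int_enum :: "nat \<Rightarrow> int^'n::finite" where
  "int_enum = from_nat_into UNIV"

lemma bij_int_enum: "bij_betw (int_enum :: nat \<Rightarrow> int^'n::finite) UNIV UNIV"
  unfolding int_enum_def
proof (rule bij_betw_from_nat_into)
  have "inj (\<lambda>z::int. (\<chi> i. z) :: int^'n)" by (auto simp: inj_def vec_eq_iff)
  then show "infinite (UNIV :: (int^'n) set)"
    using infinite_UNIV_int by (metis finite_subset finite_imageD top_greatest)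
qed auto

lemma nn_integral_int_enum:
  "(\<integral>\<^sup>+m. h m \<partial>count_space (UNIV :: (int^'n::finite) set)) = (\<Sum>n. h (int_enum n))"
  unfolding nn_integral_count_space_nat[symmetric]
  by (rule nn_integral_bij_count_space[OF bij_int_enum, symmetric])

lemma sum_abs_int_le:
  fixes \<omega> :: real assumes \<omega>: "0 \<le> \<omega>" "\<omega> < 1"
  shows "(\<Sum>z\<in>{-int R..int R}. \<omega> ^ nat \<bar>z\<bar>) \<le> 2 / (1 - \<omega>)"
proof -
  have geo: "(\<Sum>k\<le>R. \<omega> ^ k) \<le> 1 / (1 - \<omega>)"
  proof -
    have "(\<Sum>k\<le>R. \<omega> ^ k) \<le> (\<Sum>k. \<omega> ^ k)" using \<omega> by (intro sum_le_suminf summable_geometric) auto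
    then show ?thesis using \<omega> by (simp add: suminf_geometric)
  qed
  have "(\<Sum>z\<in>{-int R..int R}. \<omega> ^ nat \<bar>z\<bar>) \<le> (\<Sum>z\<in>int ` {..R} \<union> (\<lambda>k. - int k) ` {..R}. \<omega> ^ nat \<bar>z\<bar>)"
  proof (rule sum_mono2)
    show "{- int R..int R} \<subseteq> int ` {..R} \<union> (\<lambda>k. - int k) ` {..R}"
    proof
      fix z assume "z \<in> {- int R..int R}"
      then have "z = int (nat z) \<and> nat z \<le> R \<or> z = - int (nat (- z)) \<and> nat (- z) \<le> R" by auto
      then show "z \<in> int ` {..R} \<union> (\<lambda>k. - int k) ` {..R}" by blast
    qed
  qed (use \<omega> in auto)
  also have "\<dots> \<le> (\<Sum>z\<in>int ` {..R}. \<omega> ^ nat \<bar>z\<bar>) + (\<Sum>z\<in>(\<lambda>k. - int k) ` {..R}. \<omega> ^ nat \<bar>z\<bar>)"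
    using \<omega> by (subst sum_Un) (auto intro!: sum_nonneg)
  also have "(\<Sum>z\<in>int ` {..R}. \<omega> ^ nat \<bar>z\<bar>) = (\<Sum>k\<le>R. \<omega> ^ k)" by (subst sum.reindex) (auto simp: inj_on_def)
  also have "(\<Sum>z\<in>(\<lambda>k. - int k) ` {..R}. \<omega> ^ nat \<bar>z\<bar>) = (\<Sum>k\<le>R. \<omega> ^ k)" by (subst sum.reindex) (auto simp: inj_on_def)
  finally show ?thesis using geo by simp
qed

text \<open>Finitely many lattice points lie in a box, on which the sum factors into one-dimensional
  geometric sums.\<close>

lemma lattice_sum:
  fixes \<omega> :: real assumes \<omega>: "0 \<le> \<omega>" "\<omega> < 1"
  shows "(\<Sum>n. ennreal (\<omega> ^ int_l1 (int_enum n :: int^'n::finite))) \<le> ennreal ((2 / (1 - \<omega>)) ^ CARD('n))"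
proof (rule suminf_le_const[OF summableI])
  fix N
  let ?E = "int_enum ` {..<N} :: (int^'n) set"
  have inj: "inj (int_enum :: nat \<Rightarrow> int^'n)" using bij_int_enum by (rule bij_betw_imp_inj_on)
  obtain R where R: "\<And>d i. d \<in> ?E \<Longrightarrow> \<bar>d $ i\<bar> \<le> int R"
  proof
    fix d i assume d: "d \<in> ?E"
    have "nat \<bar>d $ i\<bar> \<le> int_l1 d" unfolding int_l1_def by (rule member_le_sum) auto
    also have "\<dots> \<le> (\<Sum>d\<in>?E. int_l1 d)" using d by (intro member_le_sum) auto
    finally show "\<bar>d $ i\<bar> \<le> int (\<Sum>d\<in>?E. int_l1 d)" by linarith
  qed
  let ?P = "PiE (UNIV :: 'n set) (\<lambda>_. {-int R..int R})"
  have "(\<Sum>n<N. ennreal (\<omega> ^ int_l1 (int_enum n :: int^'n))) = (\<Sum>d\<in>?E. ennreal (\<omega> ^ int_l1 d))"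
    by (subst sum.reindex) (auto intro: inj_on_subset[OF inj])
  also have "\<dots> = ennreal (\<Sum>d\<in>?E. \<omega> ^ int_l1 d)" using \<omega> by (intro sum_ennreal) auto
  also have "(\<Sum>d\<in>?E. \<omega> ^ int_l1 d) = (\<Sum>h\<in>vec_nth ` ?E. \<Prod>i\<in>UNIV. \<omega> ^ nat \<bar>h i\<bar>)"
    by (subst sum.reindex) (auto simp: inj_on_def vec_nth_inject int_l1_def power_sum)
  also have "\<dots> \<le> (\<Sum>h\<in>?P. \<Prod>i\<in>UNIV. \<omega> ^ nat \<bar>h i\<bar>)"
  proof (rule sum_mono2)
    show "finite ?P" by (intro finite_PiE) auto
    show "vec_nth ` ?E \<subseteq> ?P" using R by (force simp: abs_le_iff)
    show "0 \<le> (\<Prod>i\<in>UNIV. \<omega> ^ nat \<bar>h i\<bar>)" for h :: "'n \<Rightarrow> int" using \<omega> by (intro prod_nonneg) auto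
  qed
  also have "\<dots> = (\<Prod>i\<in>(UNIV :: 'n set). \<Sum>z\<in>{-int R..int R}. \<omega> ^ nat \<bar>z\<bar>)"
    by (rule prod_sum_PiE[symmetric]) auto
  also have "\<dots> \<le> (\<Prod>i\<in>(UNIV :: 'n set). 2 / (1 - \<omega>))"
    using sum_abs_int_le[OF \<omega>] \<omega> by (intro prod_mono) (auto intro!: sum_nonneg)
  also have "\<dots> = (2 / (1 - \<omega>)) ^ CARD('n)" by simp
  finally show "(\<Sum>n<N. ennreal (\<omega> ^ int_l1 (int_enum n :: int^'n))) \<le> ennreal ((2 / (1 - \<omega>)) ^ CARD('n))"
    by (simp add: ennreal_leI)
qed

text \<open>The indices of \<open>x\<close> and \<open>w\<close> differ in each coordinate by at
  most \<open>2 ^ j * norm (x - w) + 1\<close>. Averaging over the coordinates gives the rate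
  \<open>b / n\<close> in the lattice distance, and the rounding costs \<open>exp b\<close>.\<close>

lemma exp_to_cubes:
  fixes v :: "real^'n::finite \<Rightarrow> ennreal"
  assumes v[measurable]: "v \<in> borel_measurable lebesgue" and b: "0 \<le> b"
  shows "2 ^ (j * CARD('n)) * (\<integral>\<^sup>+w. ennreal (exp (- (b * (2 ^ j * norm (x - w))))) * v w \<partial>lebesgue)
    \<le> (\<Sum>n. ennreal (exp b * exp (- b / CARD('n)) ^ int_l1 (int_enum n :: int^'n)) * cube_avg j (cube_index j x + int_enum n) v)"
proof -
  define c where "c m = ennreal (exp b * exp (- b / CARD('n)) ^ int_l1 (m - cube_index j x))" for m :: "int^'n"
  have le: "exp (- (b * (2 ^ j * norm (x - w)))) \<le> exp b * exp (- b / CARD('n)) ^ int_l1 (cube_index j w - cube_index j x)" for w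
  proof -
    let ?d = "cube_index j w - cube_index j x"
    have "real (nat \<bar>?d $ i\<bar>) - 1 \<le> 2 ^ j * norm (x - w)" for i
    proof -
      have "real (nat \<bar>?d $ i\<bar>) - 1 \<le> \<bar>2 ^ j * w $ i - 2 ^ j * x $ i\<bar>"
        by (simp add: cube_index_def) linarith
      also have "\<dots> = 2 ^ j * \<bar>(x - w) $ i\<bar>" by (simp add: right_diff_distrib[symmetric] abs_mult abs_minus_commute)
      also have "\<dots> \<le> 2 ^ j * norm (x - w)" by (intro mult_left_mono component_le_norm_cart) auto
      finally show ?thesis .
    qed
    then have "(\<Sum>i\<in>UNIV. real (nat \<bar>?d $ i\<bar>) - 1) \<le> (\<Sum>i\<in>(UNIV :: 'n set). 2 ^ j * norm (x - w))"
      by (intro sum_mono)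
    then have "real (int_l1 ?d) - CARD('n) \<le> CARD('n) * (2 ^ j * norm (x - w))"
      by (simp add: sum_subtractf int_l1_def)
    then have "b / CARD('n) * (real (int_l1 ?d) - CARD('n)) \<le> b / CARD('n) * (CARD('n) * (2 ^ j * norm (x - w)))"
      using b by (intro mult_left_mono) auto
    then have "b / CARD('n) * real (int_l1 ?d) - b \<le> b * (2 ^ j * norm (x - w))"
      by (simp add: right_diff_distrib)
    then have "exp (- (b * (2 ^ j * norm (x - w)))) \<le> exp (b + real (int_l1 ?d) * (- b / CARD('n)))"
      by (simp add: mult.commute)
    moreover have "exp (b + real (int_l1 ?d) * (- b / CARD('n))) = exp b * exp (- b / CARD('n)) ^ int_l1 ?d"
      by (simp only: exp_add exp_of_nat_mult)
    ultimately show ?thesis by (rule ord_le_eq_trans)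
  qed
  have "(\<integral>\<^sup>+w. ennreal (exp (- (b * (2 ^ j * norm (x - w))))) * v w \<partial>lebesgue) \<le> (\<integral>\<^sup>+w. v w * c (cube_index j w) \<partial>lebesgue)"
    unfolding c_def by (intro nn_integral_mono) (subst mult.commute, intro mult_left_mono ennreal_leI le, simp)
  also have "\<dots> = (\<integral>\<^sup>+m. c m * (\<integral>\<^sup>+x. v x \<partial>lebesgue_on (dyadic_cube j m)) \<partial>count_space UNIV)"
    by (rule nn_integral_step[OF v])
  finally have "2 ^ (j * CARD('n)) * (\<integral>\<^sup>+w. ennreal (exp (- (b * (2 ^ j * norm (x - w))))) * v w \<partial>lebesgue)
     \<le> 2 ^ (j * CARD('n)) * (\<integral>\<^sup>+m. c m * (\<integral>\<^sup>+x. v x \<partial>lebesgue_on (dyadic_cube j m)) \<partial>count_space UNIV)"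
    by (rule mult_left_mono) simp
  also have "\<dots> = (\<integral>\<^sup>+m. c m * cube_avg j m v \<partial>count_space UNIV)"
    by (subst nn_integral_cmult[symmetric]) (auto simp: cube_avg_def mult_ac)
  also have "\<dots> = (\<integral>\<^sup>+d. c (cube_index j x + d) * cube_avg j (cube_index j x + d) v \<partial>count_space UNIV)"
  proof (rule nn_integral_bij_count_space[symmetric, where g="\<lambda>d. cube_index j x + d"])
    show "bij_betw (\<lambda>d. cube_index j x + d) (UNIV :: (int^'n) set) UNIV"
      by (rule bij_betwI[where g="\<lambda>m. m - cube_index j x"]) auto
  qed
  also have "\<dots> = (\<Sum>n. ennreal (exp b * exp (- b / CARD('n)) ^ int_l1 (int_enum n :: int^'n)) * cube_avg j (cube_index j x + int_enum n) v)"
    by (simp add: nn_integral_int_enum c_def)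
  finally show ?thesis .
qed

section \<open>The main estimate\<close>

lemma self_est_ex:
  fixes \<phi> :: "real^'n::finite \<Rightarrow> complex"
  assumes \<phi>: "\<phi> \<in> test_functions" "(LINT x|lborel. \<phi> x) = 1"
  shows "\<exists>C\<ge>0. \<exists>R>0. \<forall>f\<in>S'_e. self_est (\<lambda>l y. norm (conv (dyadic_family \<phi> l) f y)) i C R"
  using local_estimate_self[OF \<phi>, of i] unfolding self_est_def .

text \<open>The order of the quantifiers is the point: \<open>D\<close> is chosen before
  \<open>f\<close>. The growth constants, which depend on \<open>f\<close>, are consumed
  inside.\<close>

lemma self_est_family:
  fixes \<phi> :: "real^'n::finite \<Rightarrow> complex"
  assumes \<phi>: "\<phi> \<in> test_functions" "(LINT x|lborel. \<phi> x) = 1" and \<mu>: "0 < \<mu>" "\<mu> \<le> 1"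
    and B: "0 \<le> B"
  shows "\<exists>D\<ge>0. \<forall>f\<in>S'_e. \<forall>j x l y.
    ennreal (((1/2) ^ (l * i) * exp (- (B * (2 ^ j * norm (x - y)))) * norm (conv (dyadic_family \<phi> (j + l)) f y)) powr \<mu>)
    \<le> ennreal D * peetre_sum (\<lambda>l y. norm (conv (dyadic_family \<phi> l) f y)) \<mu> i B j x"
proof -
  obtain C R where C: "0 \<le> C" and se: "\<forall>f\<in>S'_e. self_est (\<lambda>l y. norm (conv (dyadic_family \<phi> l) f y)) i C R"
    using self_est_ex[OF \<phi>, of i] by (elim exE conjE)
  have "ennreal (((1/2) ^ (l * i) * exp (- (B * (2 ^ j * norm (x - y)))) * norm (conv (dyadic_family \<phi> (j + l)) f y)) powr \<mu>)
    \<le> ennreal ((C + 1) * exp (B * R)) * peetre_sum (\<lambda>l y. norm (conv (dyadic_family \<phi> l) f y)) \<mu> i B j x"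
    if f: "f \<in> S'_e" for f j x l y
  proof -
    let ?u = "\<lambda>l y. norm (conv (dyadic_family \<phi> l) f y)"
    have um: "?u l \<in> borel_measurable borel" for l
      by (intro borel_measurable_continuous_onI continuous_intros conv_continuous f test_dyadic_family \<phi>)
    obtain D N where g: "0 \<le> D" "\<And>l y. ?u l y \<le> D * (2 ^ (l * N) * exp (real N * norm y))"
      using conv_growth[OF \<phi>(1) f] by (elim exE conjE) auto
    show ?thesis
    proof (rule peetre_estimate[OF \<mu> norm_ge_zero um bspec[OF se f] C B _ g(2) g(1)])
      fix i
      obtain C R where "0 \<le> C" "\<forall>f\<in>S'_e. self_est (\<lambda>l y. norm (conv (dyadic_family \<phi> l) f y)) i C R"
        using self_est_ex[OF \<phi>, of i] by (elim exE conjE)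
      then show "\<exists>C\<ge>0. \<exists>R. self_est ?u i C R" using f by blast
    qed
  qed
  moreover have "0 \<le> (C + 1) * exp (B * R)" using C by simp
  ultimately show ?thesis by blast
qed

text \<open>Levels \<open>l <= k\<close> are bounded by the sum based at level \<open>l\<close>, and
  all levels \<open>l > k\<close> by the sum based at level \<open>k\<close>, since the maximal
  estimate controls every finer level. This leaves a single sum over
  \<open>d = k - l\<close>.\<close>

theorem pointwise_bound:
  fixes \<phi> \<zeta> :: "real^'n::finite \<Rightarrow> complex"
  assumes \<phi>: "\<phi> \<in> test_functions" "(LINT x|lborel. \<phi> x) = 1" and \<mu>: "0 < \<mu>" "\<mu> \<le> 1"
    and \<zeta>: "\<zeta> \<in> test_functions" and B: "0 \<le> B"
    and mom: "\<And>is. length is < L \<Longrightarrow> (LINT z|lborel. of_real (list_monomial is z) * dyadic_diff \<zeta> z) = 0"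
  shows "\<exists>c\<ge>0. \<forall>f\<in>S'_e. \<forall>k x. epowr (ennreal (norm (conv (dyadic_family \<zeta> k) f x))) \<mu>
    \<le> ennreal c * (\<Sum>d. if d \<le> k then ennreal (2 powr (- (real d * real L * \<mu>))) *
         peetre_sum (\<lambda>l y. norm (conv (dyadic_family \<phi> l) f y)) \<mu> i B (k - d) x else 0)"
proof -
  obtain D where D0: "0 \<le> D" and D': "\<forall>f\<in>S'_e. \<forall>j x l y.
    ennreal (((1/2) ^ (l * i) * exp (- (B * (2 ^ j * norm (x - y)))) * norm (conv (dyadic_family \<phi> (j + l)) f y)) powr \<mu>)
    \<le> ennreal D * peetre_sum (\<lambda>l y. norm (conv (dyadic_family \<phi> l) f y)) \<mu> i B j x"
    using self_est_family[OF \<phi> \<mu> B, of i] by (elim exE conjE)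
  note D = D0 D'[rule_format]
  have "\<exists>C\<ge>0. \<exists>R>0. \<forall>f\<in>S'_e. \<forall>k x. ennreal (norm (conv (dyadic_family \<zeta> k) f x))
    \<le> (\<Sum>l. ennreal (C * ((1/2) ^ (if l \<le> k then (k - l) * L else (l - k) * Suc i) * 2 ^ (min k l * CARD('n)))) *
         (\<integral>\<^sup>+w. ennreal (norm (conv (dyadic_family \<phi> l) f w)) * indicator (cball x (R / 2 ^ min k l)) w \<partial>lborel))"
    by (rule local_estimate_other[OF \<phi> \<zeta> mom])
  then obtain C R where C: "0 \<le> C" and R: "0 < R" and CR': "\<forall>f\<in>S'_e. \<forall>k x. ennreal (norm (conv (dyadic_family \<zeta> k) f x))
    \<le> (\<Sum>l. ennreal (C * ((1/2) ^ (if l \<le> k then (k - l) * L else (l - k) * Suc i) * 2 ^ (min k l * CARD('n)))) *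
         (\<integral>\<^sup>+w. ennreal (norm (conv (dyadic_family \<phi> l) f w)) * indicator (cball x (R / 2 ^ min k l)) w \<partial>lborel))"
    by (elim exE conjE)
  note CR = CR'[rule_format]
  define V where "V = unit_ball_vol (real CARD('n)) * R ^ CARD('n)"
  have V: "0 \<le> V" using R by (simp add: V_def)
  define c3 where "c3 = (C * V) powr \<mu> * (exp (B * R * \<mu>) * D)"
  have c3: "0 \<le> c3" using D by (simp add: c3_def)
  \<comment> \<open>The local estimate is used with exponent \<open>Suc i\<close>, the maximal
    estimate with \<open>i\<close>. The loss \<open>2 ^ (l i)\<close> of the latter is thus
    overcompensated by one factor \<open>2 ^ -l\<close>, which becomes \<open>q ^ l\<close> after
    taking the power \<open>\<mu>\<close>.\<close>
  define q where "q = (2::real) powr (- \<mu>)"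
  have q: "0 < q" "q < 1" using \<mu> powr_less_mono[of "- \<mu>" 0 "2::real"] by (auto simp: q_def)
  have powq: "2 powr (- (real (d * Suc i) * \<mu>)) * 2 powr (real (d * i) * \<mu>) = q ^ d" for d
    by (simp add: q_def powr_add[symmetric] powr_realpow[symmetric] powr_powr algebra_simps)
  define c where "c = c3 * (1 + 1 / (1 - q))"
  have "epowr (ennreal (norm (conv (dyadic_family \<zeta> k) f x))) \<mu>
    \<le> ennreal c * (\<Sum>d. if d \<le> k then ennreal (2 powr (- (real d * real L * \<mu>))) *
         peetre_sum (\<lambda>l y. norm (conv (dyadic_family \<phi> l) f y)) \<mu> i B (k - d) x else 0)"
    if f: "f \<in> S'_e" for f k x
  proof -
    let ?u = "\<lambda>l y. norm (conv (dyadic_family \<phi> l) f y)"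
    let ?K = "\<lambda>j. peetre_sum ?u \<mu> i B j x"
    have um: "?u l \<in> borel_measurable borel" for l
      by (intro borel_measurable_continuous_onI continuous_intros conv_continuous f test_dyadic_family \<phi>)
    have near: "epowr (ennreal (?u (j + l) w)) \<mu> \<le> ennreal ((2 powr (real (l * i) * \<mu>)) * (exp (B * R * \<mu>) * D)) * ?K j"
      if w: "norm (x - w) \<le> R / 2 ^ j" for j l w
    proof -
      let ?e = "(1/2::real) ^ (l * i) * exp (- (B * (2 ^ j * norm (x - w))))"
      have "2 ^ j * norm (x - w) \<le> R" using w by (simp add: field_simps)
      then have "exp (- (B * R)) \<le> exp (- (B * (2 ^ j * norm (x - w))))" using B by (simp add: mult_left_mono)
      then have "(1/2) ^ (l * i) * exp (- (B * R)) \<le> ?e" by (rule mult_left_mono) simp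
      then have "1 \<le> (2 ^ (l * i) * exp (B * R)) * ?e"
        by (simp add: power_one_over exp_minus field_simps)
      then have "?u (j + l) w \<le> (2 ^ (l * i) * exp (B * R)) * ?e * ?u (j + l) w"
        using mult_right_mono[of 1 "(2 ^ (l * i) * exp (B * R)) * ?e" "?u (j + l) w"] by simp
      then have "?u (j + l) w powr \<mu> \<le> ((2 ^ (l * i) * exp (B * R)) * (?e * ?u (j + l) w)) powr \<mu>"
        using \<mu> by (intro powr_mono2) (auto simp: mult.assoc)
      also have "\<dots> = (2 powr (real (l * i) * \<mu>) * exp (B * R * \<mu>)) * (?e * ?u (j + l) w) powr \<mu>"
      proof -
        have "(2 ^ (l * i) * exp (B * R)) powr \<mu> = 2 powr (real (l * i) * \<mu>) * exp (B * R * \<mu>)"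
          by (simp add: powr_mult powr_realpow[symmetric] powr_powr exp_powr_real del: of_nat_mult)
        then show ?thesis by (subst powr_mult) (auto simp: mult.assoc)
      qed
      finally have "ennreal (?u (j + l) w powr \<mu>) \<le> ennreal (2 powr (real (l * i) * \<mu>) * exp (B * R * \<mu>)) * ennreal ((?e * ?u (j + l) w) powr \<mu>)"
        by (simp add: ennreal_mult[symmetric] ennreal_leI)
      also have "\<dots> \<le> ennreal (2 powr (real (l * i) * \<mu>) * exp (B * R * \<mu>)) * (ennreal D * ?K j)"
        by (intro mult_left_mono D(2)[OF f]) auto
      also have "\<dots> = ennreal ((2 powr (real (l * i) * \<mu>)) * (exp (B * R * \<mu>) * D)) * ?K j"
        using D(1) by (simp add: ennreal_mult mult.assoc)
      finally show ?thesis by (simp add: epowr_ennreal)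
    qed
    define I where "I l = (\<integral>\<^sup>+w. ennreal (?u l w) * indicator (cball x (R / 2 ^ min k l)) w \<partial>lborel)" for l
    define e where "e l = (1/2::real) ^ (if l \<le> k then (k - l) * L else (l - k) * Suc i)" for l
    \<comment> \<open>\<open>u\<close> is bounded by its supremum over the ball, whose volume
      \<open>V / 2 ^ (min k l * n)\<close> cancels the normalization of the kernel.\<close>
    have single: "epowr (ennreal (C * (e l * 2 ^ (min k l * CARD('n)))) * I l) \<mu> \<le> epowr (ennreal (C * V * e l)) \<mu> * Z"
      if Z: "\<And>w. norm (x - w) \<le> R / 2 ^ min k l \<Longrightarrow> epowr (ennreal (?u l w)) \<mu> \<le> Z" for l Z
    proof -
      let ?r = "R / 2 ^ min k l"
      have "I l \<le> (\<integral>\<^sup>+w. epowr Z (1 / \<mu>) * indicator (cball x ?r) w \<partial>lborel)"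
        unfolding I_def
      proof (rule nn_integral_mono)
        fix w
        show "ennreal (?u l w) * indicator (cball x ?r) w \<le> epowr Z (1 / \<mu>) * indicator (cball x ?r) w"
        proof (cases "w \<in> cball x ?r")
          case True
          then have "epowr (ennreal (?u l w)) \<mu> \<le> Z" by (intro Z) (simp add: dist_norm)
          then have "ennreal (?u l w) \<le> epowr Z (1 / \<mu>)" by (simp add: epowr_le_iff[OF \<mu>(1)])
          then show ?thesis using True by simp
        qed simp
      qed
      also have "\<dots> = epowr Z (1 / \<mu>) * emeasure lborel (cball x ?r)"
        by (rule nn_integral_cmult_indicator) simp
      also have "emeasure lborel (cball x ?r) = ennreal (V / 2 ^ (min k l * CARD('n)))"
        using R by (subst emeasure_cball) (auto simp: V_def power_divide power_mult)
      finally have "ennreal (C * (e l * 2 ^ (min k l * CARD('n)))) * I l \<le> ennreal (C * (e l * 2 ^ (min k l * CARD('n)))) * (epowr Z (1 / \<mu>) * ennreal (V / 2 ^ (min k l * CARD('n))))"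
        by (rule mult_left_mono) simp
      also have "\<dots> = (ennreal (C * (e l * 2 ^ (min k l * CARD('n)))) * ennreal (V / 2 ^ (min k l * CARD('n)))) * epowr Z (1 / \<mu>)"
        by (simp only: mult_ac)
      also have "ennreal (C * (e l * 2 ^ (min k l * CARD('n)))) * ennreal (V / 2 ^ (min k l * CARD('n))) = ennreal (C * V * e l)"
        using C V by (subst ennreal_mult[symmetric]) (auto simp: e_def field_simps)
      finally have "epowr (ennreal (C * (e l * 2 ^ (min k l * CARD('n)))) * I l) \<mu> \<le> epowr (ennreal (C * V * e l) * epowr Z (1 / \<mu>)) \<mu>"
        using \<mu> by (intro epowr_mono) auto
      also have "\<dots> = epowr (ennreal (C * V * e l)) \<mu> * Z" using \<mu> by (simp add: epowr_mult epowr_epowr)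
      finally show ?thesis .
    qed
    define X where "X l = (if l \<le> k then ennreal (2 powr (- (real (k - l) * real L * \<mu>))) * ?K l else ennreal (q ^ (l - k)) * ?K k)" for l
    have termX: "epowr (ennreal (C * (e l * 2 ^ (min k l * CARD('n)))) * I l) \<mu> \<le> ennreal c3 * X l" for l
    proof (cases "l \<le> k")
      case True
      have "epowr (ennreal (C * (e l * 2 ^ (min k l * CARD('n)))) * I l) \<mu> \<le> epowr (ennreal (C * V * e l)) \<mu> * (ennreal (exp (B * R * \<mu>) * D) * ?K l)"
        by (rule single) (use near[of _ l 0] True in \<open>simp add: min_absorb2\<close>)
      also have "epowr (ennreal (C * V * e l)) \<mu> = ennreal ((C * V) powr \<mu> * 2 powr (- (real (k - l) * real L * \<mu>)))"
      proof -
        have "e l = 2 powr (- real ((k - l) * L))" using True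
          by (simp add: e_def powr_minus powr_realpow power_one_over inverse_eq_divide del: of_nat_mult)
        then have "(C * V * e l) powr \<mu> = (C * V) powr \<mu> * 2 powr (- (real (k - l) * real L * \<mu>))"
          using C V by (simp add: powr_mult powr_powr)
        then show ?thesis using C V by (simp add: epowr_ennreal e_def)
      qed
      also have "ennreal ((C * V) powr \<mu> * 2 powr (- (real (k - l) * real L * \<mu>))) * (ennreal (exp (B * R * \<mu>) * D) * ?K l) = ennreal c3 * X l"
        using True D(1) by (simp add: X_def c3_def ennreal_mult mult_ac)
      finally show ?thesis .
    next
      case False
      then have kl: "k + (l - k) = l" by simp
      have "epowr (ennreal (C * (e l * 2 ^ (min k l * CARD('n)))) * I l) \<mu> \<le> epowr (ennreal (C * V * e l)) \<mu> * (ennreal (2 powr (real ((l - k) * i) * \<mu>) * (exp (B * R * \<mu>) * D)) * ?K k)"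
        by (rule single) (use near[of _ k "l - k"] False kl in \<open>simp add: min_absorb1\<close>)
      also have "epowr (ennreal (C * V * e l)) \<mu> = ennreal ((C * V) powr \<mu> * 2 powr (- (real ((l - k) * Suc i) * \<mu>)))"
      proof -
        have "e l = 2 powr (- real ((l - k) * Suc i))" using False
          by (simp add: e_def powr_minus powr_realpow power_one_over inverse_eq_divide del: of_nat_mult of_nat_Suc mult_Suc_right)
        then have "(C * V * e l) powr \<mu> = (C * V) powr \<mu> * 2 powr (- (real ((l - k) * Suc i) * \<mu>))"
          using C V by (simp add: powr_mult powr_powr del: of_nat_mult of_nat_Suc mult_Suc_right)
        then show ?thesis using C V by (simp add: epowr_ennreal e_def)
      qed
      also have "ennreal ((C * V) powr \<mu> * 2 powr (- (real ((l - k) * Suc i) * \<mu>))) * (ennreal (2 powr (real ((l - k) * i) * \<mu>) * (exp (B * R * \<mu>) * D)) * ?K k)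
        = ennreal c3 * (ennreal (2 powr (- (real ((l - k) * Suc i) * \<mu>)) * 2 powr (real ((l - k) * i) * \<mu>)) * ?K k)"
        using D(1) by (simp add: c3_def ennreal_mult mult_ac)
      also have "2 powr (- (real ((l - k) * Suc i) * \<mu>)) * 2 powr (real ((l - k) * i) * \<mu>) = q ^ (l - k)"
        by (rule powq)
      finally show ?thesis using False by (simp add: X_def)
    qed
    have "epowr (ennreal (norm (conv (dyadic_family \<zeta> k) f x))) \<mu> \<le> epowr (\<Sum>l. ennreal (C * (e l * 2 ^ (min k l * CARD('n)))) * I l) \<mu>"
      using CR[OF f, of k x] \<mu> unfolding e_def I_def by (intro epowr_mono) auto
    also have "\<dots> \<le> (\<Sum>l. epowr (ennreal (C * (e l * 2 ^ (min k l * CARD('n)))) * I l) \<mu>)"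
      by (rule epowr_suminf_le[OF \<mu>])
    also have "\<dots> \<le> (\<Sum>l. ennreal c3 * X l)" by (intro suminf_le termX) auto
    also have "\<dots> = ennreal c3 * (\<Sum>l. X l)" by simp
    also have "\<dots> \<le> ennreal c3 * (ennreal (1 + 1 / (1 - q)) * (\<Sum>d. if d \<le> k then ennreal (2 powr (- (real d * real L * \<mu>))) * ?K (k - d) else 0))"
    proof (rule mult_left_mono)
      define Y where "Y d = (if d \<le> k then ennreal (2 powr (- (real d * real L * \<mu>))) * ?K (k - d) else 0)" for d
      have "?K k = Y 0" by (simp add: Y_def)
      then have Y0: "?K k \<le> (\<Sum>d. Y d)" using sum_le_suminf[OF summableI, of "{0}" Y] by simp
      have "(\<Sum>l. X l) = (\<Sum>l. X (l + Suc k)) + (\<Sum>l<Suc k. X l)" by (rule suminf_offset[OF summableI])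
      also have "(\<Sum>l<Suc k. X l) = (\<Sum>d<Suc k. Y d)"
        by (subst sum.nat_diff_reindex[symmetric]) (auto simp: X_def Y_def intro!: sum.cong)
      also have "\<dots> \<le> (\<Sum>d. Y d)" by (rule sum_le_suminf[OF summableI]) auto
      also have "(\<Sum>l. X (l + Suc k)) \<le> (\<Sum>l. ennreal (q ^ l) * ?K k)"
      proof (rule suminf_le)
        fix l
        have "q ^ Suc l \<le> q ^ l" using q by (intro power_decreasing) auto
        then show "X (l + Suc k) \<le> ennreal (q ^ l) * ?K k"
          by (auto simp: X_def intro!: mult_right_mono ennreal_leI)
      qed auto
      also have "\<dots> = ennreal (1 / (1 - q)) * ?K k"
      proof -
        have "(\<Sum>d. ennreal (q ^ d)) = ennreal (1 / (1 - q))"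
          using q by (subst suminf_ennreal_eq[of _ "1 / (1 - q)"]) (auto intro: geometric_sums)
        then show ?thesis by simp
      qed
      also have "ennreal (1 / (1 - q)) * ?K k \<le> ennreal (1 / (1 - q)) * (\<Sum>d. Y d)" by (intro mult_left_mono Y0) simp
      finally have "(\<Sum>l. X l) \<le> ennreal (1 / (1 - q)) * (\<Sum>d. Y d) + (\<Sum>d. Y d)"
        by (simp add: add_mono)
      also have "\<dots> = ennreal (1 + 1 / (1 - q)) * (\<Sum>d. Y d)"
        using q by (simp add: distrib_right add.commute)
      finally show "(\<Sum>l. X l) \<le> ennreal (1 + 1 / (1 - q)) * (\<Sum>d. if d \<le> k then ennreal (2 powr (- (real d * real L * \<mu>))) * ?K (k - d) else 0)"
        by (simp only: Y_def)
    qed simp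
    also have "\<dots> = ennreal c * (\<Sum>d. if d \<le> k then ennreal (2 powr (- (real d * real L * \<mu>))) * ?K (k - d) else 0)"
      using c3 q by (simp add: c_def ennreal_mult mult.assoc)
    finally show ?thesis .
  qed
  moreover have "0 \<le> c" using c3 q by (simp add: c_def)
  ultimately show ?thesis by blast
qed

section \<open>The moment order, finite or infinite\<close>

lemma list_monomial_count: "list_monomial is z = (\<Prod>i\<in>UNIV. z $ i ^ count_list is i)"
proof (induction "is")
  case (Cons a "is")
  have "(\<Prod>i\<in>UNIV. z $ i ^ count_list (a # is) i) = z $ a ^ Suc (count_list is a) * (\<Prod>i\<in>UNIV - {a}. z $ i ^ count_list (a # is) i)"
    by (subst prod.remove[of _ a]) auto
  also have "(\<Prod>i\<in>UNIV - {a}. z $ i ^ count_list (a # is) i) = (\<Prod>i\<in>UNIV - {a}. z $ i ^ count_list is i)"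
    by (intro prod.cong) auto
  also have "z $ a ^ Suc (count_list is a) * \<dots> = z $ a * (\<Prod>i\<in>UNIV. z $ i ^ count_list is i)"
    by (subst (2) prod.remove[of _ a]) auto
  finally show ?case using Cons by simp
qed simp

lemma mdeg_count: "mdeg (count_list (is :: 'n::finite list)) = length is"
  by (rule sum_count_set) auto

lemma moment_eq:
  fixes \<psi> :: "real^'n::finite \<Rightarrow> complex"
  assumes "\<psi> \<in> test_functions"
  shows "(LINT z|lborel. of_real (list_monomial is z) * \<psi> z) = (LINT x|lebesgue. (\<Prod>i\<in>UNIV. x $ i ^ count_list is i) *\<^sub>R \<psi> x)"
proof -
  have "(\<lambda>x. list_monomial is x *\<^sub>R \<psi> x) \<in> borel_measurable borel"
    by (intro borel_measurable_continuous_onI continuous_intros continuous_list_monomial test_continuous assms)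
  then have "(LINT x|lebesgue. list_monomial is x *\<^sub>R \<psi> x) = (LINT x|lborel. list_monomial is x *\<^sub>R \<psi> x)"
    by (intro integral_completion) simp
  then show ?thesis by (simp add: list_monomial_count[symmetric] scaleR_conv_of_real[where 'a=complex])
qed

text \<open>\<open>L\<close> counts the orders that vanish, so it is the natural number
  \<open>1 + moment_order \<psi>\<close>. In the second case the defining set contains -1 and is
  bounded above, so its supremum is a maximum.\<close>

lemma moment_order_cases:
  fixes \<psi> :: "real^'n::finite \<Rightarrow> complex"
  assumes t: "\<psi> \<in> test_functions"
  obtains "\<And>is. (LINT z|lborel. of_real (list_monomial is z) * \<psi> z) = 0"
  | L :: nat where "moment_order \<psi> = ereal (real L - 1)" "\<And>is. length is < L \<Longrightarrow> (LINT z|lborel. of_real (list_monomial is z) * \<psi> z) = 0"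
proof -
  define S where "S = {L::int. \<forall>\<beta>::'n multiindex. int (mdeg \<beta>) \<le> L \<longrightarrow> (LINT x|lebesgue. (\<Prod>i\<in>UNIV. x $ i ^ \<beta> i) *\<^sub>R \<psi> x) = 0}"
  have mo: "moment_order \<psi> = (SUP L\<in>S. ereal (of_int L))" by (simp add: moment_order_def S_def)
  have mom: "(LINT z|lborel. of_real (list_monomial is z) * \<psi> z) = 0" if "L \<in> S" "int (length is) \<le> L" for L "is"
  proof -
    have "int (mdeg (count_list is)) \<le> L" using that(2) by (simp only: mdeg_count)
    then show ?thesis using that(1) unfolding moment_eq[OF t] S_def by blast
  qed
  have "\<not> int (mdeg \<beta>) \<le> -1" for \<beta> :: "'n multiindex" by linarith
  then have m1: "-1 \<in> S" unfolding S_def by blast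
  show ?thesis
  proof (cases "\<forall>N::nat. \<exists>L\<in>S. int N \<le> L")
    case True
    then show ?thesis using mom that(1) by blast
  next
    case False
    then obtain N :: nat where N0: "\<forall>L\<in>S. \<not> int N \<le> L" by blast
    then have N: "L < int N" if "L \<in> S" for L using that by (simp add: not_le)
    define F where "F = S \<inter> {-1..int N}"
    have F: "finite F" "-1 \<in> F" using m1 by (auto simp: F_def)
    define m where "m = Max F"
    have "m \<in> F" unfolding m_def using F by (intro Max_in) auto
    then have m: "m \<in> S" "-1 \<le> m" by (auto simp: F_def)
    have up: "L \<le> m" if "L \<in> S" for L
    proof (cases "-1 \<le> L")
      case True
      then have "L \<in> F" using N[OF that] that by (auto simp: F_def)
      then show ?thesis unfolding m_def using F by (intro Max_ge)
    qed (use m in linarith)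
    have eq1: "moment_order \<psi> = ereal (of_int m)" unfolding mo
      by (rule antisym) (use m up in \<open>auto intro!: SUP_least intro: SUP_upper\<close>)
    have eq2: "(of_int m :: real) = real (nat (m + 1)) - 1" using m by simp
    show ?thesis
    proof (rule that(2)[of "nat (m + 1)"])
      show "moment_order \<psi> = ereal (real (nat (m + 1)) - 1)" unfolding eq1 eq2 ..
      fix "is" :: "'n list" assume "length is < nat (m + 1)"
      then have "int (length is) \<le> m" by linarith
      then show "(LINT z|lborel. of_real (list_monomial is z) * \<psi> z) = 0" by (rule mom[OF m(1)])
    qed
  qed
qed

text \<open>\<open>real_polynomial_function\<close> is generated inductively and has no
  coefficients. The induction therefore shows that multiplication by \<open>g\<close> preserves the
  class \<open>W\<close> of continuous functions whose products with all monomials are orthogonal to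
  \<open>\<psi>\<close>.\<close>

lemma moments_zero_poly:
  fixes \<psi> :: "real^'n::finite \<Rightarrow> complex"
  assumes t: "\<psi> \<in> test_functions" and mom: "\<And>is. (LINT z|lborel. of_real (list_monomial is z) * \<psi> z) = 0"
    and g: "real_polynomial_function g"
  shows "(LINT z|lborel. of_real (g z) * \<psi> z) = 0"
proof -
  define W where "W = {w :: real^'n \<Rightarrow> real. continuous_on UNIV w \<and> (\<forall>is. (LINT z|lborel. of_real (w z * list_monomial is z) * \<psi> z) = 0)}"
  obtain R where R: "supp_le R \<psi>" using test_supp[OF t] by metis
  have int: "integrable lborel (\<lambda>z. of_real (w z) * \<psi> z)" if "continuous_on UNIV w" for w :: "real^'n \<Rightarrow> real"
  proof -
    have "supp_le R (\<lambda>z. of_real (w z) * \<psi> z)" using R by (auto simp: supp_le_def)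
    then have "kernel R (\<lambda>z. of_real (w z) * \<psi> z)"
      by (rule kernel_continuous) (intro continuous_intros that test_continuous t)
    then show ?thesis by (simp add: kernel_def)
  qed
  have one: "(\<lambda>z. 1) \<in> W" using mom by (simp add: W_def)
  have sumW: "(\<lambda>z. w1 z + w2 z) \<in> W" if "w1 \<in> W" "w2 \<in> W" for w1 w2
  proof -
    have "(LINT z|lborel. of_real ((w1 z + w2 z) * list_monomial is z) * \<psi> z) = 0" for "is"
    proof -
      have i: "integrable lborel (\<lambda>z. of_real (w z * list_monomial is z) * \<psi> z)" if "w \<in> W" for w
        using that by (intro int continuous_intros continuous_list_monomial) (auto simp: W_def)
      have "(LINT z|lborel. of_real ((w1 z + w2 z) * list_monomial is z) * \<psi> z)
        = (LINT z|lborel. of_real (w1 z * list_monomial is z) * \<psi> z + of_real (w2 z * list_monomial is z) * \<psi> z)"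
        by (simp add: algebra_simps)
      also have "\<dots> = 0" using i[OF that(1)] i[OF that(2)] that by (simp add: W_def)
      finally show ?thesis .
    qed
    then show ?thesis using that by (auto simp: W_def intro!: continuous_intros)
  qed
  have cmulW: "(\<lambda>z. c * w z) \<in> W" if "w \<in> W" for w c
  proof -
    have "(LINT z|lborel. of_real (c * w z * list_monomial is z) * \<psi> z) = 0" for "is"
    proof -
      have "(LINT z|lborel. of_real (c * w z * list_monomial is z) * \<psi> z) = (LINT z|lborel. of_real c * (of_real (w z * list_monomial is z) * \<psi> z))"
        by (simp add: mult_ac)
      also have "\<dots> = of_real c * (LINT z|lborel. of_real (w z * list_monomial is z) * \<psi> z)" by (rule integral_mult_right_zero)
      finally show ?thesis using that by (simp add: W_def)
    qed
    then show ?thesis using that by (auto simp: W_def intro!: continuous_intros)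
  qed
  have coordW: "(\<lambda>z. z $ i * w z) \<in> W" if "w \<in> W" for w i
  proof -
    have "(LINT z|lborel. of_real (z $ i * w z * list_monomial is z) * \<psi> z) = 0" for "is"
    proof -
      have "(LINT z|lborel. of_real (w z * list_monomial (i # is) z) * \<psi> z) = 0" using that unfolding W_def by blast
      then show ?thesis by (simp add: mult_ac)
    qed
    then show ?thesis using that by (auto simp: W_def intro!: continuous_intros)
  qed
  have sW: "(\<lambda>z. \<Sum>i\<in>I. c i * (z $ i * w z)) \<in> W" if "finite I" "w \<in> W" for I c w
    using that(1)
  proof (induction I)
    case empty
    show ?case using cmulW[OF one, of 0] by simp
  next
    case (insert i I)
    then show ?case using sumW[OF cmulW[OF coordW[OF that(2)]] insert.IH] by simp
  qed
  have "\<forall>w\<in>W. (\<lambda>z. g z * w z) \<in> W"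
    using g
  proof induction
    case (linear h)
    show ?case
    proof
      fix w assume w: "w \<in> W"
      have lin: "linear h" using linear bounded_linear.linear by blast
      have hs: "h z = (\<Sum>i\<in>UNIV. h (axis i 1) * z $ i)" for z
      proof -
        have "z = (\<Sum>i\<in>UNIV. z $ i *\<^sub>R axis i 1)"
          by (metis basis_expansion scalar_mult_eq_scaleR)
        then have "h z = h (\<Sum>i\<in>UNIV. z $ i *\<^sub>R axis i 1)" by simp
        then show ?thesis by (simp add: linear_sum[OF lin] linear_scale[OF lin] mult.commute)
      qed
      have "h z * w z = (\<Sum>i\<in>UNIV. h (axis i 1) * (z $ i * w z))" for z
        by (subst hs) (simp add: sum_distrib_right mult.assoc)
      then have "(\<lambda>z. h z * w z) = (\<lambda>z. \<Sum>i\<in>UNIV. h (axis i 1) * (z $ i * w z))" by (rule ext)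
      then show "(\<lambda>z. h z * w z) \<in> W" using sW[OF finite w, of "\<lambda>i. h (axis i 1)" UNIV] by simp
    qed
  next
    case (const c)
    then show ?case using cmulW by blast
  next
    case (add f g)
    then show ?case using sumW by (simp add: distrib_right)
  next
    case (mult f g)
    then show ?case by (simp add: mult.assoc)
  qed
  from bspec[OF this one] have "(\<lambda>z. g z * 1) \<in> W" .
  then have "(LINT z|lborel. of_real (g z * 1 * list_monomial [] z) * \<psi> z) = 0" unfolding W_def by blast
  then show ?thesis by simp
qed

text \<open>By Stone-Weierstrass on a ball containing the support, \<open>\<psi>\<close> is
  orthogonal to all continuous functions; testing with its own real and imaginary parts gives
  0.\<close>

lemma moments_zero:
  fixes \<psi> :: "real^'n::finite \<Rightarrow> complex"
  assumes t: "\<psi> \<in> test_functions" and mom: "\<And>is. (LINT z|lborel. of_real (list_monomial is z) * \<psi> z) = 0"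
  shows "\<psi> x = 0"
proof -
  obtain R where R: "supp_le R \<psi>" using test_supp[OF t] by metis
  have int: "integrable lborel (\<lambda>z. of_real (w z) * \<psi> z)" if "continuous_on UNIV w" for w :: "real^'n \<Rightarrow> real"
  proof -
    have "supp_le R (\<lambda>z. of_real (w z) * \<psi> z)" using R by (auto simp: supp_le_def)
    then have "kernel R (\<lambda>z. of_real (w z) * \<psi> z)"
      by (rule kernel_continuous) (intro continuous_intros that test_continuous t)
    then show ?thesis by (simp add: kernel_def)
  qed
  have zero: "(LINT z|lborel. of_real (h z) * \<psi> z) = 0" if h: "continuous_on UNIV h" for h :: "real^'n \<Rightarrow> real"
  proof -
    have "norm (LINT z|lborel. of_real (h z) * \<psi> z) \<le> e * l1_norm \<psi>" if e: "0 < e" for e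
    proof -
      obtain g where g: "real_polynomial_function g" "\<And>z. z \<in> cball 0 R \<Longrightarrow> \<bar>h z - g z\<bar> < e"
        using Stone_Weierstrass_real_polynomial_function[of "cball 0 R" h e] continuous_on_subset[OF h] e by auto
      have gc: "continuous_on UNIV g"
        using g(1) continuous_on_polymonial_function real_polynomial_function_eq by blast
      have "(LINT z|lborel. of_real (h z) * \<psi> z) = (LINT z|lborel. of_real (h z) * \<psi> z - of_real (g z) * \<psi> z)"
        using int[OF h] int[OF gc] moments_zero_poly[OF t mom g(1)] by simp
      also have "norm \<dots> \<le> (LINT z|lborel. norm (of_real (h z) * \<psi> z - of_real (g z) * \<psi> z))"
        by (rule integral_norm_bound)
      also have "\<dots> \<le> (LINT z|lborel. e * norm (\<psi> z))"
      proof (rule integral_mono')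
        show "integrable lborel (\<lambda>z. e * norm (\<psi> z))" using kernel_test[OF t R] by (auto simp: kernel_def)
        show "norm (of_real (h z) * \<psi> z - of_real (g z) * \<psi> z) \<le> e * norm (\<psi> z)" for z
        proof (cases "norm z \<le> R")
          case True
          have "norm (of_real (h z) * \<psi> z - of_real (g z) * \<psi> z) = \<bar>h z - g z\<bar> * norm (\<psi> z)"
            by (simp add: left_diff_distrib[symmetric] norm_mult of_real_diff[symmetric] del: of_real_diff)
          then show ?thesis using g(2)[of z] True by (simp add: mult_right_mono)
        qed (use supp_leD[OF R, of z] in auto)
        show "0 \<le> e * norm (\<psi> z)" for z using e by simp
      qed
      finally show ?thesis by (simp add: l1_norm_def)
    qed
    then have le: "norm (LINT z|lborel. of_real (h z) * \<psi> z) \<le> e * l1_norm \<psi>" if "0 < e" for e using that by blast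
    have "norm (LINT z|lborel. of_real (h z) * \<psi> z) \<le> 0 + e" if "0 < e" for e
    proof -
      have l: "0 < l1_norm \<psi> + 1" using l1_norm_nonneg[of \<psi>] by simp
      have "norm (LINT z|lborel. of_real (h z) * \<psi> z) \<le> e / (l1_norm \<psi> + 1) * l1_norm \<psi>" using that l by (intro le) simp
      also have "\<dots> \<le> e" using that l by (simp add: field_simps)
      finally show ?thesis by simp
    qed
    then have "norm (LINT z|lborel. of_real (h z) * \<psi> z) \<le> 0" by (rule field_le_epsilon)
    then show ?thesis by simp
  qed
  have cz: "h x = 0" if h: "continuous_on UNIV h" and hz: "(LINT z|lborel. h z * h z) = 0" and hi: "integrable lborel (\<lambda>z. h z * h z)"
    for h :: "real^'n \<Rightarrow> real"
  proof (rule ccontr)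
    assume "h x \<noteq> 0"
    have "AE z in lborel. h z * h z = 0"
      using hz integral_nonneg_eq_0_iff_AE[OF hi] by simp
    then have "AE z in lebesgue. h z = 0" by (simp add: AE_completion)
    note ae = this
    have hm: "h \<in> borel_measurable lebesgue"
      by (intro measurable_completion) (use borel_measurable_continuous_onI[OF h] in simp)
    have "{z \<in> space lebesgue. \<not> h z = 0} \<in> sets lebesgue"
      by (intro sets.sets_Collect_neg borel_measurable_eq hm) auto
    from AE_iff_null[OF this] ae have "{z \<in> space lebesgue. \<not> h z = 0} \<in> null_sets lebesgue" by simp
    then have "negligible {z. h z \<noteq> 0}" by (simp add: negligible_iff_null_sets)
    moreover have "open {z. h z \<noteq> 0}" using open_Collect_neq[OF h continuous_on_const] .
    ultimately show False using open_not_negligible[of "{z. h z \<noteq> 0}"] \<open>h x \<noteq> 0\<close> by blast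
  qed
  have cR: "continuous_on UNIV (\<lambda>z. Re (\<psi> z))" and cI: "continuous_on UNIV (\<lambda>z. Im (\<psi> z))"
    by (intro continuous_intros test_continuous t)+
  have "Re (\<psi> x) = 0"
  proof (rule cz[OF cR])
    show "(LINT z|lborel. Re (\<psi> z) * Re (\<psi> z)) = 0"
      using arg_cong[OF zero[OF cR], of Re] integral_Re[OF int[OF cR]] by simp
    show "integrable lborel (\<lambda>z. Re (\<psi> z) * Re (\<psi> z))" using integrable_Re[OF int[OF cR]] by simp
  qed
  moreover have "Im (\<psi> x) = 0"
  proof (rule cz[OF cI])
    show "(LINT z|lborel. Im (\<psi> z) * Im (\<psi> z)) = 0"
      using arg_cong[OF zero[OF cI], of Im] integral_Im[OF int[OF cI]] by simp
    show "integrable lborel (\<lambda>z. Im (\<psi> z) * Im (\<psi> z))" using integrable_Im[OF int[OF cI]] by simp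
  qed
  ultimately show ?thesis by (simp add: complex_eq_iff)
qed

text \<open>Iterating \<open>\<zeta> y = 2 ^ n * \<zeta> (2 y)\<close> carries every nonzero point
  out of the support; at the origin the relation itself forces the value 0.\<close>

lemma dyadic_diff_zero:
  fixes \<zeta> :: "real^'n::finite \<Rightarrow> complex"
  assumes t: "\<zeta> \<in> test_functions" and z: "\<And>x. dyadic_diff \<zeta> x = 0"
  shows "\<zeta> = (\<lambda>x. 0)"
proof
  fix x
  obtain R where R: "supp_le R \<zeta>" using test_supp[OF t] by metis
  have step: "\<zeta> y = of_real (2 ^ CARD('n)) * \<zeta> (2 *\<^sub>R y)" for y
    using z[of "2 *\<^sub>R y"] by (simp add: dyadic_diff_def scaleR_conv_of_real[where 'a=complex] field_simps)
  have iter: "\<zeta> y = of_real (2 ^ (k * CARD('n))) * \<zeta> (2 ^ k *\<^sub>R y)" for k y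
  proof (induction k)
    case (Suc k)
    then show ?case using step[of "2 ^ k *\<^sub>R y"] by (simp add: power_add)
  qed simp
  show "\<zeta> x = 0"
  proof (cases "x = 0")
    case True
    have "\<zeta> 0 * (of_real (2 ^ CARD('n)) - 1) = 0" using step[of 0] by (simp add: algebra_simps)
    moreover have "complex_of_real (2 ^ CARD('n)) - 1 \<noteq> 0"
    proof -
      have "(1::real) < 2 ^ CARD('n)" by (rule one_less_power) auto
      then show ?thesis by (metis of_real_1 of_real_eq_iff less_irrefl right_minus_eq)
    qed
    ultimately show ?thesis using True by simp
  next
    case False
    obtain k where "R / norm x < 2 ^ k" using real_arch_pow[of 2 "R / norm x"] by auto
    then have "R < norm (2 ^ k *\<^sub>R x :: real^'n)" using False by (simp add: field_simps)
    then show ?thesis using iter[of x k] supp_leD[OF R] by simp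
  qed
qed

section \<open>Summation over cubes and levels\<close>

lemma nn_Lp_zero: "0 < P \<Longrightarrow> nn_Lp M P (\<lambda>x. 0) = 0"
  using nn_Lp_cmult[of P "\<lambda>x. 0" M 0] by simp

lemma besov_norm_zero:
  fixes t :: "nat \<Rightarrow> real^'n::finite \<Rightarrow> real"
  assumes "f \<in> S'_e" "0 < p" "0 < q"
  shows "besov_norm p q (\<lambda>x. 0) t f = 0"
proof -
  have "dyadic_family (\<lambda>x::real^'n. 0) k = (\<lambda>x. 0)" for k
    by (auto simp: dyadic_family_def dilate_def dyadic_diff_def)
  then show ?thesis
    using assms by (simp add: besov_norm_def conv_zero Lp_norm_nn_Lp lq_norm_nn_Lp nn_Lp_zero)
qed

text \<open>Assumption \<open>i\<close> lowers the decay exponent to \<open>A * \<mu>\<close>, the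
  one that matches the powers \<open>2 powr (k * A)\<close> in condition (i).\<close>

lemma peetre_to_cubes:
  fixes u :: "nat \<Rightarrow> real^'n::finite \<Rightarrow> real"
  assumes um: "\<And>l. u l \<in> borel_measurable borel" and u0: "\<And>l y. 0 \<le> u l y"
    and \<mu>: "0 < \<mu>" and B: "0 \<le> B" and i: "A * \<mu> \<le> real i * \<mu> - real CARD('n)"
  shows "peetre_sum u \<mu> i B j x \<le> (\<Sum>l. ennreal (2 powr (- (real l * (A * \<mu>)))) *
     (\<Sum>n. ennreal (exp (\<mu> * B) * exp (- (\<mu> * B) / CARD('n)) ^ int_l1 (int_enum n :: int^'n)) *
        cube_avg j (cube_index j x + int_enum n) (\<lambda>w. ennreal (u (j + l) w powr \<mu>))))"
  unfolding peetre_sum_def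
proof (rule suminf_le)
  fix l
  let ?v = "\<lambda>w. ennreal (u (j + l) w powr \<mu>)"
  note um[measurable]
  have vm: "?v \<in> borel_measurable lebesgue" by (rule measurable_completion) simp
  have e: "(\<integral>\<^sup>+w. ennreal (exp (- (\<mu> * (B * (2 ^ j * norm (x - w))))) * u (j + l) w powr \<mu>) \<partial>lborel)
    = (\<integral>\<^sup>+w. ennreal (exp (- (\<mu> * B * (2 ^ j * norm (x - w))))) * ?v w \<partial>lebesgue)"
    by (simp add: nn_integral_completion ennreal_mult mult.assoc)
  have "ennreal (2 powr (- (real l * (real i * \<mu> - real CARD('n)))) * 2 ^ (j * CARD('n)))
    = ennreal (2 powr (- (real l * (real i * \<mu> - real CARD('n))))) * 2 ^ (j * CARD('n))"
    by (simp add: ennreal_mult two_power_ennreal)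
  also have "\<dots> \<le> ennreal (2 powr (- (real l * (A * \<mu>)))) * 2 ^ (j * CARD('n))"
    using i by (intro mult_right_mono ennreal_leI powr_mono) (auto intro: mult_left_mono)
  finally have "ennreal (2 powr (- (real l * (real i * \<mu> - real CARD('n)))) * 2 ^ (j * CARD('n))) *
      (\<integral>\<^sup>+w. ennreal (exp (- (\<mu> * (B * (2 ^ j * norm (x - w))))) * u (j + l) w powr \<mu>) \<partial>lborel)
    \<le> ennreal (2 powr (- (real l * (A * \<mu>)))) * 2 ^ (j * CARD('n)) * (\<integral>\<^sup>+w. ennreal (exp (- (\<mu> * B * (2 ^ j * norm (x - w))))) * ?v w \<partial>lebesgue)"
    unfolding e by (rule mult_right_mono) simp
  also have "\<dots> = ennreal (2 powr (- (real l * (A * \<mu>)))) * (2 ^ (j * CARD('n)) * (\<integral>\<^sup>+w. ennreal (exp (- (\<mu> * B * (2 ^ j * norm (x - w))))) * ?v w \<partial>lebesgue))"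
    by (simp only: mult.assoc)
  also have "\<dots> \<le> ennreal (2 powr (- (real l * (A * \<mu>)))) *
     (\<Sum>n. ennreal (exp (\<mu> * B) * exp (- (\<mu> * B) / CARD('n)) ^ int_l1 (int_enum n :: int^'n)) * cube_avg j (cube_index j x + int_enum n) ?v)"
    using \<mu> B by (intro mult_left_mono exp_to_cubes vm) auto
  finally show "ennreal (2 powr (- (real l * (real i * \<mu> - real CARD('n)))) * 2 ^ (j * CARD('n))) *
      (\<integral>\<^sup>+w. ennreal (exp (- (\<mu> * (B * (2 ^ j * norm (x - w))))) * u (j + l) w powr \<mu>) \<partial>lborel)
    \<le> ennreal (2 powr (- (real l * (A * \<mu>)))) *
     (\<Sum>n. ennreal (exp (\<mu> * B) * exp (- (\<mu> * B) / CARD('n)) ^ int_l1 (int_enum n :: int^'n)) * cube_avg j (cube_index j x + int_enum n) ?v)" .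
qed auto

text \<open>Minkowski in the exponent \<open>p / \<mu>\<close>, which is at least 1, takes the sums
  over \<open>d\<close>, \<open>l\<close> and the lattice out of the norm. Assumption
  \<open>\<omega>\<close> says that the exponential weight beats the cost of shifting cubes by a
  factor \<open>exp (- 1)\<close> per unit step; \<open>g1\<close> and \<open>g2\<close> are the
  forms in which the geometric decay from (i) and (ii) enters.\<close>

lemma norm_chain:
  fixes t :: "nat \<Rightarrow> real^'n::finite \<Rightarrow> real" and F G :: "nat \<Rightarrow> real^'n \<Rightarrow> complex"
  assumes r: "0 < r" "r \<le> p" and \<sigma>: "\<sigma> = r * conj_exp (exp_ratio p r)"
    and \<mu>: "0 < \<mu>" "ennreal \<mu> \<le> r"
    and wt: "\<And>k. weight (t k)"
    and C1: "0 < C1" and C2: "0 < C2" and \<alpha>1: "\<And>k. 0 < \<alpha>1 k" and \<alpha>2: "\<And>k. 0 < \<alpha>2 k"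
    and c1: "\<And>k j m. k \<le> j \<Longrightarrow> cube_mean p k m (t k) * cube_mean \<sigma> k m (\<lambda>x. inverse (t j x)) \<le> ennreal (C1 * (\<alpha>1 k / \<alpha>1 j))"
    and c2: "\<And>k j m. k \<le> j \<Longrightarrow> inverse (cube_mean p k m (t k)) * cube_mean p k m (t j) \<le> ennreal (C2 * (\<alpha>2 j / \<alpha>2 k))"
    and c3: "\<And>k m m'. (\<forall>i. \<bar>m $ i - m' $ i\<bar> \<le> 1) \<Longrightarrow> cube_norm p k m (t k) \<le> ennreal (2 powr \<alpha>3) * cube_norm p k m' (t k)"
    and F: "\<And>l. continuous_on UNIV (F l)" and G: "\<And>l. continuous_on UNIV (G l)"
    and B: "0 \<le> B" and i: "A * \<mu> \<le> real i * \<mu> - real CARD('n)"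
    and \<omega>: "exp (- (\<mu> * B) / CARD('n)) * 2 powr (\<alpha>3 * \<mu>) \<le> exp (- 1)"
    and c: "0 \<le> c"
    and pw: "\<And>k x. epowr (ennreal (norm (G k x))) \<mu> \<le> ennreal c * (\<Sum>d. if d \<le> k then ennreal (2 powr (- (real d * real L * \<mu>))) *
         peetre_sum (\<lambda>l y. norm (F l y)) \<mu> i B (k - d) x else 0)"
    and K: "0 \<le> K1" "0 \<le> K2" "0 \<le> \<theta>"
    and g1: "\<And>j l. 2 powr (- (real l * (A * \<mu>))) * (\<alpha>1 j / \<alpha>1 (j + l)) powr \<mu> \<le> K1 * \<theta> ^ l"
    and g2: "\<And>k d. d \<le> k \<Longrightarrow> 2 powr (- (real d * real L * \<mu>)) * (\<alpha>2 k / \<alpha>2 (k - d)) powr \<mu> \<le> K2 * \<theta> ^ d"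
  shows "epowr (Lp_norm lebesgue p (\<lambda>x. t k x *\<^sub>R G k x)) \<mu>
    \<le> ennreal (3 * c * exp (\<mu> * B) * (C1 * C2) powr \<mu> * K1 * K2 * (2 / (1 - exp (- 1))) ^ CARD('n)) *
      (\<Sum>d. \<Sum>l. ennreal (\<theta> ^ d * \<theta> ^ l) * (if d \<le> k then epowr (Lp_norm lebesgue p (\<lambda>x. t (k - d + l) x *\<^sub>R F (k - d + l) x)) \<mu> else 0))"
proof -
  define P where "P = p / ennreal \<mu>"
  have p0: "0 < p" using r by (rule less_le_trans)
  have P: "1 \<le> P"
  proof -
    have "ennreal \<mu> \<le> p" using \<mu>(2) r(2) by (rule order_trans)
    then have "ennreal \<mu> / ennreal \<mu> \<le> P" unfolding P_def by (rule divide_right_mono_ennreal)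
    then show ?thesis using \<mu> by simp
  qed
  have P0: "0 < P" using P by (metis less_le_trans zero_less_one)
  have [measurable]: "t k \<in> borel_measurable lebesgue" for k using wt by (auto simp: weight_def)
  have [measurable]: "F l \<in> borel_measurable lebesgue" "G l \<in> borel_measurable lebesgue" for l
    using F G by (auto intro!: measurable_completion borel_measurable_continuous_onI)
  define u where "u l y = norm (F l y)" for l y
  define a where "a l = epowr (Lp_norm lebesgue p (\<lambda>x. t l x *\<^sub>R F l x)) \<mu>" for l
  have a: "a l = epowr (nn_Lp lebesgue p (\<lambda>x. ennreal (\<bar>t l x\<bar> * u l x))) \<mu>" for l
    by (simp add: a_def Lp_norm_nn_Lp u_def)
  have um: "u l \<in> borel_measurable borel" for l
    unfolding u_def[abs_def] by (intro borel_measurable_continuous_onI continuous_intros F)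
  have uml[measurable]: "u l \<in> borel_measurable lebesgue" for l unfolding u_def[abs_def] by measurable
  have u0: "0 \<le> u l y" for l y by (simp add: u_def)
  let ?T = "\<lambda>x. epowr (ennreal \<bar>t k x\<bar>) \<mu>"
  define w where "w = exp (- (\<mu> * B) / CARD('n))"
  define S where "S d l n x = ?T x * cube_avg (k - d) (cube_index (k - d) x + int_enum n) (\<lambda>x. ennreal (u (k - d + l) x powr \<mu>))" for d l n x
  define q where "q d l n = (if d \<le> k then ennreal (c * 2 powr (- (real d * real L * \<mu>)) * 2 powr (- (real l * (A * \<mu>))) * (exp (\<mu> * B) * w ^ int_l1 (int_enum n :: int^'n))) else 0)" for d l n
  have Sm[measurable]: "S d l n \<in> borel_measurable lebesgue" for d l n
    unfolding S_def[abs_def] by measurable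
  have point: "?T x * epowr (ennreal (norm (G k x))) \<mu> \<le> (\<Sum>d. \<Sum>l. \<Sum>n. q d l n * S d l n x)" for x
  proof -
    have "?T x * epowr (ennreal (norm (G k x))) \<mu> \<le> ?T x * (ennreal c * (\<Sum>d. if d \<le> k then ennreal (2 powr (- (real d * real L * \<mu>))) *
         peetre_sum u \<mu> i B (k - d) x else 0))"
      using pw[of k x] unfolding u_def[abs_def] by (intro mult_left_mono) auto
    also have "\<dots> = (\<Sum>d. ?T x * (ennreal c * (if d \<le> k then ennreal (2 powr (- (real d * real L * \<mu>))) * peetre_sum u \<mu> i B (k - d) x else 0)))"
      by simp
    also have "\<dots> \<le> (\<Sum>d. \<Sum>l. \<Sum>n. q d l n * S d l n x)"
    proof (rule suminf_le)
      fix d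
      show "?T x * (ennreal c * (if d \<le> k then ennreal (2 powr (- (real d * real L * \<mu>))) * peetre_sum u \<mu> i B (k - d) x else 0))
        \<le> (\<Sum>l. \<Sum>n. q d l n * S d l n x)"
      proof (cases "d \<le> k")
        case True
        let ?j = "k - d"
        have "?T x * (ennreal c * (ennreal (2 powr (- (real d * real L * \<mu>))) * peetre_sum u \<mu> i B ?j x))
          \<le> ?T x * (ennreal c * (ennreal (2 powr (- (real d * real L * \<mu>))) * (\<Sum>l. ennreal (2 powr (- (real l * (A * \<mu>)))) *
             (\<Sum>n. ennreal (exp (\<mu> * B) * w ^ int_l1 (int_enum n :: int^'n)) *
              cube_avg ?j (cube_index ?j x + int_enum n) (\<lambda>w. ennreal (u (?j + l) w powr \<mu>))))))"
          unfolding w_def by (intro mult_left_mono peetre_to_cubes um u0 \<mu> B i) auto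
        also have "\<dots> = (\<Sum>l. \<Sum>n. ?T x * (ennreal c * (ennreal (2 powr (- (real d * real L * \<mu>))) * (ennreal (2 powr (- (real l * (A * \<mu>)))) *
             (ennreal (exp (\<mu> * B) * w ^ int_l1 (int_enum n :: int^'n)) *
              cube_avg ?j (cube_index ?j x + int_enum n) (\<lambda>w. ennreal (u (?j + l) w powr \<mu>)))))))"
          by simp
        also have "\<dots> = (\<Sum>l. \<Sum>n. q d l n * S d l n x)"
          using True c by (simp add: q_def S_def ennreal_mult w_def mult_ac)
        finally show ?thesis using True by simp
      qed simp
    qed auto
    finally show ?thesis .
  qed
  define M0 where "M0 = 3 * c * exp (\<mu> * B) * (C1 * C2) powr \<mu> * K1 * K2"
  define \<Lambda> where "\<Lambda> = (2 / (1 - exp (- 1 :: real))) ^ CARD('n)"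
  have M0: "0 \<le> M0" unfolding M0_def using c K by (intro mult_nonneg_nonneg) auto
  have e1: "exp (- 1 :: real) < 1" by simp
  then have \<Lambda>: "0 \<le> \<Lambda>" unfolding \<Lambda>_def by (intro zero_le_power divide_nonneg_nonneg) auto
  have each: "nn_Lp lebesgue P (\<lambda>x. q d l n * S d l n x)
    \<le> ennreal M0 * (ennreal (\<theta> ^ d * \<theta> ^ l) * (if d \<le> k then a (k - d + l) else 0)) * ennreal (exp (- 1) ^ int_l1 (int_enum n :: int^'n))" for d l n
  proof (cases "d \<le> k")
    case True
    let ?j = "k - d" and ?N = "int_l1 (int_enum n :: int^'n)"
    let ?c1 = "C1 * (\<alpha>1 ?j / \<alpha>1 (?j + l)) * (C2 * (\<alpha>2 k / \<alpha>2 ?j)) * 2 powr (\<alpha>3 * real ?N)"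
    have "nn_Lp lebesgue P (\<lambda>x. q d l n * S d l n x) \<le> q d l n * nn_Lp lebesgue P (S d l n)"
      by (rule nn_Lp_cmult[OF P0 Sm])
    also have "\<dots> \<le> q d l n * (ennreal (3 * ?c1 powr \<mu>) * a (?j + l))"
      unfolding S_def[abs_def] P_def a
      by (intro mult_left_mono weighted_step[OF r \<sigma> \<mu> wt C1 C2 \<alpha>1 \<alpha>2 c1 c2 c3 uml u0]) auto
    also have "\<dots> = ennreal (c * 2 powr (- (real d * real L * \<mu>)) * 2 powr (- (real l * (A * \<mu>))) * (exp (\<mu> * B) * w ^ ?N) * (3 * ?c1 powr \<mu>)) * a (?j + l)"
      using True c by (simp add: q_def w_def ennreal_mult mult.assoc)
    also have "\<dots> \<le> ennreal (M0 * (\<theta> ^ d * \<theta> ^ l) * exp (- 1) ^ ?N) * a (?j + l)"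
    proof (intro mult_right_mono ennreal_leI)
      have pos: "0 \<le> C1 * C2" "0 \<le> \<alpha>1 ?j / \<alpha>1 (?j + l)" "0 \<le> \<alpha>2 k / \<alpha>2 ?j"
        using C1 C2 \<alpha>1[of ?j] \<alpha>1[of "?j + l"] \<alpha>2[of k] \<alpha>2[of ?j] by auto
      have e0: "?c1 = (C1 * C2) * (\<alpha>1 ?j / \<alpha>1 (?j + l)) * (\<alpha>2 k / \<alpha>2 ?j) * 2 powr (\<alpha>3 * real ?N)" by (simp only: mult_ac)
      have e: "?c1 powr \<mu> = (C1 * C2) powr \<mu> * (\<alpha>1 ?j / \<alpha>1 (?j + l)) powr \<mu> * (\<alpha>2 k / \<alpha>2 ?j) powr \<mu> * (2 powr (\<alpha>3 * \<mu>)) ^ ?N"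
      proof -
        have "(2 powr (\<alpha>3 * real ?N)) powr \<mu> = (2 powr (\<alpha>3 * \<mu>)) ^ ?N"
          by (simp add: powr_powr powr_realpow[symmetric] mult_ac)
        then show ?thesis unfolding e0 by (simp only: powr_mult pos mult_nonneg_nonneg powr_ge_zero)
      qed
      have "c * 2 powr (- (real d * real L * \<mu>)) * 2 powr (- (real l * (A * \<mu>))) * (exp (\<mu> * B) * w ^ ?N) * (3 * ?c1 powr \<mu>)
        = (3 * c * exp (\<mu> * B) * (C1 * C2) powr \<mu>) * (2 powr (- (real l * (A * \<mu>))) * (\<alpha>1 ?j / \<alpha>1 (?j + l)) powr \<mu>) *
          (2 powr (- (real d * real L * \<mu>)) * (\<alpha>2 k / \<alpha>2 ?j) powr \<mu>) * (w ^ ?N * (2 powr (\<alpha>3 * \<mu>)) ^ ?N)"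
        unfolding e by (simp only: mult_ac)
      also have "\<dots> \<le> (3 * c * exp (\<mu> * B) * (C1 * C2) powr \<mu>) * (K1 * \<theta> ^ l) * (K2 * \<theta> ^ d) * exp (- 1) ^ ?N"
      proof (rule mult_mono[OF mult_mono[OF mult_mono[OF order_refl g1] g2[OF True]]])
        have "w ^ ?N * (2 powr (\<alpha>3 * \<mu>)) ^ ?N = (w * 2 powr (\<alpha>3 * \<mu>)) ^ ?N" by (simp only: power_mult_distrib)
        also have "\<dots> \<le> exp (- 1) ^ ?N" using \<omega> unfolding w_def[symmetric] by (intro power_mono) (auto simp: w_def)
        finally show "w ^ ?N * (2 powr (\<alpha>3 * \<mu>)) ^ ?N \<le> exp (- 1) ^ ?N" .
      qed (use c K in \<open>auto intro!: mult_nonneg_nonneg simp: w_def\<close>)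
      also have "\<dots> = M0 * (\<theta> ^ d * \<theta> ^ l) * exp (- 1) ^ ?N" unfolding M0_def by (simp only: mult_ac)
      finally show "c * 2 powr (- (real d * real L * \<mu>)) * 2 powr (- (real l * (A * \<mu>))) * (exp (\<mu> * B) * w ^ ?N) * (3 * ?c1 powr \<mu>)
        \<le> M0 * (\<theta> ^ d * \<theta> ^ l) * exp (- 1) ^ ?N" .
    qed simp
    also have "\<dots> = ennreal M0 * (ennreal (\<theta> ^ d * \<theta> ^ l) * (if d \<le> k then a (k - d + l) else 0)) * ennreal (exp (- 1) ^ ?N)"
      using True M0 K by (simp add: ennreal_mult mult_ac)
    finally show ?thesis .
  qed (simp add: q_def nn_Lp_zero P0)
  have "epowr (Lp_norm lebesgue p (\<lambda>x. t k x *\<^sub>R G k x)) \<mu> = nn_Lp lebesgue P (\<lambda>x. epowr (ennreal (norm (t k x *\<^sub>R G k x))) \<mu>)"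
    unfolding Lp_norm_nn_Lp P_def by (rule nn_Lp_power[OF p0 \<mu>(1)]) measurable
  also have "\<dots> = nn_Lp lebesgue P (\<lambda>x. ?T x * epowr (ennreal (norm (G k x))) \<mu>)"
    using \<mu> by (simp add: ennreal_mult epowr_mult)
  also have "\<dots> \<le> nn_Lp lebesgue P (\<lambda>x. \<Sum>d. \<Sum>l. \<Sum>n. q d l n * S d l n x)"
    using point by (intro nn_Lp_AE_mono P0) auto
  also have "\<dots> \<le> (\<Sum>d. nn_Lp lebesgue P (\<lambda>x. \<Sum>l. \<Sum>n. q d l n * S d l n x))"
    by (rule nn_Lp_suminf[OF P]) measurable
  also have "\<dots> \<le> (\<Sum>d. \<Sum>l. nn_Lp lebesgue P (\<lambda>x. \<Sum>n. q d l n * S d l n x))"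
    by (intro suminf_le nn_Lp_suminf[OF P] summableI borel_measurable_suminf borel_measurable_times) auto
  also have "\<dots> \<le> (\<Sum>d. \<Sum>l. \<Sum>n. nn_Lp lebesgue P (\<lambda>x. q d l n * S d l n x))"
    by (intro suminf_le nn_Lp_suminf[OF P] summableI borel_measurable_times) auto
  also have "\<dots> \<le> (\<Sum>d. \<Sum>l. \<Sum>n. ennreal M0 * (ennreal (\<theta> ^ d * \<theta> ^ l) * (if d \<le> k then a (k - d + l) else 0)) * ennreal (exp (- 1) ^ int_l1 (int_enum n :: int^'n)))"
    by (intro suminf_le summableI each)
  also have "\<dots> = (\<Sum>d. \<Sum>l. ennreal M0 * (ennreal (\<theta> ^ d * \<theta> ^ l) * (if d \<le> k then a (k - d + l) else 0)) * (\<Sum>n. ennreal (exp (- 1) ^ int_l1 (int_enum n :: int^'n))))"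
    by (simp only: ennreal_suminf_cmult)
  also have "\<dots> \<le> (\<Sum>d. \<Sum>l. ennreal M0 * (ennreal (\<theta> ^ d * \<theta> ^ l) * (if d \<le> k then a (k - d + l) else 0)) * ennreal \<Lambda>)"
    unfolding \<Lambda>_def by (intro suminf_le summableI mult_left_mono lattice_sum) auto
  also have "\<dots> = (\<Sum>d. \<Sum>l. (ennreal M0 * ennreal \<Lambda>) * (ennreal (\<theta> ^ d * \<theta> ^ l) * (if d \<le> k then a (k - d + l) else 0)))"
    by (simp only: mult_ac)
  also have "\<dots> = (ennreal M0 * ennreal \<Lambda>) * (\<Sum>d. \<Sum>l. ennreal (\<theta> ^ d * \<theta> ^ l) * (if d \<le> k then a (k - d + l) else 0))"
    by (simp only: ennreal_suminf_cmult)
  also have "ennreal M0 * ennreal \<Lambda> = ennreal (M0 * \<Lambda>)" using M0 \<Lambda> by (simp add: ennreal_mult)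
  finally show ?thesis by (simp only: M0_def \<Lambda>_def a_def)
qed

text \<open>The two implications are the side conditions for \<open>muckenhoupt_geometric\<close>,
  applied to the exponents in the order \<open>s, s'\<close> for (i) and in the reverse order for
  (ii).\<close>

lemma conj_exp_properties:
  assumes "1 \<le> s"
  shows "0 < conj_exp s" "s = \<infinity> \<Longrightarrow> conj_exp s = 1" "conj_exp s = \<infinity> \<Longrightarrow> s = 1"
proof -
  show "conj_exp s = 1" if "s = \<infinity>" using that by (simp add: conj_exp_def)
  have "0 < conj_exp s \<and> (conj_exp s = \<infinity> \<longrightarrow> s = 1)"
  proof (cases s)
    case (real x)
    then have x: "1 \<le> x" using assms by (simp add: ennreal_1[symmetric] del: ennreal_1)
    have "1 - inverse s = ennreal (1 - 1 / x)"
      using x real by (simp add: inverse_ennreal inverse_eq_divide ennreal_1[symmetric] ennreal_minus del: ennreal_1)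
    then have c: "conj_exp s = inverse (ennreal (1 - 1 / x))" by (simp add: conj_exp_def)
    show ?thesis
    proof (cases "x = 1")
      case True
      then show ?thesis using c real by simp
    next
      case False
      then have "0 < 1 - 1 / x" using x by simp
      then show ?thesis using c by (simp add: inverse_ennreal)
    qed
  qed (simp add: conj_exp_def)
  then show "0 < conj_exp s" "conj_exp s = \<infinity> \<Longrightarrow> s = 1" by auto
qed

theorem theorem3p2:
  fixes p q r \<sigma>\<^sub>1 \<sigma>\<^sub>2 s s' :: ennreal
    and \<alpha>\<^sub>3 A \<mu> :: real
    and \<alpha>\<^sub>1 \<alpha>\<^sub>2 :: "nat \<Rightarrow> real"
    and t :: "nat \<Rightarrow> real^'n::finite \<Rightarrow> real"
    and \<phi>\<^sub>0 \<zeta>\<^sub>0 :: "real^'n \<Rightarrow> complex"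
    and b\<^sub>1 b\<^sub>2 :: "nat \<Rightarrow> ennreal"
  assumes p: "0 < p" and q: "0 < q" and r: "0 < r" "r \<le> p"
    and \<sigma>\<^sub>1: "\<sigma>\<^sub>1 = r * conj_exp (exp_ratio p r)"
    and \<sigma>\<^sub>2: "\<sigma>\<^sub>2 = p"
    and \<alpha>\<^sub>3: "0 \<le> \<alpha>\<^sub>3"
    and \<alpha>\<^sub>1: "\<forall>k. 0 < \<alpha>\<^sub>1 k"
    and \<alpha>\<^sub>2: "\<forall>k. 0 < \<alpha>\<^sub>2 k"
    and t: "t \<in> weight_class \<alpha>\<^sub>3 \<alpha>\<^sub>1 \<alpha>\<^sub>2 \<sigma>\<^sub>1 \<sigma>\<^sub>2 p"
    and \<phi>\<^sub>0: "\<phi>\<^sub>0 \<in> test_functions" "(LINT x|lebesgue. \<phi>\<^sub>0 x) = 1"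
    and \<zeta>\<^sub>0: "\<zeta>\<^sub>0 \<in> test_functions"
    and A: "0 < A"
    and \<mu>: "0 < \<mu>" "ennreal \<mu> \<le> min 1 (min q r)"
    and s: "s = exp_ratio q (ennreal \<mu>)" and s': "s' = conj_exp s"
    and b\<^sub>1: "\<And>k. b\<^sub>1 k = epowr (ennreal (2 powr (real k * A) * \<alpha>\<^sub>1 k)) \<mu>"
    and i: "(SUP N\<in>{1..}. lq_norm {0..N} s b\<^sub>1 * lq_norm {N..} s' (\<lambda>k. inverse (b\<^sub>1 k))) < \<infinity>"
    and b\<^sub>2: "\<And>k. b\<^sub>2 k =
      epowr (two_epowr (- (ereal (real k) * (1 + moment_order (dyadic_diff \<zeta>\<^sub>0)))) * ennreal (\<alpha>\<^sub>2 k)) \<mu>"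
    and ii: "(SUP N\<in>{1..}. lq_norm {N..} s b\<^sub>2 * lq_norm {0..N} s' (\<lambda>k. inverse (b\<^sub>2 k))) < \<infinity>"
  shows "\<exists>C::real. 0 < C \<and> (\<forall>f\<in>S'_e. besov_norm p q \<zeta>\<^sub>0 t f \<le> ennreal C * besov_norm p q \<phi>\<^sub>0 t f)"
proof -
  have \<mu>1: "\<mu> \<le> 1" and \<mu>q: "ennreal \<mu> \<le> q" and \<mu>r: "ennreal \<mu> \<le> r" using \<mu>(2) by auto
  have \<mu>\<mu>: "ennreal \<mu> / ennreal \<mu> = 1" using \<mu>(1) by simp
  \<comment> \<open>As \<open>\<mu>\<close> is finite, the clause of \<open>exp_ratio\<close> for
    equal exponents agrees with the quotient.\<close>
  have s_eq: "s = q / ennreal \<mu>" using s \<mu>\<mu> by (auto simp: exp_ratio_def)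
  have s1: "1 \<le> s" using divide_right_mono_ennreal[OF \<mu>q, of "ennreal \<mu>"] \<mu>\<mu> by (simp add: s_eq)
  have s0: "0 < s" using s1 by (metis less_le_trans zero_less_one)
  note s'_props = conj_exp_properties[OF s1, folded s']
  have intphi: "(LINT x|lborel. \<phi>\<^sub>0 x) = 1"
    using \<phi>\<^sub>0(2) integral_completion[of \<phi>\<^sub>0 lborel] borel_test[OF \<phi>\<^sub>0(1)] by simp
  have wt: "weight (t k)" for k using t by (auto simp: weight_class_def admissible_def)
  obtain C\<^sub>1 C\<^sub>2 where C12: "0 < C\<^sub>1" "0 < C\<^sub>2"
    and cc: "\<forall>k j m. k \<le> j \<longrightarrow>
        cube_mean p k m (t k) * cube_mean \<sigma>\<^sub>1 k m (\<lambda>x. inverse (t j x)) \<le> ennreal (C\<^sub>1 * (\<alpha>\<^sub>1 k / \<alpha>\<^sub>1 j)) \<and>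
        inverse (cube_mean p k m (t k)) * cube_mean \<sigma>\<^sub>2 k m (t j) \<le> ennreal (C\<^sub>2 * (\<alpha>\<^sub>2 j / \<alpha>\<^sub>2 k))"
    using t unfolding weight_class_def by blast
  have c1: "cube_mean p k m (t k) * cube_mean \<sigma>\<^sub>1 k m (\<lambda>x. inverse (t j x)) \<le> ennreal (C\<^sub>1 * (\<alpha>\<^sub>1 k / \<alpha>\<^sub>1 j))"
    and c2: "inverse (cube_mean p k m (t k)) * cube_mean p k m (t j) \<le> ennreal (C\<^sub>2 * (\<alpha>\<^sub>2 j / \<alpha>\<^sub>2 k))"
    if "k \<le> j" for k j m using cc that unfolding \<sigma>\<^sub>2 by blast+
  have c3: "cube_norm p k m (t k) \<le> ennreal (2 powr \<alpha>\<^sub>3) * cube_norm p k m' (t k)"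
    if "\<forall>i. \<bar>m $ i - m' $ i\<bar> \<le> 1" for k m m' using t that unfolding weight_class_def by blast
  have tdz: "dyadic_diff \<zeta>\<^sub>0 \<in> test_functions" by (rule test_dyadic_diff[OF \<zeta>\<^sub>0])
  show ?thesis
  proof (cases rule: moment_order_cases[OF tdz, case_names vanish finite])
    \<comment> \<open>This is the case of infinite moment order; there both
      \<open>\<zeta>\<^sub>0\<close> and the left-hand side vanish.\<close>
    case vanish
    have "\<zeta>\<^sub>0 = (\<lambda>x. 0)" by (rule dyadic_diff_zero[OF \<zeta>\<^sub>0 moments_zero[OF tdz vanish]])
    then have "besov_norm p q \<zeta>\<^sub>0 t f \<le> ennreal 1 * besov_norm p q \<phi>\<^sub>0 t f" if "f \<in> S'_e" for f
      using besov_norm_zero[OF that p q] by simp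
    then show ?thesis by (intro exI[of _ 1]) auto
  next
    case (finite L)
    define \<beta>\<^sub>1 where "\<beta>\<^sub>1 k = (2 powr (real k * A) * \<alpha>\<^sub>1 k) powr \<mu>" for k
    define \<beta>\<^sub>2 where "\<beta>\<^sub>2 k = (2 powr (- (real k * real L)) * \<alpha>\<^sub>2 k) powr \<mu>" for k
    have \<beta>pos: "0 < \<beta>\<^sub>1 k" "0 < \<beta>\<^sub>2 k" for k
      using \<alpha>\<^sub>1[rule_format, of k] \<alpha>\<^sub>2[rule_format, of k] by (auto simp: \<beta>\<^sub>1_def \<beta>\<^sub>2_def)
    have b1: "b\<^sub>1 = (\<lambda>k. ennreal (\<beta>\<^sub>1 k))"
      using \<alpha>\<^sub>1 by (auto simp: b\<^sub>1 \<beta>\<^sub>1_def epowr_ennreal less_imp_le)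
    \<comment> \<open>With finite moment order, \<open>1 + moment_order\<close> is the natural
      number \<open>L\<close>, and the extended exponent becomes a real one.\<close>
    have b2: "b\<^sub>2 = (\<lambda>k. ennreal (\<beta>\<^sub>2 k))"
    proof
      fix k
      have "- (ereal (real k) * (1 + moment_order (dyadic_diff \<zeta>\<^sub>0))) = ereal (- (real k * real L))"
        unfolding finite(1) by (simp add: one_ereal_def)
      then have "two_epowr (- (ereal (real k) * (1 + moment_order (dyadic_diff \<zeta>\<^sub>0)))) = ennreal (2 powr (- (real k * real L)))"
        by (simp add: two_epowr_def)
      then have "b\<^sub>2 k = epowr (ennreal (2 powr (- (real k * real L)) * \<alpha>\<^sub>2 k)) \<mu>"
        using \<alpha>\<^sub>2[rule_format, of k] by (simp add: b\<^sub>2 ennreal_mult less_imp_le)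
      then show "b\<^sub>2 k = ennreal (\<beta>\<^sub>2 k)"
        using \<alpha>\<^sub>2[rule_format, of k] by (simp add: \<beta>\<^sub>2_def epowr_ennreal less_imp_le)
    qed
    obtain K\<^sub>1 \<theta>\<^sub>1 where K1: "0 \<le> K\<^sub>1" "0 < \<theta>\<^sub>1" "\<theta>\<^sub>1 < 1" "\<forall>j d. \<beta>\<^sub>1 j \<le> K\<^sub>1 * \<theta>\<^sub>1 ^ d * \<beta>\<^sub>1 (j + d)"
      using muckenhoupt_geometric[OF \<beta>pos(1) s0 s'_props(1) _ i[unfolded b1]] s'_props(2) by blast
    have inv2: "inverse (ennreal (\<beta>\<^sub>2 k)) = ennreal (1 / \<beta>\<^sub>2 k)" "inverse (ennreal (1 / \<beta>\<^sub>2 k)) = ennreal (\<beta>\<^sub>2 k)" for k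
      using \<beta>pos(2)[of k] by (simp_all add: inverse_ennreal inverse_eq_divide)
    \<comment> \<open>Condition (ii) has the form of condition (i) for the sequence
      \<open>1 / \<beta>\<^sub>2\<close>, with \<open>s\<close> and \<open>s'\<close>
      interchanged.\<close>
    have "(SUP N\<in>{1..}. lq_norm {0..N} s' (\<lambda>k. ennreal (1 / \<beta>\<^sub>2 k)) * lq_norm {N..} s (\<lambda>k. inverse (ennreal (1 / \<beta>\<^sub>2 k)))) < \<infinity>"
      using ii unfolding b2 inv2 by (simp only: mult.commute)
    then obtain K\<^sub>2 \<theta>\<^sub>2 where K2: "0 \<le> K\<^sub>2" "0 < \<theta>\<^sub>2" "\<theta>\<^sub>2 < 1" "\<forall>j d. 1 / \<beta>\<^sub>2 j \<le> K\<^sub>2 * \<theta>\<^sub>2 ^ d * (1 / \<beta>\<^sub>2 (j + d))"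
      using muckenhoupt_geometric[of "\<lambda>k. 1 / \<beta>\<^sub>2 k" s' s] \<beta>pos(2) s'_props(1,3) s0 by auto
    define \<theta> where "\<theta> = max \<theta>\<^sub>1 \<theta>\<^sub>2"
    have \<theta>: "0 < \<theta>" "\<theta> < 1" using K1 K2 by (auto simp: \<theta>_def)
    have g1: "2 powr (- (real l * (A * \<mu>))) * (\<alpha>\<^sub>1 j / \<alpha>\<^sub>1 (j + l)) powr \<mu> \<le> K\<^sub>1 * \<theta> ^ l" for j l
    proof -
      have a: "0 < \<alpha>\<^sub>1 j" "0 < \<alpha>\<^sub>1 (j + l)" using \<alpha>\<^sub>1 by auto
      have "2 powr (- (real l * (A * \<mu>))) * (\<alpha>\<^sub>1 j / \<alpha>\<^sub>1 (j + l)) powr \<mu> = (2 powr (- (real l * A)) * (\<alpha>\<^sub>1 j / \<alpha>\<^sub>1 (j + l))) powr \<mu>"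
        using a by (subst powr_mult) (auto simp: powr_powr mult.assoc)
      also have "2 powr (- (real l * A)) * (\<alpha>\<^sub>1 j / \<alpha>\<^sub>1 (j + l)) = (2 powr (real j * A) * \<alpha>\<^sub>1 j) / (2 powr (real (j + l) * A) * \<alpha>\<^sub>1 (j + l))"
        by (simp add: powr_add powr_minus distrib_right field_simps)
      also have "\<dots> powr \<mu> = \<beta>\<^sub>1 j / \<beta>\<^sub>1 (j + l)" unfolding \<beta>\<^sub>1_def by (rule powr_divide)
      also have "\<dots> \<le> K\<^sub>1 * \<theta>\<^sub>1 ^ l" using K1(4)[rule_format, of j l] \<beta>pos(1)[of "j + l"] by (simp add: divide_le_eq)
      also have "\<dots> \<le> K\<^sub>1 * \<theta> ^ l" using K1 by (intro mult_left_mono power_mono) (auto simp: \<theta>_def)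
      finally show ?thesis .
    qed
    have g2: "2 powr (- (real d * real L * \<mu>)) * (\<alpha>\<^sub>2 k / \<alpha>\<^sub>2 (k - d)) powr \<mu> \<le> K\<^sub>2 * \<theta> ^ d" if d: "d \<le> k" for k d
    proof -
      let ?j = "k - d"
      have a: "0 < \<alpha>\<^sub>2 k" "0 < \<alpha>\<^sub>2 ?j" using \<alpha>\<^sub>2 by auto
      have kd: "real k = real ?j + real d" using d by simp
      have "2 powr (- (real d * real L * \<mu>)) * (\<alpha>\<^sub>2 k / \<alpha>\<^sub>2 ?j) powr \<mu> = (2 powr (- (real d * real L)) * (\<alpha>\<^sub>2 k / \<alpha>\<^sub>2 ?j)) powr \<mu>"
        using a by (subst powr_mult) (auto simp: powr_powr mult.assoc)
      also have "2 powr (- (real d * real L)) * (\<alpha>\<^sub>2 k / \<alpha>\<^sub>2 ?j) = (2 powr (- (real k * real L)) * \<alpha>\<^sub>2 k) / (2 powr (- (real ?j * real L)) * \<alpha>\<^sub>2 ?j)"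
      proof -
        have "2 powr (- (real k * real L)) = 2 powr (- (real d * real L)) * 2 powr (- (real ?j * real L))"
          unfolding kd by (simp add: powr_add[symmetric] algebra_simps)
        then show ?thesis by simp
      qed
      also have "\<dots> powr \<mu> = \<beta>\<^sub>2 k / \<beta>\<^sub>2 ?j" unfolding \<beta>\<^sub>2_def by (rule powr_divide)
      also have "\<dots> \<le> K\<^sub>2 * \<theta>\<^sub>2 ^ d"
      proof -
        have "1 / \<beta>\<^sub>2 ?j \<le> K\<^sub>2 * \<theta>\<^sub>2 ^ d * (1 / \<beta>\<^sub>2 k)" using K2(4)[rule_format, of ?j d] d by simp
        from mult_right_mono[OF this, of "\<beta>\<^sub>2 k"] show ?thesis using \<beta>pos(2)[of k] by simp
      qed
      also have "\<dots> \<le> K\<^sub>2 * \<theta> ^ d" using K2 by (intro mult_left_mono power_mono) (auto simp: \<theta>_def)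
      finally show ?thesis .
    qed
    \<comment> \<open>Chosen so that the rate \<open>bb / n\<close> per unit lattice step equals
      \<open>\<alpha>\<^sub>3 * \<mu> * ln 2 + 1\<close>: the first part compensates the growth
      \<open>2 powr (\<alpha>\<^sub>3 * \<mu>)\<close>, the second leaves the factor
      \<open>exp (- 1)\<close>.\<close>
    define bb where "bb = real CARD('n) * (\<alpha>\<^sub>3 * \<mu> * ln 2 + 1)"
    define B where "B = bb / \<mu>"
    have bb0: "0 \<le> bb" unfolding bb_def using \<alpha>\<^sub>3 \<mu>(1) by (intro mult_nonneg_nonneg add_nonneg_nonneg) auto
    have B0: "0 \<le> B" and \<mu>B: "\<mu> * B = bb" using bb0 \<mu>(1) by (auto simp: B_def)
    have \<omega>: "exp (- (\<mu> * B) / CARD('n)) * 2 powr (\<alpha>\<^sub>3 * \<mu>) \<le> exp (- 1)"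
    proof -
      have "- (\<mu> * B) / CARD('n) = - (\<alpha>\<^sub>3 * \<mu> * ln 2 + 1)" unfolding \<mu>B bb_def by simp
      then show ?thesis by (simp add: powr_def exp_add[symmetric])
    qed
    \<comment> \<open>The decay exponent has to reach \<open>A * \<mu>\<close> after the loss of the
      dimension, that is, \<open>N * \<mu> - n >= A * \<mu>\<close>.\<close>
    define N where "N = nat \<lceil>A + CARD('n) / \<mu>\<rceil>"
    have N: "A * \<mu> \<le> real N * \<mu> - real CARD('n)"
    proof -
      have "A + CARD('n) / \<mu> \<le> real N" unfolding N_def by (rule real_nat_ceiling_ge)
      then have "(A + CARD('n) / \<mu>) * \<mu> \<le> real N * \<mu>" using \<mu>(1) by (intro mult_right_mono) auto
      then show ?thesis using \<mu>(1) by (simp add: distrib_right)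
    qed
    have "\<exists>c\<ge>0. \<forall>f\<in>S'_e. \<forall>k x. epowr (ennreal (norm (conv (dyadic_family \<zeta>\<^sub>0 k) f x))) \<mu>
      \<le> ennreal c * (\<Sum>d. if d \<le> k then ennreal (2 powr (- (real d * real L * \<mu>))) *
         peetre_sum (\<lambda>l y. norm (conv (dyadic_family \<phi>\<^sub>0 l) f y)) \<mu> N B (k - d) x else 0)"
      by (rule pointwise_bound[OF \<phi>\<^sub>0(1) intphi \<mu>(1) \<mu>1 \<zeta>\<^sub>0 B0 finite(2)])
    then obtain c where c: "0 \<le> c" and pw: "\<forall>f\<in>S'_e. \<forall>k x. epowr (ennreal (norm (conv (dyadic_family \<zeta>\<^sub>0 k) f x))) \<mu>
      \<le> ennreal c * (\<Sum>d. if d \<le> k then ennreal (2 powr (- (real d * real L * \<mu>))) *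
         peetre_sum (\<lambda>l y. norm (conv (dyadic_family \<phi>\<^sub>0 l) f y)) \<mu> N B (k - d) x else 0)"
      by (elim exE conjE)
    define M where "M = 3 * c * exp (\<mu> * B) * (C\<^sub>1 * C\<^sub>2) powr \<mu> * K\<^sub>1 * K\<^sub>2 * (2 / (1 - exp (- 1))) ^ CARD('n)"
    have M: "0 \<le> M" unfolding M_def using c K1 K2 by (intro mult_nonneg_nonneg zero_le_power divide_nonneg_nonneg) auto
    \<comment> \<open>The square comes from the two geometric series, over the coarser levels
      \<open>d\<close> and over the finer levels \<open>l\<close>.\<close>
    define H where "H = M * (1 / (1 - \<theta>)) ^ 2"
    have H: "0 \<le> H" using M by (simp add: H_def)
    \<comment> \<open>The argument works with the \<open>\<mu>\<close>-th powers of the quasi-norms,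
      whence the root of \<open>H\<close>; the summand 1 makes the constant positive.\<close>
    have "besov_norm p q \<zeta>\<^sub>0 t f \<le> ennreal (H powr (1 / \<mu>) + 1) * besov_norm p q \<phi>\<^sub>0 t f" if f: "f \<in> S'_e" for f
    proof -
      let ?n = "nn_Lp (count_space UNIV) s"
      define cz where "cz k = epowr (Lp_norm lebesgue p (\<lambda>x. t k x *\<^sub>R conv (dyadic_family \<zeta>\<^sub>0 k) f x)) \<mu>" for k
      define a where "a k = epowr (Lp_norm lebesgue p (\<lambda>x. t k x *\<^sub>R conv (dyadic_family \<phi>\<^sub>0 k) f x)) \<mu>" for k
      define h where "h k = (\<Sum>d. \<Sum>l. ennreal (\<theta> ^ d * \<theta> ^ l) * (if d \<le> k then a (k - d + l) else 0))" for k
      have nz: "epowr (besov_norm p q \<zeta>\<^sub>0 t f) \<mu> = ?n cz"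
        unfolding besov_norm_def lq_norm_nn_Lp s_eq cz_def[abs_def] by (rule nn_Lp_power[OF q \<mu>(1)]) simp
      have na: "epowr (besov_norm p q \<phi>\<^sub>0 t f) \<mu> = ?n a"
        unfolding besov_norm_def lq_norm_nn_Lp s_eq a_def[abs_def] by (rule nn_Lp_power[OF q \<mu>(1)]) simp
      have cont: "continuous_on UNIV (conv (dyadic_family g l) f)" if "g \<in> test_functions" for g l
        by (rule conv_continuous[OF f test_dyadic_family[OF that]])
      have czh: "cz k \<le> ennreal M * h k" for k
        unfolding cz_def h_def M_def a_def
        by (rule norm_chain[OF r \<sigma>\<^sub>1 \<mu>(1) \<mu>r wt C12 \<alpha>\<^sub>1[rule_format] \<alpha>\<^sub>2[rule_format] c1 c2 c3 cont[OF \<phi>\<^sub>0(1)] cont[OF \<zeta>\<^sub>0] B0 N \<omega> c _ K1(1) K2(1) less_imp_le[OF \<theta>(1)] g1 g2])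
           (use pw f in auto)
      have "?n cz \<le> ?n (\<lambda>k. ennreal M * h k)" using czh by (intro nn_Lp_AE_mono s0) auto
      also have "\<dots> \<le> ennreal M * ?n h" by (intro nn_Lp_cmult s0) auto
      also have "?n h \<le> ennreal ((1 / (1 - \<theta>)) ^ 2) * ?n a"
        by (rule geometric_convolution[OF s1 \<theta>]) (simp add: h_def)
      finally have "epowr (besov_norm p q \<zeta>\<^sub>0 t f) \<mu> \<le> ennreal M * (ennreal ((1 / (1 - \<theta>)) ^ 2) * epowr (besov_norm p q \<phi>\<^sub>0 t f) \<mu>)"
        unfolding nz na by (simp add: mult_left_mono)
      also have "\<dots> = ennreal H * epowr (besov_norm p q \<phi>\<^sub>0 t f) \<mu>"
        using M by (simp add: H_def ennreal_mult mult.assoc)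
      finally have "besov_norm p q \<zeta>\<^sub>0 t f \<le> epowr (ennreal H * epowr (besov_norm p q \<phi>\<^sub>0 t f) \<mu>) (1 / \<mu>)"
        by (simp only: epowr_le_iff[OF \<mu>(1)])
      also have "\<dots> = ennreal (H powr (1 / \<mu>)) * besov_norm p q \<phi>\<^sub>0 t f"
        using \<mu>(1) H by (simp add: epowr_mult epowr_epowr epowr_ennreal)
      also have "\<dots> \<le> ennreal (H powr (1 / \<mu>) + 1) * besov_norm p q \<phi>\<^sub>0 t f"
        by (intro mult_right_mono ennreal_leI) auto
      finally show ?thesis .
    qed
    moreover have "0 < H powr (1 / \<mu>) + 1" by (simp add: add_nonneg_pos)
    ultimately show ?thesis by blast
  qed
qed

end
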